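(* Let the ground field $K$ be infinite, of characteristic 0. Let $E=\{p_1,\dots,p_e\}$ be a collection of $e$ distinct points in $\mathbf P^2$ and let $X=\mathbf P^2(p_1,\dots,p_e)$ be the blow-up of $\mathbf P^2$ in these points, embedded by the linear system $|dL-\sum_iE_i|$. If the homogeneous ideal $I_E$ of the points is generated in degree $d-1$ (i.e. by forms of degree at most $d-1$), then $X$ has a special rank 2 Ulrich sheaf.
   Context: $L$ denotes the class on $X$ of the pullback of a line and $E_i$ the exceptional divisor over $p_i$; $H=dL-\sum_iE_i$ is the hyperplane class, and $K_X$ the canonical class. A special rank 2 Ulrich sheaf (bundle) on $X$ is a rank 2 vector bundle $\mathcal F$ on $X$ with $c_1(\mathcal F)=3H+K_X$ that is 0-regular with respect to $H$, i.e. $H^i(\mathcal F(-iH))=0$ for all $i>0$. (Such an $\mathcal F$ is automatically an Ulrich sheaf on $X\subset\mathbf P^r$: $H^1(\mathcal F(j))=0$ for all $j$, $H^0(\mathcal F(j))=0$ for $j<0$, $H^2(\mathcal F(j))=0$ for $j\ge-2$.) *)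

theory Defs
  imports "HOL-Analysis.Analysis" "HOL-Library.Poly_Mapping"
    "HOL-Computational_Algebra.Polynomial" "HOL-Computational_Algebra.Fraction_Field"
begin

text \<open>
  An integral separated scheme of finite type over a field \<open>K\<close> is represented, in the manner of
  Chevalley and Zariski, by the set \<open>X\<close> of its local rings (at all scheme points, closed or not),
  regarded as subrings of its function field \<open>K(X)\<close>; such a scheme is determined by this set.
  A subsheaf \<open>F\<close> of a constant sheaf \<open>K(X)\<^sup>n\<close> is represented by its stalks, i.e. by a map taking
  a point (= local ring) \<open>x\<close> to an \<open>x\<close>-submodule \<open>F x\<close>.  As \<open>X\<close> is integral, every vector bundle of
  rank \<open>n\<close> is isomorphic to such a subsheaf, and its sections over a nonempty open set \<open>U\<close> are the
  elements of the intersection of the stalks \<open>F x\<close>, \<open>x \<in> U\<close>.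
\<close>

section \<open>Subrings of a field, their local rings, and modules over them\<close>

definition subring_of_field :: "'f::field set \<Rightarrow> bool" where
  "subring_of_field B \<longleftrightarrow> 0 \<in> B \<and> 1 \<in> B \<and>
     (\<forall>a\<in>B. \<forall>b\<in>B. a + b \<in> B \<and> a - b \<in> B \<and> a * b \<in> B)"

definition prime_ideal_in :: "'f::field set \<Rightarrow> 'f set \<Rightarrow> bool" where
  "prime_ideal_in B P \<longleftrightarrow> P \<subseteq> B \<and> 0 \<in> P \<and> 1 \<notin> P \<and>
     (\<forall>a\<in>P. \<forall>b\<in>P. a + b \<in> P) \<and> (\<forall>a\<in>B. \<forall>b\<in>P. a * b \<in> P) \<and>
     (\<forall>a\<in>B. \<forall>b\<in>B. a * b \<in> P \<longrightarrow> a \<in> P \<or> b \<in> P)"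

text \<open>The local rings of the affine scheme \<open>Spec B\<close>.\<close>

definition Spec_rings :: "'f::field set \<Rightarrow> 'f set set" where
  "Spec_rings B = {{a / b | a b. a \<in> B \<and> b \<in> B - P} | P. prime_ideal_in B P}"

definition submod_gen :: "('r \<Rightarrow> 'm \<Rightarrow> 'm::comm_monoid_add) \<Rightarrow> 'r set \<Rightarrow> 'm set \<Rightarrow> 'm set" where
  "submod_gen sc R G = {(\<Sum>g\<in>T. sc (r g) g) | T r. finite T \<and> T \<subseteq> G \<and> (\<forall>g\<in>T. r g \<in> R)}"

section \<open>Topology, line bundles, vector bundles\<close>

text \<open>
  The domains of definition of the rational functions form a subbasis of the Zariski topology:
  \<open>D(g)\<close> in an affine chart \<open>Spec B\<close> is the locus where \<open>1 / g\<close> is regular, and \<open>Spec B\<close> itself is the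
  locus where the finitely many generators of \<open>B\<close> are regular.
\<close>

definition zariski :: "'f::field set set \<Rightarrow> 'f set topology" where
  "zariski X = topology_generated_by (range (\<lambda>f. {x \<in> X. f \<in> x}))"

type_synonym 'f frac_sheaf = "'f set \<Rightarrow> 'f set"

definition tensor :: "'f::field frac_sheaf \<Rightarrow> 'f frac_sheaf \<Rightarrow> 'f frac_sheaf" where
  "tensor M N x = submod_gen (*) x {m * n | m n. m \<in> M x \<and> n \<in> N x}"

text \<open>The structure sheaf is the identity map: its stalk at the point \<open>x\<close> is the local ring \<open>x\<close>.\<close>

fun tensor_power :: "'f::field frac_sheaf \<Rightarrow> nat \<Rightarrow> 'f frac_sheaf" where
  "tensor_power M 0 = (\<lambda>x. x)"
| "tensor_power M (Suc n) = tensor (tensor_power M n) M"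

fun tensor_prod :: "(nat \<Rightarrow> 'f::field frac_sheaf) \<Rightarrow> nat \<Rightarrow> 'f frac_sheaf" where
  "tensor_prod M 0 = (\<lambda>x. x)"
| "tensor_prod M (Suc n) = tensor (tensor_prod M n) (M n)"

definition dual :: "'f::field frac_sheaf \<Rightarrow> 'f frac_sheaf" where
  "dual M x = {f. \<forall>m \<in> M x. f * m \<in> x}"

text \<open>
  Equality of the divisor classes of two invertible sheaves: an isomorphism between nonzero
  subsheaves of the constant sheaf \<open>K(X)\<close> is multiplication by a nonzero rational function.
\<close>

definition same_class :: "'f::field set set \<Rightarrow> 'f frac_sheaf \<Rightarrow> 'f frac_sheaf \<Rightarrow> bool" where
  "same_class X M N \<longleftrightarrow> (\<exists>f. f \<noteq> 0 \<and> (\<forall>x\<in>X. M x = (\<lambda>m. f * m) ` N x))"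

text \<open>Local freeness; the local frames are the columns of the matrix \<open>B\<close>.\<close>

definition vector_bundle :: "'f::field set set \<Rightarrow> ('f set \<Rightarrow> ('f ^ 'n) set) \<Rightarrow> bool" where
  "vector_bundle X F \<longleftrightarrow>
     (\<forall>x\<in>X. \<exists>U. openin (zariski X) U \<and> x \<in> U \<and>
        (\<exists>B :: 'f ^ 'n ^ 'n. invertible B \<and>
           (\<forall>y\<in>U. F y = (\<lambda>v. B *v v) ` {v. \<forall>i. v $ i \<in> y})))"

text \<open>
  The determinant line bundle \<open>\<Lambda>\<^sup>n F\<close>, as a subsheaf of \<open>\<Lambda>\<^sup>n K(X)\<^sup>n = K(X)\<close>.
  Its class in \<open>Pic X\<close> is the first Chern class of \<open>F\<close>.
\<close>

definition det_bundle :: "('f::field set \<Rightarrow> ('f ^ 'n) set) \<Rightarrow> 'f frac_sheaf" where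
  "det_bundle F x = submod_gen (*) x {det A | A. \<forall>i. A $ i \<in> F x}"

definition twist :: "('f::field set \<Rightarrow> ('f ^ 'n) set) \<Rightarrow> 'f frac_sheaf \<Rightarrow> 'f set \<Rightarrow> ('f ^ 'n) set" where
  "twist F M x = submod_gen (*s) x {m *s v | m v. m \<in> M x \<and> v \<in> F x}"

section \<open>Cech cohomology\<close>

text \<open>
  Only nonempty open sets occur in covers.  Since \<open>X\<close> is irreducible, all finite intersections of
  members are then nonempty, restriction maps are inclusions inside the constant sheaf, and
  sections are intersections of stalks.  Nonempty members are cofinal among all covers.
\<close>

definition open_cover :: "'f::field set set \<Rightarrow> 'f set set set \<Rightarrow> bool" where
  "open_cover X C \<longleftrightarrow> (\<forall>U\<in>C. openin (zariski X) U \<and> U \<noteq> {}) \<and> \<Union>C = X"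

definition sections :: "('x \<Rightarrow> 'm set) \<Rightarrow> 'x set \<Rightarrow> 'm set" where
  "sections F U = (\<Inter>x\<in>U. F x)"

definition cech_cochain ::
    "('f set \<Rightarrow> ('f::field ^ 'n) set) \<Rightarrow> 'f set set set \<Rightarrow> nat \<Rightarrow> ('f set set list \<Rightarrow> 'f ^ 'n) \<Rightarrow> bool" where
  "cech_cochain F C p c \<longleftrightarrow>
     (\<forall>us. length us = Suc p \<and> set us \<subseteq> C \<longrightarrow> c us \<in> sections F (\<Inter>(set us)))"

definition cech_d :: "('u list \<Rightarrow> 'f::field ^ 'n) \<Rightarrow> 'u list \<Rightarrow> 'f ^ 'n" where
  "cech_d c us = (\<Sum>k<length us. (- 1) ^ k *s c (take k us @ drop (Suc k) us))"

definition cech_cocycle ::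
    "('f set \<Rightarrow> ('f::field ^ 'n) set) \<Rightarrow> 'f set set set \<Rightarrow> nat \<Rightarrow> ('f set set list \<Rightarrow> 'f ^ 'n) \<Rightarrow> bool" where
  "cech_cocycle F C p c \<longleftrightarrow> cech_cochain F C p c \<and>
     (\<forall>us. length us = p + 2 \<and> set us \<subseteq> C \<longrightarrow> cech_d c us = 0)"

text \<open>
  Vanishing of \<open>H\<^sup>p(X, F)\<close> for \<open>p > 0\<close>, where \<open>H\<^sup>p\<close> is the direct limit of the Cech cohomology groups
  over all open covers, as in Serre's FAC (for quasi-coherent sheaves on a noetherian separated
  scheme this is derived functor cohomology): every cocycle becomes a coboundary on a refinement.
\<close>

definition cohomology_vanishes ::
    "'f::field set set \<Rightarrow> ('f set \<Rightarrow> ('f ^ 'n) set) \<Rightarrow> nat \<Rightarrow> bool" where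
  "cohomology_vanishes X F p \<longleftrightarrow>
     (\<forall>C c. open_cover X C \<and> cech_cocycle F C p c \<longrightarrow>
        (\<exists>C' \<tau> b. open_cover X C' \<and> (\<forall>V\<in>C'. \<tau> V \<in> C \<and> V \<subseteq> \<tau> V) \<and>
           cech_cochain F C' (p - 1) b \<and>
           (\<forall>us. length us = Suc p \<and> set us \<subseteq> C' \<longrightarrow> cech_d b us = c (map \<tau> us))))"

section \<open>The projective plane and its function field\<close>

text \<open>
  \<open>K[x\<^sub>1,x\<^sub>2,x\<^sub>3]\<close> is the ring of finitely supported functions on exponent vectors.  The function field
  of the plane is \<open>K(s,t)\<close>, \<open>s = x\<^sub>1/x\<^sub>3\<close>, \<open>t = x\<^sub>2/x\<^sub>3\<close>, as fractions of \<open>K[s][t]\<close>.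
\<close>

type_synonym 'k poly3 = "(3 \<Rightarrow>\<^sub>0 nat) \<Rightarrow>\<^sub>0 'k"
type_synonym 'k ff = "'k poly poly fract"

definition is_form :: "nat \<Rightarrow> 'k::zero poly3 \<Rightarrow> bool" where
  "is_form n f \<longleftrightarrow> (\<forall>m\<in>Poly_Mapping.keys f. (\<Sum>i\<in>UNIV. Poly_Mapping.lookup m i) = n)"

definition eval_poly3 :: "('k::zero \<Rightarrow> 'r::comm_semiring_1) \<Rightarrow> 'r ^ 3 \<Rightarrow> 'k poly3 \<Rightarrow> 'r" where
  "eval_poly3 \<iota> v f =
     (\<Sum>m\<in>Poly_Mapping.keys f. \<iota> (Poly_Mapping.lookup f m) * (\<Prod>i\<in>UNIV. (v $ i) ^ Poly_Mapping.lookup m i))"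

definition const_ff :: "'k::field \<Rightarrow> 'k ff" where
  "const_ff c = Fract [:[:c:]:] 1"

text \<open>The homogeneous coordinates \<open>(s : t : 1)\<close> of the generic point.\<close>

definition coord :: "'k::field ff ^ 3" where
  "coord = vector [Fract [:[:0, 1:]:] 1, Fract [:0, 1:] 1, 1]"

definition subalgebra_gen :: "'k::field ff set \<Rightarrow> 'k ff set" where
  "subalgebra_gen G = \<Inter>{B. subring_of_field B \<and> range const_ff \<subseteq> B \<and> G \<subseteq> B}"

text \<open>The coordinate ring \<open>K[x\<^sub>1/x\<^sub>j, x\<^sub>2/x\<^sub>j, x\<^sub>3/x\<^sub>j]\<close> of the \<open>j\<close>-th standard affine chart of the plane.\<close>

definition chart_ring :: "3 \<Rightarrow> 'k::field ff set" where
  "chart_ring j = subalgebra_gen (range (\<lambda>i. coord $ i / coord $ j))"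

text \<open>The dehomogenization of a homogeneous ideal in the \<open>j\<close>-th chart.\<close>

definition chart_ideal :: "'k::field poly3 set \<Rightarrow> 3 \<Rightarrow> 'k ff set" where
  "chart_ideal J j =
     {eval_poly3 const_ff coord f / (coord $ j) ^ n | f n. f \<in> J \<and> is_form n f}"

definition ideal_gen :: "'k::field poly3 set \<Rightarrow> 'k poly3 set" where
  "ideal_gen = module.span (*)"

text \<open>
  Points of the plane are given by nonzero vectors of homogeneous coordinates.
\<close>

definition distinct_points :: "nat \<Rightarrow> (nat \<Rightarrow> 'k::field ^ 3) \<Rightarrow> bool" where
  "distinct_points e p \<longleftrightarrow> (\<forall>i<e. p i \<noteq> 0) \<and>
     (\<forall>i<e. \<forall>j<e. i \<noteq> j \<longrightarrow> \<not> (\<exists>c. p i = c *s p j))"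

definition points_ideal :: "('k::field ^ 3) set \<Rightarrow> 'k poly3 set" where
  "points_ideal E = ideal_gen {f. \<exists>n. is_form n f \<and> (\<forall>v\<in>E. eval_poly3 id v f = 0)}"

definition generated_in_degree_le :: "'k::field poly3 set \<Rightarrow> nat \<Rightarrow> bool" where
  "generated_in_degree_le I n \<longleftrightarrow> I = ideal_gen {f \<in> I. \<exists>m\<le>n. is_form m f}"

section \<open>The blow-up and its divisor classes\<close>

text \<open>
  Over the \<open>j\<close>-th chart, with ring \<open>A\<close> and ideal \<open>I\<close>, the blow-up is the union of the
  affine schemes \<open>Spec A[I/a]\<close>, \<open>a \<in> I\<close>, \<open>a \<noteq> 0\<close>.
\<close>

definition blowup_plane :: "'k::field poly3 set \<Rightarrow> 'k ff set set" where
  "blowup_plane J = (\<Union>j. \<Union>a \<in> chart_ideal J j - {0}.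
     Spec_rings (subalgebra_gen (chart_ring j \<union> {b / a | b. b \<in> chart_ideal J j})))"

text \<open>
  The inverse image ideal sheaf on \<open>X\<close> of the ideal sheaf on the plane given by \<open>J\<close>; the
  point \<open>x\<close> lies over the \<open>j\<close>-th chart iff \<open>x\<close> contains \<open>chart_ring j\<close>.
\<close>

definition inverse_image_ideal :: "'k::field poly3 set \<Rightarrow> 'k ff frac_sheaf" where
  "inverse_image_ideal J x = submod_gen (*) x (\<Union>j\<in>{j. chart_ring j \<subseteq> x}. chart_ideal J j)"

text \<open>\<open>O(L)\<close>: the ideal sheaf of the pullback of the line \<open>x\<^sub>3 = 0\<close> is \<open>O(-L)\<close>.\<close>

definition O_L :: "'k::field ff frac_sheaf" where
  "O_L = dual (inverse_image_ideal (ideal_gen {Poly_Mapping.single (Poly_Mapping.single 3 1) 1}))"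

text \<open>\<open>O(-E\<^sub>i)\<close>, where \<open>E\<^sub>i\<close> is the inverse image of the point \<open>v = p\<^sub>i\<close>.\<close>

definition O_minus_E :: "'k::field ^ 3 \<Rightarrow> 'k ff frac_sheaf" where
  "O_minus_E v = inverse_image_ideal (points_ideal {v})"

text \<open>\<open>O(H)\<close> with \<open>H = dL - E\<^sub>1 - \<dots> - E\<^sub>e\<close> (the points are numbered from \<open>0\<close>).\<close>

definition O_H :: "nat \<Rightarrow> nat \<Rightarrow> (nat \<Rightarrow> 'k::field ^ 3) \<Rightarrow> 'k ff frac_sheaf" where
  "O_H d e p = tensor (tensor_power O_L d) (tensor_prod (\<lambda>i. O_minus_E (p i)) e)"

text \<open>
  The derivation of \<open>K(s,t)\<close> extending a derivation of \<open>K[s][t]\<close>, by the quotient rule; it does not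
  depend on the chosen representation as a fraction.
\<close>

definition ff_deriv :: "('k::field poly poly \<Rightarrow> 'k poly poly) \<Rightarrow> 'k ff \<Rightarrow> 'k ff" where
  "ff_deriv D q = (let (a, b) = (SOME (a, b). b \<noteq> 0 \<and> q = Fract a b)
     in Fract (D a * b - a * D b) (b * b))"

definition jacobian :: "'k::field ff \<Rightarrow> 'k ff \<Rightarrow> 'k ff" where
  "jacobian f g =
     ff_deriv (map_poly pderiv) f * ff_deriv pderiv g
     - ff_deriv pderiv f * ff_deriv (map_poly pderiv) g"

text \<open>
  The canonical sheaf \<open>\<Lambda>\<^sup>2 \<Omega>\<close> of the smooth surface \<open>X\<close>, embedded in its generic stalk
  \<open>\<Lambda>\<^sup>2 \<Omega>(K(X)/K) = K(X) ds \<and> dt\<close>: its stalk at \<open>x\<close> is generated by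
  \<open>df \<and> dg = jacobian f g ds \<and> dt\<close> for \<open>f, g \<in> x\<close>.
\<close>

definition canonical_sheaf :: "'k::field ff frac_sheaf" where
  "canonical_sheaf x = submod_gen (*) x {jacobian f g | f g. f \<in> x \<and> g \<in> x}"

text \<open>
  The complete linear system of the invertible sheaf \<open>M\<close>, with space of sections \<open>V\<close>, embeds \<open>X\<close>
  in \<open>P(V)\<close>: the affine pieces of the image are the \<open>Spec K[V/s]\<close> for \<open>s \<in> V\<close>, \<open>s \<noteq> 0\<close>.
\<close>

definition embedded_by_complete_system :: "'k::field ff set set \<Rightarrow> 'k ff frac_sheaf \<Rightarrow> bool" where
  "embedded_by_complete_system X M \<longleftrightarrow>
     X = (\<Union>s \<in> sections M X - {0}. Spec_rings (subalgebra_gen {v / s | v. v \<in> sections M X}))"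

section \<open>Special Ulrich bundles\<close>

definition zero_regular ::
    "'f::field set set \<Rightarrow> 'f frac_sheaf \<Rightarrow> ('f set \<Rightarrow> ('f ^ 'n) set) \<Rightarrow> bool" where
  "zero_regular X OH F \<longleftrightarrow>
     (\<forall>i>0. cohomology_vanishes X (twist F (tensor_power (dual OH) i)) i)"

definition special_rank2_ulrich ::
    "'k::field ff set set \<Rightarrow> 'k ff frac_sheaf \<Rightarrow> ('k ff set \<Rightarrow> ('k ff ^ 2) set) \<Rightarrow> bool" where
  "special_rank2_ulrich X OH F \<longleftrightarrow>
     vector_bundle X F \<and>
     same_class X (det_bundle F) (tensor (tensor_power OH 3) canonical_sheaf) \<and>
     zero_regular X OH F"

end

theory Submission
  imports Defs
begin

text \<open>
  Choose affine coordinates \<open>u, v\<close> in which the points have distinct \<open>u\<close>-coordinates \<open>u\<^sub>i\<close>.  On the affine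
  plane their ideal is \<open>(f, g)\<close> with \<open>f = v - \<phi>(u)\<close>, \<open>\<phi>\<close> an interpolation polynomial, and
  \<open>g = \<Prod>(u - u\<^sub>i)\<close>; so \<open>X\<close> is covered by the two charts where \<open>g / f\<close> or \<open>f / g\<close> is regular and by
  two charts around the line at infinity.  Write \<open>E\<close> for the sum of the exceptional divisors.  The
  banded matrix with rows \<open>(u, v, 1)\<close> is surjective as a map from the sum of \<open>d + 1\<close> copies of \<open>O(nL - kE)\<close>
  to the sum of \<open>d - 1\<close> copies of \<open>O((n+1)L - kE)\<close>; its kernel \<open>F(n, k)\<close> is a bundle of rank 2 and first
  Chern class \<open>(2n - d + 1)L - 2kE\<close>.  The Ulrich bundle is \<open>F(2d - 2, 1)\<close>, whose class is \<open>3H + K\<close>, and its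
  twist by \<open>-iH\<close> is \<open>F(2d - 2 - id, 1 - i)\<close>.  Hence \<open>H\<^sup>1\<close> of the twist by \<open>-H\<close> vanishes because
  the matrix is surjective on polynomials of degree \<open>d - 2\<close> and \<open>H\<^sup>1(O((d-2)L)) = 0\<close>, and \<open>H\<^sup>2\<close> of the twist by
  \<open>-2H\<close> vanishes because \<open>H\<^sup>2(O(-2L + E)) = 0\<close> and \<open>H\<^sup>1(O(-L + E)) = 0\<close>.
\<close>

section \<open>Local rings of subrings of a field\<close>

text \<open>The parameters of \<open>F(2d - 2, 1)\<close> are forced: equating
  \<open>(2n - d + 1)L - 2kE\<close> with \<open>3H + K = (3d - 3)L - 2E\<close> leaves no choice.
  Multiplicity 1 along E is what makes the points harmless: the twist by \<open>-H\<close> cancels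
  E, and the twist by \<open>-2H\<close> leaves \<open>O(E)\<close>, which has no higher direct
  image. So all cohomology is that of the plane. The plane is covered by the complements of three
  curves: the line at infinity and the closures of \<open>g1P = 0\<close> and
  \<open>g2P = 0\<close>, whose leading forms are powers of u and of v. The three have no common
  zero, and Cech cohomology becomes division with respect to total degree. Both affine curves pass
  through all the points, so the charts near infinity never meet E. At the point
  \<open>u = 0\<close> of the line at infinity the homogenized rows become \<open>(0, v, 0)\<close>,
  so there the two outermost entries of a kernel vector must serve as a frame; the continuants are
  the pivots of that elimination and are therefore made factors of \<open>g2P\<close>.
  Characteristic 0 gives enough constants for the choice of coordinates and lets a Jacobian detect
  algebraic independence.\<close>

context
  fixes B :: "'f::field set"
  assumes B: "subring_of_field B"
begin

lemma subring_0: "0 \<in> B" and subring_1: "1 \<in> B"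
  using B by (auto simp: subring_of_field_def)

lemma subring_add: "a \<in> B \<Longrightarrow> b \<in> B \<Longrightarrow> a + b \<in> B"
  and subring_diff: "a \<in> B \<Longrightarrow> b \<in> B \<Longrightarrow> a - b \<in> B"
  and subring_mult: "a \<in> B \<Longrightarrow> b \<in> B \<Longrightarrow> a * b \<in> B"
  using B by (auto simp: subring_of_field_def)

lemma subring_uminus: "a \<in> B \<Longrightarrow> - a \<in> B"
  using subring_diff[OF subring_0] by simp

lemma subring_power: "a \<in> B \<Longrightarrow> a ^ n \<in> B"
  by (induction n) (auto intro: subring_1 subring_mult)

lemma subring_sum: "(\<And>i. i \<in> S \<Longrightarrow> h i \<in> B) \<Longrightarrow> sum h S \<in> B"
  by (induction S rule: infinite_finite_induct) (auto intro: subring_0 subring_add)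

lemma subring_prod: "(\<And>i. i \<in> S \<Longrightarrow> h i \<in> B) \<Longrightarrow> prod h S \<in> B"
  by (induction S rule: infinite_finite_induct) (auto intro: subring_1 subring_mult)

end

lemmas subring_closed = subring_0 subring_1 subring_add subring_diff subring_mult
  subring_uminus subring_power subring_sum subring_prod

definition unit_in :: "'f::field set \<Rightarrow> 'f \<Rightarrow> bool" where
  "unit_in x a \<longleftrightarrow> a \<noteq> 0 \<and> a \<in> x \<and> inverse a \<in> x"

text \<open>Locality is stated through units, as the contrapositive of the nonunits being closed
  under addition. This form directly picks an invertible term out of an invertible sum.\<close>

definition local_subring :: "'f::field set \<Rightarrow> bool" where
  "local_subring x \<longleftrightarrow> subring_of_field x \<and>
     (\<forall>a\<in>x. \<forall>b\<in>x. unit_in x (a + b) \<longrightarrow> unit_in x a \<or> unit_in x b)"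

definition localize :: "'f::field set \<Rightarrow> 'f set \<Rightarrow> 'f set" where
  "localize B P = {a / b | a b. a \<in> B \<and> b \<in> B - P}"

lemma Spec_rings_eq: "Spec_rings B = {localize B P | P. prime_ideal_in B P}"
  unfolding Spec_rings_def localize_def by auto

lemma unit_in_mem: "unit_in x a \<Longrightarrow> a \<in> x"
  and unit_in_nonzero: "unit_in x a \<Longrightarrow> a \<noteq> 0"
  and unit_in_inverse_mem: "unit_in x a \<Longrightarrow> inverse a \<in> x"
  by (auto simp: unit_in_def)

lemma unit_in_inverse: "unit_in x a \<Longrightarrow> unit_in x (inverse a)"
  by (auto simp: unit_in_def)

lemma unit_in_1: "subring_of_field x \<Longrightarrow> unit_in x 1"
  by (auto simp: unit_in_def intro: subring_closed)

lemma unit_in_mult: "subring_of_field x \<Longrightarrow> unit_in x a \<Longrightarrow> unit_in x b \<Longrightarrow> unit_in x (a * b)"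
  by (auto simp: unit_in_def intro: subring_closed)

lemma unit_in_divide: "subring_of_field x \<Longrightarrow> unit_in x a \<Longrightarrow> unit_in x b \<Longrightarrow> unit_in x (a / b)"
  unfolding divide_inverse by (intro unit_in_mult unit_in_inverse)

lemma unit_in_power: "subring_of_field x \<Longrightarrow> unit_in x a \<Longrightarrow> unit_in x (a ^ n)"
  by (induction n) (auto intro: unit_in_mult unit_in_1)

lemma unit_in_prod: "subring_of_field x \<Longrightarrow> (\<And>i. i \<in> S \<Longrightarrow> unit_in x (h i)) \<Longrightarrow> unit_in x (prod h S)"
  by (induction S rule: infinite_finite_induct) (auto intro: unit_in_1 unit_in_mult)

lemma unit_in_uminus: "subring_of_field x \<Longrightarrow> unit_in x a \<Longrightarrow> unit_in x (- a)"
  by (auto simp: unit_in_def intro: subring_closed)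

lemma unit_in_factor:
  assumes "subring_of_field x" "unit_in x (a * b)" "a \<in> x" "b \<in> x"
  shows "unit_in x a"
proof -
  have "inverse a = b * inverse (a * b)" "a \<noteq> 0"
    using assms(2) by (auto simp: unit_in_def)
  moreover have "b * inverse (a * b) \<in> x"
    using assms by (auto intro: subring_closed simp: unit_in_def)
  ultimately show ?thesis using assms(3) unfolding unit_in_def by metis
qed

lemma unit_in_mult_iff: "subring_of_field x \<Longrightarrow> unit_in x a \<Longrightarrow> a * b \<in> x \<longleftrightarrow> b \<in> x"
  using subring_mult[of x a b] subring_mult[of x "inverse a" "a * b"]
  by (auto simp: unit_in_def simp flip: mult.assoc)

lemma unit_in_divide_mem: "subring_of_field x \<Longrightarrow> b \<in> x \<Longrightarrow> unit_in x a \<Longrightarrow> b / a \<in> x"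
  unfolding divide_inverse by (auto simp: unit_in_def intro: subring_closed)

lemma local_subringD: "local_subring x \<Longrightarrow> subring_of_field x"
  by (auto simp: local_subring_def)

lemma local_subring_add:
  "local_subring x \<Longrightarrow> a \<in> x \<Longrightarrow> b \<in> x \<Longrightarrow> unit_in x (a + b) \<Longrightarrow> unit_in x a \<or> unit_in x b"
  by (auto simp: local_subring_def)

lemma local_subring_sum:
  assumes "local_subring x" "finite S" "\<And>i. i \<in> S \<Longrightarrow> h i \<in> x" "unit_in x (sum h S)"
  shows "\<exists>i\<in>S. unit_in x (h i)"
  using assms(2,1,3,4)
proof (induction S rule: finite_induct)
  case empty
  then show ?case by (simp add: unit_in_def)
next
  case (insert i S)
  have "sum h S \<in> x" using insert by (auto intro: subring_sum local_subringD)
  then show ?case using insert local_subring_add[of x "h i" "sum h S"] by auto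
qed

lemma unit_in_add_nonunit:
  assumes "local_subring x" "unit_in x a" "b \<in> x" "\<not> unit_in x b"
  shows "unit_in x (a + b)"
proof -
  note s = local_subringD[OF assms(1)]
  have "unit_in x ((a + b) + (- b))" using assms by simp
  moreover have "\<not> unit_in x (- b)" using unit_in_uminus[OF s] assms(4) by fastforce
  moreover have "a + b \<in> x" "- b \<in> x"
    using assms(3) unit_in_mem[OF assms(2)] subring_add[OF s] subring_uminus[OF s] by auto
  ultimately show ?thesis
    using local_subring_add[OF assms(1), of "a + b" "- b"] by blast
qed

lemma prime_nonunits:
  assumes "local_subring x"
  shows "prime_ideal_in x {a \<in> x. \<not> unit_in x a}"
proof -
  note s = local_subringD[OF assms]
  have f: "unit_in x b" if "unit_in x (a * b)" "a \<in> x" "b \<in> x" for a b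
    using unit_in_factor[OF s, of b a] that by (simp add: mult.commute)
  show ?thesis
    unfolding prime_ideal_in_def
  proof (intro conjI ballI impI)
    fix a b assume "a \<in> {a \<in> x. \<not> unit_in x a}" "b \<in> {a \<in> x. \<not> unit_in x a}"
    then show "a + b \<in> {a \<in> x. \<not> unit_in x a}"
      using local_subring_add[OF assms, of a b] subring_add[OF s] by auto
  next
    fix a b assume "a \<in> x" "b \<in> {a \<in> x. \<not> unit_in x a}"
    then show "a * b \<in> {a \<in> x. \<not> unit_in x a}"
      using f subring_mult[OF s] by auto
  next
    fix a b assume "a \<in> x" "b \<in> x" "a * b \<in> {a \<in> x. \<not> unit_in x a}"
    then show "a \<in> {a \<in> x. \<not> unit_in x a} \<or> b \<in> {a \<in> x. \<not> unit_in x a}"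
      using unit_in_mult[OF s] by auto
  qed (use subring_0[OF s] unit_in_1[OF s] in \<open>auto simp: unit_in_def\<close>)
qed

lemma prime_ideal_mult: "prime_ideal_in B P \<Longrightarrow> a \<in> B \<Longrightarrow> b \<in> B \<Longrightarrow> a * b \<in> P \<Longrightarrow> a \<in> P \<or> b \<in> P"
  by (auto simp: prime_ideal_in_def)

lemma prime_ideal_power: "prime_ideal_in B P \<Longrightarrow> subring_of_field B \<Longrightarrow> a \<in> B \<Longrightarrow> a ^ n \<in> P \<Longrightarrow> a \<in> P"
proof (induction n)
  case 0
  then show ?case by (auto simp: prime_ideal_in_def)
next
  case (Suc n)
  then show ?case using prime_ideal_mult[of B P a "a ^ n"] subring_power[of B a n] by auto
qed

lemma prime_compl_mult: "prime_ideal_in B P \<Longrightarrow> subring_of_field B \<Longrightarrow> a \<in> B - P \<Longrightarrow> b \<in> B - P \<Longrightarrow> a * b \<in> B - P"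
  by (auto simp: prime_ideal_in_def intro: subring_closed)

context
  fixes B P :: "'f::field set"
  assumes B: "subring_of_field B" and P: "prime_ideal_in B P"
begin

lemma localize_nz: "b \<in> B - P \<Longrightarrow> b \<noteq> 0"
  using P by (auto simp: prime_ideal_in_def)

lemma localizeI: "a \<in> B \<Longrightarrow> b \<in> B - P \<Longrightarrow> a / b \<in> localize B P"
  by (auto simp: localize_def)

lemma one_compl: "1 \<in> B - P"
  using P B by (auto simp: prime_ideal_in_def intro: subring_closed)

lemma localize_super: "B \<subseteq> localize B P"
  using localizeI[OF _ one_compl] by auto

lemma subring_localize: "subring_of_field (localize B P)"
  unfolding subring_of_field_def
proof (intro conjI ballI)
  show "0 \<in> localize B P" "1 \<in> localize B P"
    using localize_super subring_0[OF B] subring_1[OF B] by auto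
next
  fix x y assume "x \<in> localize B P" "y \<in> localize B P"
  then obtain a b c d where *: "x = a / b" "y = c / d" "a \<in> B" "b \<in> B - P" "c \<in> B" "d \<in> B - P"
    by (auto simp: localize_def)
  note nz = localize_nz[OF *(4)] localize_nz[OF *(6)]
  have bd: "b * d \<in> B - P" using prime_compl_mult[OF P B *(4) *(6)] .
  have "x + y = (a * d + c * b) / (b * d)" "x - y = (a * d - c * b) / (b * d)" "x * y = (a * c) / (b * d)"
    using nz by (auto simp: * field_simps)
  then show "x + y \<in> localize B P" "x - y \<in> localize B P" "x * y \<in> localize B P"
    using * bd by (auto intro!: localizeI subring_closed[OF B])
qed

lemma unit_in_localize_iff:
  assumes "a \<in> B" shows "unit_in (localize B P) a \<longleftrightarrow> a \<notin> P"
proof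
  assume "a \<notin> P"
  then show "unit_in (localize B P) a"
    using assms localize_nz[of a] localize_super localizeI[of 1 a] subring_1[OF B]
    by (auto simp: unit_in_def field_simps)
next
  assume u: "unit_in (localize B P) a"
  then obtain c d where *: "inverse a = c / d" "c \<in> B" "d \<in> B - P"
    by (auto simp: localize_def unit_in_def)
  have "d = a * c" using * u localize_nz[OF *(3)] by (auto simp: unit_in_def field_simps)
  then show "a \<notin> P" using * P assms by (auto simp: prime_ideal_in_def mult.commute)
qed

lemma local_localize: "local_subring (localize B P)"
  unfolding local_subring_def
proof (intro conjI ballI impI)
  show "subring_of_field (localize B P)" by (rule subring_localize)
next
  fix x y assume "x \<in> localize B P" "y \<in> localize B P" and u: "unit_in (localize B P) (x + y)"
  then obtain a b c d where *: "x = a / b" "y = c / d" "a \<in> B" "b \<in> B - P" "c \<in> B" "d \<in> B - P"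
    by (auto simp: localize_def)
  note nz = localize_nz[OF *(4)] localize_nz[OF *(6)]
  note s = subring_localize
  have ub: "unit_in (localize B P) b" "unit_in (localize B P) d" using * by (auto simp: unit_in_localize_iff)
  have "(x + y) * (b * d) = a * d + c * b" using nz by (auto simp: * field_simps)
  moreover have "unit_in (localize B P) ((x + y) * (b * d))"
    using u ub by (auto intro: unit_in_mult s)
  ultimately have "a * d + c * b \<notin> P"
    using * by (subst unit_in_localize_iff[symmetric]) (auto intro: subring_closed[OF B])
  then have "a \<notin> P \<or> c \<notin> P"
    using P *(3-6) unfolding prime_ideal_in_def by (metis DiffD1 mult.commute)
  then show "unit_in (localize B P) x \<or> unit_in (localize B P) y"
    using * ub by (auto simp: unit_in_localize_iff[symmetric] intro: unit_in_divide s)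
qed

end

lemma local_Spec_rings: "subring_of_field B \<Longrightarrow> x \<in> Spec_rings B \<Longrightarrow> local_subring x"
  and Spec_rings_super: "subring_of_field B \<Longrightarrow> x \<in> Spec_rings B \<Longrightarrow> B \<subseteq> x"
  by (auto simp: Spec_rings_eq intro: local_localize dest: localize_super)

lemma Spec_rings_fraction:
  assumes "subring_of_field B" "x \<in> Spec_rings B" "y \<in> x"
  obtains a b where "y = a / b" "a \<in> B" "b \<in> B" "unit_in x b"
proof -
  obtain P where P: "prime_ideal_in B P" "x = localize B P" using assms by (auto simp: Spec_rings_eq)
  with assms(3) obtain a b where "y = a / b" "a \<in> B" "b \<in> B - P" by (auto simp: localize_def)
  then show thesis using that P assms(1) by (auto simp: unit_in_localize_iff)
qed

text \<open>
  \<open>S\<close> is the local ring of \<open>R\<close> at the center of \<open>x\<close>, and \<open>x\<close>, being a local ring of \<open>T\<close>, is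
  contained in \<open>S\<close> as soon as \<open>T\<close> is: elements of \<open>T\<close> that are units of \<open>x\<close> are units of \<open>S\<close>.
\<close>

lemma Spec_rings_transfer:
  assumes T: "subring_of_field T" "x \<in> Spec_rings T" and R: "subring_of_field R" "R \<subseteq> x"
    and sub: "\<And>S. subring_of_field S \<Longrightarrow> R \<subseteq> S \<Longrightarrow> S \<subseteq> x \<Longrightarrow>
      (\<And>y. y \<in> S \<Longrightarrow> unit_in x y \<Longrightarrow> inverse y \<in> S) \<Longrightarrow> T \<subseteq> S"
  shows "x \<in> Spec_rings R"
proof -
  have loc: "local_subring x" using local_Spec_rings[OF T] .
  note sx = local_subringD[OF loc]
  define P where "P = {a \<in> R. \<not> unit_in x a}"
  have P: "prime_ideal_in R P"
  proof -
    have sub: "a \<in> x" if "a \<in> R" for a using that R by auto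
    show ?thesis
      using prime_nonunits[OF loc] subring_closed(1-5)[OF R(1)] unfolding prime_ideal_in_def P_def
      by (simp add: subset_iff sub) (metis sub)
  qed
  let ?S = "localize R P"
  have Sx: "?S \<subseteq> x"
    using R by (auto simp: localize_def P_def intro: unit_in_divide_mem[OF sx])
  have inv: "inverse y \<in> ?S" if "y \<in> ?S" "unit_in x y" for y
  proof -
    obtain a b where *: "y = a / b" "a \<in> R" "b \<in> R - P" using \<open>y \<in> ?S\<close> by (auto simp: localize_def)
    then have "unit_in x b" by (auto simp: P_def)
    then have "unit_in x (y * b)" using that sx by (auto intro: unit_in_mult)
    then have "unit_in x a" using * \<open>unit_in x b\<close> by (auto simp: unit_in_def)
    then have "b / a \<in> ?S" using * by (intro localizeI[OF R(1) P]) (auto simp: P_def)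
    then show ?thesis using * by simp
  qed
  have TS: "T \<subseteq> ?S"
    using sub[OF subring_localize[OF R(1) P] localize_super[OF R(1) P] Sx inv] .
  have "x \<subseteq> ?S"
  proof
    fix y assume "y \<in> x"
    then obtain a b where *: "y = a / b" "a \<in> T" "b \<in> T" "unit_in x b" using Spec_rings_fraction[OF T] by blast
    then have "a \<in> ?S" "inverse b \<in> ?S" using TS inv by auto
    then show "y \<in> ?S" unfolding * divide_inverse by (rule subring_mult[OF subring_localize[OF R(1) P]])
  qed
  with Sx have "x = ?S" by auto
  then show ?thesis using P by (auto simp: Spec_rings_eq)
qed

text \<open>Instance of the transfer lemma with \<open>T = x\<close>: a denominator from
  \<open>B\<close> that is a unit of \<open>x\<close> stays a unit of the localization, so its
  inverse lies in every admissible \<open>S\<close>.\<close>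

lemma Spec_rings_generization:
  assumes "subring_of_field B" "x \<in> Spec_rings B" "prime_ideal_in x Q"
  shows "localize x Q \<in> Spec_rings B"
proof -
  have sx: "subring_of_field x" using local_Spec_rings[OF assms(1,2)] by (rule local_subringD)
  have xQ: "x \<subseteq> localize x Q" by (rule localize_super[OF sx assms(3)])
  show ?thesis
  proof (rule Spec_rings_transfer[of x])
    show "localize x Q \<in> Spec_rings x" using assms(3) by (auto simp: Spec_rings_eq)
    show "B \<subseteq> localize x Q" using Spec_rings_super[OF assms(1,2)] xQ by auto
  next
    fix S assume S: "subring_of_field S" "B \<subseteq> S"
      and inv: "\<And>y. y \<in> S \<Longrightarrow> unit_in (localize x Q) y \<Longrightarrow> inverse y \<in> S"
    show "x \<subseteq> S"
    proof
      fix y assume "y \<in> x"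
      then obtain a b where *: "y = a / b" "a \<in> B" "b \<in> B" "unit_in x b"
        using Spec_rings_fraction[OF assms(1,2)] by blast
      then have "unit_in (localize x Q) b" using xQ by (auto simp: unit_in_def)
      then show "y \<in> S" using * S inv unfolding divide_inverse * by (auto intro: subring_mult)
    qed
  qed (use sx assms in auto)
qed

subsection \<open>Prime ideals\<close>

definition ideal_of :: "'f::field set \<Rightarrow> 'f set \<Rightarrow> bool" where
  "ideal_of B J \<longleftrightarrow> J \<subseteq> B \<and> 0 \<in> J \<and> (\<forall>a\<in>J. \<forall>b\<in>J. a + b \<in> J) \<and> (\<forall>a\<in>B. \<forall>b\<in>J. a * b \<in> J)"

text \<open>Krull's lemma: an ideal that is maximal among those containing \<open>J\<close> and
  disjoint from the multiplicative set \<open>M\<close> is prime.\<close>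

lemma prime_ideal_exists:
  assumes B: "subring_of_field B" and J: "ideal_of B J"
    and M: "1 \<in> M" "\<And>a b. a \<in> M \<Longrightarrow> b \<in> M \<Longrightarrow> a * b \<in> M" "M \<subseteq> B" "M \<inter> J = {}"
  obtains P where "prime_ideal_in B P" "J \<subseteq> P" "M \<inter> P = {}"
proof -
  define A where "A = {I. ideal_of B I \<and> J \<subseteq> I \<and> M \<inter> I = {}}"
  have "\<exists>P\<in>A. \<forall>I\<in>A. P \<subseteq> I \<longrightarrow> I = P"
  proof (rule subset_Zorn_nonempty)
    show "A \<noteq> {}" using J M by (auto simp: A_def)
  next
    fix C assume C: "C \<noteq> {}" "subset.chain A C"
    have mem: "I \<in> A" if "I \<in> C" for I using C that by (auto simp: subset_chain_def)
    have "a + b \<in> \<Union>C" if ab: "a \<in> \<Union>C" "b \<in> \<Union>C" for a b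
    proof -
      obtain I I' where "a \<in> I" "I \<in> C" "b \<in> I'" "I' \<in> C" using ab by blast
      moreover have "I \<subseteq> I' \<or> I' \<subseteq> I" using C calculation by (auto simp: subset_chain_def)
      ultimately show ?thesis using mem unfolding A_def ideal_of_def by blast
    qed
    moreover have id: "ideal_of B I" "J \<subseteq> I" "M \<inter> I = {}" if "I \<in> C" for I
      using mem[OF that] by (auto simp: A_def)
    have "a * b \<in> \<Union>C" if "a \<in> B" "b \<in> \<Union>C" for a b
      using that id(1) unfolding ideal_of_def by blast
    moreover have "\<Union>C \<subseteq> B" "J \<subseteq> \<Union>C" "M \<inter> \<Union>C = {}"
      using id C(1) unfolding ideal_of_def by blast+
    moreover have "0 \<in> \<Union>C" using id(1) C(1) by (auto simp: ideal_of_def)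
    ultimately show "\<Union>C \<in> A" unfolding A_def ideal_of_def by simp
  qed
  then obtain P where P: "P \<in> A" and max: "\<And>I. I \<in> A \<Longrightarrow> P \<subseteq> I \<Longrightarrow> I = P" by blast
  have I: "ideal_of B P" "J \<subseteq> P" "M \<inter> P = {}" using P by (auto simp: A_def)
  \<comment> \<open>By maximality, enlarging \<open>P\<close> by an outside element produces an
    element of \<open>M\<close>. Two such elements have a product in \<open>M\<close> that would lie
    in \<open>P\<close> if \<open>a * b\<close> did.\<close>
  have meets: "\<exists>m\<in>M. \<exists>q\<in>P. \<exists>r\<in>B. m = q + r * a" if a: "a \<in> B" "a \<notin> P" for a
  proof (rule ccontr)
    assume *: "\<not> ?thesis"
    define I where "I = {q + r * a | q r. q \<in> P \<and> r \<in> B}"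
    have q0: "q = q + 0 * a" for q by simp
    have "P \<subseteq> I" unfolding I_def using subring_0[OF B] q0 by blast
    have "ideal_of B I" unfolding ideal_of_def
    proof (intro conjI ballI)
      show "I \<subseteq> B" using I(1) a subring_add[OF B] subring_mult[OF B] unfolding I_def ideal_of_def by blast
      show "0 \<in> I" using \<open>P \<subseteq> I\<close> I by (auto simp: ideal_of_def)
    next
      fix b c assume "b \<in> I" "c \<in> I"
      then obtain q r q' r' where "b = q + r * a" "c = q' + r' * a" "q \<in> P" "r \<in> B" "q' \<in> P" "r' \<in> B"
        by (auto simp: I_def)
      moreover have "q + r * a + (q' + r' * a) = (q + q') + (r + r') * a" by (simp add: algebra_simps)
      moreover have "q + q' \<in> P" "r + r' \<in> B"
        using calculation I(1) subring_add[OF B] by (auto simp: ideal_of_def)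
      ultimately show "b + c \<in> I" unfolding I_def by blast
    next
      fix b c assume "b \<in> B" "c \<in> I"
      then obtain q r where "c = q + r * a" "q \<in> P" "r \<in> B" by (auto simp: I_def)
      moreover have "b * (q + r * a) = b * q + (b * r) * a" by (simp add: algebra_simps)
      moreover have "b * q \<in> P" "b * r \<in> B"
        using calculation \<open>b \<in> B\<close> I(1) subring_mult[OF B] by (auto simp: ideal_of_def)
      ultimately show "b * c \<in> I" unfolding I_def by blast
    qed
    moreover have "M \<inter> I = {}" using * by (auto simp: I_def)
    ultimately have "I \<in> A" using \<open>P \<subseteq> I\<close> I by (auto simp: A_def)
    then have "I = P" using max \<open>P \<subseteq> I\<close> by blast
    moreover have "a \<in> I"
    proof -
      have "a = 0 + 1 * a" by simp
      then show ?thesis unfolding I_def using I subring_1[OF B] unfolding ideal_of_def by blast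
    qed
    ultimately show False using a by blast
  qed
  have "prime_ideal_in B P" unfolding prime_ideal_in_def
  proof (intro conjI ballI impI)
    fix a b assume ab: "a \<in> B" "b \<in> B" "a * b \<in> P"
    show "a \<in> P \<or> b \<in> P"
    proof (rule ccontr)
      assume "\<not> ?thesis"
      then obtain m m' q q' r r' where *: "m \<in> M" "m = q + r * a" "q \<in> P" "r \<in> B"
        "m' \<in> M" "m' = q' + r' * b" "q' \<in> P" "r' \<in> B" using meets ab by blast
      have "m * m' = q * q' + (r' * b) * q + (r * a) * q' + (r * r') * (a * b)" by (simp add: * algebra_simps)
      also have "... \<in> P" using I * ab subring_mult[OF B] unfolding ideal_of_def by (meson subsetD)
      finally show False using M(2) * I by blast
    qed
  qed (use I M in \<open>auto simp: ideal_of_def\<close>)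
  then show thesis using that I by blast
qed

text \<open>The possible denominators of \<open>a\<close>, the \<open>b\<close> with
  \<open>b * a\<close> in \<open>B\<close>, form an ideal. If it were proper, a prime above it would
  give a local ring without \<open>a\<close>.\<close>

lemma Inter_Spec_rings:
  assumes B: "subring_of_field B" and a: "\<And>x. x \<in> Spec_rings B \<Longrightarrow> a \<in> x"
  shows "a \<in> B"
proof (rule ccontr)
  assume n: "a \<notin> B"
  define J where "J = {b \<in> B. b * a \<in> B}"
  have "ideal_of B J" unfolding ideal_of_def J_def
    using subring_closed(1-5)[OF B] by (auto simp: distrib_right mult.assoc)
  then obtain P where P: "prime_ideal_in B P" "J \<subseteq> P"
    using prime_ideal_exists[OF B, of J "{1}"] n subring_1[OF B] by (auto simp: J_def)
  then have "a \<in> localize B P" using a by (auto simp: Spec_rings_eq)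
  then obtain c d where *: "a = c / d" "c \<in> B" "d \<in> B - P" by (auto simp: localize_def)
  then have "d * a = c" using localize_nz[OF B P(1)] by auto
  then have "d \<in> J" using * by (auto simp: J_def)
  then show False using * P by auto
qed

subsection \<open>Generated submodules and subalgebras\<close>

lemma submod_gen_least:
  assumes "0 \<in> N" "\<And>a b. a \<in> N \<Longrightarrow> b \<in> N \<Longrightarrow> a + b \<in> N" "\<And>r g. r \<in> R \<Longrightarrow> g \<in> G \<Longrightarrow> sc r g \<in> N"
  shows "submod_gen sc R G \<subseteq> N"
proof -
  have "(\<Sum>g\<in>T. sc (r g) g) \<in> N" if "finite T" "T \<subseteq> G" "\<forall>g\<in>T. r g \<in> R" for T r
    using that by (induction T rule: finite_induct) (auto intro: assms)
  then show ?thesis by (auto simp: submod_gen_def)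
qed

lemma submod_gen_single: "r \<in> R \<Longrightarrow> g \<in> G \<Longrightarrow> sc r g \<in> submod_gen sc R G"
  unfolding submod_gen_def by (auto intro!: exI[of _ "{g}"] exI[of _ "\<lambda>_. r"])

lemma ideal_of_submod_gen:
  assumes B: "subring_of_field B" and G: "G \<subseteq> B"
  shows "ideal_of B (submod_gen (*) B G)" "G \<subseteq> submod_gen (*) B G"
proof -
  show "G \<subseteq> submod_gen (*) B G"
    using submod_gen_single[OF subring_1[OF B], of _ G "(*)"] by auto
  show "ideal_of B (submod_gen (*) B G)" unfolding ideal_of_def
  proof (intro conjI ballI)
    show "submod_gen (*) B G \<subseteq> B" using G by (intro submod_gen_least) (auto intro: subring_closed[OF B])
    show "0 \<in> submod_gen (*) B G" unfolding submod_gen_def by (auto intro!: exI[of _ "{}"])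
  next
    fix a b assume "a \<in> submod_gen (*) B G" "b \<in> submod_gen (*) B G"
    then obtain T r T' r' where *: "a = (\<Sum>g\<in>T. r g * g)" "finite T" "T \<subseteq> G" "\<forall>g\<in>T. r g \<in> B"
      "b = (\<Sum>g\<in>T'. r' g * g)" "finite T'" "T' \<subseteq> G" "\<forall>g\<in>T'. r' g \<in> B" by (auto simp: submod_gen_def)
    define q where "q g = (if g \<in> T then r g else 0) + (if g \<in> T' then r' g else 0)" for g
    have "a = (\<Sum>g\<in>T \<union> T'. (if g \<in> T then r g else 0) * g)"
      unfolding *(1) using * by (intro sum.mono_neutral_cong_left) auto
    moreover have "b = (\<Sum>g\<in>T \<union> T'. (if g \<in> T' then r' g else 0) * g)"
      unfolding *(5) using * by (intro sum.mono_neutral_cong_left) auto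
    ultimately have "a + b = (\<Sum>g\<in>T \<union> T'. q g * g)"
      by (simp add: q_def sum.distrib distrib_right)
    moreover have "\<forall>g\<in>T \<union> T'. q g \<in> B" using * subring_0[OF B] by (auto simp: q_def subring_add[OF B])
    ultimately show "a + b \<in> submod_gen (*) B G"
      using * unfolding submod_gen_def by (auto intro!: exI[of _ "T \<union> T'"] exI[of _ q])
  next
    fix a b assume "a \<in> B" "b \<in> submod_gen (*) B G"
    then obtain T r where *: "b = (\<Sum>g\<in>T. r g * g)" "finite T" "T \<subseteq> G" "\<forall>g\<in>T. r g \<in> B"
      by (auto simp: submod_gen_def)
    have "a * b = (\<Sum>g\<in>T. (a * r g) * g)" by (simp add: * sum_distrib_left mult.assoc)
    then show "a * b \<in> submod_gen (*) B G"
      using * \<open>a \<in> B\<close> unfolding submod_gen_def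
      by (auto intro!: exI[of _ "T"] exI[of _ "\<lambda>g. a * r g"] intro: subring_closed[OF B])
  qed
qed

lemma subalgebra_gen_least:
  "subring_of_field B \<Longrightarrow> range const_ff \<subseteq> B \<Longrightarrow> G \<subseteq> B \<Longrightarrow> subalgebra_gen G \<subseteq> B"
  by (auto simp: subalgebra_gen_def)

lemma subalgebra_gen_super: "G \<subseteq> subalgebra_gen G"
  and const_subalgebra_gen: "const_ff c \<in> subalgebra_gen G"
  by (auto simp: subalgebra_gen_def)

lemma subring_subalgebra_gen: "subring_of_field (subalgebra_gen G)"
  unfolding subalgebra_gen_def subring_of_field_def by auto

section \<open>Noetherian subrings\<close>

text \<open>Arbitrary subsets instead of ideals, with the finite generating set chosen inside
  \<open>S\<close>: this directly yields finite subfamilies of a given family of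
  denominators.\<close>

definition noetherian_subring :: "'f::field set \<Rightarrow> bool" where
  "noetherian_subring B \<longleftrightarrow> (\<forall>S\<subseteq>B. \<exists>T. finite T \<and> T \<subseteq> S \<and> S \<subseteq> submod_gen (*) B T)"

lemma ideal_ofD:
  assumes "ideal_of B J"
  shows "J \<subseteq> B" "0 \<in> J" "a \<in> J \<Longrightarrow> b \<in> J \<Longrightarrow> a + b \<in> J" "r \<in> B \<Longrightarrow> b \<in> J \<Longrightarrow> r * b \<in> J"
  using assms by (auto simp: ideal_of_def)

lemma ideal_of_sum: "ideal_of B J \<Longrightarrow> (\<And>i. i \<in> S \<Longrightarrow> h i \<in> J) \<Longrightarrow> sum h S \<in> J"
  by (induction S rule: infinite_finite_induct) (auto intro: ideal_ofD)

lemma submod_gen_subset_ideal: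
  "ideal_of B J \<Longrightarrow> G \<subseteq> J \<Longrightarrow> submod_gen (*) B G \<subseteq> J"
  by (intro submod_gen_least) (auto intro: ideal_ofD)

lemma submod_gen_mono: "G \<subseteq> H \<Longrightarrow> submod_gen sc B G \<subseteq> submod_gen sc B H"
  unfolding submod_gen_def by blast

lemma submod_gen_finite_support:
  assumes "finite F" "F \<subseteq> submod_gen sc B S"
  obtains T where "finite T" "T \<subseteq> S" "F \<subseteq> submod_gen sc B T"
proof -
  have "\<exists>T. finite T \<and> T \<subseteq> S \<and> F \<subseteq> submod_gen sc B T"
    using assms
  proof (induction F rule: finite_induct)
    case (insert a F)
    then obtain T where T: "finite T" "T \<subseteq> S" "F \<subseteq> submod_gen sc B T" by auto
    obtain T' r where T': "a = (\<Sum>g\<in>T'. sc (r g) g)" "finite T'" "T' \<subseteq> S" "\<forall>g\<in>T'. r g \<in> B"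
      using insert.prems by (auto simp: submod_gen_def)
    have "a \<in> submod_gen sc B T'" unfolding submod_gen_def using T' by blast
    then have "insert a F \<subseteq> submod_gen sc B (T \<union> T')"
      using T submod_gen_mono[of T "T \<union> T'" sc B] submod_gen_mono[of T' "T \<union> T'" sc B] by auto
    then show ?case using T T' by (metis finite_UnI Un_subset_iff)
  qed (auto intro!: exI[of _ "{}"])
  then show thesis using that by blast
qed

lemma noetherian_field:
  assumes "subring_of_field B" "\<And>a. a \<in> B \<Longrightarrow> inverse a \<in> B"
  shows "noetherian_subring B"
  unfolding noetherian_subring_def
proof (intro allI impI)
  fix S assume S: "S \<subseteq> B"
  show "\<exists>T. finite T \<and> T \<subseteq> S \<and> S \<subseteq> submod_gen (*) B T"
  proof (cases "S \<subseteq> {0}")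
    case True
    then show ?thesis
      using ideal_ofD(2)[OF ideal_of_submod_gen(1)[OF assms(1), of "{}"]] by (intro exI[of _ "{}"]) auto
  next
    case False
    then obtain s where s: "s \<in> S" "s \<noteq> 0" by blast
    have "a \<in> submod_gen (*) B {s}" if "a \<in> S" for a
    proof -
      have "a * inverse s \<in> B" using that S s assms by (auto intro: subring_mult)
      then have "(a * inverse s) * s \<in> submod_gen (*) B {s}" by (rule submod_gen_single) simp
      then show ?thesis using s by (simp add: mult.assoc)
    qed
    then show ?thesis using s by (intro exI[of _ "{s}"]) auto
  qed
qed

definition adjoin :: "'f::field set \<Rightarrow> 'f \<Rightarrow> 'f set" where
  "adjoin R t = {poly q t | q. \<forall>i. coeff q i \<in> R}"

lemma subring_adjoin:
  assumes R: "subring_of_field R"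
  shows "subring_of_field (adjoin R t)" "R \<subseteq> adjoin R t" "t \<in> adjoin R t"
proof -
  have c: "\<forall>i. coeff [:a:] i \<in> R" if "a \<in> R" for a
    using that by (auto simp: coeff_pCons split: nat.splits intro: subring_0[OF R])
  show "R \<subseteq> adjoin R t" unfolding adjoin_def using c by (force intro: exI[of _ "[:_:]"])
  show "t \<in> adjoin R t" unfolding adjoin_def
    using subring_0[OF R] subring_1[OF R]
    by (auto intro!: exI[of _ "[:0, 1:]"] simp: coeff_pCons split: nat.splits)
  have "a + b \<in> adjoin R t" "a - b \<in> adjoin R t" "a * b \<in> adjoin R t"
    if ab: "a \<in> adjoin R t" "b \<in> adjoin R t" for a b
  proof -
    obtain p q where *: "a = poly p t" "b = poly q t" "\<forall>i. coeff p i \<in> R" "\<forall>i. coeff q i \<in> R"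
      using ab unfolding adjoin_def by blast
    have "a + b = poly (p + q) t" "a - b = poly (p - q) t" "a * b = poly (p * q) t" by (auto simp: *)
    moreover have "\<forall>i. coeff (p + q) i \<in> R" "\<forall>i. coeff (p - q) i \<in> R" "\<forall>i. coeff (p * q) i \<in> R"
      using * by (auto simp: coeff_mult subring_add[OF R] subring_diff[OF R]
          intro!: subring_sum[OF R] subring_mult[OF R])
    ultimately show "a + b \<in> adjoin R t" "a - b \<in> adjoin R t" "a * b \<in> adjoin R t"
      unfolding adjoin_def by blast+
  qed
  then show "subring_of_field (adjoin R t)"
    using \<open>R \<subseteq> adjoin R t\<close> subring_0[OF R] subring_1[OF R] by (auto simp: subring_of_field_def)
qed

text \<open>
  Hilbert's basis theorem.  \<open>L n\<close> consists of the coefficients at \<open>t\<^sup>n\<close> of the polynomial expressions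
  of degree at most \<open>n\<close> whose value lies in the ideal.
\<close>

lemma noetherian_adjoin:
  fixes R :: "'f::field set"
  assumes R: "subring_of_field R" and noeth: "noetherian_subring R"
  shows "noetherian_subring (adjoin R t)"
  unfolding noetherian_subring_def
proof (intro allI impI)
  fix S assume S: "S \<subseteq> adjoin R t"
  let ?B = "adjoin R t"
  note B = subring_adjoin[OF R, of t]
  define J where "J = submod_gen (*) ?B S"
  have J: "ideal_of ?B J" and SJ: "S \<subseteq> J" using ideal_of_submod_gen[OF B(1) S] by (auto simp: J_def)
  define Q where "Q n = {q. (\<forall>i. coeff q i \<in> R) \<and> degree q \<le> n \<and> poly q t \<in> J}" for n
  define L where "L n = (\<lambda>q. coeff q n) ` Q n" for n
  have LR: "L n \<subseteq> R" for n by (auto simp: L_def Q_def)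
  have shift: "monom 1 k * q \<in> Q (n + k)" if "q \<in> Q n" for q n k
  proof -
    have "degree (monom 1 k * q) \<le> n + k"
      using that degree_mult_le[of "monom 1 k" q] degree_monom_le[of "1::'f" k] by (auto simp: Q_def)
    moreover have "poly (monom 1 k * q) t \<in> J"
      using that ideal_ofD(4)[OF J subring_power[OF B(1) B(3)]] by (auto simp: Q_def poly_monom)
    moreover have "coeff (monom 1 k * q) i \<in> R" for i
      using that subring_0[OF R] by (auto simp: Q_def coeff_monom_mult)
    ultimately show ?thesis by (auto simp: Q_def)
  qed
  have Lmono: "L n \<subseteq> L m" if "n \<le> m" for n m
  proof
    fix a assume "a \<in> L n"
    then obtain q where q: "q \<in> Q n" "a = coeff q n" by (auto simp: L_def)
    have "a = coeff (monom 1 (m - n) * q) m" using q that by (simp add: coeff_monom_mult)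
    moreover have "monom 1 (m - n) * q \<in> Q m" using shift[OF q(1), of "m - n"] that by simp
    ultimately show "a \<in> L m" by (auto simp: L_def)
  qed
  obtain T where T: "finite T" "T \<subseteq> (\<Union>n. L n)" "(\<Union>n. L n) \<subseteq> submod_gen (*) R T"
    using noeth LR unfolding noetherian_subring_def by (metis UN_least)
  have "\<exists>D. T \<subseteq> L D" using T(1,2)
  proof (induction T rule: finite_induct)
    case (insert a T)
    then obtain D n where "T \<subseteq> L D" "a \<in> L n" by auto
    then show ?case using Lmono[of D "max D n"] Lmono[of n "max D n"] by (intro exI[of _ "max D n"]) auto
  qed auto
  then obtain D where D: "T \<subseteq> L D" by blast
  have "\<exists>Tn. finite Tn \<and> Tn \<subseteq> L n \<and> L n \<subseteq> submod_gen (*) R Tn" for n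
    using noeth LR unfolding noetherian_subring_def by blast
  then obtain Tn where Tn: "finite (Tn n)" "Tn n \<subseteq> L n" "L n \<subseteq> submod_gen (*) R (Tn n)" for n by metis
  have "\<forall>n. \<forall>b\<in>Tn n. \<exists>q\<in>Q n. b = coeff q n" using Tn(2) by (auto simp: L_def)
  then obtain qq where qq: "qq n b \<in> Q n" "b = coeff (qq n b) n" if "b \<in> Tn n" for n b
    unfolding bchoice_iff by metis
  define F where "F = (\<Union>n\<in>{..D}. (\<lambda>b. poly (qq n b) t) ` Tn n)"
  have "finite F" using Tn by (auto simp: F_def)
  have "F \<subseteq> J" using qq by (auto simp: F_def Q_def)
  then obtain T' where T': "finite T'" "T' \<subseteq> S" "F \<subseteq> submod_gen (*) ?B T'"
    using submod_gen_finite_support[OF \<open>finite F\<close>] unfolding J_def by metis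
  define J' where "J' = submod_gen (*) ?B T'"
  have J': "ideal_of ?B J'" using ideal_of_submod_gen[OF B(1)] T' S by (auto simp: J'_def)
  have main: "poly q t \<in> J'" if "\<forall>i. coeff q i \<in> R" "poly q t \<in> J" "\<forall>i\<ge>n. coeff q i = 0" for q n
    using that
  proof (induction n arbitrary: q)
    case 0
    then have "q = 0" by (intro poly_eqI) auto
    then show ?case using ideal_ofD(2)[OF J'] by simp
  next
    case (Suc n)
    \<comment> \<open>From degree \<open>D\<close> on, the ideals of leading coefficients have
      stabilized, so in higher degrees the chosen polynomials of degree \<open>D\<close> are shifted
      by a power of \<open>t\<close>.\<close>
    define m where "m = min n D"
    have "q \<in> Q n" using Suc.prems by (auto simp: Q_def intro: degree_le)
    then have cL: "coeff q n \<in> L n" by (auto simp: L_def)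
    have "coeff q n \<in> submod_gen (*) R (Tn m)"
    proof (cases "n \<le> D")
      case True
      then show ?thesis using cL Tn(3) by (auto simp: m_def)
    next
      case False
      then have "L D \<subseteq> submod_gen (*) R (Tn m)" using Tn(3)[of D] by (auto simp: m_def)
      then have "submod_gen (*) R T \<subseteq> submod_gen (*) R (Tn m)"
        using D Tn(2)[of m] LR[of m] by (intro submod_gen_subset_ideal ideal_of_submod_gen R) blast+
      then show ?thesis using cL T(3) by auto
    qed
    then obtain T0 r where r: "coeff q n = (\<Sum>b\<in>T0. r b * b)" "finite T0" "T0 \<subseteq> Tn m" "\<forall>b\<in>T0. r b \<in> R"
      by (auto simp: submod_gen_def)
    define p where "p = (\<Sum>b\<in>T0. smult (r b) (monom 1 (n - m) * qq m b))"
    have mem: "monom 1 (n - m) * qq m b \<in> Q n" if "b \<in> T0" for b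
      using shift[OF qq(1)[of b m], of "n - m"] that r by (auto simp: m_def)
    have pR: "coeff p i \<in> R" for i
      unfolding p_def coeff_sum coeff_smult using mem r
      by (auto simp: Q_def intro!: subring_sum[OF R] subring_mult[OF R])
    have top: "coeff p n = coeff q n"
      unfolding p_def coeff_sum coeff_smult r(1) coeff_monom_mult
      using r qq by (auto simp: m_def intro!: sum.cong)
    have above: "coeff p i = 0" if "i > n" for i
      unfolding p_def coeff_sum coeff_smult
    proof (intro sum.neutral ballI)
      fix b assume "b \<in> T0"
      then have "degree (monom 1 (n - m) * qq m b) < i" using mem that by (auto simp: Q_def intro: le_less_trans)
      then show "r b * coeff (monom 1 (n - m) * qq m b) i = 0" by (simp add: coeff_eq_0)
    qed
    have pF: "poly p t = (\<Sum>b\<in>T0. (r b * t ^ (n - m)) * poly (qq m b) t)"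
      by (simp add: p_def poly_sum poly_monom mult.assoc)
    have rt: "r b * t ^ (n - m) \<in> ?B" if "b \<in> T0" for b
      using that r B subring_mult[OF B(1)] subring_power[OF B(1)] by (meson subsetD)
    have "F \<subseteq> J'" using T' by (simp add: J'_def)
    moreover have "poly (qq m b) t \<in> F" if "b \<in> T0" for b
      unfolding F_def using that r(3) by (intro UN_I[of m] imageI) (auto simp: m_def)
    ultimately have pJ': "poly p t \<in> J'" unfolding pF
      by (intro ideal_of_sum[OF J'] ideal_ofD(4)[OF J'] rt) auto
    have "poly p t \<in> J" unfolding p_def poly_sum poly_smult
      using mem r B by (intro ideal_of_sum[OF J] ideal_ofD(4)[OF J]) (auto simp: Q_def)
    then have "poly q t + (- 1) * poly p t \<in> J"
      using Suc.prems subring_uminus[OF B(1) subring_1[OF B(1)]] by (intro ideal_ofD[OF J])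
    moreover have "coeff (q - p) i = 0" if "i \<ge> n" for i
      using that top above Suc.prems(3) by (cases "i = n") auto
    ultimately have "poly (q - p) t \<in> J'"
      using Suc.prems pR by (intro Suc.IH) (auto intro: subring_diff[OF R])
    then have "poly (q - p) t + poly p t \<in> J'" using pJ' by (rule ideal_ofD(3)[OF J'])
    then show ?case by simp
  qed
  have "S \<subseteq> J'"
  proof
    fix a assume "a \<in> S"
    then obtain q where "a = poly q t" "\<forall>i. coeff q i \<in> R" using S by (auto simp: adjoin_def)
    then show "a \<in> J'" using main[of q "Suc (degree q)"] \<open>a \<in> S\<close> SJ
      by (auto simp: Suc_le_eq coeff_eq_0)
  qed
  then show "\<exists>T. finite T \<and> T \<subseteq> S \<and> S \<subseteq> submod_gen (*) ?B T"
    using T' by (auto simp: J'_def)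
qed

lemma const_ff_hom:
  "const_ff 0 = 0" "const_ff 1 = 1" "const_ff (a + b) = const_ff a + const_ff b"
  "const_ff (a - b) = const_ff a - const_ff b" "const_ff (a * b) = const_ff a * const_ff b"
  "const_ff (- a) = - const_ff a"
  by (simp_all add: const_ff_def fract_collapse flip: one_pCons)

lemma const_ff_inject: "const_ff a = const_ff b \<longleftrightarrow> a = b"
  by (simp add: const_ff_def eq_fract)

lemma const_ff_inverse: "const_ff (inverse a) = inverse (const_ff a)"
proof (cases "a = 0")
  case False
  then have "const_ff a * const_ff (inverse a) = 1" by (simp add: const_ff_hom(2) flip: const_ff_hom(5))
  then show ?thesis using inverse_unique by metis
qed (simp add: const_ff_hom)

lemma subring_const_ff: "subring_of_field (range const_ff)"
  using rangeI[of const_ff 0] rangeI[of const_ff 1] unfolding subring_of_field_def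
  by (auto simp: const_ff_hom(1,2) simp flip: const_ff_hom(3-5))

lemma subalgebra_gen_mono: "G \<subseteq> H \<Longrightarrow> subalgebra_gen G \<subseteq> subalgebra_gen H"
  unfolding subalgebra_gen_def by blast

lemma subalgebra_gen_insert: "subalgebra_gen (insert t G) = adjoin (subalgebra_gen G) t"
proof
  note s = subring_subalgebra_gen[of G]
  show "subalgebra_gen (insert t G) \<subseteq> adjoin (subalgebra_gen G) t"
    using subring_adjoin[OF s, of t] subalgebra_gen_super[of G] const_subalgebra_gen[of _ G]
    by (intro subalgebra_gen_least) blast+
next
  note s = subring_subalgebra_gen[of "insert t G"]
  have "poly q t \<in> subalgebra_gen (insert t G)" if "\<forall>i. coeff q i \<in> subalgebra_gen G" for q
    unfolding poly_altdef using that subalgebra_gen_mono[of G "insert t G"] subalgebra_gen_super[of "insert t G"]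
    by (intro subring_sum[OF s] subring_mult[OF s] subring_power[OF s]) auto
  then show "adjoin (subalgebra_gen G) t \<subseteq> subalgebra_gen (insert t G)" by (auto simp: adjoin_def)
qed

lemma noetherian_subalgebra_gen: "finite G \<Longrightarrow> noetherian_subring (subalgebra_gen G)"
proof (induction G rule: finite_induct)
  case empty
  have "subalgebra_gen {} = range (const_ff :: 'a \<Rightarrow> _)"
    using subalgebra_gen_least[OF subring_const_ff, of "{}"] const_subalgebra_gen[of _ "{}"] by auto
  moreover have "noetherian_subring (range (const_ff :: 'a \<Rightarrow> _))"
    by (rule noetherian_field[OF subring_const_ff]) (auto simp flip: const_ff_inverse)
  ultimately show ?case by simp
next
  case (insert t G)
  then show ?case
    by (simp add: subalgebra_gen_insert noetherian_adjoin subring_subalgebra_gen)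
qed

section \<open>The Zariski topology\<close>

lemma openin_zariski_finite:
  assumes "finite G" "\<And>x. x \<in> X \<Longrightarrow> 1 \<in> x"
  shows "openin (zariski X) {x \<in> X. G \<subseteq> x}"
  using assms(1)
proof (induction G rule: finite_induct)
  case empty
  have "openin (zariski X) {x \<in> X. 1 \<in> x}"
    unfolding zariski_def by (intro topology_generated_by_Basis) auto
  moreover have "{x \<in> X. 1 \<in> x} = X" using assms by auto
  ultimately show ?case by simp
next
  case (insert f G)
  have "openin (zariski X) {x \<in> X. f \<in> x}"
    unfolding zariski_def by (intro topology_generated_by_Basis) auto
  then have "openin (zariski X) ({x \<in> X. f \<in> x} \<inter> {x \<in> X. G \<subseteq> x})" using insert by auto
  moreover have "{x \<in> X. f \<in> x} \<inter> {x \<in> X. G \<subseteq> x} = {x \<in> X. insert f G \<subseteq> x}" by auto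
  ultimately show ?case by simp
qed

lemma openin_zariski_subset: "openin (zariski X) U \<Longrightarrow> U \<subseteq> X"
  using openin_subset[of "zariski X" U] by (auto simp: zariski_def topology_generated_by_topspace)

lemma openin_zariski_nbhd:
  assumes "openin (zariski X) U" "x \<in> U"
  obtains G where "finite G" "G \<subseteq> x" "{y \<in> X. G \<subseteq> y} \<subseteq> U"
proof -
  have "generate_topology_on (range (\<lambda>f. {x \<in> X. f \<in> x})) U"
    using assms(1) by (simp add: zariski_def openin_topology_generated_by_iff)
  then have "\<exists>G. finite G \<and> G \<subseteq> x \<and> {y \<in> X. G \<subseteq> y} \<subseteq> U" using assms(2)
  proof (induction arbitrary: x rule: generate_topology_on.induct)
    case (Int a b)
    then obtain G H where "finite G \<and> G \<subseteq> x \<and> {y \<in> X. G \<subseteq> y} \<subseteq> a" "finite H \<and> H \<subseteq> x \<and> {y \<in> X. H \<subseteq> y} \<subseteq> b"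
      by (meson IntE)
    then show ?case by (intro exI[of _ "G \<union> H"]) auto
  next
    case (UN K)
    then show ?case by (meson Sup_upper UnionE subset_trans)
  next
    case (Basis s)
    then obtain f where "s = {x \<in> X. f \<in> x}" by auto
    then show ?case using Basis by (intro exI[of _ "{f}"]) auto
  qed auto
  then show thesis using that by blast
qed

text \<open>Larger local rings are generizations. Basic open sets are given by membership of
  functions in the local ring, which persists when the ring grows.\<close>

lemma openin_zariski_up: "openin (zariski X) U \<Longrightarrow> x \<in> U \<Longrightarrow> y \<in> X \<Longrightarrow> x \<subseteq> y \<Longrightarrow> y \<in> U"
  using openin_zariski_nbhd by (metis (mono_tags, lifting) mem_Collect_eq subset_iff)

text \<open>Finitely many functions cut out a basic neighbourhood of \<open>x\<close>. Take
  \<open>h\<close> to be the product of their denominators over \<open>R\<close>: where it is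
  invertible, all of them are regular.\<close>

lemma openin_zariski_principal:
  assumes R: "subring_of_field R" "x \<in> Spec_rings R" and U: "openin (zariski X) U" "x \<in> U"
    and X: "\<And>y. y \<in> X \<Longrightarrow> subring_of_field y"
  obtains h where "h \<in> R" "unit_in x h" "{y \<in> X. R \<subseteq> y \<and> inverse h \<in> y} \<subseteq> U"
proof -
  note lx = local_Spec_rings[OF R] note sx = local_subringD[OF lx]
  obtain G where G: "finite G" "G \<subseteq> x" "{y \<in> X. G \<subseteq> y} \<subseteq> U" using openin_zariski_nbhd[OF U] .
  have "\<forall>g\<in>G. \<exists>a b. g = a / b \<and> a \<in> R \<and> b \<in> R \<and> unit_in x b"
    using Spec_rings_fraction[OF R] G(2) by (metis subsetD)
  then obtain a b where ab: "\<And>g. g \<in> G \<Longrightarrow> g = a g / b g \<and> a g \<in> R \<and> b g \<in> R \<and> unit_in x (b g)" by metis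
  define h where "h = (\<Prod>g\<in>G. b g)"
  have hu: "unit_in x h" unfolding h_def using ab by (intro unit_in_prod sx) auto
  have "g \<in> y" if y: "y \<in> X" "R \<subseteq> y" "inverse h \<in> y" and g: "g \<in> G" for y g
  proof -
    note sy = X[OF y(1)]
    have "h = b g * (\<Prod>g\<in>G - {g}. b g)" unfolding h_def using G(1) g by (rule prod.remove)
    then have "g = a g * (\<Prod>g\<in>G - {g}. b g) * inverse h"
      using ab[OF g] unit_in_nonzero[OF hu] by (auto simp: field_simps)
    also have "... \<in> y" using y ab g by (intro subring_mult[OF sy] subring_prod[OF sy]) auto
    finally show ?thesis .
  qed
  then have "{y \<in> X. R \<subseteq> y \<and> inverse h \<in> y} \<subseteq> U" using G by auto
  moreover have "h \<in> R" unfolding h_def using ab by (intro subring_prod[OF R(1)]) auto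
  ultimately show thesis using that hu by blast
qed

text \<open>A noetherian topological space, in the form that every open set is
  quasi-compact.\<close>

definition noetherian_points :: "'f::field set set \<Rightarrow> bool" where
  "noetherian_points X \<longleftrightarrow> (\<forall>\<U>. (\<forall>U\<in>\<U>. openin (zariski X) U) \<longrightarrow> (\<exists>\<V>. finite \<V> \<and> \<V> \<subseteq> \<U> \<and> \<Union>\<V> = \<Union>\<U>))"

lemma unit_in_some_generator:
  assumes "local_subring x" "R \<subseteq> x" "T \<subseteq> R" "unit_in x h" "h \<in> submod_gen (*) R T"
  obtains t where "t \<in> T" "unit_in x t"
proof -
  obtain T' r where r: "h = (\<Sum>g\<in>T'. r g * g)" "finite T'" "T' \<subseteq> T" "\<forall>g\<in>T'. r g \<in> R"
    using assms(5) by (auto simp: submod_gen_def)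
  note sx = local_subringD[OF assms(1)]
  have mem: "r g \<in> x" "g \<in> x" if "g \<in> T'" for g using that r assms by auto
  then obtain g where g: "g \<in> T'" "unit_in x (r g * g)"
    using local_subring_sum[OF assms(1) r(2), of "\<lambda>g. r g * g"] r assms(4) subring_mult[OF sx] by auto
  then have "unit_in x g" using unit_in_factor[OF sx, of g "r g"] mem by (simp add: mult.commute)
  then show thesis using that g r by auto
qed

lemma noetherian_points_cover:
  assumes "finite \<R>" and R: "\<And>R. R \<in> \<R> \<Longrightarrow> subring_of_field R \<and> noetherian_subring R"
    and X: "X \<subseteq> (\<Union>R\<in>\<R>. Spec_rings R)"
  shows "noetherian_points X"
  unfolding noetherian_points_def
proof (intro allI impI)
  fix \<U> assume \<U>: "\<forall>U\<in>\<U>. openin (zariski X) U"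
  have sX: "local_subring y" if "y \<in> X" for y using that X R local_Spec_rings by blast
  have one: "\<exists>\<V>. finite \<V> \<and> \<V> \<subseteq> \<U> \<and> \<Union>\<U> \<inter> Spec_rings R \<subseteq> \<Union>\<V>" if RR: "R \<in> \<R>" for R
  proof -
    \<comment> \<open>Denominators whose principal open set fits into one member of the family. If a
      combination of the finitely many generators is a unit at a point, so is one generator, and its
      open set contains the point.\<close>
    define S where "S = {h \<in> R. \<exists>U\<in>\<U>. {y \<in> X. R \<subseteq> y \<and> inverse h \<in> y} \<subseteq> U}"
    obtain T where T: "finite T" "T \<subseteq> S" "S \<subseteq> submod_gen (*) R T"
      using R[OF RR] unfolding noetherian_subring_def S_def by (metis (no_types, lifting) mem_Collect_eq subsetI)
    have "\<forall>h\<in>T. \<exists>U\<in>\<U>. {y \<in> X. R \<subseteq> y \<and> inverse h \<in> y} \<subseteq> U" using T(2) by (auto simp: S_def)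
    then obtain U where U: "\<And>h. h \<in> T \<Longrightarrow> U h \<in> \<U> \<and> {y \<in> X. R \<subseteq> y \<and> inverse h \<in> y} \<subseteq> U h" by metis
    have "x \<in> \<Union>(U ` T)" if x: "x \<in> V" "V \<in> \<U>" "x \<in> Spec_rings R" for x V
    proof -
      have xX: "x \<in> X" using x \<U> openin_zariski_subset by blast
      have Rx: "R \<subseteq> x" using Spec_rings_super x R[OF RR] by blast
      obtain h where h: "h \<in> R" "unit_in x h" "{y \<in> X. R \<subseteq> y \<and> inverse h \<in> y} \<subseteq> V"
        using openin_zariski_principal[of R x X V] x \<U> R[OF RR] sX local_subringD by metis
      then have "h \<in> S" using x by (auto simp: S_def)
      then have "h \<in> submod_gen (*) R T" using T by auto
      then obtain t where "t \<in> T" "unit_in x t"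
        using unit_in_some_generator[OF sX[OF xX] Rx _ h(2)] T by (auto simp: S_def)
      then show ?thesis using U[of t] xX Rx by (auto simp: unit_in_def)
    qed
    then show ?thesis using T U by (intro exI[of _ "U ` T"]) auto
  qed
  then obtain V where V: "\<And>R. R \<in> \<R> \<Longrightarrow> finite (V R) \<and> V R \<subseteq> \<U> \<and> \<Union>\<U> \<inter> Spec_rings R \<subseteq> \<Union>(V R)"
    by metis
  have "\<Union>\<U> \<subseteq> X" using \<U> openin_zariski_subset by blast
  have "\<Union>(\<Union>(V ` \<R>)) = \<Union>\<U>"
  proof
    show "\<Union>(\<Union>(V ` \<R>)) \<subseteq> \<Union>\<U>" using V by blast
    show "\<Union>\<U> \<subseteq> \<Union>(\<Union>(V ` \<R>))"
    proof
      fix x assume x: "x \<in> \<Union>\<U>"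
      then obtain R where R: "R \<in> \<R>" "x \<in> Spec_rings R" using \<open>\<Union>\<U> \<subseteq> X\<close> X by blast
      then have "x \<in> \<Union>(V R)" using V[OF R(1)] x by blast
      then show "x \<in> \<Union>(\<Union>(V ` \<R>))" using R(1) by blast
    qed
  qed
  then show "\<exists>\<V>. finite \<V> \<and> \<V> \<subseteq> \<U> \<and> \<Union>\<V> = \<Union>\<U>"
    using V assms(1) by (intro exI[of _ "\<Union>(V ` \<R>)"] conjI finite_UN_I[of \<R> V]) blast+
qed

text \<open>Quasi-compactness of \<open>Spec R\<close> in algebraic form. If the denominators
  adapted to the cover generated a proper ideal, the local ring at a prime above it would still have
  a principal neighbourhood inside a member of the cover, whose denominator is not in the
  prime.\<close>

lemma affine_partition:
  assumes R: "subring_of_field R" "Spec_rings R \<subseteq> X" and X: "\<And>y. y \<in> X \<Longrightarrow> subring_of_field y"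
    and C: "\<And>U. U \<in> C \<Longrightarrow> openin (zariski X) U" "X \<subseteq> \<Union>C"
  obtains T where "finite T" "T \<subseteq> R" "0 \<notin> T" "1 \<in> submod_gen (*) R T"
    "\<And>h. h \<in> T \<Longrightarrow> \<exists>U\<in>C. {y \<in> X. R \<subseteq> y \<and> inverse h \<in> y} \<subseteq> U"
proof -
  define S where "S = {h \<in> R. h \<noteq> 0 \<and> (\<exists>U\<in>C. {y \<in> X. R \<subseteq> y \<and> inverse h \<in> y} \<subseteq> U)}"
  have SR: "S \<subseteq> R" by (auto simp: S_def)
  note J = ideal_of_submod_gen[OF R(1) SR]
  have "1 \<in> submod_gen (*) R S"
  proof (rule ccontr)
    assume n: "1 \<notin> submod_gen (*) R S"
    obtain P where P: "prime_ideal_in R P" "submod_gen (*) R S \<subseteq> P"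
      by (rule prime_ideal_exists[OF R(1) J(1), of "{1}"]) (use n subring_1[OF R(1)] in auto)
    define x where "x = localize R P"
    have x: "x \<in> Spec_rings R" using P by (auto simp: x_def Spec_rings_eq)
    then obtain U where "U \<in> C" "x \<in> U" using R C by blast
    then obtain h where h: "h \<in> R" "unit_in x h" "{y \<in> X. R \<subseteq> y \<and> inverse h \<in> y} \<subseteq> U"
      using openin_zariski_principal[OF R(1) x, of X U] C X by metis
    then have "h \<in> S" using \<open>U \<in> C\<close> by (auto simp: S_def unit_in_def)
    then have "h \<in> P" using J(2) P(2) by blast
    then show False using h unit_in_localize_iff[OF R(1) P(1) h(1)] by (simp add: x_def)
  qed
  then obtain T where T: "finite T" "T \<subseteq> S" "{1} \<subseteq> submod_gen (*) R T"
    using submod_gen_finite_support[of "{1}" "(*)" R S] by auto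
  then show thesis using that[of T] by (auto simp: S_def)
qed

text \<open>A prime containing all the powers \<open>h ^ n\<close> contains every \<open>h\<close>
  itself, so the powers also generate the unit ideal.\<close>

lemma unit_ideal_powers:
  assumes R: "subring_of_field R" "finite T" "T \<subseteq> R" "1 \<in> submod_gen (*) R T"
  obtains g where "\<And>h. h \<in> T \<Longrightarrow> g h \<in> R" "(\<Sum>h\<in>T. g h * h ^ n) = 1"
proof -
  define J where "J = {\<Sum>h\<in>T. g h * h ^ n | g. \<forall>h\<in>T. g h \<in> R}"
  have J: "ideal_of R J" unfolding ideal_of_def
  proof (intro conjI ballI)
    show "J \<subseteq> R" using R by (auto simp: J_def intro!: subring_sum[OF R(1)] subring_mult[OF R(1)] subring_power[OF R(1)])
    show "0 \<in> J" unfolding J_def using subring_0[OF R(1)] by (auto intro!: exI[of _ "\<lambda>_. 0"])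
  next
    fix a b assume "a \<in> J" "b \<in> J"
    then obtain g k where "a = (\<Sum>h\<in>T. g h * h ^ n)" "b = (\<Sum>h\<in>T. k h * h ^ n)" "\<forall>h\<in>T. g h \<in> R" "\<forall>h\<in>T. k h \<in> R"
      by (auto simp: J_def)
    then show "a + b \<in> J" unfolding J_def
      by (auto intro!: exI[of _ "\<lambda>h. g h + k h"] simp: distrib_right sum.distrib subring_add[OF R(1)])
  next
    fix a b assume "a \<in> R" "b \<in> J"
    then obtain g where "b = (\<Sum>h\<in>T. g h * h ^ n)" "\<forall>h\<in>T. g h \<in> R" by (auto simp: J_def)
    then show "a * b \<in> J" unfolding J_def using \<open>a \<in> R\<close>
      by (auto intro!: exI[of _ "\<lambda>h. a * g h"] simp: sum_distrib_left mult.assoc subring_mult[OF R(1)])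
  qed
  have pw: "h ^ n \<in> J" if "h \<in> T" for h
  proof -
    have "h ^ n = (\<Sum>k\<in>T. (if k = h then 1 else 0) * k ^ n)"
      using that R(2) by (simp add: if_distrib[of "\<lambda>a. a * _"] cong: if_cong)
    then show ?thesis unfolding J_def using subring_0[OF R(1)] subring_1[OF R(1)]
      by (auto intro!: exI[of _ "\<lambda>k. if k = h then 1 else 0"])
  qed
  have "1 \<in> J"
  proof (rule ccontr)
    assume n: "1 \<notin> J"
    obtain P where P: "prime_ideal_in R P" "J \<subseteq> P"
      by (rule prime_ideal_exists[OF R(1) J, of "{1}"]) (use n subring_1[OF R(1)] in auto)
    have "T \<subseteq> P" using pw P R prime_ideal_power[OF P(1) R(1)] by blast
    moreover have "ideal_of R P" using P by (auto simp: prime_ideal_in_def ideal_of_def)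
    ultimately have "1 \<in> P" using submod_gen_subset_ideal R(4) by blast
    then show False using P by (auto simp: prime_ideal_in_def)
  qed
  then show thesis using that by (auto simp: J_def)
qed

section \<open>Quasi-coherence\<close>

definition generization_closed :: "'f::field set set \<Rightarrow> bool" where
  "generization_closed X \<longleftrightarrow> (\<forall>x\<in>X. subring_of_field x \<and> (\<forall>Q. prime_ideal_in x Q \<longrightarrow> localize x Q \<in> X))"

text \<open>If no power of \<open>f\<close> were a denominator of \<open>s\<close>, some prime of
  \<open>x\<close> would contain all denominators of \<open>s\<close> and avoid the powers of
  \<open>f\<close>. Localizing there gives a point where \<open>f\<close> is invertible and
  \<open>s\<close> is not regular.\<close>

lemma local_denominators:
  assumes X: "generization_closed X" "x \<in> X" and f: "f \<in> x" "f \<noteq> 0"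
    and s: "\<And>y. y \<in> X \<Longrightarrow> x \<subseteq> y \<Longrightarrow> inverse f \<in> y \<Longrightarrow> s \<in> y"
  obtains n where "f ^ n * s \<in> x"
proof -
  have sx: "subring_of_field x" using X by (auto simp: generization_closed_def)
  have "\<exists>n. f ^ n * s \<in> x"
  proof (rule ccontr)
    assume n: "\<nexists>n. f ^ n * s \<in> x"
    define J where "J = {a \<in> x. a * s \<in> x}"
    have J: "ideal_of x J" unfolding ideal_of_def J_def
      using subring_closed(1-5)[OF sx] by (auto simp: distrib_right mult.assoc)
    obtain Q where Q: "prime_ideal_in x Q" "J \<subseteq> Q" "range (\<lambda>n. f ^ n) \<inter> Q = {}"
    proof (rule prime_ideal_exists[OF sx J, of "range (\<lambda>n. f ^ n)"])
      show "1 \<in> range (\<lambda>n. f ^ n)" by (auto intro: image_eqI[of _ _ 0])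
      show "range (\<lambda>n. f ^ n) \<subseteq> x" using f subring_power[OF sx] by auto
      show "range (\<lambda>n. f ^ n) \<inter> J = {}" using n by (auto simp: J_def)
    qed (auto simp flip: power_add)
    have "f \<notin> Q" using Q(3) by (metis Int_iff empty_iff power_one_right rangeI)
    then have "inverse f \<in> localize x Q"
      using unit_in_localize_iff[OF sx Q(1) f(1)] by (auto simp: unit_in_def)
    moreover have "localize x Q \<in> X" using X Q by (auto simp: generization_closed_def)
    ultimately have "s \<in> localize x Q" using s localize_super[OF sx Q(1)] by auto
    then obtain a b where ab: "s = a / b" "a \<in> x" "b \<in> x - Q" by (auto simp: localize_def)
    then have "b * s = a" using localize_nz[OF sx Q(1)] by auto
    then have "b \<in> J" using ab by (auto simp: J_def)
    then show False using ab Q by auto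
  qed
  then show thesis using that by blast
qed

text \<open>
  The stalkwise form of quasi-coherence: sections over the locus where \<open>f\<close> is invertible extend
  after multiplication with a power of \<open>f\<close>.
\<close>

definition (in vector_space) qc_sheaf :: "'a set set \<Rightarrow> ('a set \<Rightarrow> 'b set) \<Rightarrow> bool" where
  "qc_sheaf X F \<longleftrightarrow>
     (\<forall>x\<in>X. 0 \<in> F x \<and> (\<forall>a\<in>F x. \<forall>b\<in>F x. a + b \<in> F x) \<and> (\<forall>r\<in>x. \<forall>a\<in>F x. scale r a \<in> F x)) \<and>
     (\<forall>x\<in>X. \<forall>f s. f \<noteq> 0 \<longrightarrow> f \<in> x \<longrightarrow> (\<forall>y\<in>X. x \<subseteq> y \<longrightarrow> inverse f \<in> y \<longrightarrow> s \<in> F y) \<longrightarrow>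
       (\<exists>n U. openin (zariski X) U \<and> x \<in> U \<and> (\<forall>y\<in>U. f \<in> y \<longrightarrow> scale (f ^ n) s \<in> F y)))"

context vector_space
begin

lemma qc_sheafD:
  assumes "qc_sheaf X F" "x \<in> X"
  shows "0 \<in> F x" "a \<in> F x \<Longrightarrow> b \<in> F x \<Longrightarrow> a + b \<in> F x" "r \<in> x \<Longrightarrow> a \<in> F x \<Longrightarrow> scale r a \<in> F x"
  using assms by (auto simp: qc_sheaf_def)

lemma qc_sheaf_power_mono:
  assumes F: "qc_sheaf X F" and y: "y \<in> X" "subring_of_field y" "f \<in> y" and "scale (f ^ n) s \<in> F y" "n \<le> m"
  shows "scale (f ^ m) s \<in> F y"
proof -
  have "scale (f ^ (m - n)) (scale (f ^ n) s) \<in> F y"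
    by (rule qc_sheafD(3)[OF F y(1) subring_power[OF y(2,3)] assms(5)])
  then show ?thesis using assms(6) by (simp add: scale_scale flip: power_add)
qed

text \<open>The definition provides an exponent near each point; quasi-compactness of
  \<open>V\<close> makes it uniform. Larger exponents work too, which later permits one exponent for
  finitely many sections.\<close>

lemma qc_sheaf_extend:
  assumes F: "qc_sheaf X F" and X: "noetherian_points X" "\<And>y. y \<in> X \<Longrightarrow> subring_of_field y"
    and V: "openin (zariski X) V" and f: "f \<noteq> 0" "\<And>y. y \<in> V \<Longrightarrow> f \<in> y"
    and s: "\<And>y. y \<in> V \<Longrightarrow> inverse f \<in> y \<Longrightarrow> s \<in> F y"
  obtains n where "\<And>m y. y \<in> V \<Longrightarrow> m \<ge> n \<Longrightarrow> scale (f ^ m) s \<in> F y"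
proof -
  define \<U> where "\<U> = {U. openin (zariski X) U \<and> U \<subseteq> V \<and> (\<exists>n. \<forall>y\<in>U. scale (f ^ n) s \<in> F y)}"
  have VX: "V \<subseteq> X" using openin_zariski_subset[OF V] .
  have "x \<in> \<Union>\<U>" if x: "x \<in> V" for x
  proof -
    have *: "\<forall>y\<in>X. x \<subseteq> y \<longrightarrow> inverse f \<in> y \<longrightarrow> s \<in> F y"
      using s openin_zariski_up[OF V x] by blast
    then obtain n U where "openin (zariski X) U" "x \<in> U" "\<forall>y\<in>U. f \<in> y \<longrightarrow> scale (f ^ n) s \<in> F y"
    proof -
      have "x \<in> X" using x VX by auto
      with F have "\<forall>f s. f \<noteq> 0 \<longrightarrow> f \<in> x \<longrightarrow> (\<forall>y\<in>X. x \<subseteq> y \<longrightarrow> inverse f \<in> y \<longrightarrow> s \<in> F y) \<longrightarrow>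
       (\<exists>n U. openin (zariski X) U \<and> x \<in> U \<and> (\<forall>y\<in>U. f \<in> y \<longrightarrow> scale (f ^ n) s \<in> F y))"
        unfolding qc_sheaf_def by simp
      from this[rule_format, OF f(1) f(2)[OF x], of s] *
      have "\<exists>n U. openin (zariski X) U \<and> x \<in> U \<and> (\<forall>y\<in>U. f \<in> y \<longrightarrow> scale (f ^ n) s \<in> F y)"
        by simp
      then show thesis using that by blast
    qed
    then have "U \<inter> V \<in> \<U>" using V f by (auto simp: \<U>_def)
    then show ?thesis using x \<open>x \<in> U\<close> by blast
  qed
  then have "\<Union>\<U> = V" by (auto simp: \<U>_def)
  moreover obtain \<V> where \<V>: "finite \<V>" "\<V> \<subseteq> \<U>" "\<Union>\<V> = \<Union>\<U>"
    using X(1) unfolding noetherian_points_def \<U>_def by (metis (no_types, lifting) mem_Collect_eq)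
  moreover have "\<forall>U\<in>\<V>. \<exists>n. \<forall>y\<in>U. scale (f ^ n) s \<in> F y" using \<V> by (auto simp: \<U>_def)
  then obtain n where n: "\<And>U y. U \<in> \<V> \<Longrightarrow> y \<in> U \<Longrightarrow> scale (f ^ n U) s \<in> F y" by metis
  ultimately have "scale (f ^ m) s \<in> F y" if y: "y \<in> V" and m: "m \<ge> Max (insert 0 (n ` \<V>))" for m y
  proof -
    obtain U where U: "U \<in> \<V>" "y \<in> U" using \<V>(3) y \<open>\<Union>\<U> = V\<close> by auto
    have "n U \<le> m" using m \<V>(1) U(1) by auto
    moreover have "y \<in> X" using y VX by auto
    ultimately show ?thesis using qc_sheaf_power_mono[OF F _ _ _ n[OF U]] X(2) f(2)[OF y] by blast
  qed
  then show thesis using that by blast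
qed

text \<open>A locally free sheaf is given here by dual frames: near each point its stalks are cut
  out by finitely many linear functionals with values in the local ring, and
  \<open>local_denominators\<close> is applied to each coordinate. The index type stays free in
  order to serve both line bundles and bundles of rank two.\<close>

lemma qc_sheaf_frames:
  assumes X: "generization_closed X" "\<And>x. x \<in> X \<Longrightarrow> 1 \<in> x"
    and F: "\<And>x. x \<in> X \<Longrightarrow> \<exists>U I \<psi>. openin (zariski X) U \<and> x \<in> U \<and> finite (I :: 'i set) \<and>
      (\<forall>i\<in>I. \<forall>a b r. \<psi> i (a + b) = \<psi> i a + \<psi> i b \<and> \<psi> i (scale r a) = r * \<psi> i a) \<and>
      (\<forall>y\<in>U. F y = {v. \<forall>i\<in>I. \<psi> i v \<in> y})"
  shows "qc_sheaf X F"
  unfolding qc_sheaf_def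
proof (intro conjI ballI allI impI)
  fix x assume x: "x \<in> X"
  obtain U I \<psi> where U': "openin (zariski X) U \<and> x \<in> U \<and> finite (I :: 'i set) \<and>
      (\<forall>i\<in>I. \<forall>a b r. \<psi> i (a + b) = \<psi> i a + \<psi> i b \<and> \<psi> i (scale r a) = r * \<psi> i a) \<and>
      (\<forall>y\<in>U. F y = {v. \<forall>i\<in>I. \<psi> i v \<in> y})"
    using F[OF x] by (elim exE) (rule that)
  then have U: "openin (zariski X) U" "x \<in> U" "finite I"
    "\<And>i a b r. i \<in> I \<Longrightarrow> \<psi> i (a + b) = \<psi> i a + \<psi> i b \<and> \<psi> i (scale r a) = r * \<psi> i a"
    "\<forall>y\<in>U. F y = {v. \<forall>i\<in>I. \<psi> i v \<in> y}"
    by simp_all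
  have sx: "subring_of_field x" using X x by (auto simp: generization_closed_def)
  have Fx: "F x = {v. \<forall>i\<in>I. \<psi> i v \<in> x}" using U by auto
  have z: "\<psi> i 0 = 0" if "i \<in> I" for i using U(4)[OF that, of 0 0 0] by simp
  show "0 \<in> F x" using z subring_0[OF sx] by (auto simp: Fx)
  show "a + b \<in> F x" if "a \<in> F x" "b \<in> F x" for a b
    using that U(4) subring_add[OF sx] by (auto simp: Fx)
  show "scale r a \<in> F x" if "r \<in> x" "a \<in> F x" for a r
    using that U(4) subring_mult[OF sx] by (auto simp: Fx)
  fix f s assume f: "f \<noteq> 0" "f \<in> x" and s: "\<forall>y\<in>X. x \<subseteq> y \<longrightarrow> inverse f \<in> y \<longrightarrow> s \<in> F y"
  have "\<exists>n. f ^ n * \<psi> i s \<in> x" if i: "i \<in> I" for i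
  proof (rule local_denominators[OF X(1) x f(2,1), of "\<psi> i s"])
    fix y assume y: "y \<in> X" "x \<subseteq> y" "inverse f \<in> y"
    then have "y \<in> U" using openin_zariski_up U by blast
    then show "\<psi> i s \<in> y" using s y U(5) i by auto
  qed blast
  then obtain n where n: "\<And>i. i \<in> I \<Longrightarrow> f ^ n i * \<psi> i s \<in> x" by metis
  define N where "N = Max (insert 0 (n ` I))"
  have N: "f ^ N * \<psi> i s \<in> x" if i: "i \<in> I" for i
  proof -
    have "n i \<le> N" using U(3) i by (auto simp: N_def)
    then have "f ^ N * \<psi> i s = f ^ (N - n i) * (f ^ n i * \<psi> i s)" by (simp flip: power_add mult.assoc)
    also have "... \<in> x" by (rule subring_mult[OF sx subring_power[OF sx f(2)] n[OF i]])
    finally show ?thesis .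
  qed
  let ?G = "(\<lambda>i. f ^ N * \<psi> i s) ` I"
  have "openin (zariski X) (U \<inter> {y \<in> X. ?G \<subseteq> y})"
    using U(1,3) X(2) by (intro openin_Int openin_zariski_finite) auto
  moreover have "x \<in> U \<inter> {y \<in> X. ?G \<subseteq> y}" using U(2) N x by auto
  moreover have "scale (f ^ N) s \<in> F y" if "y \<in> U \<inter> {y \<in> X. ?G \<subseteq> y}" for y
    using that U(4,5) by auto
  ultimately show "\<exists>n U. openin (zariski X) U \<and> x \<in> U \<and> (\<forall>y\<in>U. f \<in> y \<longrightarrow> scale (f ^ n) s \<in> F y)"
    by blast
qed

end

section \<open>Cech complexes\<close>

text \<open>The alternating sum unfolded at the head of the list: omitting the head comes with sign
  plus, and every later omission changes its sign. Identities such as \<open>d d = 0\<close> then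
  follow by induction on the list.\<close>

fun cech_diff :: "('u list \<Rightarrow> 'm::ab_group_add) \<Rightarrow> 'u list \<Rightarrow> 'm" where
  "cech_diff c [] = 0"
| "cech_diff c (u # us) = c us - cech_diff (\<lambda>vs. c (u # vs)) us"

lemma cech_d_eq: "cech_d c us = cech_diff c us"
proof (induction us arbitrary: c)
  case Nil
  then show ?case by (simp add: cech_d_def)
next
  case (Cons u us)
  have "cech_d c (u # us) = c us + (\<Sum>k<length us. (- 1) ^ Suc k *s c (u # take k us @ drop (Suc k) us))"
    unfolding cech_d_def length_Cons sum.lessThan_Suc_shift by simp
  also have "(\<Sum>k<length us. (- 1) ^ Suc k *s c (u # take k us @ drop (Suc k) us)) = - cech_d (\<lambda>vs. c (u # vs)) us"
    unfolding cech_d_def sum_negf[symmetric] by (intro sum.cong) (auto simp: vector_scalar_mult_def vec_eq_iff)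
  finally show ?case using Cons by simp
qed

lemma cech_diff_cong:
  assumes "\<And>vs. Suc (length vs) = length us \<Longrightarrow> set vs \<subseteq> set us \<Longrightarrow> c vs = c' vs"
  shows "cech_diff c us = cech_diff c' us"
  using assms
proof (induction us arbitrary: c c')
  case (Cons u us)
  have "cech_diff (\<lambda>vs. c (u # vs)) us = cech_diff (\<lambda>vs. c' (u # vs)) us"
  proof (rule Cons.IH)
    fix vs assume "Suc (length vs) = length us" "set vs \<subseteq> set us"
    then show "c (u # vs) = c' (u # vs)" by (intro Cons.prems) auto
  qed
  then show ?case using Cons.prems[of us] by auto
qed simp

lemma cech_diff_additive:
  assumes "\<And>a b. \<phi> (a + b) = \<phi> a + \<phi> b"
  shows "cech_diff (\<lambda>vs. \<phi> (c vs)) us = \<phi> (cech_diff c us)"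
proof -
  interpret additive \<phi> by standard (rule assms)
  show ?thesis by (induction us arbitrary: c) (simp_all add: zero diff)
qed

lemma cech_diff_add: "cech_diff (\<lambda>vs. c vs + c' vs) us = cech_diff c us + cech_diff c' us"
  by (induction us arbitrary: c c') (simp_all add: algebra_simps)

lemma cech_diff_diff: "cech_diff (\<lambda>vs. c vs - c' vs) us = cech_diff c us - cech_diff c' us"
  by (induction us arbitrary: c c') (simp_all add: algebra_simps)

lemma cech_diff_sum: "cech_diff (\<lambda>vs. \<Sum>i\<in>I. c i vs) us = (\<Sum>i\<in>I. cech_diff (c i) us)"
proof (induction I rule: infinite_finite_induct)
  case empty
  show ?case by (induction us) (simp_all)
next
  case (infinite I)
  show ?case using infinite by (simp) (induction us, simp_all)
qed (simp add: cech_diff_add)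

lemma cech_diff_cech_diff: "cech_diff (cech_diff c) us = 0"
proof (induction us arbitrary: c)
  case (Cons u us)
  have "cech_diff (\<lambda>vs. cech_diff c (u # vs)) us = cech_diff c us"
    using Cons by (simp add: cech_diff_diff)
  then show ?case by simp
qed simp

text \<open>
  The complexes are augmented: a cochain on lists of length \<open>n\<close> has Cech degree \<open>n - 1\<close>, and on the
  empty list (intersection \<open>UNIV\<close>) it is a section over \<open>Y\<close>.  The sheaf is restricted to \<open>Y\<close>,
  the cover \<open>C\<close> is not.
\<close>

definition cochain :: "('x \<Rightarrow> 'm set) \<Rightarrow> 'x set set \<Rightarrow> 'x set \<Rightarrow> nat \<Rightarrow> ('x set list \<Rightarrow> 'm) \<Rightarrow> bool" where
  "cochain F C Y n c \<longleftrightarrow> (\<forall>us. length us = n \<and> set us \<subseteq> C \<longrightarrow> c us \<in> sections F (\<Inter>(set us) \<inter> Y))"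

definition acyclic_at :: "('x \<Rightarrow> 'm::ab_group_add set) \<Rightarrow> 'x set set \<Rightarrow> 'x set \<Rightarrow> nat \<Rightarrow> bool" where
  "acyclic_at F C Y n \<longleftrightarrow>
     (\<forall>c. cochain F C Y n c \<and> (\<forall>us. length us = Suc n \<and> set us \<subseteq> C \<longrightarrow> cech_diff c us = 0) \<longrightarrow>
        (\<exists>b. cochain F C Y (n - 1) b \<and> (\<forall>us. length us = n \<and> set us \<subseteq> C \<longrightarrow> cech_diff b us = c us)))"

lemma sections_mem: "s \<in> sections F U \<longleftrightarrow> (\<forall>x\<in>U. s \<in> F x)"
  by (simp add: sections_def)

lemma sections_mono: "U \<subseteq> V \<Longrightarrow> sections F V \<subseteq> sections F U"
  by (auto simp: sections_def)

locale group_sheaf =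
  fixes X :: "'x set" and F :: "'x \<Rightarrow> 'm::ab_group_add set"
  assumes zero: "x \<in> X \<Longrightarrow> 0 \<in> F x"
    and diff: "x \<in> X \<Longrightarrow> a \<in> F x \<Longrightarrow> b \<in> F x \<Longrightarrow> a - b \<in> F x"
begin

lemma sections_0: "U \<subseteq> X \<Longrightarrow> 0 \<in> sections F U"
  and sections_diff: "U \<subseteq> X \<Longrightarrow> a \<in> sections F U \<Longrightarrow> b \<in> sections F U \<Longrightarrow> a - b \<in> sections F U"
  using zero diff by (auto simp: sections_def subset_iff)

lemma sections_uminus: "U \<subseteq> X \<Longrightarrow> a \<in> sections F U \<Longrightarrow> - a \<in> sections F U"
  using sections_diff[of U 0 a] sections_0 by simp

lemma sections_add: "U \<subseteq> X \<Longrightarrow> a \<in> sections F U \<Longrightarrow> b \<in> sections F U \<Longrightarrow> a + b \<in> sections F U"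
  using sections_diff[of U a "- b"] sections_uminus by simp

lemma sections_sum: "U \<subseteq> X \<Longrightarrow> (\<And>i. i \<in> I \<Longrightarrow> h i \<in> sections F U) \<Longrightarrow> sum h I \<in> sections F U"
  by (induction I rule: infinite_finite_induct) (auto intro: sections_add sections_0)

lemma cochain_cech_diff:
  assumes "Y \<subseteq> X" "cochain F C Y n c"
  shows "cochain F C Y (Suc n) (cech_diff c)"
proof -
  \<comment> \<open>The induction shortens the list while the open set must stay fixed;
    \<open>W\<close> stands for the intersection belonging to the original list.\<close>
  have "cech_diff c us \<in> sections F (W \<inter> Y)"
    if "length us = Suc n" "W \<subseteq> \<Inter>(set us)"
       "\<And>vs. length vs = n \<Longrightarrow> set vs \<subseteq> set us \<Longrightarrow> c vs \<in> sections F (W \<inter> Y)" for us W c n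
    using that
  proof (induction us arbitrary: c n)
    case (Cons u us)
    have WX: "W \<inter> Y \<subseteq> X" using assms by auto
    have "c us \<in> sections F (W \<inter> Y)" using Cons.prems by auto
    moreover have "cech_diff (\<lambda>vs. c (u # vs)) us \<in> sections F (W \<inter> Y)"
    proof (cases n)
      case 0
      then show ?thesis using Cons.prems sections_0[OF WX] by auto
    next
      case (Suc k)
      show ?thesis
      proof (rule Cons.IH[of k])
        show "c (u # vs) \<in> sections F (W \<inter> Y)" if "length vs = k" "set vs \<subseteq> set us" for vs
          using Cons.prems(3)[of "u # vs"] that Suc by auto
      qed (use Cons.prems Suc in auto)
    qed
    ultimately show ?case using sections_diff[OF WX] by simp
  qed simp
  note key = this
  show ?thesis unfolding cochain_def
  proof (intro allI impI)
    fix us assume us: "length us = Suc n \<and> set us \<subseteq> C"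
    show "cech_diff c us \<in> sections F (\<Inter>(set us) \<inter> Y)"
    proof (rule key)
      fix vs assume vs: "length vs = n" "set vs \<subseteq> set us"
      then have "\<Inter>(set us) \<inter> Y \<subseteq> \<Inter>(set vs) \<inter> Y" by auto
      then show "c vs \<in> sections F (\<Inter>(set us) \<inter> Y)"
        using assms(2) vs us sections_mono unfolding cochain_def by (metis order_trans subsetD)
    qed (use us in auto)
  qed
qed

lemma cochain_diff: "Y \<subseteq> X \<Longrightarrow> cochain F C Y n c \<Longrightarrow> cochain F C Y n c' \<Longrightarrow> cochain F C Y n (\<lambda>us. c us - c' us)"
  and cochain_add: "Y \<subseteq> X \<Longrightarrow> cochain F C Y n c \<Longrightarrow> cochain F C Y n c' \<Longrightarrow> cochain F C Y n (\<lambda>us. c us + c' us)"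
  unfolding cochain_def using sections_diff sections_add by (simp_all add: le_infI2)

lemma cochain_mono: "Y \<subseteq> Z \<Longrightarrow> cochain F C Z n c \<Longrightarrow> cochain F C Y n c"
  unfolding cochain_def sections_def by blast

lemma acyclic_atE:
  assumes "acyclic_at F C Y n" "cochain F C Y n c"
    "\<And>us. length us = Suc n \<Longrightarrow> set us \<subseteq> C \<Longrightarrow> cech_diff c us = 0"
  obtains b where "cochain F C Y (n - 1) b" "\<And>us. length us = n \<Longrightarrow> set us \<subseteq> C \<Longrightarrow> cech_diff b us = c us"
  using assms unfolding acyclic_at_def by blast

lemma acyclic_atD:
  assumes "acyclic_at F C Y (Suc n)" "cochain F C Y (Suc n) c"
    "\<And>us. length us = Suc (Suc n) \<Longrightarrow> set us \<subseteq> C \<Longrightarrow> cech_diff c us = 0"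
  shows "\<exists>b. cochain F C Y n b \<and> (\<forall>us. length us = Suc n \<and> set us \<subseteq> C \<longrightarrow> cech_diff b us = c us)"
  using assms unfolding acyclic_at_def by simp

text \<open>Exactness in Cech degree 0 is the sheaf axiom. Restrictions are inclusions in a constant
  group, so a cocycle is one and the same element on all members of the cover.\<close>

lemma acyclic_at_1:
  assumes Y: "Y \<subseteq> X" "Y \<subseteq> \<Union>C"
  shows "acyclic_at F C Y (Suc 0)"
  unfolding acyclic_at_def
proof (intro allI impI, elim conjE)
  fix c assume c: "cochain F C Y (Suc 0) c" and cc: "\<forall>us. length us = Suc (Suc 0) \<and> set us \<subseteq> C \<longrightarrow> cech_diff c us = 0"
  have const: "c [u] = c [v]" if "u \<in> C" "v \<in> C" for u v
    using cc[rule_format, of "[u, v]"] that by simp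
  have mem: "c [u] \<in> sections F (u \<inter> Y)" if "u \<in> C" for u
    using c that unfolding cochain_def by (metis Inter_insert Inter_empty empty_subsetI inf_top_right insert_subset length_Cons list.set(1,2) list.size(3))
  show "\<exists>b. cochain F C Y (Suc 0 - 1) b \<and> (\<forall>us. length us = Suc 0 \<and> set us \<subseteq> C \<longrightarrow> cech_diff b us = c us)"
  proof (cases "C = {}")
    case True
    then have "Y = {}" using Y by auto
    then show ?thesis using True by (auto simp: cochain_def length_Suc_conv sections_def)
  next
    case False
    then obtain u0 where u0: "u0 \<in> C" by auto
    have "c [u0] \<in> sections F Y" unfolding sections_mem
    proof
      fix x assume "x \<in> Y"
      then obtain u where "u \<in> C" "x \<in> u" using Y by auto
      then show "c [u0] \<in> F x" using mem[of u] const[of u u0] u0 \<open>x \<in> Y\<close> by (auto simp: sections_mem)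
    qed
    moreover have "cech_diff (\<lambda>_. c [u0]) us = c us" if "length us = Suc 0" "set us \<subseteq> C" for us
    proof -
      from that(1) obtain u where "us = [u]" by (auto simp: length_Suc_conv)
      then show ?thesis using that(2) const[OF u0, of u] by simp
    qed
    ultimately show ?thesis
      by (intro exI[of _ "\<lambda>_. c [u0]"]) (simp add: cochain_def)
  qed
qed

text \<open>
  Two Mayer-Vietoris arguments, for the covers of \<open>Y\<close> by two and by three subsets.  Their hypotheses
  on decompositions are only needed in one degree, where they are the Cech vanishing for this
  small cover.
\<close>

lemma acyclic_at_Un:
  assumes Y: "Y1 \<union> Y2 \<subseteq> X"
    and acyc: "acyclic_at F C Y1 (Suc (Suc n))" "acyclic_at F C Y2 (Suc (Suc n))" "acyclic_at F C (Y1 \<inter> Y2) (Suc n)"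
    and dec: "\<And>us s. length us = n \<Longrightarrow> set us \<subseteq> C \<Longrightarrow> s \<in> sections F (\<Inter>(set us) \<inter> (Y1 \<inter> Y2)) \<Longrightarrow>
      \<exists>s1 s2. s1 \<in> sections F (\<Inter>(set us) \<inter> Y1) \<and> s2 \<in> sections F (\<Inter>(set us) \<inter> Y2) \<and> s = s1 - s2"
  shows "acyclic_at F C (Y1 \<union> Y2) (Suc (Suc n))"
  unfolding acyclic_at_def
proof (intro allI impI, elim conjE)
  fix c assume c: "cochain F C (Y1 \<union> Y2) (Suc (Suc n)) c"
    and cc: "\<forall>us. length us = Suc (Suc (Suc n)) \<and> set us \<subseteq> C \<longrightarrow> cech_diff c us = 0"
  have Y': "Y1 \<subseteq> X" "Y2 \<subseteq> X" "Y1 \<inter> Y2 \<subseteq> X" using Y by auto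
  have cc': "cech_diff c us = 0" if "length us = Suc (Suc (Suc n))" "set us \<subseteq> C" for us using cc that by blast
  obtain b1 where b1: "cochain F C Y1 (Suc n) b1" "\<And>us. length us = Suc (Suc n) \<Longrightarrow> set us \<subseteq> C \<Longrightarrow> cech_diff b1 us = c us"
    using acyclic_atE[OF acyc(1) cochain_mono[OF _ c] cc'] by auto
  obtain b2 where b2: "cochain F C Y2 (Suc n) b2" "\<And>us. length us = Suc (Suc n) \<Longrightarrow> set us \<subseteq> C \<Longrightarrow> cech_diff b2 us = c us"
    using acyclic_atE[OF acyc(2) cochain_mono[OF _ c] cc'] by auto
  have "cochain F C (Y1 \<inter> Y2) (Suc n) (\<lambda>us. b1 us - b2 us)"
    using cochain_mono[OF _ b1(1), of "Y1 \<inter> Y2"] cochain_mono[OF _ b2(1), of "Y1 \<inter> Y2"] Y' by (intro cochain_diff) auto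
  moreover have "cech_diff (\<lambda>us. b1 us - b2 us) us = 0" if "length us = Suc (Suc n)" "set us \<subseteq> C" for us
    using b1(2) b2(2) that by (simp add: cech_diff_diff)
  ultimately obtain s where s: "cochain F C (Y1 \<inter> Y2) n s"
    "\<And>us. length us = Suc n \<Longrightarrow> set us \<subseteq> C \<Longrightarrow> cech_diff s us = b1 us - b2 us"
    using acyclic_atE[OF acyc(3), of "\<lambda>us. b1 us - b2 us"] by auto
  have "\<forall>us. \<exists>s1 s2. length us = n \<and> set us \<subseteq> C \<longrightarrow>
    s1 \<in> sections F (\<Inter>(set us) \<inter> Y1) \<and> s2 \<in> sections F (\<Inter>(set us) \<inter> Y2) \<and> s us = s1 - s2"
    using dec s(1) unfolding cochain_def by blast
  then obtain s1 s2 where s12: "\<And>us. length us = n \<Longrightarrow> set us \<subseteq> C \<Longrightarrow>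
    s1 us \<in> sections F (\<Inter>(set us) \<inter> Y1) \<and> s2 us \<in> sections F (\<Inter>(set us) \<inter> Y2) \<and> s us = s1 us - s2 us"
    by metis
  have co: "cochain F C Y1 n s1" "cochain F C Y2 n s2" using s12 by (auto simp: cochain_def)
  \<comment> \<open>The primitives over \<open>Y1\<close> and \<open>Y2\<close> differ by the
    coboundary of \<open>s = s1 - s2\<close>. Correcting each by the coboundary of its own part
    makes them equal, so they are one cochain over the union.\<close>
  define b where "b us = b1 us - cech_diff s1 us" for us
  have b: "b us = b2 us - cech_diff s2 us" if "length us = Suc n" "set us \<subseteq> C" for us
  proof -
    have "cech_diff s us = cech_diff (\<lambda>us. s1 us - s2 us) us"
      using s12 that by (intro cech_diff_cong) auto
    then show ?thesis using s(2)[OF that] by (simp add: b_def cech_diff_diff algebra_simps)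
  qed
  have "cochain F C Y1 (Suc n) b" unfolding b_def by (intro cochain_diff b1 cochain_cech_diff Y' co)
  moreover have "cochain F C Y2 (Suc n) (\<lambda>us. b2 us - cech_diff s2 us)"
    by (intro cochain_diff b2 cochain_cech_diff Y' co)
  then have "cochain F C Y2 (Suc n) b" using b by (simp add: cochain_def)
  ultimately have "cochain F C (Y1 \<union> Y2) (Suc n) b"
    unfolding cochain_def sections_def by blast
  moreover have "cech_diff b us = c us" if "length us = Suc (Suc n)" "set us \<subseteq> C" for us
    using b1(2)[OF that] by (simp add: b_def[abs_def] cech_diff_diff cech_diff_cech_diff)
  ultimately show "\<exists>b. cochain F C (Y1 \<union> Y2) (Suc (Suc n) - 1) b \<and> (\<forall>us. length us = Suc (Suc n) \<and> set us \<subseteq> C \<longrightarrow> cech_diff b us = c us)"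
    by auto
qed

lemma acyclic_at_Un3:
  assumes Y: "Y0 \<union> Y1 \<union> Y2 \<subseteq> X"
    and acyc: "acyclic_at F C Y0 (Suc (Suc n))" "acyclic_at F C Y1 (Suc (Suc n))" "acyclic_at F C Y2 (Suc (Suc n))"
      "acyclic_at F C (Y0 \<inter> Y1) (Suc n)" "acyclic_at F C (Y0 \<inter> Y2) (Suc n)" "acyclic_at F C (Y1 \<inter> Y2) (Suc n)"
      "n > 0 \<Longrightarrow> acyclic_at F C (Y0 \<inter> Y1 \<inter> Y2) n"
    and C: "C \<noteq> {}"
    and dec1: "\<And>us s01 s02 s12. length us = n \<Longrightarrow> set us \<subseteq> C \<Longrightarrow> s01 \<in> sections F (\<Inter>(set us) \<inter> (Y0 \<inter> Y1)) \<Longrightarrow>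
      s02 \<in> sections F (\<Inter>(set us) \<inter> (Y0 \<inter> Y2)) \<Longrightarrow> s12 \<in> sections F (\<Inter>(set us) \<inter> (Y1 \<inter> Y2)) \<Longrightarrow>
      s01 - s02 + s12 = 0 \<Longrightarrow>
      \<exists>r0 r1 r2. r0 \<in> sections F (\<Inter>(set us) \<inter> Y0) \<and> r1 \<in> sections F (\<Inter>(set us) \<inter> Y1) \<and>
        r2 \<in> sections F (\<Inter>(set us) \<inter> Y2) \<and> s01 = r0 - r1 \<and> s02 = r0 - r2 \<and> s12 = r1 - r2"
    and dec2: "\<And>us e. Suc (length us) = n \<Longrightarrow> set us \<subseteq> C \<Longrightarrow> e \<in> sections F (\<Inter>(set us) \<inter> (Y0 \<inter> Y1 \<inter> Y2)) \<Longrightarrow>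
      \<exists>e01 e02 e12. e01 \<in> sections F (\<Inter>(set us) \<inter> (Y0 \<inter> Y1)) \<and> e02 \<in> sections F (\<Inter>(set us) \<inter> (Y0 \<inter> Y2)) \<and>
        e12 \<in> sections F (\<Inter>(set us) \<inter> (Y1 \<inter> Y2)) \<and> e = e01 - e02 + e12"
  shows "acyclic_at F C (Y0 \<union> Y1 \<union> Y2) (Suc (Suc n))"
  unfolding acyclic_at_def
proof (intro allI impI, elim conjE)
  fix c assume c: "cochain F C (Y0 \<union> Y1 \<union> Y2) (Suc (Suc n)) c"
    and cc: "\<forall>us. length us = Suc (Suc (Suc n)) \<and> set us \<subseteq> C \<longrightarrow> cech_diff c us = 0"
  have Y': "Y0 \<subseteq> X" "Y1 \<subseteq> X" "Y2 \<subseteq> X" "Y0 \<inter> Y1 \<subseteq> X" "Y0 \<inter> Y2 \<subseteq> X" "Y1 \<inter> Y2 \<subseteq> X" "Y0 \<inter> Y1 \<inter> Y2 \<subseteq> X"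
    using Y by auto
  have cc': "cech_diff c us = 0" if "length us = Suc (Suc (Suc n))" "set us \<subseteq> C" for us using cc that by blast
  obtain b0 where b0: "cochain F C Y0 (Suc n) b0" "\<And>us. length us = Suc (Suc n) \<Longrightarrow> set us \<subseteq> C \<Longrightarrow> cech_diff b0 us = c us"
    using acyclic_atE[OF acyc(1) cochain_mono[OF _ c] cc'] by auto
  obtain b1 where b1: "cochain F C Y1 (Suc n) b1" "\<And>us. length us = Suc (Suc n) \<Longrightarrow> set us \<subseteq> C \<Longrightarrow> cech_diff b1 us = c us"
    using acyclic_atE[OF acyc(2) cochain_mono[OF _ c] cc'] by auto
  obtain b2 where b2: "cochain F C Y2 (Suc n) b2" "\<And>us. length us = Suc (Suc n) \<Longrightarrow> set us \<subseteq> C \<Longrightarrow> cech_diff b2 us = c us"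
    using acyclic_atE[OF acyc(3) cochain_mono[OF _ c] cc'] by auto
  have pair: "\<exists>s. cochain F C (Y \<inter> Z) n s \<and> (\<forall>us. length us = Suc n \<and> set us \<subseteq> C \<longrightarrow> cech_diff s us = b us - b' us)"
    if "acyclic_at F C (Y \<inter> Z) (Suc n)" "Y \<inter> Z \<subseteq> X" "cochain F C Y (Suc n) b" "cochain F C Z (Suc n) b'"
      "\<And>us. length us = Suc (Suc n) \<Longrightarrow> set us \<subseteq> C \<Longrightarrow> cech_diff b us = c us"
      "\<And>us. length us = Suc (Suc n) \<Longrightarrow> set us \<subseteq> C \<Longrightarrow> cech_diff b' us = c us" for Y Z b b'
  proof -
    have "cochain F C (Y \<inter> Z) (Suc n) (\<lambda>us. b us - b' us)"
      using cochain_mono[OF _ that(3), of "Y \<inter> Z"] cochain_mono[OF _ that(4), of "Y \<inter> Z"] that(2) by (intro cochain_diff) auto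
    moreover have "cech_diff (\<lambda>us. b us - b' us) us = 0" if "length us = Suc (Suc n)" "set us \<subseteq> C" for us
      using that \<open>\<And>us. _ \<Longrightarrow> _ \<Longrightarrow> cech_diff b us = c us\<close> \<open>\<And>us. _ \<Longrightarrow> _ \<Longrightarrow> cech_diff b' us = c us\<close>
      by (simp add: cech_diff_diff)
    ultimately show ?thesis by (rule acyclic_atD[OF that(1)])
  qed
  obtain s01 where s01: "cochain F C (Y0 \<inter> Y1) n s01" "\<And>us. length us = Suc n \<Longrightarrow> set us \<subseteq> C \<Longrightarrow> cech_diff s01 us = b0 us - b1 us"
    using pair[OF acyc(4) Y'(4) b0(1) b1(1) b0(2) b1(2)] by auto
  obtain s02 where s02: "cochain F C (Y0 \<inter> Y2) n s02" "\<And>us. length us = Suc n \<Longrightarrow> set us \<subseteq> C \<Longrightarrow> cech_diff s02 us = b0 us - b2 us"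
    using pair[OF acyc(5) Y'(5) b0(1) b2(1) b0(2) b2(2)] by auto
  obtain s12 where s12: "cochain F C (Y1 \<inter> Y2) n s12" "\<And>us. length us = Suc n \<Longrightarrow> set us \<subseteq> C \<Longrightarrow> cech_diff s12 us = b1 us - b2 us"
    using pair[OF acyc(6) Y'(6) b1(1) b2(1) b1(2) b2(2)] by auto
  \<comment> \<open>\<open>t\<close> measures the failure of \<open>s01\<close>, \<open>s02\<close>,
    \<open>s12\<close> to satisfy the cocycle condition of the small cover. Its coboundary vanishes
    because the differences of \<open>b0\<close>, \<open>b1\<close>, \<open>b2\<close> add up to
    zero.\<close>
  define t where "t us = s01 us - s02 us + s12 us" for us
  have tc: "cech_diff t us = 0" if "length us = Suc n" "set us \<subseteq> C" for us
    using s01(2)[OF that] s02(2)[OF that] s12(2)[OF that]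
    by (simp add: t_def[abs_def] cech_diff_add cech_diff_diff)
  have "\<exists>s01' s02' s12'. cochain F C (Y0 \<inter> Y1) n s01' \<and> cochain F C (Y0 \<inter> Y2) n s02' \<and> cochain F C (Y1 \<inter> Y2) n s12' \<and>
    (\<forall>us. length us = Suc n \<and> set us \<subseteq> C \<longrightarrow> cech_diff s01' us = b0 us - b1 us \<and> cech_diff s02' us = b0 us - b2 us \<and> cech_diff s12' us = b1 us - b2 us) \<and>
    (\<forall>us. length us = n \<and> set us \<subseteq> C \<longrightarrow> s01' us - s02' us + s12' us = 0)"
  proof (cases n)
    \<comment> \<open>On a one-element list the coboundary of \<open>t\<close> is
      \<open>t []\<close> itself. The nonempty cover \<open>C\<close> supplies such a list.\<close>
    case 0
    obtain u where "u \<in> C" using C by auto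
    then have "t [] = 0" using tc[of "[u]"] 0 by simp
    then show ?thesis using s01 s02 s12 0
      by (intro exI[of _ s01] exI[of _ s02] exI[of _ s12]) (auto simp: t_def)
  next
    \<comment> \<open>Here \<open>t\<close> is a coboundary over the triple overlap. Distributing
      its primitive over the double overlaps by \<open>dec2\<close> gives corrections that make the
      sum vanish.\<close>
    case (Suc m)
    have "cochain F C (Y0 \<inter> Y1 \<inter> Y2) n t" unfolding t_def
      using cochain_mono[OF _ s01(1), of "Y0 \<inter> Y1 \<inter> Y2"] cochain_mono[OF _ s02(1), of "Y0 \<inter> Y1 \<inter> Y2"]
        cochain_mono[OF _ s12(1), of "Y0 \<inter> Y1 \<inter> Y2"]
      by (intro cochain_add cochain_diff Y') blast+
    then obtain e where e: "cochain F C (Y0 \<inter> Y1 \<inter> Y2) m e" "\<And>us. length us = n \<Longrightarrow> set us \<subseteq> C \<Longrightarrow> cech_diff e us = t us"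
      using acyclic_atE[OF acyc(7), of t] tc Suc by auto
    have "\<forall>us. \<exists>e01 e02 e12. length us = m \<and> set us \<subseteq> C \<longrightarrow>
      e01 \<in> sections F (\<Inter>(set us) \<inter> (Y0 \<inter> Y1)) \<and> e02 \<in> sections F (\<Inter>(set us) \<inter> (Y0 \<inter> Y2)) \<and>
        e12 \<in> sections F (\<Inter>(set us) \<inter> (Y1 \<inter> Y2)) \<and> e us = e01 - e02 + e12"
      using dec2 e(1) Suc unfolding cochain_def by blast
    then obtain e01 e02 e12 where ee: "\<And>us. length us = m \<Longrightarrow> set us \<subseteq> C \<Longrightarrow>
      e01 us \<in> sections F (\<Inter>(set us) \<inter> (Y0 \<inter> Y1)) \<and> e02 us \<in> sections F (\<Inter>(set us) \<inter> (Y0 \<inter> Y2)) \<and>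
        e12 us \<in> sections F (\<Inter>(set us) \<inter> (Y1 \<inter> Y2)) \<and> e us = e01 us - e02 us + e12 us"
      by metis
    have co: "cochain F C (Y0 \<inter> Y1) m e01" "cochain F C (Y0 \<inter> Y2) m e02" "cochain F C (Y1 \<inter> Y2) m e12"
      using ee by (auto simp: cochain_def)
    note co' = cochain_cech_diff[OF Y'(4) co(1)] cochain_cech_diff[OF Y'(5) co(2)] cochain_cech_diff[OF Y'(6) co(3)]
    have te: "t us = cech_diff e01 us - cech_diff e02 us + cech_diff e12 us" if "length us = n" "set us \<subseteq> C" for us
    proof -
      have "cech_diff e us = cech_diff (\<lambda>us. e01 us - e02 us + e12 us) us"
        using ee that Suc by (intro cech_diff_cong) auto
      then show ?thesis using e(2)[OF that] by (simp add: cech_diff_diff cech_diff_add)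
    qed
    show ?thesis
      by (intro exI[of _ "\<lambda>us. s01 us - cech_diff e01 us"] exI[of _ "\<lambda>us. s02 us - cech_diff e02 us"]
          exI[of _ "\<lambda>us. s12 us - cech_diff e12 us"] conjI allI impI cochain_diff Y' s01 s02 s12)
        (use co' Suc s01(2) s02(2) s12(2) te in \<open>auto simp: cech_diff_diff cech_diff_cech_diff t_def algebra_simps\<close>)
  qed
  then obtain s01' s02' s12' where s': "cochain F C (Y0 \<inter> Y1) n s01'" "cochain F C (Y0 \<inter> Y2) n s02'" "cochain F C (Y1 \<inter> Y2) n s12'"
    "\<And>us. length us = Suc n \<Longrightarrow> set us \<subseteq> C \<Longrightarrow> cech_diff s01' us = b0 us - b1 us \<and> cech_diff s02' us = b0 us - b2 us \<and> cech_diff s12' us = b1 us - b2 us"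
    "\<And>us. length us = n \<Longrightarrow> set us \<subseteq> C \<Longrightarrow> s01' us - s02' us + s12' us = 0" by blast
  have "\<forall>us. \<exists>r0 r1 r2. length us = n \<and> set us \<subseteq> C \<longrightarrow> r0 \<in> sections F (\<Inter>(set us) \<inter> Y0) \<and> r1 \<in> sections F (\<Inter>(set us) \<inter> Y1) \<and>
        r2 \<in> sections F (\<Inter>(set us) \<inter> Y2) \<and> s01' us = r0 - r1 \<and> s02' us = r0 - r2 \<and> s12' us = r1 - r2"
    using dec1 s'(1-3,5) unfolding cochain_def by blast
  then obtain r0 r1 r2 where r: "\<And>us. length us = n \<Longrightarrow> set us \<subseteq> C \<Longrightarrow> r0 us \<in> sections F (\<Inter>(set us) \<inter> Y0) \<and> r1 us \<in> sections F (\<Inter>(set us) \<inter> Y1) \<and>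
        r2 us \<in> sections F (\<Inter>(set us) \<inter> Y2) \<and> s01' us = r0 us - r1 us \<and> s02' us = r0 us - r2 us \<and> s12' us = r1 us - r2 us"
    by metis
  have co: "cochain F C Y0 n r0" "cochain F C Y1 n r1" "cochain F C Y2 n r2" using r by (auto simp: cochain_def)
  define b where "b us = b0 us - cech_diff r0 us" for us
  have "b us = b1 us - cech_diff r1 us" "b us = b2 us - cech_diff r2 us" if us: "length us = Suc n" "set us \<subseteq> C" for us
  proof -
    have "cech_diff s01' us = cech_diff (\<lambda>us. r0 us - r1 us) us" "cech_diff s02' us = cech_diff (\<lambda>us. r0 us - r2 us) us"
      using r us by (auto intro!: cech_diff_cong)
    then show "b us = b1 us - cech_diff r1 us" "b us = b2 us - cech_diff r2 us"
      using s'(4)[OF us] by (simp_all add: b_def cech_diff_diff algebra_simps)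
  qed
  note b = this
  have "cochain F C Y0 (Suc n) b" unfolding b_def by (intro cochain_diff b0 cochain_cech_diff Y' co)
  moreover have "cochain F C Y1 (Suc n) (\<lambda>us. b1 us - cech_diff r1 us)"
    by (intro cochain_diff b1 cochain_cech_diff Y' co)
  then have "cochain F C Y1 (Suc n) b" using b(1) by (simp add: cochain_def)
  moreover have "cochain F C Y2 (Suc n) (\<lambda>us. b2 us - cech_diff r2 us)"
    by (intro cochain_diff b2 cochain_cech_diff Y' co)
  then have "cochain F C Y2 (Suc n) b" using b(2) by (simp add: cochain_def)
  ultimately have "cochain F C (Y0 \<union> Y1 \<union> Y2) (Suc n) b"
    unfolding cochain_def sections_def by blast
  moreover have "cech_diff b us = c us" if "length us = Suc (Suc n)" "set us \<subseteq> C" for us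
    using b0(2)[OF that] by (simp add: b_def[abs_def] cech_diff_diff cech_diff_cech_diff)
  ultimately show "\<exists>b. cochain F C (Y0 \<union> Y1 \<union> Y2) (Suc (Suc n) - 1) b \<and> (\<forall>us. length us = Suc (Suc n) \<and> set us \<subseteq> C \<longrightarrow> cech_diff b us = c us)"
    by auto
qed

end

lemma (in vector_space) qc_sheaf_group:
  assumes "qc_sheaf X F" "\<And>x. x \<in> X \<Longrightarrow> subring_of_field x"
  shows "group_sheaf X F"
proof
  fix x a b assume x: "x \<in> X"
  show "0 \<in> F x" using qc_sheafD(1)[OF assms(1) x] .
  assume ab: "a \<in> F x" "b \<in> F x"
  have "scale (- 1) b \<in> F x"
    using qc_sheafD(3)[OF assms(1) x _ ab(2)] subring_uminus subring_1 assms(2)[OF x] by blast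
  then show "a - b \<in> F x" using qc_sheafD(2)[OF assms(1) x ab(1), of "- b"] by simp
qed

text \<open>The contracting homotopy of a partition of unity. Principal open sets
  \<open>D(h)\<close> refine the cover by \<open>\<tau>\<close>; a power \<open>h ^ N\<close>
  extends \<open>c (\<tau> h # us)\<close> beyond \<open>D(h)\<close>, with one \<open>N\<close> for
  all \<open>h\<close> and all lists since both are finite in number; and coefficients with
  \<open>sum g h * h ^ N = 1\<close> glue the extensions to a primitive.\<close>

lemma (in vector_space) acyclic_at_affine:
  assumes F: "qc_sheaf X F" and X: "noetherian_points X" "\<And>x. x \<in> X \<Longrightarrow> subring_of_field x"
    and R: "subring_of_field R" "Spec_rings R \<subseteq> X"
    and Y: "Y = {x \<in> X. R \<subseteq> x}" "openin (zariski X) Y"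
    and C: "finite C" "\<And>U. U \<in> C \<Longrightarrow> openin (zariski X) U" "X \<subseteq> \<Union>C"
  shows "acyclic_at F C Y (Suc n)"
  unfolding acyclic_at_def
proof (intro allI impI, elim conjE)
  fix c assume c: "cochain F C Y (Suc n) c"
    and cc: "\<forall>us. length us = Suc (Suc n) \<and> set us \<subseteq> C \<longrightarrow> cech_diff c us = 0"
  interpret group_sheaf X F using qc_sheaf_group[OF F X(2)] .
  obtain T where T: "finite T" "T \<subseteq> R" "0 \<notin> T" "1 \<in> submod_gen (*) R T"
    "\<And>h. h \<in> T \<Longrightarrow> \<exists>U\<in>C. {y \<in> X. R \<subseteq> y \<and> inverse h \<in> y} \<subseteq> U"
    by (rule affine_partition[OF R X(2) C(2,3)]) (assumption, assumption, rule that)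
  from T(5) obtain \<tau> where \<tau>: "\<And>h. h \<in> T \<Longrightarrow> \<tau> h \<in> C" "\<And>h. h \<in> T \<Longrightarrow> {y \<in> X. R \<subseteq> y \<and> inverse h \<in> y} \<subseteq> \<tau> h"
    by metis
  define A where "A = {us. set us \<subseteq> C \<and> length us = n}"
  have "finite A" unfolding A_def by (rule finite_lists_length_eq[OF C(1)])
  have op: "openin (zariski X) (\<Inter>(set us) \<inter> Y)" if "set us \<subseteq> C" for us
    using that C(2) Y(2) by (induction us) (auto simp: Int_assoc)
  have ext: "\<exists>k. \<forall>m\<ge>k. scale (h ^ m) (c (\<tau> h # us)) \<in> sections F (\<Inter>(set us) \<inter> Y)"
    if h: "h \<in> T" and us: "us \<in> A" for h us
  proof -
    have mem: "c (\<tau> h # us) \<in> sections F (\<Inter>(set (\<tau> h # us)) \<inter> Y)"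
    proof -
      have "length (\<tau> h # us) = Suc n \<and> set (\<tau> h # us) \<subseteq> C" using us \<tau>(1)[OF h] by (auto simp: A_def)
      then show ?thesis using c unfolding cochain_def by blast
    qed
    obtain k where "\<And>m y. y \<in> \<Inter>(set us) \<inter> Y \<Longrightarrow> m \<ge> k \<Longrightarrow> scale (h ^ m) (c (\<tau> h # us)) \<in> F y"
    proof (rule qc_sheaf_extend[OF F X, rotated -1])
      fix k assume "\<And>m y. y \<in> \<Inter>(set us) \<inter> Y \<Longrightarrow> k \<le> m \<Longrightarrow> scale (h ^ m) (c (\<tau> h # us)) \<in> F y"
      then show thesis by (rule that)
    next
      show "openin (zariski X) (\<Inter>(set us) \<inter> Y)" using op us by (auto simp: A_def)
      show "h \<noteq> 0" using h T by auto
      show "h \<in> y" if "y \<in> \<Inter>(set us) \<inter> Y" for y using that h T Y by auto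
      show "c (\<tau> h # us) \<in> F y" if "y \<in> \<Inter>(set us) \<inter> Y" "inverse h \<in> y" for y
        using mem that \<tau>(2)[OF h] Y(1) by (auto simp: sections_mem)
    qed
    then show ?thesis by (intro exI[of _ k]) (simp add: sections_mem)
  qed
  then obtain k where k: "\<And>h us m. h \<in> T \<Longrightarrow> us \<in> A \<Longrightarrow> m \<ge> k h us \<Longrightarrow>
    scale (h ^ m) (c (\<tau> h # us)) \<in> sections F (\<Inter>(set us) \<inter> Y)" by metis
  define N where "N = Max (insert 0 ((\<lambda>(h, us). k h us) ` (T \<times> A)))"
  have N: "k h us \<le> N" if "h \<in> T" "us \<in> A" for h us
    unfolding N_def using T(1) \<open>finite A\<close> that by (intro Max_ge) auto
  obtain g where g: "\<And>h. h \<in> T \<Longrightarrow> g h \<in> R" "(\<Sum>h\<in>T. g h * h ^ N) = 1"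
    using unit_ideal_powers[OF R(1) T(1,2,4)] by metis
  define b where "b us = (\<Sum>h\<in>T. scale (g h) (scale (h ^ N) (c (\<tau> h # us))))" for us
  have "cochain F C Y n b"
    unfolding cochain_def
  proof (intro allI impI)
    fix us assume us: "length us = n \<and> set us \<subseteq> C"
    have sub: "\<Inter>(set us) \<inter> Y \<subseteq> X" using Y by auto
    show "b us \<in> sections F (\<Inter>(set us) \<inter> Y)"
      unfolding b_def
    proof (rule sections_sum[OF sub])
      fix h assume h: "h \<in> T"
      have "scale (h ^ N) (c (\<tau> h # us)) \<in> sections F (\<Inter>(set us) \<inter> Y)"
        using k[OF h _ N[OF h]] us by (auto simp: A_def)
      then show "scale (g h) (scale (h ^ N) (c (\<tau> h # us))) \<in> sections F (\<Inter>(set us) \<inter> Y)"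
        unfolding sections_mem using g(1)[OF h] Y(1) qc_sheafD(3)[OF F] by blast
    qed
  qed
  moreover have "cech_diff b us = c us" if us: "length us = Suc n" "set us \<subseteq> C" for us
  proof -
    have 1: "cech_diff (\<lambda>vs. c (\<tau> h # vs)) us = c us" if "h \<in> T" for h
    proof -
      have "cech_diff c (\<tau> h # us) = 0" using us \<tau>(1)[OF that] by (intro cc[rule_format]) auto
      then show ?thesis by simp
    qed
    have "cech_diff b us = (\<Sum>h\<in>T. cech_diff (\<lambda>us. scale (g h) (scale (h ^ N) (c (\<tau> h # us)))) us)"
      unfolding b_def by (rule cech_diff_sum)
    also have "... = (\<Sum>h\<in>T. scale (g h) (scale (h ^ N) (cech_diff (\<lambda>us. c (\<tau> h # us)) us)))"
      by (intro sum.cong refl cech_diff_additive) (simp only: scale_right_distrib)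
    also have "... = (\<Sum>h\<in>T. scale (g h * h ^ N) (c us))" using 1 by simp
    also have "... = c us" by (simp add: g(2) flip: scale_sum_left)
    finally show ?thesis .
  qed
  ultimately show "\<exists>b. cochain F C Y (Suc n - 1) b \<and> (\<forall>us. length us = Suc n \<and> set us \<subseteq> C \<longrightarrow> cech_diff b us = c us)"
    by auto
qed

lemma mem_scale_image:
  fixes b :: "'f::field ^ 'n"
  assumes "\<theta> \<noteq> 0"
  shows "b \<in> (\<lambda>a. \<theta> *s a) ` S \<longleftrightarrow> inverse \<theta> *s b \<in> S"
proof
  assume "inverse \<theta> *s b \<in> S"
  moreover have "b = \<theta> *s (inverse \<theta> *s b)" using assms by (simp add: vector_smult_assoc)
  ultimately show "b \<in> (\<lambda>a. \<theta> *s a) ` S" by blast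
qed (use assms in \<open>auto simp: vector_smult_assoc\<close>)

lemma acyclic_at_scale:
  fixes F :: "'f::field set \<Rightarrow> ('f ^ 'n) set"
  assumes "\<theta> \<noteq> 0" "acyclic_at F C Y n"
  shows "acyclic_at (\<lambda>x. (\<lambda>v. \<theta> *s v) ` F x) C Y n"
proof -
  have mem: "v \<in> sections (\<lambda>x. (\<lambda>v. \<theta> *s v) ` F x) U \<longleftrightarrow> inverse \<theta> *s v \<in> sections F U" for v :: "'f ^ 'n" and U
    using assms(1) by (simp add: sections_mem mem_scale_image)
  have lin: "cech_diff (\<lambda>us. r *s c us) us = r *s cech_diff c us" for r and c :: "'f set set list \<Rightarrow> 'f ^ 'n" and us
    by (rule cech_diff_additive) (simp add: vector_add_ldistrib)
  show ?thesis unfolding acyclic_at_def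
  proof (intro allI impI, elim conjE)
    fix c assume c: "cochain (\<lambda>x. (\<lambda>v. \<theta> *s v) ` F x) C Y n c"
      and cc: "\<forall>us. length us = Suc n \<and> set us \<subseteq> C \<longrightarrow> cech_diff c us = 0"
    have "cochain F C Y n (\<lambda>us. inverse \<theta> *s c us)" using c by (auto simp: cochain_def mem)
    moreover have "\<forall>us. length us = Suc n \<and> set us \<subseteq> C \<longrightarrow> cech_diff (\<lambda>us. inverse \<theta> *s c us) us = 0"
      using cc by (simp add: lin)
    ultimately obtain b where b: "cochain F C Y (n - 1) b"
      "\<forall>us. length us = n \<and> set us \<subseteq> C \<longrightarrow> cech_diff b us = inverse \<theta> *s c us"
      using assms(2) unfolding acyclic_at_def by blast
    have "cochain (\<lambda>x. (\<lambda>v. \<theta> *s v) ` F x) C Y (n - 1) (\<lambda>us. \<theta> *s b us)"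
      using b(1) assms(1) by (simp add: cochain_def mem vector_smult_assoc)
    moreover have "cech_diff (\<lambda>us. \<theta> *s b us) us = c us" if "length us = n \<and> set us \<subseteq> C" for us
      using b(2)[rule_format, OF that] assms(1) by (simp add: lin vector_smult_assoc)
    ultimately show "\<exists>b. cochain (\<lambda>x. (\<lambda>v. \<theta> *s v) ` F x) C Y (n - 1) b \<and>
        (\<forall>us. length us = n \<and> set us \<subseteq> C \<longrightarrow> cech_diff b us = c us)" by blast
  qed
qed

text \<open>Since the limit over covers permits refinement, it suffices to treat finite covers
  subordinate to \<open>A\<close>: intersect the given cover with \<open>A\<close>, extract a finite
  subfamily by noetherianity, and discard the empty set, which \<open>open_cover\<close>
  forbids.\<close>

lemma cohomology_vanishesI:
  fixes F :: "'f::field set \<Rightarrow> ('f ^ 'n) set"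
  assumes X: "noetherian_points X" "X \<noteq> {}"
    and A: "\<And>W. W \<in> A \<Longrightarrow> openin (zariski X) W" "X \<subseteq> \<Union>A"
    and p: "p > 0"
    and acyc: "\<And>C. finite C \<Longrightarrow> C \<noteq> {} \<Longrightarrow> (\<And>U. U \<in> C \<Longrightarrow> openin (zariski X) U) \<Longrightarrow> \<Union>C = X \<Longrightarrow>
      (\<And>U. U \<in> C \<Longrightarrow> \<exists>W\<in>A. U \<subseteq> W) \<Longrightarrow> acyclic_at F C X (Suc p)"
  shows "cohomology_vanishes X F p"
  unfolding cohomology_vanishes_def
proof (intro allI impI, elim conjE)
  fix C c assume C: "open_cover X C" and c: "cech_cocycle F C p c"
  define \<U> where "\<U> = {U \<inter> W | U W. U \<in> C \<and> W \<in> A}"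
  have op\<U>: "\<forall>U\<in>\<U>. openin (zariski X) U" using C A by (auto simp: \<U>_def open_cover_def)
  have "\<Union>\<U> = X" using C A(2) unfolding \<U>_def open_cover_def by blast
  obtain \<V> where \<V>: "finite \<V>" "\<V> \<subseteq> \<U>" "\<Union>\<V> = \<Union>\<U>"
  proof -
    have "(\<forall>U\<in>\<U>. openin (zariski X) U) \<longrightarrow> (\<exists>\<V>. finite \<V> \<and> \<V> \<subseteq> \<U> \<and> \<Union>\<V> = \<Union>\<U>)"
      using X(1) unfolding noetherian_points_def by (rule spec)
    from mp[OF this op\<U>] show thesis by (elim exE conjE) (rule that)
  qed
  define C' where "C' = \<V> - {{}}"
  have C': "finite C'" "C' \<subseteq> \<U>" "\<Union>C' = X" "{} \<notin> C'" using \<V> \<open>\<Union>\<U> = X\<close> by (auto simp: C'_def)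
  have "\<forall>V\<in>C'. \<exists>U. U \<in> C \<and> V \<subseteq> U" using C'(2) by (auto simp: \<U>_def)
  then obtain \<tau> where \<tau>: "\<forall>V\<in>C'. \<tau> V \<in> C \<and> V \<subseteq> \<tau> V" by metis
  have ac: "acyclic_at F C' X (Suc p)"
  proof (rule acyc)
    show "\<exists>W\<in>A. U \<subseteq> W" if "U \<in> C'" for U using that C'(2) by (auto simp: \<U>_def)
  qed (use C' op\<U> X in auto)
  have oc: "open_cover X C'" using C' op\<U> by (auto simp: open_cover_def)
  have sub: "\<Inter>(set us) \<inter> X = \<Inter>(set us)" if "set us \<subseteq> C'" "us \<noteq> []" for us
    using that C'(3) by (cases us) auto
  have "cochain F C' X (Suc p) (\<lambda>us. c (map \<tau> us))"
    unfolding cochain_def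
  proof (intro allI impI)
    fix us assume us: "length us = Suc p \<and> set us \<subseteq> C'"
    then have "set (map \<tau> us) \<subseteq> C" using \<tau> by auto
    then have "c (map \<tau> us) \<in> sections F (\<Inter>(set (map \<tau> us)))"
    proof -
      have "length (map \<tau> us) = Suc p \<and> set (map \<tau> us) \<subseteq> C" using us \<open>set (map \<tau> us) \<subseteq> C\<close> by simp
      moreover have "\<forall>us. length us = Suc p \<and> set us \<subseteq> C \<longrightarrow> c us \<in> sections F (\<Inter>(set us))"
        using c unfolding cech_cocycle_def cech_cochain_def by (rule conjunct1)
      ultimately show ?thesis by (simp del: set_map length_map)
    qed
    moreover have "\<Inter>(set us) \<inter> X \<subseteq> \<Inter>(set (map \<tau> us))" using us \<tau> by auto
    ultimately show "c (map \<tau> us) \<in> sections F (\<Inter>(set us) \<inter> X)" by (meson sections_mono subsetD)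
  qed
  moreover have diffmap: "cech_diff (\<lambda>us. e (map \<tau> us)) us = cech_diff e (map \<tau> us)" for us and e :: "'f set set list \<Rightarrow> 'f ^ 'n"
  proof (induction us arbitrary: e)
    case (Cons u us)
    have "cech_diff (\<lambda>vs. e (map \<tau> (u # vs))) us = cech_diff (\<lambda>vs. e (\<tau> u # vs)) (map \<tau> us)"
      using Cons[of "\<lambda>vs. e (\<tau> u # vs)"] by simp
    then show ?case by simp
  qed simp
  have "cech_diff (\<lambda>us. c (map \<tau> us)) us = 0" if us: "length us = Suc (Suc p)" "set us \<subseteq> C'" for us
  proof -
    have "set (map \<tau> us) \<subseteq> C" using \<tau> us by auto
    then have "cech_d c (map \<tau> us) = 0"
    proof -
      have "length (map \<tau> us) = p + 2 \<and> set (map \<tau> us) \<subseteq> C" using us \<open>set (map \<tau> us) \<subseteq> C\<close> by simp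
      then show ?thesis using c by (simp add: cech_cocycle_def)
    qed
    then show ?thesis by (simp add: diffmap cech_d_eq)
  qed
  ultimately obtain b where b: "cochain F C' X p b" "\<forall>us. length us = Suc p \<and> set us \<subseteq> C' \<longrightarrow> cech_diff b us = c (map \<tau> us)"
    using ac unfolding acyclic_at_def diff_Suc_1 by blast
  have "cech_cochain F C' (p - 1) b"
    unfolding cech_cochain_def
  proof (intro allI impI)
    fix us assume us: "length us = Suc (p - 1) \<and> set us \<subseteq> C'"
    then have "length us = p" "us \<noteq> []" using p by auto
    then show "b us \<in> sections F (\<Inter>(set us))" using b(1) us sub[of us] unfolding cochain_def by metis
  qed
  then show "\<exists>C' \<tau> b. open_cover X C' \<and> (\<forall>V\<in>C'. \<tau> V \<in> C \<and> V \<subseteq> \<tau> V) \<and> cech_cochain F C' (p - 1) b \<and>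
           (\<forall>us. length us = Suc p \<and> set us \<subseteq> C' \<longrightarrow> cech_d b us = c (map \<tau> us))"
    using oc \<tau> b(2) by (intro exI[of _ C'] exI[of _ \<tau>] exI[of _ b]) (simp add: cech_d_eq)
qed

section \<open>Polynomials in two variables and total degree\<close>

text \<open>In \<open>K[u][v]\<close>, \<open>cf h i j\<close> is the coefficient of \<open>u\<^sup>i v\<^sup>j\<close>.\<close>

definition cf :: "'k::comm_ring_1 poly poly \<Rightarrow> nat \<Rightarrow> nat \<Rightarrow> 'k" where
  "cf h i j = coeff (coeff h j) i"

text \<open>The bound is an integer because twisting can make it negative; a negative bound leaves
  only the zero polynomial.\<close>

definition tdle :: "int \<Rightarrow> 'k::comm_ring_1 poly poly \<Rightarrow> bool" where
  "tdle n h \<longleftrightarrow> (\<forall>i j. cf h i j \<noteq> 0 \<longrightarrow> int (i + j) \<le> n)"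

definition mono2 :: "'k::comm_ring_1 \<Rightarrow> nat \<Rightarrow> nat \<Rightarrow> 'k poly poly" where
  "mono2 c i j = monom (monom c i) j"

lemma cf_simps [simp]: "cf 0 i j = 0" "cf (p + q) i j = cf p i j + cf q i j"
  "cf (p - q) i j = cf p i j - cf q i j" "cf (- p) i j = - cf p i j"
  by (simp_all add: cf_def)

lemma cf_sum: "cf (\<Sum>x\<in>S. p x) i j = (\<Sum>x\<in>S. cf (p x) i j)"
  by (simp add: cf_def coeff_sum)

lemma cf_mono2: "cf (mono2 c i j) a b = (if a = i \<and> b = j then c else 0)"
  by (simp add: cf_def mono2_def)

lemma mono2_mult: "mono2 c a b * mono2 d i j = mono2 (c * d) (a + i) (b + j)"
  by (simp add: mono2_def mult_monom)

lemma mono2_1: "mono2 1 0 0 = 1"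
  by (simp add: mono2_def)

lemma cf_mult: "cf (p * q) i j = (\<Sum>b\<le>j. \<Sum>a\<le>i. cf p a b * cf q (i - a) (j - b))"
  by (simp add: cf_def coeff_mult coeff_sum)

lemma cf_ext: "(\<And>i j. cf p i j = cf q i j) \<Longrightarrow> p = q"
  by (simp add: cf_def poly_eq_iff)

lemma cf_mult_mono2:
  "cf (p * mono2 c a b) i j = (if a \<le> i \<and> b \<le> j then cf p (i - a) (j - b) * c else 0)"
proof -
  have "coeff (p * mono2 c a b) j = (if b \<le> j then coeff p (j - b) * monom c a else 0)"
    using coeff_monom_mult[of "monom c a" b p j] by (simp add: mult.commute mono2_def)
  then show ?thesis
    using coeff_monom_mult[of c a "coeff p (j - b)" i] by (simp add: cf_def mult.commute)
qed

lemma tdleD: "tdle n h \<Longrightarrow> int (i + j) > n \<Longrightarrow> cf h i j = 0"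
  unfolding tdle_def using linorder_not_le by blast

lemma tdleI: "(\<And>i j. int (i + j) > n \<Longrightarrow> cf h i j = 0) \<Longrightarrow> tdle n h"
  unfolding tdle_def using linorder_not_le by blast

lemma tdle_0: "tdle n 0"
  and tdle_add: "tdle n p \<Longrightarrow> tdle n q \<Longrightarrow> tdle n (p + q)"
  and tdle_diff: "tdle n p \<Longrightarrow> tdle n q \<Longrightarrow> tdle n (p - q)"
  and tdle_uminus: "tdle n p \<Longrightarrow> tdle n (- p)"
  and tdle_mono: "tdle n p \<Longrightarrow> n \<le> m \<Longrightarrow> tdle m p"
  by (auto intro!: tdleI simp: tdleD)

lemma tdle_mono2: "int (i + j) \<le> n \<Longrightarrow> tdle n (mono2 c i j)"
  by (auto simp: tdle_def cf_mono2 split: if_splits)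

lemma tdle_mult: "tdle n p \<Longrightarrow> tdle m q \<Longrightarrow> tdle (n + m) (p * q)"
proof (intro tdleI)
  fix i j assume *: "tdle n p" "tdle m q" "n + m < int (i + j)"
  have "cf p a b * cf q (i - a) (j - b) = 0" if "b \<le> j" "a \<le> i" for a b
  proof (cases "int (a + b) > n")
    case True
    then show ?thesis using tdleD[OF *(1)] by simp
  next
    case False
    then have "int (i - a + (j - b)) > m" using * that by linarith
    then show ?thesis using tdleD[OF *(2)] by simp
  qed
  then show "cf (p * q) i j = 0" unfolding cf_mult by (intro sum.neutral ballI) auto
qed

lemma tdle_1: "n \<ge> 0 \<Longrightarrow> tdle n 1"
  using tdle_mono2[of 0 0 n 1] by (simp add: mono2_1)

lemma tdle_power: "tdle n p \<Longrightarrow> tdle (int k * n) (p ^ k)"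
proof (induction k)
  case (Suc k)
  then show ?case using tdle_mult[of n p "int k * n" "p ^ k"] by (simp add: algebra_simps)
qed (simp add: tdle_1)

lemma sum_mono2: "h = (\<Sum>j\<le>degree h. \<Sum>i\<le>degree (coeff h j). mono2 (cf h i j) i j)"
proof -
  have "(\<Sum>i\<le>degree (coeff h j). mono2 (cf h i j) i j) = monom (coeff h j) j" for j
  proof -
    have "(\<Sum>i\<le>degree (coeff h j). mono2 (cf h i j) i j) = monom (\<Sum>i\<le>degree (coeff h j). monom (cf h i j) i) j"
      by (simp add: mono2_def monom_sum)
    then show ?thesis by (simp add: cf_def poly_as_sum_of_monoms)
  qed
  then show ?thesis by (simp add: poly_as_sum_of_monoms)
qed

lemma tdle_exists: "\<exists>n::nat. tdle (int n) h"
proof -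
  have "\<exists>n::nat. tdle (int n) (sum p S)" if "\<And>i. i \<in> S \<Longrightarrow> \<exists>n::nat. tdle (int n) (p i)"
    for S :: "nat set" and p :: "nat \<Rightarrow> 'a poly poly"
    using that
  proof (induction S rule: infinite_finite_induct)
    case (insert i S)
    then obtain n m where nm: "tdle (int n) (p i)" "tdle (int m) (sum p S)" by (metis insert_iff)
    have "tdle (int (n + m)) (p i + sum p S)"
      by (intro tdle_add tdle_mono[OF nm(1)] tdle_mono[OF nm(2)]) auto
    then show ?case using insert by (intro exI[of _ "n + m"]) simp
  qed (auto intro: tdle_0)
  note s = this
  show ?thesis by (subst sum_mono2, rule s, rule s, rule exI, rule tdle_mono2[OF order_refl])
qed

lemma tdle_induct [consumes 1, case_names zero add mono]:
  assumes "tdle n h" "P 0" "\<And>p q. P p \<Longrightarrow> P q \<Longrightarrow> P (p + q)"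
    "\<And>c i j. int (i + j) \<le> n \<Longrightarrow> P (mono2 c i j)"
  shows "P h"
proof -
  have s: "P (sum p S)" if "\<And>i. i \<in> S \<Longrightarrow> P (p i)" for S :: "nat set" and p
    using that by (induction S rule: infinite_finite_induct) (auto intro: assms)
  have "P (mono2 (cf h i j) i j)" for i j
    using assms(1,2,4) by (cases "cf h i j = 0") (auto simp: tdle_def mono2_def)
  then show ?thesis by (subst sum_mono2) (intro s)
qed

text \<open>\<open>G\<close> has degree \<open>M\<close> with leading form exactly
  \<open>u^M\<close>, so at infinity its homogenization vanishes only where u does.
  \<open>vtop\<close> is the analogue for v; two such polynomials and the line at infinity have no
  common zero.\<close>

definition utop :: "nat \<Rightarrow> 'k::comm_ring_1 poly poly \<Rightarrow> bool" where
  "utop M G \<longleftrightarrow> tdle (int M - 1) (G - mono2 1 M 0)"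

definition vtop :: "nat \<Rightarrow> 'k::comm_ring_1 poly poly \<Rightarrow> bool" where
  "vtop M G \<longleftrightarrow> tdle (int M - 1) (G - mono2 1 0 M)"

lemma tdle_top_mult:
  assumes "tdle (int a - 1) (p - p')" "tdle (int b - 1) (q - q')" "tdle (int a) p'" "tdle (int b) q'"
  shows "tdle (int (a + b) - 1) (p * q - p' * q')"
proof -
  have q: "tdle (int b) q" using tdle_add[OF tdle_mono[OF assms(2), of "int b"] assms(4)] by simp
  have "p * q - p' * q' = (p - p') * q + p' * (q - q')" by (simp add: algebra_simps)
  moreover have "tdle (int (a + b) - 1) ((p - p') * q)"
    using tdle_mult[OF assms(1) q] by (simp add: algebra_simps)
  moreover have "tdle (int (a + b) - 1) (p' * (q - q'))"
    using tdle_mult[OF assms(3,2)] by (simp add: algebra_simps)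
  ultimately show ?thesis by (simp add: tdle_add)
qed

lemma utop_mult: "utop a p \<Longrightarrow> utop b q \<Longrightarrow> utop (a + b) (p * q)"
  and vtop_mult: "vtop a p \<Longrightarrow> vtop b q \<Longrightarrow> vtop (a + b) (p * q)"
  using tdle_top_mult[of a p "mono2 1 a 0" b q "mono2 1 b 0"] tdle_top_mult[of a p "mono2 1 0 a" b q "mono2 1 0 b"]
  by (simp_all add: utop_def vtop_def mono2_mult tdle_mono2)

lemma utop_1: "utop 0 1" and vtop_1: "vtop 0 1"
  by (simp_all add: utop_def vtop_def mono2_1 tdle_0)

lemma utop_power: "utop a p \<Longrightarrow> utop (k * a) (p ^ k)"
  and vtop_power: "vtop a p \<Longrightarrow> vtop (k * a) (p ^ k)"
  by (induction k) (auto intro: utop_1 utop_mult vtop_1 vtop_mult)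

lemma utop_prod: "(\<And>i. i \<in> S \<Longrightarrow> utop (a i) (p i)) \<Longrightarrow> utop (sum a S) (prod p S)"
  and vtop_prod: "(\<And>i. i \<in> S \<Longrightarrow> vtop (a i) (p i)) \<Longrightarrow> vtop (sum a S) (prod p S)"
  by (induction S rule: infinite_finite_induct) (auto intro: utop_1 utop_mult vtop_1 vtop_mult)

lemma utop_tdle: "utop M G \<Longrightarrow> tdle (int M) G"
  using tdle_add[OF tdle_mono[of "int M - 1" "G - mono2 1 M 0" "int M"] tdle_mono2[of M 0 "int M" 1]]
  by (simp add: utop_def)

lemma vtop_tdle: "vtop M G \<Longrightarrow> tdle (int M) G"
  using tdle_add[OF tdle_mono[of "int M - 1" "G - mono2 1 0 M" "int M"] tdle_mono2[of 0 M "int M" 1]]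
  by (simp add: vtop_def)

text \<open>In the top degree only the leading form \<open>u^M\<close> of \<open>G\<close>
  contributes, and multiplying by it shifts exponents.\<close>

lemma cf_mult_utop:
  assumes "utop M G" "tdle n h" "int (i + j) = n + int M"
  shows "cf (h * G) i j = (if M \<le> i then cf h (i - M) j else 0)"
proof -
  have "tdle (n + (int M - 1)) (h * (G - mono2 1 M 0))" using assms by (intro tdle_mult) (auto simp: utop_def)
  then have "cf (h * (G - mono2 1 M 0)) i j = 0" using assms(3) by (intro tdleD) auto
  then show ?thesis by (simp add: right_diff_distrib cf_mult_mono2)
qed

lemma cf_mult_vtop:
  assumes "vtop M G" "tdle n h" "int (i + j) = n + int M"
  shows "cf (h * G) i j = (if M \<le> j then cf h i (j - M) else 0)"
proof -
  have "tdle (n + (int M - 1)) (h * (G - mono2 1 0 M))" using assms by (intro tdle_mult) (auto simp: vtop_def)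
  then have "cf (h * (G - mono2 1 0 M)) i j = 0" using assms(3) by (intro tdleD) auto
  then show ?thesis by (simp add: right_diff_distrib cf_mult_mono2)
qed

lemma utop_nonzero: "utop M G \<Longrightarrow> G \<noteq> 0"
  using tdleD[of "int M - 1" "G - mono2 1 M 0" M 0] by (auto simp: utop_def cf_mono2)

lemma vtop_nonzero: "vtop M G \<Longrightarrow> G \<noteq> 0"
  using tdleD[of "int M - 1" "G - mono2 1 0 M" 0 M] by (auto simp: vtop_def cf_mono2)

text \<open>
  \<open>H\<^sup>0\<close>, \<open>H\<^sup>1\<close> and \<open>H\<^sup>2\<close> of line bundles on the plane are contained in the lemmas \<open>tdle_cancel_utop\<close>,
  \<open>tdle_split\<close> and \<open>tdle_remainder\<close>.
\<close>

lemma tdle_cancel_utop: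
  assumes G: "utop M G" and h: "tdle (n + int M) (h * G)"
  shows "tdle n h"
proof -
  obtain D where D: "tdle (int D) h" using tdle_exists by blast
  \<comment> \<open>The degree of \<open>h\<close> is lowered one step at a time: its top form
    reappears, multiplied by \<open>u^M\<close>, in degree beyond the bound on
    \<open>h * G\<close>.\<close>
  have "tdle (n + int k) h \<Longrightarrow> tdle n h" for k
  proof (induction k)
    case (Suc k)
    have "tdle (n + int k) h"
    proof (rule tdleI)
      fix i j assume ij: "n + int k < int (i + j)"
      show "cf h i j = 0"
      proof (cases "int (i + j) = n + int (Suc k)")
        case True
        then have "cf (h * G) (i + M) j = cf h i j" using cf_mult_utop[OF G Suc.prems, of "i + M" j] by auto
        moreover have "cf (h * G) (i + M) j = 0" using True by (intro tdleD[OF h]) auto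
        ultimately show ?thesis by simp
      next
        case False
        then show ?thesis using ij by (intro tdleD[OF Suc.prems]) auto
      qed
    qed
    then show ?case by (rule Suc.IH)
  qed simp
  from this[of "nat (int D - n)"] show ?thesis using tdle_mono[OF D] by simp
qed

lemma tdle_split:
  assumes G1: "utop M1 G1" and G2: "vtop M2 G2" and n: "n \<ge> - 1"
    and h: "tdle (int M1 + int M2 + n) (h1 * G2 - h2 * G1)"
  obtains k where "tdle (int M1 + n) (h1 - k * G1)" "tdle (int M2 + n) (h2 - k * G2)"
proof -
  have main: "\<exists>k. tdle (int M1 + n) (h1 - k * G1) \<and> tdle (int M2 + n) (h2 - k * G2)"
    if "tdle (int M1 + n + int D) h1" "tdle (int M2 + n + int D) h2" "tdle (int M1 + int M2 + n) (h1 * G2 - h2 * G1)"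
    for D h1 h2
    using that
  proof (induction D arbitrary: h1 h2)
    case 0
    then show ?case by (intro exI[of _ 0]) simp
  next
    case (Suc D)
    \<comment> \<open>The degree by which the current top forms exceed \<open>M1\<close> and
      \<open>M2\<close>. It is at least 0 even for \<open>D = 0\<close>, which is exactly what
      \<open>n \<ge> - 1\<close> provides.\<close>
    define N where "N = nat (n + int (Suc D))"
    have N: "int N = n + int (Suc D)" using n by (simp add: N_def)
    have h1: "tdle (int M1 + int N) h1" and h2: "tdle (int M2 + int N) h2" using Suc.prems by (simp_all add: N add.assoc)
    \<comment> \<open>The top forms of \<open>h1\<close> and \<open>h2\<close> satisfy
      \<open>h1 v^M2 = h2 u^M1\<close>, hence they are \<open>u^M1\<close> and \<open>v^M2\<close>
      times a common form. This form is read off from the coefficients of \<open>h1\<close>;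
      subtracting its multiples lowers both degrees.\<close>
    define \<kappa> where "\<kappa> = (\<Sum>a\<le>N. mono2 (cf h1 (a + M1) (N - a)) a (N - a))"
    have cf\<kappa>: "cf \<kappa> a b = cf h1 (a + M1) b" if "a + b = N" for a b
    proof -
      have "cf \<kappa> a b = (\<Sum>x\<le>N. if x = a then cf h1 (x + M1) (N - x) else 0)"
        unfolding \<kappa>_def cf_sum cf_mono2 using that by (intro sum.cong) auto
      also have "... = cf h1 (a + M1) b" using that by (auto simp: sum.delta)
      finally show ?thesis .
    qed
    have \<kappa>: "tdle (int N) \<kappa>"
      by (auto intro!: tdleI sum.neutral simp: \<kappa>_def cf_sum cf_mono2)
    have zero: "cf (h1 * G2) i j = cf (h2 * G1) i j" if "int (i + j) = int M1 + int M2 + int N" for i j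
    proof -
      have "cf (h1 * G2 - h2 * G1) i j = 0" using that N by (intro tdleD[OF Suc.prems(3)]) linarith
      then show ?thesis by simp
    qed
    have h1': "tdle (int M1 + n + int D) (h1 - \<kappa> * G1)"
    proof (rule tdleI)
      fix i j assume ij: "int M1 + n + int D < int (i + j)"
      have t: "tdle (int M1 + int N) (h1 - \<kappa> * G1)"
        using tdle_mult[OF \<kappa> utop_tdle[OF G1]] by (intro tdle_diff h1) (simp add: add.commute)
      show "cf (h1 - \<kappa> * G1) i j = 0"
      proof (cases "i + j = M1 + N")
        case True
        have e: "cf (\<kappa> * G1) i j = (if M1 \<le> i then cf \<kappa> (i - M1) j else 0)"
          using True by (intro cf_mult_utop[OF G1 \<kappa>]) simp
        show ?thesis
        proof (cases "M1 \<le> i")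
          case True
          then show ?thesis using e cf\<kappa>[of "i - M1" j] \<open>i + j = M1 + N\<close> by simp
        next
          case False
          have "cf (h1 * G2) i (j + M2) = cf h1 i j"
            using True by (subst cf_mult_vtop[OF G2 h1]) auto
          moreover have "cf (h2 * G1) i (j + M2) = 0"
            using True False by (subst cf_mult_utop[OF G1 h2]) auto
          ultimately show ?thesis using zero[of i "j + M2"] True False e by simp
        qed
      next
        case False
        then show ?thesis using ij N by (intro tdleD[OF t]) linarith
      qed
    qed
    have h2': "tdle (int M2 + n + int D) (h2 - \<kappa> * G2)"
    proof (rule tdleI)
      fix i j assume ij: "int M2 + n + int D < int (i + j)"
      have t: "tdle (int M2 + int N) (h2 - \<kappa> * G2)"
        using tdle_mult[OF \<kappa> vtop_tdle[OF G2]] by (intro tdle_diff h2) (simp add: add.commute)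
      show "cf (h2 - \<kappa> * G2) i j = 0"
      proof (cases "i + j = M2 + N")
        case True
        have e: "cf (\<kappa> * G2) i j = (if M2 \<le> j then cf \<kappa> i (j - M2) else 0)"
          using True by (intro cf_mult_vtop[OF G2 \<kappa>]) simp
        have 1: "cf (h2 * G1) (i + M1) j = cf h2 i j"
          using True by (subst cf_mult_utop[OF G1 h2]) auto
        have 2: "cf (h1 * G2) (i + M1) j = (if M2 \<le> j then cf h1 (i + M1) (j - M2) else 0)"
          using True by (subst cf_mult_vtop[OF G2 h1]) auto
        show ?thesis using 1 2 e zero[of "i + M1" j] True cf\<kappa>[of i "j - M2"] by auto
      next
        case False
        then show ?thesis using ij N by (intro tdleD[OF t]) linarith
      qed
    qed
    have "(h1 - \<kappa> * G1) * G2 - (h2 - \<kappa> * G2) * G1 = h1 * G2 - h2 * G1" by (simp add: algebra_simps)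
    then obtain k where "tdle (int M1 + n) (h1 - \<kappa> * G1 - k * G1)" "tdle (int M2 + n) (h2 - \<kappa> * G2 - k * G2)"
      using Suc.IH[OF h1' h2'] Suc.prems(3) by metis
    then show ?case by (intro exI[of _ "\<kappa> + k"]) (simp add: algebra_simps)
  qed
  obtain a b where ab: "tdle (int a) h1" "tdle (int b) h2" using tdle_exists by metis
  have "\<exists>k. tdle (int M1 + n) (h1 - k * G1) \<and> tdle (int M2 + n) (h2 - k * G2)"
    by (rule main[of "Suc (a + b)"]) (use ab h n in \<open>auto elim!: tdle_mono\<close>)
  then show thesis using that by blast
qed

lemma tdle_remainder:
  assumes G1: "utop M1 G1" and G2: "vtop M2 G2"
  shows "\<exists>a b r. h = a * G1 + b * G2 + r \<and> tdle (int M1 + int M2 - 2) r"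
proof -
  define P where "P h \<longleftrightarrow> (\<exists>a b r. h = a * G1 + b * G2 + r \<and> tdle (int M1 + int M2 - 2) r)" for h
  have P0: "P 0" unfolding P_def by (intro exI[of _ 0]) (simp add: tdle_0)
  have Padd: "P (p + q)" if pq: "P p" "P q" for p q
  proof -
    obtain a b r a' b' r' where *: "p = a * G1 + b * G2 + r" "tdle (int M1 + int M2 - 2) r"
      "q = a' * G1 + b' * G2 + r'" "tdle (int M1 + int M2 - 2) r'" using pq unfolding P_def by blast
    have "p + q = (a + a') * G1 + (b + b') * G2 + (r + r')" by (simp add: * algebra_simps)
    then show ?thesis using tdle_add[OF *(2,4)] unfolding P_def by blast
  qed
  have Pmult: "P (a * G1)" "P (a * G2)" for a
    unfolding P_def by (rule exI[of _ a], rule exI[of _ 0], rule exI[of _ 0], simp add: tdle_0)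
      (rule exI[of _ 0], rule exI[of _ a], rule exI[of _ 0], simp add: tdle_0)
  have "P (mono2 c i j)" for c i j
  proof (induction "i + j" arbitrary: c i j rule: less_induct)
    case less
    have low: "P q" if "tdle (int (i + j) - 1) q" for q
      using that
    proof (induction rule: tdle_induct)
      case (mono c i' j')
      then show ?case by (intro less) linarith
    qed (auto intro: P0 Padd)
    \<comment> \<open>A monomial of degree above \<open>M1 + M2 - 2\<close> is divisible by
      \<open>u^M1\<close> or by \<open>v^M2\<close>. Exchanging that factor for \<open>G1\<close> or
      \<open>G2\<close> leaves terms of smaller degree only.\<close>
    consider "int (i + j) \<le> int M1 + int M2 - 2" | "M1 \<le> i" | "M2 \<le> j" by linarith
    then show ?case
    proof cases
      case 1
      then have "tdle (int M1 + int M2 - 2) (mono2 c i j)" by (rule tdle_mono2)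
      then show ?thesis unfolding P_def by (intro exI[of _ 0] exI[of _ "mono2 c i j"]) simp
    next
      case 2
      have "tdle (int (i - M1 + j) + (int M1 - 1)) (mono2 c (i - M1) j * (G1 - mono2 1 M1 0))"
        using G1 by (intro tdle_mult tdle_mono2) (auto simp: utop_def)
      then have "P (- (mono2 c (i - M1) j * (G1 - mono2 1 M1 0)))" using 2 by (intro low tdle_uminus) (simp add: add_diff_eq)
      moreover have "mono2 c i j = mono2 c (i - M1) j * G1 + - (mono2 c (i - M1) j * (G1 - mono2 1 M1 0))"
        using 2 by (simp add: algebra_simps mono2_mult)
      ultimately show ?thesis using Padd[OF Pmult(1)] by metis
    next
      case 3
      have "tdle (int (i + (j - M2)) + (int M2 - 1)) (mono2 c i (j - M2) * (G2 - mono2 1 0 M2))"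
        using G2 by (intro tdle_mult tdle_mono2) (auto simp: vtop_def)
      then have "P (- (mono2 c i (j - M2) * (G2 - mono2 1 0 M2)))" using 3 by (intro low tdle_uminus) (simp add: add_diff_eq add.assoc)
      moreover have "mono2 c i j = mono2 c i (j - M2) * G2 + - (mono2 c i (j - M2) * (G2 - mono2 1 0 M2))"
        using 3 by (simp add: algebra_simps mono2_mult)
      ultimately show ?thesis using Padd[OF Pmult(2)] by metis
    qed
  qed
  note Pmono = this
  obtain n where "tdle (int n) h" using tdle_exists by blast
  then have "P h" by (induction rule: tdle_induct) (auto intro: P0 Padd Pmono)
  then show ?thesis by (simp add: P_def)
qed

text \<open>
  Global surjectivity of the banded matrix of linear forms with rows \<open>(u, v, 1)\<close> that defines the
  bundle.  Modulo its image, \<open>u\<close> lowers, \<open>1\<close> (the third homogeneous coordinate) raises the index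
  of a basis vector, and \<open>v\<close> can be eliminated.
\<close>

lemma band_surj:
  fixes z :: "nat \<Rightarrow> 'k::comm_ring_1 poly poly"
  assumes z: "\<And>k. k < N \<Longrightarrow> tdle (int N) (z k)"
  obtains r where "\<And>j. tdle (int N - 1) (r j)"
    "\<And>k. k < N \<Longrightarrow> z k = mono2 1 1 0 * r k + mono2 1 0 1 * r (Suc k) + r (Suc (Suc k))"
proof -
  define W where "W z \<longleftrightarrow> (\<exists>r. (\<forall>j. tdle (int N - 1) (r j)) \<and>
    (\<forall>k<N. z k = mono2 1 1 0 * r k + mono2 1 0 1 * r (Suc k) + r (Suc (Suc k))))" for z :: "nat \<Rightarrow> 'k poly poly"
  have Wadd: "W (\<lambda>k. z k + z' k)" if zz: "W z" "W z'" for z z'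
  proof -
    obtain r r' where "\<forall>j. tdle (int N - 1) (r j)" "\<forall>k<N. z k = mono2 1 1 0 * r k + mono2 1 0 1 * r (Suc k) + r (Suc (Suc k))"
      "\<forall>j. tdle (int N - 1) (r' j)" "\<forall>k<N. z' k = mono2 1 1 0 * r' k + mono2 1 0 1 * r' (Suc k) + r' (Suc (Suc k))"
      using zz unfolding W_def by blast
    then show ?thesis unfolding W_def
      by (intro exI[of _ "\<lambda>j. r j + r' j"]) (auto intro: tdle_add simp: algebra_simps)
  qed
  have Wneg: "W (\<lambda>k. - z k)" if zz: "W z" for z
  proof -
    obtain r where "\<forall>j. tdle (int N - 1) (r j)" "\<forall>k<N. z k = mono2 1 1 0 * r k + mono2 1 0 1 * r (Suc k) + r (Suc (Suc k))"
      using zz unfolding W_def by blast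
    then show ?thesis unfolding W_def
      by (intro exI[of _ "\<lambda>j. - r j"]) (auto intro: tdle_uminus)
  qed
  have W0: "W z" if "\<And>k. k < N \<Longrightarrow> z k = 0" for z
    unfolding W_def using that by (intro exI[of _ "\<lambda>_. 0"]) (auto intro: tdle_0)
  have Wcong: "W z" if "W z'" "\<And>k. k < N \<Longrightarrow> z k = z' k" for z z'
    using that unfolding W_def by simp
  \<comment> \<open>The vector with the single entry \<open>m\<close> at position \<open>k\<close>.
    Integer positions let the relations run off both ends, where the vector has no entry among the
    first \<open>N\<close>.\<close>
  define e where "e m k = (\<lambda>i. if int i = k then m else 0)" for m :: "'k poly poly" and k :: int
  have e_out: "W (e m k)" if "k < 0 \<or> k \<ge> int N" for m k
    using that by (intro W0) (auto simp: e_def)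
  have rel: "W (\<lambda>i. e (mono2 1 1 0 * m) k i + e (mono2 1 0 1 * m) (k - 1) i + e m (k - 2) i)"
    if m: "tdle (int N - 1) m" for m k
  proof (cases "k < 0")
    case True
    then show ?thesis by (intro W0) (auto simp: e_def)
  next
    case False
    show ?thesis unfolding W_def
      by (rule exI[of _ "e m k"]) (use False m in \<open>auto simp: e_def intro: tdle_0\<close>)
  qed
  have u_rel: "W (e (mono2 c (Suc a) b) k)"
    if W1: "W (e (mono2 c a (Suc b)) (k - 1))" and W2: "W (e (mono2 c a b) (k - 2))" and "a + b < N" for c a b k
  proof -
    have "tdle (int N - 1) (mono2 c a b)" using that by (intro tdle_mono2) auto
    note R = rel[OF this, of "k"]
    show ?thesis
      by (rule Wcong[OF Wadd[OF Wadd[OF R Wneg[OF W1]] Wneg[OF W2]]]) (simp add: mono2_mult e_def)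
  qed
  have one_rel: "W (e (mono2 c a b) k)"
    if W1: "W (e (mono2 c (Suc a) b) (k + 2))" and W2: "W (e (mono2 c a (Suc b)) (k + 1))" and "a + b < N" for c a b k
  proof -
    have "tdle (int N - 1) (mono2 c a b)" using that by (intro tdle_mono2) auto
    note R = rel[OF this, of "k + 2"]
    show ?thesis
      by (rule Wcong[OF Wadd[OF Wadd[OF R Wneg[OF W1]] Wneg[OF W2]]]) (simp add: mono2_mult e_def)
  qed
  have v_rel: "W (e (mono2 c a (Suc b)) k)"
    if W1: "W (e (mono2 c (Suc a) b) (k + 1))" and W2: "W (e (mono2 c a b) (k - 1))" and "a + b < N" for c a b k
  proof -
    have "tdle (int N - 1) (mono2 c a b)" using that by (intro tdle_mono2) auto
    note R = rel[OF this, of "k + 1"]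
    show ?thesis
      by (rule Wcong[OF Wadd[OF Wadd[OF R Wneg[OF W1]] Wneg[OF W2]]]) (simp add: mono2_mult e_def)
  qed
  \<comment> \<open>Each use of \<open>u_rel\<close> removes one factor u and lowers the position by
    at least one, so a u-exponent above the position drives the position below 0.\<close>
  have A: "W (e (mono2 c a b) k)" if "a + b \<le> N" "int a > k" for a b k c
    using that
  proof (induction a arbitrary: b k)
    case 0
    then show ?case by (intro e_out) auto
  next
    case (Suc a)
    show ?case by (rule u_rel[OF Suc.IH Suc.IH]) (use Suc.prems in auto)
  qed
  \<comment> \<open>Mirror image of \<open>A\<close>: \<open>m\<close> is the exponent of the third
    homogeneous coordinate, and \<open>one_rel\<close> consumes it while raising the position up to
    \<open>N\<close> or beyond.\<close>
  have Z: "W (e (mono2 c a b) k)" if "a + b + m = N" "int m \<ge> int N - k" for a b k c m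
    using that
  proof (induction m arbitrary: a b k)
    case 0
    then show ?case by (intro e_out) auto
  next
    case (Suc m)
    show ?case by (rule one_rel[OF Suc.IH Suc.IH]) (use Suc.prems in auto)
  qed
  \<comment> \<open>The factors v are removed by \<open>v_rel\<close>. For a pure power of u either
    the u-exponent exceeds the position, or the exponent of the third coordinate is large enough for
    \<open>Z\<close>.\<close>
  have all: "W (e (mono2 c a b) k)" if "a + b \<le> N" for a b k c
    using that
  proof (induction b arbitrary: a k)
    case 0
    show ?case
    proof (cases "int a > k")
      case True
      then show ?thesis using 0 by (intro A) auto
    next
      case False
      then show ?thesis using 0 by (intro Z[of a 0 "N - a"]) auto
    qed
  next
    case (Suc b)
    show ?case by (rule v_rel[OF Suc.IH Suc.IH]) (use Suc.prems in auto)
  qed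
  have single: "W (e m k)" if "tdle (int N) m" for m k
    using that
  proof (induction rule: tdle_induct)
    case zero
    show ?case by (intro W0) (simp add: e_def)
  next
    case (add p q)
    show ?case by (rule Wcong[OF Wadd[OF add]]) (simp add: e_def)
  next
    case (mono c i j)
    then show ?case by (intro all) auto
  qed
  have "W (\<lambda>i. \<Sum>k<n. e (z k) (int k) i)" if "n \<le> N" for n
    using that
  proof (induction n)
    case 0
    show ?case by (intro W0) simp
  next
    case (Suc n)
    then have "W (\<lambda>i. (\<Sum>k<n. e (z k) (int k) i) + e (z n) (int n) i)"
      by (intro Wadd single z) auto
    then show ?case by (rule Wcong) simp
  qed
  then have "W (\<lambda>i. \<Sum>k<N. e (z k) (int k) i)" by simp
  then have "W z"
  proof (rule Wcong)
    fix i assume "i < N"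
    have "(\<Sum>k<N. e (z k) (int k) i) = (\<Sum>k<N. if k = i then z k else 0)"
      by (intro sum.cong) (auto simp: e_def)
    also have "... = z i" using \<open>i < N\<close> by (simp add: sum.delta)
    finally show "z i = (\<Sum>k<N. e (z k) (int k) i)" by simp
  qed
  then obtain r where "\<forall>j. tdle (int N - 1) (r j)"
    "\<forall>k<N. z k = mono2 1 1 0 * r k + mono2 1 0 1 * r (Suc k) + r (Suc (Suc k))" unfolding W_def by blast
  then show thesis using that by blast
qed

section \<open>Evaluation of polynomials and forms\<close>

locale rhom =
  fixes \<kappa> :: "'a::comm_ring_1 \<Rightarrow> 'b::comm_ring_1"
  assumes add: "\<kappa> (x + y) = \<kappa> x + \<kappa> y" and mult: "\<kappa> (x * y) = \<kappa> x * \<kappa> y" and one: "\<kappa> 1 = 1"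
begin

lemma zero: "\<kappa> 0 = 0"
  using add[of 0 0] by simp

lemma neg: "\<kappa> (- x) = - \<kappa> x"
  using add[of x "- x"] by (simp add: zero eq_neg_iff_add_eq_0 add.commute)

lemma minus: "\<kappa> (x - y) = \<kappa> x - \<kappa> y"
  using add[of x "- y"] by (simp add: neg)

lemma sum: "\<kappa> (\<Sum>i\<in>S. h i) = (\<Sum>i\<in>S. \<kappa> (h i))"
  by (induction S rule: infinite_finite_induct) (auto simp: zero add)

lemma prod: "\<kappa> (\<Prod>i\<in>S. h i) = (\<Prod>i\<in>S. \<kappa> (h i))"
  by (induction S rule: infinite_finite_induct) (auto simp: one mult)

lemma power: "\<kappa> (x ^ n) = \<kappa> x ^ n"
  by (induction n) (auto simp: one mult)

end

definition evalp :: "('a::comm_ring_1 \<Rightarrow> 'b::comm_ring_1) \<Rightarrow> 'b \<Rightarrow> 'a poly \<Rightarrow> 'b" where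
  "evalp \<kappa> a p = fold_coeffs (\<lambda>c r. \<kappa> c + a * r) p 0"

context rhom
begin

lemma evalp_0: "evalp \<kappa> a 0 = 0"
  by (simp add: evalp_def)

lemma evalp_pCons: "evalp \<kappa> a (pCons c p) = \<kappa> c + a * evalp \<kappa> a p"
  by (cases "p = 0 \<and> c = 0") (auto simp: evalp_def zero)

lemma evalp_add: "evalp \<kappa> a (p + q) = evalp \<kappa> a p + evalp \<kappa> a q"
  by (induction p q rule: poly_induct2) (simp_all add: evalp_0 evalp_pCons add algebra_simps)

lemma evalp_smult: "evalp \<kappa> a (smult c p) = \<kappa> c * evalp \<kappa> a p"
  by (induction p) (simp_all add: evalp_0 evalp_pCons mult algebra_simps)

lemma evalp_mult: "evalp \<kappa> a (p * q) = evalp \<kappa> a p * evalp \<kappa> a q"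
  by (induction p) (simp_all add: evalp_0 evalp_pCons evalp_add evalp_smult zero algebra_simps)

lemma rhom_evalp: "rhom (evalp \<kappa> a)"
  by standard (simp_all add: evalp_add evalp_mult one_pCons evalp_pCons evalp_0 one)

lemma evalp_monom: "evalp \<kappa> a (monom c n) = \<kappa> c * a ^ n"
  by (induction n) (simp_all add: monom_0 monom_Suc evalp_pCons evalp_0 zero algebra_simps)

end

abbreviation ev2 :: "('a::comm_ring_1 \<Rightarrow> 'b::comm_ring_1) \<Rightarrow> 'b \<Rightarrow> 'b \<Rightarrow> 'a poly poly \<Rightarrow> 'b" where
  "ev2 \<kappa> a b \<equiv> evalp (evalp \<kappa> a) b"

context rhom
begin

lemma rhom_ev2: "rhom (ev2 \<kappa> a b)"
  by (rule rhom.rhom_evalp[OF rhom_evalp])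

lemma ev2_mono2: "ev2 \<kappa> a b (mono2 c i j) = \<kappa> c * a ^ i * b ^ j"
  by (simp add: mono2_def rhom.evalp_monom[OF rhom_evalp] evalp_monom)

lemma ev2_sum: "ev2 \<kappa> a b h = (\<Sum>j\<le>degree h. \<Sum>i\<le>degree (coeff h j). \<kappa> (cf h i j) * a ^ i * b ^ j)"
proof -
  have "ev2 \<kappa> a b h = ev2 \<kappa> a b (\<Sum>j\<le>degree h. \<Sum>i\<le>degree (coeff h j). mono2 (cf h i j) i j)"
    using sum_mono2[of h] by simp
  then show ?thesis by (simp only: rhom.sum[OF rhom_ev2] ev2_mono2)
qed

end

lemma rhom_id: "rhom (\<lambda>x::'a::comm_ring_1. x)"
  by standard auto

lemma rhom_const_ff: "rhom const_ff"
  by standard (auto simp: const_ff_hom)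

subsection \<open>Forms in three variables\<close>

lemma eval_poly3_superset:
  assumes "rhom \<iota>" "finite S" "Poly_Mapping.keys f \<subseteq> S"
  shows "eval_poly3 \<iota> v f = (\<Sum>m\<in>S. \<iota> (Poly_Mapping.lookup f m) * (\<Prod>i\<in>UNIV. (v $ i) ^ Poly_Mapping.lookup m i))"
  unfolding eval_poly3_def using assms
  by (intro sum.mono_neutral_left) (auto simp: in_keys_iff rhom.zero)

lemma eval_poly3_single:
  "rhom \<iota> \<Longrightarrow> eval_poly3 \<iota> v (Poly_Mapping.single m c) = \<iota> c * (\<Prod>i\<in>UNIV. (v $ i) ^ Poly_Mapping.lookup m i)"
  by (subst eval_poly3_superset[of _ "{m}"]) auto

lemma eval_poly3_add:
  assumes "rhom \<iota>"
  shows "eval_poly3 \<iota> v (f + g) = eval_poly3 \<iota> v f + eval_poly3 \<iota> v g"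
proof -
  let ?S = "Poly_Mapping.keys f \<union> Poly_Mapping.keys g"
  have "finite ?S" by simp
  then show ?thesis
    using Poly_Mapping.keys_add[of f g]
    by (simp add: eval_poly3_superset[OF assms, of ?S] lookup_add rhom.add[OF assms] distrib_right sum.distrib)
qed

lemma eval_poly3_sum:
  assumes "rhom \<iota>"
  shows "eval_poly3 \<iota> v (\<Sum>x\<in>S. f x) = (\<Sum>x\<in>S. eval_poly3 \<iota> v (f x))"
  by (induction S rule: infinite_finite_induct) (auto simp: eval_poly3_add[OF assms] eval_poly3_def[of _ _ 0])

lemma poly3_sum_single: "(f :: 'k::comm_ring_1 poly3) = (\<Sum>m\<in>Poly_Mapping.keys f. Poly_Mapping.single m (Poly_Mapping.lookup f m))"
proof (rule poly_mapping_eqI)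
  fix k
  have "Poly_Mapping.lookup (\<Sum>m\<in>Poly_Mapping.keys f. Poly_Mapping.single m (Poly_Mapping.lookup f m)) k =
    (\<Sum>m\<in>Poly_Mapping.keys f. if m = k then Poly_Mapping.lookup f m else 0)"
    by (simp add: lookup_sum lookup_single when_def)
  then show "Poly_Mapping.lookup f k = Poly_Mapping.lookup (\<Sum>m\<in>Poly_Mapping.keys f. Poly_Mapping.single m (Poly_Mapping.lookup f m)) k"
    by (simp add: sum.delta in_keys_iff)
qed

lemma eval_poly3_mult:
  fixes \<iota> :: "'k::comm_ring_1 \<Rightarrow> 'r::comm_ring_1"
  assumes "rhom \<iota>"
  shows "eval_poly3 \<iota> v (f * g) = eval_poly3 \<iota> v f * eval_poly3 \<iota> v g"
proof -
  have s: "eval_poly3 \<iota> v (Poly_Mapping.single m c * Poly_Mapping.single m' c') =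
    eval_poly3 \<iota> v (Poly_Mapping.single m c) * eval_poly3 \<iota> v (Poly_Mapping.single m' c')" for m m' c c'
    by (simp add: mult_single eval_poly3_single[OF assms] lookup_add power_add prod.distrib rhom.mult[OF assms])
  have "f * g = (\<Sum>m\<in>Poly_Mapping.keys f. \<Sum>m'\<in>Poly_Mapping.keys g.
      Poly_Mapping.single m (Poly_Mapping.lookup f m) * Poly_Mapping.single m' (Poly_Mapping.lookup g m'))"
    by (subst (1) poly3_sum_single[of f], subst (1) poly3_sum_single[of g]) (simp add: sum_product)
  then have "eval_poly3 \<iota> v (f * g) = (\<Sum>m\<in>Poly_Mapping.keys f. \<Sum>m'\<in>Poly_Mapping.keys g.
      eval_poly3 \<iota> v (Poly_Mapping.single m (Poly_Mapping.lookup f m)) * eval_poly3 \<iota> v (Poly_Mapping.single m' (Poly_Mapping.lookup g m')))"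
    by (simp add: eval_poly3_sum[OF assms] s)
  also have "... = eval_poly3 \<iota> v f * eval_poly3 \<iota> v g"
    by (subst (3) poly3_sum_single[of f], subst (3) poly3_sum_single[of g]) (simp add: eval_poly3_sum[OF assms] sum_product)
  finally show ?thesis .
qed

lemma rhom_eval_poly3: "rhom \<iota> \<Longrightarrow> rhom (eval_poly3 \<iota> v)"
  by standard (auto simp: eval_poly3_add eval_poly3_mult single_one[symmetric] eval_poly3_single rhom.one simp del: single_one)

lemma eval_poly3_hom:
  assumes "rhom \<psi>"
  shows "\<psi> (eval_poly3 \<iota> v f) = eval_poly3 (\<lambda>c. \<psi> (\<iota> c)) (\<chi> i. \<psi> (v $ i)) f"
  by (simp add: eval_poly3_def rhom.sum[OF assms] rhom.mult[OF assms] rhom.prod[OF assms] rhom.power[OF assms])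

lemma eval_poly3_scale:
  assumes "is_form n f"
  shows "eval_poly3 \<iota> (\<chi> i. l * v $ i) f = l ^ n * eval_poly3 \<iota> v f"
proof -
  have "(\<Prod>i\<in>UNIV. (l * v $ i) ^ Poly_Mapping.lookup m i) = l ^ n * (\<Prod>i\<in>UNIV. (v $ i) ^ Poly_Mapping.lookup m i)"
    if "m \<in> Poly_Mapping.keys f" for m
    using that assms by (simp add: is_form_def power_mult_distrib prod.distrib flip: power_sum)
  then show ?thesis unfolding eval_poly3_def by (simp add: sum_distrib_left algebra_simps)
qed

lemma is_form_0: "is_form n 0"
  and is_form_add: "is_form n f \<Longrightarrow> is_form n g \<Longrightarrow> is_form n (f + g)"
  by (use Poly_Mapping.keys_add[of f g] in \<open>auto simp: is_form_def\<close>)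

lemma is_form_sum: "(\<And>x. x \<in> S \<Longrightarrow> is_form n (f x)) \<Longrightarrow> is_form n (\<Sum>x\<in>S. f x)"
  by (induction S rule: infinite_finite_induct) (auto intro: is_form_0 is_form_add)

lemma is_form_single: "(\<Sum>i\<in>UNIV. Poly_Mapping.lookup m i) = n \<Longrightarrow> is_form n (Poly_Mapping.single m c)"
  by (auto simp: is_form_def)

lemma is_form_mult: "is_form n f \<Longrightarrow> is_form m g \<Longrightarrow> is_form (n + m) (f * g)"
  using keys_mult[of f g] by (fastforce simp: is_form_def lookup_add sum.distrib)

lemma is_form_1: "is_form 0 (1 :: 'k::comm_ring_1 poly3)"
  using is_form_single[of 0 0 "1::'k"] by simp

lemma is_form_power: "is_form n f \<Longrightarrow> is_form (k * n) (f ^ k)" for f :: "'k::comm_ring_1 poly3"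
  by (induction k) (auto intro: is_form_1 is_form_mult)

definition var3 :: "3 \<Rightarrow> 'k::comm_ring_1 poly3" where
  "var3 i = Poly_Mapping.single (Poly_Mapping.single i 1) 1"

definition linear_form :: "'k::comm_ring_1 ^ 3 \<Rightarrow> 'k poly3" where
  "linear_form a = (\<Sum>i\<in>UNIV. Poly_Mapping.single 0 (a $ i) * var3 i)"

lemma is_form_linear: "is_form 1 (linear_form a)"
proof -
  have "is_form (0 + 1) (Poly_Mapping.single 0 (a $ i) * var3 i)" for i
    unfolding var3_def
    by (intro is_form_mult is_form_single) (simp_all add: lookup_single when_def)
  then show ?thesis unfolding linear_form_def by (intro is_form_sum) simp
qed

lemma eval_var3: "rhom \<iota> \<Longrightarrow> eval_poly3 \<iota> v (var3 i) = v $ i"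
proof -
  assume "rhom \<iota>"
  have "(\<Prod>j\<in>UNIV. (v $ j) ^ Poly_Mapping.lookup (Poly_Mapping.single i 1) j) = (\<Prod>j\<in>UNIV. if j = i then v $ j else 1)"
    by (intro prod.cong) (auto simp: lookup_single when_def)
  then show ?thesis using \<open>rhom \<iota>\<close> by (simp add: var3_def eval_poly3_single rhom.one prod.delta)
qed

lemma eval_linear_form: "rhom \<iota> \<Longrightarrow> eval_poly3 \<iota> v (linear_form a) = (\<Sum>i\<in>UNIV. \<iota> (a $ i) * v $ i)"
  unfolding linear_form_def
  by (simp add: eval_poly3_sum eval_poly3_mult eval_var3 eval_poly3_single)

text \<open>Meaningful only if \<open>h\<close> has total degree at most \<open>n\<close>; otherwise \<open>n - i - j\<close> is truncated.\<close>

definition homogenize :: "'k::comm_ring_1 ^ 3 \<Rightarrow> 'k ^ 3 \<Rightarrow> 'k ^ 3 \<Rightarrow> nat \<Rightarrow> 'k poly poly \<Rightarrow> 'k poly3" where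
  "homogenize a0 a1 a2 n h = (\<Sum>j\<le>degree h. \<Sum>i\<le>degree (coeff h j).
     Poly_Mapping.single 0 (cf h i j) * (linear_form a0 ^ (n - i - j) * (linear_form a1 ^ i * linear_form a2 ^ j)))"

lemma is_form_homogenize:
  assumes "tdle (int n) h"
  shows "is_form n (homogenize a0 a1 a2 n h)"
  unfolding homogenize_def
proof (intro is_form_sum)
  fix i j
  show "is_form n (Poly_Mapping.single 0 (cf h i j) * (linear_form a0 ^ (n - i - j) * (linear_form a1 ^ i * linear_form a2 ^ j)))"
  proof (cases "cf h i j = 0")
    case False
    then have "int (i + j) \<le> int n" using assms unfolding tdle_def by blast
    then have "i + j \<le> n" by simp
    then have n: "n = 0 + ((n - i - j) * 1 + (i * 1 + j * 1))" by simp
    show ?thesis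
      by (subst n, intro is_form_mult is_form_power is_form_linear is_form_single) simp
  qed (simp add: is_form_0)
qed

lemma eval_homogenize:
  fixes \<iota> :: "'k::comm_ring_1 \<Rightarrow> 'r::field"
  assumes "rhom \<iota>" "tdle (int n) h"
    and L: "eval_poly3 \<iota> v (linear_form a0) = l0" "eval_poly3 \<iota> v (linear_form a1) = l1"
      "eval_poly3 \<iota> v (linear_form a2) = l2" "l0 \<noteq> 0"
  shows "eval_poly3 \<iota> v (homogenize a0 a1 a2 n h) = l0 ^ n * ev2 \<iota> (l1 / l0) (l2 / l0) h"
proof -
  note e = rhom_eval_poly3[OF assms(1), of v]
  have "\<iota> (cf h i j) * (l0 ^ (n - i - j) * (l1 ^ i * l2 ^ j)) = l0 ^ n * (\<iota> (cf h i j) * (l1 / l0) ^ i * (l2 / l0) ^ j)" for i j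
  proof (cases "cf h i j = 0")
    case False
    then have "int (i + j) \<le> int n" using assms(2) unfolding tdle_def by blast
    then have "i + j \<le> n" by simp
    then have "l0 ^ n = l0 ^ (n - i - j) * l0 ^ i * l0 ^ j" by (simp flip: power_add)
    then show ?thesis using L(4) by (simp add: power_divide field_simps)
  qed (simp add: rhom.zero[OF assms(1)])
  note t = this
  have "eval_poly3 \<iota> v (homogenize a0 a1 a2 n h) =
    (\<Sum>j\<le>degree h. \<Sum>i\<le>degree (coeff h j). \<iota> (cf h i j) * (l0 ^ (n - i - j) * (l1 ^ i * l2 ^ j)))"
    by (simp add: homogenize_def rhom.sum[OF e] rhom.mult[OF e] rhom.power[OF e] eval_poly3_single[OF assms(1)] L(1-3))
  also have "... = (\<Sum>j\<le>degree h. \<Sum>i\<le>degree (coeff h j). l0 ^ n * (\<iota> (cf h i j) * (l1 / l0) ^ i * (l2 / l0) ^ j))"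
    by (intro sum.cong refl t)
  finally show ?thesis by (simp only: rhom.ev2_sum[OF assms(1)] sum_distrib_left)
qed

lemma ev2_const: "rhom \<kappa> \<Longrightarrow> ev2 \<kappa> a b [:[:c:]:] = \<kappa> c"
  by (simp add: rhom.evalp_pCons rhom.evalp_0 rhom.rhom_evalp)

lemma ev2_eval_poly3:
  assumes "rhom \<kappa>"
  shows "ev2 \<kappa> a b (eval_poly3 (\<lambda>c. [:[:c:]:]) w f) = eval_poly3 \<kappa> (\<chi> i. ev2 \<kappa> a b (w $ i)) f"
  by (simp add: eval_poly3_hom[OF rhom.rhom_ev2[OF assms]] ev2_const[OF assms])

lemma module_poly3: "module ((*) :: 'k::comm_ring_1 poly3 \<Rightarrow> _)"
  by standard (auto simp: algebra_simps)

lemma points_ideal_vanishes: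
  fixes f :: "'k::field poly3"
  assumes "f \<in> points_ideal E" "v \<in> E"
  shows "eval_poly3 id v f = 0"
proof -
  interpret module "(*) :: 'k poly3 \<Rightarrow> _" by (rule module_poly3)
  have id: "rhom (id :: 'k \<Rightarrow> 'k)" by standard auto
  show ?thesis using assms(1) unfolding points_ideal_def ideal_gen_def
  proof (induction rule: span_induct_alt)
    case base
    show ?case by (rule rhom.zero[OF rhom_eval_poly3[OF id]])
  next
    case (step c g h)
    then have "eval_poly3 id v g = 0" "eval_poly3 id v h = 0" using assms(2) by blast+
    then show ?case by (simp only: eval_poly3_add[OF id] eval_poly3_mult[OF id] mult_zero_right add_0)
  qed
qed

lemma points_idealI:
  fixes f :: "'k::field poly3"
  assumes "is_form n f" "\<And>v. v \<in> E \<Longrightarrow> eval_poly3 id v f = 0"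
  shows "f \<in> points_ideal E"
proof -
  interpret module "(*) :: 'k poly3 \<Rightarrow> _" by (rule module_poly3)
  show ?thesis unfolding points_ideal_def ideal_gen_def using assms by (intro span_base) auto
qed

text \<open>Multiplication by a variable shifts exponent vectors injectively, so the cofactor
  inherits homogeneity from the product.\<close>

lemma form_in_var_ideal:
  fixes f :: "'k::field poly3"
  assumes "f \<in> ideal_gen {var3 i}" "is_form n f" "f \<noteq> 0"
  obtains m g where "n = Suc m" "is_form m g" "f = g * var3 i"
proof -
  interpret module "(*) :: 'k poly3 \<Rightarrow> _" by (rule module_poly3)
  obtain g where g: "f = g * var3 i" using assms(1) by (auto simp: ideal_gen_def span_singleton)
  have lk: "Poly_Mapping.lookup f (m + Poly_Mapping.single i 1) = Poly_Mapping.lookup g m" for m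
  proof -
    have "f = (\<Sum>k\<in>Poly_Mapping.keys g. Poly_Mapping.single (k + Poly_Mapping.single i 1) (Poly_Mapping.lookup g k))"
      unfolding g var3_def by (subst (1) poly3_sum_single[of g]) (simp add: sum_distrib_right mult_single)
    then have "Poly_Mapping.lookup f (m + Poly_Mapping.single i 1) =
      (\<Sum>k\<in>Poly_Mapping.keys g. if k = m then Poly_Mapping.lookup g k else 0)"
      by (simp add: lookup_sum lookup_single when_def)
    then show ?thesis by (simp add: sum.delta in_keys_iff)
  qed
  have deg: "(\<Sum>j\<in>UNIV. Poly_Mapping.lookup m j) + 1 = n" if "m \<in> Poly_Mapping.keys g" for m
  proof -
    have "m + Poly_Mapping.single i 1 \<in> Poly_Mapping.keys f" using that lk[of m] by (simp add: in_keys_iff)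
    then have "(\<Sum>j\<in>UNIV. Poly_Mapping.lookup (m + Poly_Mapping.single i 1) j) = n" using assms(2) by (auto simp: is_form_def)
    then show ?thesis by (simp add: lookup_add sum.distrib lookup_single when_def)
  qed
  have "g \<noteq> 0" using assms(3) g by auto
  then obtain m0 where "m0 \<in> Poly_Mapping.keys g" by (metis keys_eq_empty ex_in_conv)
  then have "n = Suc (n - 1)" using deg by fastforce
  moreover have "is_form (n - 1) g" using deg by (fastforce simp: is_form_def)
  ultimately show thesis using that g by blast
qed

section \<open>Derivations and the Jacobian\<close>

locale poly_derivation =
  fixes D :: "'k::field poly poly \<Rightarrow> 'k poly poly"
  assumes add: "D (a + b) = D a + D b" and mult: "D (a * b) = D a * b + a * D b"
    and const: "D [:[:c:]:] = 0"
begin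

text \<open>Independence of the chosen representative: differentiating the cross-multiplied equation
  of two representatives compares their quotient rules.\<close>

lemma ff_deriv_Fract:
  assumes "b \<noteq> 0"
  shows "ff_deriv D (Fract a b) = Fract (D a * b - a * D b) (b * b)"
proof -
  define s where "s = (SOME (c, d). d \<noteq> 0 \<and> Fract a b = Fract c d)"
  obtain c d where s: "s = (c, d)" by force
  have "case s of (c, d) \<Rightarrow> d \<noteq> 0 \<and> Fract a b = Fract c d"
    unfolding s_def by (rule someI[of _ "(a, b)"]) (use assms in auto)
  then have d: "d \<noteq> 0" and eq: "a * d = c * b" using assms by (auto simp: s eq_fract)
  from arg_cong[OF eq, of D] have Deq: "D a * d + a * D d = D c * b + c * D b" by (simp add: mult)
  have "(D c * d - c * D d) * (b * b) = (D a * b - a * D b) * (d * d)"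
  proof -
    have "(D c * d - c * D d) * (b * b) - (D a * b - a * D b) * (d * d)
      = - (D a * d + a * D d - D c * b - c * D b) * (b * d)
        + (a * d - c * b) * (D b * d + b * D d)" by (simp add: algebra_simps)
    then show ?thesis using Deq eq by simp
  qed
  moreover have "ff_deriv D (Fract a b) = Fract (D c * d - c * D d) (d * d)"
    unfolding ff_deriv_def s_def[symmetric] by (simp add: s)
  ultimately show ?thesis using assms d by (simp add: eq_fract)
qed

end

locale derivation =
  fixes \<delta> :: "'k::field ff \<Rightarrow> 'k ff"
  assumes add: "\<delta> (a + b) = \<delta> a + \<delta> b" and mult: "\<delta> (a * b) = \<delta> a * b + a * \<delta> b"
    and const: "\<delta> (const_ff c) = 0"
begin

lemma zero: "\<delta> 0 = 0" and one: "\<delta> 1 = 0"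
  using const[of 0] const[of 1] by (simp_all add: const_ff_hom)

lemma neg: "\<delta> (- a) = - \<delta> a"
  using add[of a "- a"] by (simp add: zero eq_neg_iff_add_eq_0 add.commute)

lemma diff: "\<delta> (a - b) = \<delta> a - \<delta> b"
  using add[of a "- b"] by (simp add: neg)

lemma divide: assumes "b \<noteq> 0" shows "\<delta> (a / b) = (\<delta> a - (a / b) * \<delta> b) / b"
proof -
  have "\<delta> a = \<delta> (a / b) * b + (a / b) * \<delta> b" using mult[of "a / b" b] assms by simp
  then show ?thesis using assms by (simp add: field_simps)
qed

lemma evalp_const: "\<delta> (evalp const_ff a p) = evalp const_ff a (pderiv p) * \<delta> a"
proof (induction p)
  case 0
  then show ?case by (simp add: rhom.evalp_0[OF rhom_const_ff] zero)
next
  case (pCons c p)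
  then show ?case
    by (simp add: rhom.evalp_pCons[OF rhom_const_ff] rhom.evalp_add[OF rhom_const_ff] pderiv_pCons add mult const
        const_ff_hom algebra_simps)
qed

lemma ev2_const:
  "\<delta> (ev2 const_ff a b h) = ev2 const_ff a b (map_poly pderiv h) * \<delta> a + ev2 const_ff a b (pderiv h) * \<delta> b"
proof (induction h)
  case 0
  then show ?case by (simp add: rhom.evalp_0[OF rhom.rhom_evalp[OF rhom_const_ff]] zero)
next
  case (pCons c p)
  note r = rhom.rhom_evalp[OF rhom_const_ff, of a]
  have "map_poly pderiv (pCons c p) = pCons (pderiv c) (map_poly pderiv p)"
    by (simp add: map_poly_pCons)
  then show ?case using pCons
    by (simp add: rhom.evalp_pCons[OF r] rhom.evalp_add[OF r] pderiv_pCons add mult evalp_const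
        rhom.zero[OF r] algebra_simps)
qed

text \<open>Elements whose derivative is divisible by \<open>\<rho>\<close> form a subalgebra, and
  the quotient rule carries the property over to denominators that are units. Hence only algebra
  generators need to be differentiated.\<close>

lemma Spec_rings_bound:
  assumes x: "x \<in> Spec_rings (subalgebra_gen G)" and G: "\<And>g. g \<in> G \<Longrightarrow> \<delta> g / \<rho> \<in> x" and \<rho>: "\<rho> \<noteq> 0"
    and a: "a \<in> x"
  shows "\<delta> a / \<rho> \<in> x"
proof -
  note sG = subring_subalgebra_gen[of G]
  have sx: "subring_of_field x" and Gx: "subalgebra_gen G \<subseteq> x"
    using local_subringD[OF local_Spec_rings[OF sG x]] Spec_rings_super[OF sG x] by auto
  define B where "B = {a \<in> x. \<delta> a / \<rho> \<in> x}"
  have B: "subring_of_field B"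
    unfolding subring_of_field_def
  proof (intro conjI ballI)
    show "0 \<in> B" "1 \<in> B" using subring_0[OF sx] subring_1[OF sx] by (auto simp: B_def zero one)
  next
    fix a b assume ab: "a \<in> B" "b \<in> B"
    show "a + b \<in> B" "a - b \<in> B"
      using ab subring_add[OF sx] subring_diff[OF sx]
      by (auto simp: B_def add diff add_divide_distrib diff_divide_distrib)
    have "\<delta> (a * b) / \<rho> = (\<delta> a / \<rho>) * b + a * (\<delta> b / \<rho>)" by (simp add: mult add_divide_distrib)
    moreover have "(\<delta> a / \<rho>) * b + a * (\<delta> b / \<rho>) \<in> x" "a * b \<in> x"
      using ab by (auto simp only: B_def mem_Collect_eq intro!: subring_add[OF sx] subring_mult[OF sx])
    ultimately show "a * b \<in> B" by (simp only: B_def mem_Collect_eq)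
  qed
  have "const_ff c \<in> B" for c
    using Gx const_subalgebra_gen[of c G] subring_0[OF sx] by (auto simp: B_def const)
  moreover have "G \<subseteq> B" using G Gx subalgebra_gen_super[of G] by (auto simp: B_def)
  ultimately have GB: "subalgebra_gen G \<subseteq> B" using subalgebra_gen_least[OF B] by blast
  obtain c d where *: "a = c / d" "c \<in> subalgebra_gen G" "d \<in> subalgebra_gen G" "unit_in x d"
    using Spec_rings_fraction[OF sG x a] by blast
  have mem: "\<delta> c / \<rho> \<in> x" "\<delta> d / \<rho> \<in> x" using * GB by (auto simp: B_def)
  have "\<delta> a / \<rho> = (\<delta> c / \<rho> - a * (\<delta> d / \<rho>)) / d"
    using *(1) divide[OF unit_in_nonzero[OF *(4)], of c] by (simp add: diff_divide_distrib mult_ac)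
  also have "... \<in> x"
    by (rule unit_in_divide_mem[OF sx subring_diff[OF sx mem(1) subring_mult[OF sx a mem(2)]] *(4)])
  finally show ?thesis .
qed

end

lemma poly_derivation_pderiv: "poly_derivation pderiv"
  by standard (auto simp: pderiv_add pderiv_mult pderiv_pCons algebra_simps)

lemma poly_derivation_map: "poly_derivation (map_poly pderiv)"
proof
  fix a b :: "'a poly poly" and c :: 'a
  show "map_poly pderiv (a + b) = map_poly pderiv a + map_poly pderiv b"
    by (rule poly_eqI) (simp add: coeff_map_poly pderiv_add)
  show "map_poly pderiv (a * b) = map_poly pderiv a * b + a * map_poly pderiv b"
  proof (rule poly_eqI)
    fix n
    have "coeff (map_poly pderiv (a * b)) n = (\<Sum>i\<le>n. pderiv (coeff a i * coeff b (n - i)))"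
      by (simp add: coeff_map_poly coeff_mult higher_pderiv_sum[of 1, simplified])
    also have "... = (\<Sum>i\<le>n. pderiv (coeff a i) * coeff b (n - i) + coeff a i * pderiv (coeff b (n - i)))"
      by (intro sum.cong refl) (simp add: pderiv_mult algebra_simps)
    also have "... = coeff (map_poly pderiv a * b + a * map_poly pderiv b) n"
      by (simp add: coeff_mult coeff_map_poly sum.distrib)
    finally show "coeff (map_poly pderiv (a * b)) n = coeff (map_poly pderiv a * b + a * map_poly pderiv b) n" .
  qed
  show "map_poly pderiv [:[:c:]:] = 0" by (simp add: map_poly_pCons pderiv_pCons)
qed

lemma (in poly_derivation) derivation_ff: "derivation (ff_deriv D)"
proof
  have D1: "D 1 = 0" using const[of 1] by (simp flip: one_pCons)
  fix x y :: "'k ff" and c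
  obtain a b where x: "x = Fract a b" "b \<noteq> 0" by (cases x) auto
  obtain a' b' where y: "y = Fract a' b'" "b' \<noteq> 0" by (cases y) auto
  show "ff_deriv D (x + y) = ff_deriv D x + ff_deriv D y"
    using x(2) y(2) unfolding x(1) y(1)
    by (simp add: ff_deriv_Fract eq_fract add mult) (simp add: algebra_simps)
  show "ff_deriv D (x * y) = ff_deriv D x * y + x * ff_deriv D y"
    using x(2) y(2) unfolding x(1) y(1)
    by (simp add: ff_deriv_Fract eq_fract add mult) (simp add: algebra_simps)
  show "ff_deriv D (const_ff c) = 0"
    by (simp add: const_ff_def ff_deriv_Fract const D1 fract_collapse)
qed

abbreviation dds :: "'k::field ff \<Rightarrow> 'k ff" where "dds \<equiv> ff_deriv (map_poly pderiv)"
abbreviation ddt :: "'k::field ff \<Rightarrow> 'k ff" where "ddt \<equiv> ff_deriv pderiv"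

lemma derivation_dds: "derivation dds" and derivation_ddt: "derivation ddt"
  by (rule poly_derivation.derivation_ff[OF poly_derivation_map] poly_derivation.derivation_ff[OF poly_derivation_pderiv])+

lemma derivation_jacobian_right: "derivation (jacobian f)"
  by standard (simp_all add: jacobian_def derivation.add[OF derivation_dds] derivation.add[OF derivation_ddt]
      derivation.mult[OF derivation_dds] derivation.mult[OF derivation_ddt]
      derivation.const[OF derivation_dds] derivation.const[OF derivation_ddt] algebra_simps)

lemma jacobian_commute: "jacobian f g = - jacobian g f"
  by (simp add: jacobian_def)

lemma jacobian_self: "jacobian f f = 0"
  by (simp add: jacobian_def)

lemma jacobian_coord: "jacobian (coord $ 1) (coord $ 2) = (1 :: 'k::field ff)"
proof -
  note a = poly_derivation.ff_deriv_Fract[OF poly_derivation_map] poly_derivation.ff_deriv_Fract[OF poly_derivation_pderiv]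
  have "map_poly pderiv (1 :: 'k poly poly) = 0" by (simp add: one_pCons map_poly_pCons)
  then show ?thesis
    by (simp add: jacobian_def coord_def a map_poly_pCons pderiv_pCons fract_collapse flip: one_pCons)
qed

lemma derivation_jacobian_left: "derivation (\<lambda>f. jacobian f g)"
  by standard (simp_all add: jacobian_def derivation.add[OF derivation_dds] derivation.add[OF derivation_ddt]
      derivation.mult[OF derivation_dds] derivation.mult[OF derivation_ddt]
      derivation.const[OF derivation_dds] derivation.const[OF derivation_ddt] algebra_simps)

lemma jacobian_Spec_rings_bound:
  assumes x: "x \<in> Spec_rings (subalgebra_gen G)"
    and G: "\<And>g h. g \<in> G \<Longrightarrow> h \<in> G \<Longrightarrow> jacobian g h / \<rho> \<in> x" and \<rho>: "\<rho> \<noteq> 0"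
    and ab: "a \<in> x" "b \<in> x"
  shows "jacobian a b / \<rho> \<in> x"
proof -
  have "jacobian a g / \<rho> \<in> x" if "g \<in> G" for g
    using derivation.Spec_rings_bound[OF derivation_jacobian_left x _ \<rho> ab(1)] G that by blast
  then show ?thesis
    using derivation.Spec_rings_bound[OF derivation_jacobian_right x _ \<rho> ab(2)] by blast
qed

lemma cf_map_pderiv: "cf (map_poly pderiv h) i j = of_nat (Suc i) * cf h (Suc i) j"
  by (simp add: cf_def coeff_map_poly coeff_pderiv)

lemma cf_pderiv: "cf (pderiv h) i j = of_nat (Suc j) * cf h i (Suc j)"
proof -
  have "coeff (pderiv h) j = of_nat (Suc j) * coeff h (Suc j)" by (simp add: coeff_pderiv)
  also have "(of_nat (Suc j) :: 'a poly) = [:of_nat (Suc j):]" by (simp only: of_nat_poly)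
  finally show ?thesis by (simp add: cf_def)
qed

text \<open>The Jacobian criterion in characteristic 0. Differentiating a relation gives two linear
  equations for the values of its partial derivatives; these have smaller degree, so by induction
  both are zero and the relation is constant.\<close>

lemma ev2_injective:
  fixes a b :: "'k::field_char_0 ff"
  assumes j: "jacobian a b \<noteq> 0" and h: "ev2 const_ff a b h = 0"
  shows "h = 0"
proof -
  have const_case: "h = 0" if "cf h = (\<lambda>i j. if i = 0 \<and> j = 0 then cf h 0 0 else 0)" "ev2 const_ff a b h = 0" for h
  proof -
    have "h = mono2 (cf h 0 0) 0 0" by (rule cf_ext) (subst that(1), simp add: cf_mono2)
    moreover from this have "const_ff (cf h 0 0) = 0"
      using that(2) rhom.ev2_mono2[OF rhom_const_ff, of a b "cf h 0 0" 0 0] by simp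
    then have "cf h 0 0 = 0" using const_ff_inject[of "cf h 0 0" 0] by (simp add: const_ff_hom)
    ultimately show ?thesis by (metis mono2_def monom_0 pCons_0_0)
  qed
  have "tdle (int n) h \<Longrightarrow> ev2 const_ff a b h = 0 \<Longrightarrow> h = 0" for n
  proof (induction n arbitrary: h)
    case 0
    show ?case
      by (rule const_case[OF _ 0(2)]) (use tdleD[OF 0(1)] in \<open>auto simp: fun_eq_iff\<close>)
  next
    case (Suc n)
    let ?p = "map_poly pderiv h" and ?q = "pderiv h"
    have "ev2 const_ff a b ?p * dds a + ev2 const_ff a b ?q * dds b = 0"
      "ev2 const_ff a b ?p * ddt a + ev2 const_ff a b ?q * ddt b = 0"
      using derivation.ev2_const[OF derivation_dds, of a b h] derivation.ev2_const[OF derivation_ddt, of a b h] Suc.prems(2)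
      by (simp_all add: derivation.zero[OF derivation_dds] derivation.zero[OF derivation_ddt])
    \<comment> \<open>Cramer's rule for the two linear equations.\<close>
    moreover have "ev2 const_ff a b ?p * jacobian a b = (ev2 const_ff a b ?p * dds a + ev2 const_ff a b ?q * dds b) * ddt b
        - (ev2 const_ff a b ?p * ddt a + ev2 const_ff a b ?q * ddt b) * dds b"
      "ev2 const_ff a b ?q * jacobian a b = - (ev2 const_ff a b ?p * dds a + ev2 const_ff a b ?q * dds b) * ddt a
        + (ev2 const_ff a b ?p * ddt a + ev2 const_ff a b ?q * ddt b) * dds a"
      by (simp_all add: jacobian_def algebra_simps)
    ultimately have "ev2 const_ff a b ?p = 0" "ev2 const_ff a b ?q = 0" using j by auto
    moreover have "tdle (int n) ?p" "tdle (int n) ?q"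
      using tdleD[OF Suc.prems(1)] by (auto intro!: tdleI simp: cf_map_pderiv cf_pderiv)
    ultimately have 0: "?p = 0" "?q = 0" using Suc.IH by blast+
    have z1: "cf h (Suc i) j = 0" for i j
    proof -
      have "of_nat (Suc i) * cf h (Suc i) j = 0" using cf_map_pderiv[of h i j] 0(1) by simp
      then show ?thesis by (simp del: of_nat_Suc)
    qed
    have z2: "cf h i (Suc j) = 0" for i j
    proof -
      have "of_nat (Suc j) * cf h i (Suc j) = 0" using cf_pderiv[of h i j] 0(2) by simp
      then show ?thesis by (simp del: of_nat_Suc)
    qed
    show ?case
    proof (rule const_case[OF _ Suc.prems(2)], intro ext)
      fix i j show "cf h i j = (if i = 0 \<and> j = 0 then cf h 0 0 else 0)"
        using z1 z2 by (cases i; cases j) auto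
    qed
  qed
  then show ?thesis using tdle_exists h by blast
qed

section \<open>Charts of the blown-up plane\<close>

lemma coord_independent:
  fixes c :: "'k::field ^ 3"
  assumes "(\<Sum>i\<in>UNIV. const_ff (c $ i) * coord $ i) = 0"
  shows "c = 0"
proof -
  have "(\<Sum>i\<in>UNIV. const_ff (c $ i) * coord $ i) = Fract [:[:c $ 3, c $ 1:], [:c $ 2:]:] 1"
    by (simp add: sum_3 coord_def const_ff_def)
  then have "[:[:c $ 3, c $ 1:], [:c $ 2:]:] = 0" using assms by (simp add: eq_fract Zero_fract_def)
  then show ?thesis by (simp add: vec_eq_iff forall_3)
qed

lemma evalp_id: "evalp (\<lambda>x. x) a p = poly p a"
  by (induction p) (simp_all add: rhom.evalp_0[OF rhom_id] rhom.evalp_pCons[OF rhom_id])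

lemma ev2_id_poly: "ev2 (\<lambda>x. x) a (poly \<psi> a) h = poly (poly h \<psi>) a"
proof (induction h)
  case 0
  show ?case by (simp add: rhom.evalp_0[OF rhom.rhom_evalp[OF rhom_id]])
next
  case (pCons c h)
  then show ?case
    using rhom.evalp_pCons[OF rhom.rhom_evalp[OF rhom_id], of a "poly \<psi> a" c h] evalp_id[of a c] by simp
qed

lemma prod_linear_dvd:
  fixes q :: "'k::field poly"
  assumes "finite S" "inj_on r S" "\<And>i. i \<in> S \<Longrightarrow> poly q (r i) = 0"
  shows "(\<Prod>i\<in>S. [:- r i, 1:]) dvd q"
  using assms
proof (induction S rule: finite_induct)
  case (insert i S)
  then obtain k where k: "q = (\<Prod>i\<in>S. [:- r i, 1:]) * k" by (auto elim: dvdE)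
  have "poly (\<Prod>i\<in>S. [:- r i, 1:]) (r i) \<noteq> 0" using insert by (auto simp: poly_prod)
  then have "poly k (r i) = 0" using insert.prems(2)[of i] k by auto
  then have "[:- r i, 1:] dvd k" by (simp add: poly_eq_0_iff_dvd)
  then show ?case using insert k by (metis mult.commute mult_dvd_mono dvd_refl prod.insert)
qed simp

lemma interpolation:
  fixes r s :: "'i \<Rightarrow> 'k::field"
  assumes "finite S" "inj_on r S"
  obtains \<psi> where "\<And>i. i \<in> S \<Longrightarrow> poly \<psi> (r i) = s i"
proof -
  have "\<exists>\<psi>. \<forall>i\<in>S. poly \<psi> (r i) = s i" using assms
  proof (induction S rule: finite_induct)
    case (insert i S)
    then obtain \<psi> where \<psi>: "\<forall>i\<in>S. poly \<psi> (r i) = s i" by auto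
    define q where "q = (\<Prod>i\<in>S. [:- r i, 1:])"
    have qi: "poly q (r i) \<noteq> 0" using insert by (auto simp: q_def poly_prod)
    have qS: "poly q (r j) = 0" if "j \<in> S" for j using that insert by (auto simp: q_def poly_prod)
    show ?case
      by (rule exI[of _ "\<psi> + smult ((s i - poly \<psi> (r i)) / poly q (r i)) q"]) (use \<psi> qi qS in auto)
  qed auto
  then show thesis using that by blast
qed

text \<open>\<open>A\<close> is a change of homogeneous coordinates; its third row is the line at infinity.\<close>

locale plane_points =
  fixes p :: "nat \<Rightarrow> 'k::field_char_0 ^ 3" and e d :: nat and A N :: "'k ^ 3 ^ 3" and \<phi> :: "'k poly"
  assumes NA: "N ** A = mat 1"
    and infinity: "i < e \<Longrightarrow> (A *v p i) $ 3 \<noteq> 0"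
    and distinct: "inj_on (\<lambda>i. (A *v p i) $ 1 / (A *v p i) $ 3) {..<e}"
    and interp: "i < e \<Longrightarrow> poly \<phi> ((A *v p i) $ 1 / (A *v p i) $ 3) = (A *v p i) $ 2 / (A *v p i) $ 3"
    and d_pos: "d \<ge> 1"
begin

definition l :: "3 \<Rightarrow> 'k ff" where "l a = (\<Sum>k\<in>UNIV. const_ff (A $ a $ k) * coord $ k)"
definition u :: "'k ff" where "u = l 1 / l 3"
definition v :: "'k ff" where "v = l 2 / l 3"
definition up :: "nat \<Rightarrow> 'k" where "up i = (A *v p i) $ 1 / (A *v p i) $ 3"
definition vp :: "nat \<Rightarrow> 'k" where "vp i = (A *v p i) $ 2 / (A *v p i) $ 3"
abbreviation EV :: "'k poly poly \<Rightarrow> 'k ff" where "EV \<equiv> ev2 const_ff u v"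
text \<open>The original coordinate \<open>coord $ i\<close> divided by \<open>l 3\<close>, as an
  affine linear polynomial in the new coordinates u, v; the coefficients come from the inverse
  matrix \<open>N\<close>.\<close>

definition lamP :: "3 \<Rightarrow> 'k poly poly" where "lamP i = [:[:N $ i $ 3, N $ i $ 1:], [:N $ i $ 2:]:]"
definition lam :: "3 \<Rightarrow> 'k ff" where "lam i = EV (lamP i)"
abbreviation U :: "'k poly poly" where "U \<equiv> mono2 1 1 0"
abbreviation V :: "'k poly poly" where "V \<equiv> mono2 1 0 1"

lemma rhom_EV: "rhom EV" by (rule rhom.rhom_ev2[OF rhom_const_ff])

lemmas EV_hom = rhom.add[OF rhom_EV] rhom.mult[OF rhom_EV] rhom.one[OF rhom_EV] rhom.zero[OF rhom_EV]
  rhom.minus[OF rhom_EV] rhom.neg[OF rhom_EV] rhom.power[OF rhom_EV] rhom.prod[OF rhom_EV] rhom.sum[OF rhom_EV]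

lemma EV_mono2: "EV (mono2 c i j) = const_ff c * u ^ i * v ^ j"
  by (rule rhom.ev2_mono2[OF rhom_const_ff])

lemma EV_U: "EV U = u" and EV_V: "EV V = v"
  by (simp_all add: EV_mono2 const_ff_hom)

lemma AN: "A ** N = mat 1"
  using NA by (simp add: matrix_left_right_inverse)

lemma NA_entry: "(\<Sum>a\<in>UNIV. N $ i $ a * A $ a $ k) = (if i = k then 1 else 0)"
  using NA by (simp add: matrix_matrix_mult_def mat_def vec_eq_iff)

lemma l_nonzero: "l a \<noteq> 0"
proof
  assume "l a = 0"
  then have "A $ a = 0" using coord_independent[of "A $ a"] by (simp add: l_def)
  then have "(A ** N) $ a $ a = 0" by (simp add: matrix_matrix_mult_def)
  then show False using AN by (simp add: mat_def)
qed

lemma u_nonzero: "u \<noteq> 0" and v_nonzero: "v \<noteq> 0"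
  using l_nonzero by (simp_all add: u_def v_def)

lemma lam_eq: "lam i = const_ff (N $ i $ 3) + const_ff (N $ i $ 1) * u + const_ff (N $ i $ 2) * v"
proof -
  note r = rhom.rhom_evalp[OF rhom_const_ff, of u]
  show ?thesis
    by (simp add: lam_def lamP_def rhom.evalp_pCons[OF r] rhom.evalp_pCons[OF rhom_const_ff] rhom.evalp_0[OF r]
        rhom.evalp_0[OF rhom_const_ff] algebra_simps)
qed

lemma coord_lam: "coord $ i = l 3 * lam i"
proof -
  have "(\<Sum>a\<in>UNIV. const_ff (N $ i $ a) * l a) = (\<Sum>a\<in>UNIV. \<Sum>k\<in>UNIV. const_ff (N $ i $ a * A $ a $ k) * coord $ k)"
    by (simp add: l_def sum_distrib_left const_ff_hom mult.assoc)
  also have "... = (\<Sum>k\<in>UNIV. \<Sum>a\<in>UNIV. const_ff (N $ i $ a * A $ a $ k) * coord $ k)" by (rule sum.swap)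
  also have "... = (\<Sum>k\<in>UNIV. const_ff (\<Sum>a\<in>UNIV. N $ i $ a * A $ a $ k) * coord $ k)"
    by (simp only: rhom.sum[OF rhom_const_ff] sum_distrib_right)
  also have "... = (\<Sum>k\<in>UNIV. if k = i then coord $ k else 0)"
    unfolding NA_entry by (intro sum.cong) (auto simp: const_ff_hom)
  also have "... = coord $ i" by (simp add: sum.delta)
  finally have "coord $ i = (\<Sum>a\<in>UNIV. const_ff (N $ i $ a) * l a)" by simp
  also have "... = l 3 * lam i"
    using l_nonzero[of 3] by (simp add: sum_3 lam_eq u_def v_def field_simps)
  finally show ?thesis .
qed

lemma lam_sum: "(\<Sum>k\<in>UNIV. const_ff (A $ a $ k) * lam k) = l a / l 3"
proof -
  have "l a = l 3 * (\<Sum>k\<in>UNIV. const_ff (A $ a $ k) * lam k)"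
    unfolding l_def[of a] coord_lam by (simp add: sum_distrib_left mult.left_commute)
  then show ?thesis using l_nonzero[of 3] by simp
qed

lemma lam_nonzero: "lam i \<noteq> 0"
proof
  assume *: "lam i = 0"
  then have "coord $ i = (0 :: 'k ff)" using coord_lam[of i] by simp
  moreover have "coord $ i \<noteq> (0 :: 'k ff)"
  proof
    assume 0: "coord $ i = (0 :: 'k ff)"
    have "(\<Sum>k\<in>UNIV. const_ff (axis i (1::'k) $ k) * coord $ k) = (\<Sum>k\<in>UNIV. if k = i then coord $ k else 0)"
      by (intro sum.cong) (auto simp: axis_def const_ff_hom)
    then have "axis i (1::'k) = 0" using 0 by (intro coord_independent) (simp add: sum.delta)
    then show False by (simp add: axis_eq_0_iff)
  qed
  ultimately show False by simp
qed

lemma coord_ratio: "coord $ i / coord $ j = lam i / lam j"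
  using l_nonzero[of 3] by (simp add: coord_lam)

text \<open>A derivation that kills u and v kills every ratio of the \<open>lam i\<close>, hence the
  original coordinates. If the Jacobian of u and v vanished, applying this to both arguments in turn
  would give \<open>jacobian s t = 0\<close>, whereas it is 1.\<close>

lemma jacobian_uv: "jacobian u v \<noteq> 0"
proof
  assume 0: "jacobian u v = 0"
  have coord3: "coord $ i = lam i / lam 3" for i
    using coord_ratio[of i 3] by (simp add: coord_def)
  have kill: "\<delta> (coord $ i) = 0" if "derivation \<delta>" "\<delta> u = 0" "\<delta> v = 0" for \<delta> i
  proof -
    have "\<delta> (lam j) = 0" for j
      unfolding lam_def by (subst derivation.ev2_const[OF that(1)]) (simp add: that)
    then show ?thesis unfolding coord3 by (simp add: derivation.divide[OF that(1)] lam_nonzero)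
  qed
  have "jacobian u (coord $ i) = 0" for i
    by (rule kill[OF derivation_jacobian_right]) (simp_all add: 0 jacobian_self)
  moreover have "jacobian v (coord $ i) = 0" for i
    by (rule kill[OF derivation_jacobian_right]) (use 0 jacobian_commute[of v u] in \<open>simp_all add: jacobian_self\<close>)
  ultimately have "jacobian (coord $ 1) (coord $ 2 :: 'k ff) = 0"
    by (intro kill[OF derivation_jacobian_left])
  then have "(1 :: 'k ff) = 0" by (rule trans[OF jacobian_coord[symmetric]])
  then show False by simp
qed

lemma EV_inject: "EV h = EV h' \<longleftrightarrow> h = h'"
  using ev2_injective[OF jacobian_uv, of "h - h'"] by (auto simp: EV_hom)

lemma EV_eq_0: "EV h = 0 \<longleftrightarrow> h = 0"
  using EV_inject[of h 0] by (simp add: EV_hom)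

subsection \<open>Local rings over a chart\<close>

text \<open>Coordinate functions of a standard affine chart with respect to the new homogeneous
  coordinates \<open>(u : v : 1)\<close>. Only \<open>\<mu> = 1, u, v\<close> are used: the affine
  plane and the two charts that meet the line at infinity.\<close>

definition chart :: "'k ff \<Rightarrow> 'k ff set" where "chart \<mu> = {1 / \<mu>, u / \<mu>, v / \<mu>}"

lemma chart_mem: "chart \<mu> \<subseteq> x \<Longrightarrow> inverse \<mu> \<in> x" "chart \<mu> \<subseteq> x \<Longrightarrow> u / \<mu> \<in> x" "chart \<mu> \<subseteq> x \<Longrightarrow> v / \<mu> \<in> x"
  by (auto simp: chart_def inverse_eq_divide)

lemma const_mem: "x \<in> Spec_rings (subalgebra_gen G) \<Longrightarrow> const_ff c \<in> x"
  using Spec_rings_super[OF subring_subalgebra_gen] const_subalgebra_gen by blast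

definition loc_pt :: "'k ff set \<Rightarrow> bool" where
  "loc_pt x \<longleftrightarrow> local_subring x \<and> range const_ff \<subseteq> x"

lemma loc_pt_Spec_rings: "x \<in> Spec_rings (subalgebra_gen G) \<Longrightarrow> loc_pt x"
  using local_Spec_rings[OF subring_subalgebra_gen] const_mem by (auto simp: loc_pt_def)

lemma subalgebra_gen_subset: "subring_of_field x \<Longrightarrow> range const_ff \<subseteq> x \<Longrightarrow> subalgebra_gen G \<subseteq> x \<longleftrightarrow> G \<subseteq> x"
  using subalgebra_gen_least[of x G] subalgebra_gen_super[of G] by blast

text \<open>A monomial \<open>u^i v^j\<close> over \<open>\<mu>^n\<close> is a product of chart
  coordinates; the missing \<open>n - i - j\<close> factors are \<open>1 / \<mu>\<close>.\<close>

lemma tdle_chart_mem: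
  assumes x: "subring_of_field x" "range const_ff \<subseteq> x" "chart \<mu> \<subseteq> x" "\<mu> \<noteq> 0" and h: "tdle (int n) h"
  shows "EV h / \<mu> ^ n \<in> x"
  using h
proof (induction rule: tdle_induct)
  case zero
  then show ?case using subring_0[OF x(1)] by (simp add: EV_hom)
next
  case (add p q)
  then show ?case using subring_add[OF x(1)] by (simp add: EV_hom add_divide_distrib)
next
  case (mono c i j)
  then have "n = i + j + (n - i - j)" by simp
  then have "\<mu> ^ n = \<mu> ^ i * \<mu> ^ j * \<mu> ^ (n - i - j)" by (metis power_add)
  then have "EV (mono2 c i j) / \<mu> ^ n = const_ff c * (u / \<mu>) ^ i * (v / \<mu>) ^ j * inverse \<mu> ^ (n - i - j)"
    using x(4) by (simp add: EV_mono2 power_divide power_inverse field_simps)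
  also have "... \<in> x" using x chart_mem[OF x(3)] by (intro subring_mult[OF x(1)] subring_power[OF x(1)]) auto
  finally show ?case .
qed

lemma EV_mem:
  assumes x: "subring_of_field x" "range const_ff \<subseteq> x" "chart 1 \<subseteq> x"
  shows "EV h \<in> x"
proof -
  obtain n where "tdle (int n) h" using tdle_exists by blast
  from tdle_chart_mem[OF x _ this] show ?thesis by simp
qed

definition types :: "'k ff set" where "types = {1, u, v}"

lemma types_nonzero: "\<mu> \<in> types \<Longrightarrow> \<mu> \<noteq> 0"
  using u_nonzero v_nonzero by (auto simp: types_def)

lemma types_l: "\<mu> \<in> types \<Longrightarrow> \<exists>a. \<mu> = l a / l 3"
  using l_nonzero by (auto simp: types_def u_def v_def intro: exI[of _ 3])

lemma types_in_chart: "\<mu> \<in> types \<Longrightarrow> \<mu>' \<in> types \<Longrightarrow> \<mu>' / \<mu> \<in> chart \<mu>"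
  by (auto simp: types_def chart_def)

lemma lam_chart:
  assumes x: "subring_of_field x" "range const_ff \<subseteq> x" "chart \<mu> \<subseteq> x"
  shows "lam i / \<mu> \<in> x"
proof -
  have "lam i / \<mu> = const_ff (N $ i $ 3) * inverse \<mu> + const_ff (N $ i $ 1) * (u / \<mu>) + const_ff (N $ i $ 2) * (v / \<mu>)"
    by (simp add: lam_eq divide_inverse algebra_simps)
  also have "... \<in> x" using x chart_mem[OF x(3)] by (intro subring_add[OF x(1)] subring_mult[OF x(1)]) auto
  finally show ?thesis .
qed

lemma type_lam_mem:
  assumes x: "subring_of_field x" "range const_ff \<subseteq> x" and c: "\<And>k. lam k / \<rho> \<in> x" and \<mu>: "\<mu> \<in> types"
  shows "\<mu> / \<rho> \<in> x"
proof -
  obtain a where a: "\<mu> = l a / l 3" using types_l[OF \<mu>] by blast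
  have "\<mu> / \<rho> = (\<Sum>k\<in>UNIV. const_ff (A $ a $ k) * (lam k / \<rho>))"
    unfolding a lam_sum[symmetric] by (simp add: sum_divide_distrib)
  also have "... \<in> x" using x c by (intro subring_sum[OF x(1)] subring_mult[OF x(1)]) auto
  finally show ?thesis .
qed

lemma chart_ring_subset:
  assumes x: "subring_of_field x" "range const_ff \<subseteq> x"
  shows "chart_ring j \<subseteq> x \<longleftrightarrow> (\<forall>i. lam i / lam j \<in> x)"
  unfolding chart_ring_def subalgebra_gen_subset[OF x] by (auto simp: coord_ratio)

text \<open>The blow-up is defined with the old standard charts, the computations use the new ones.
  At a point lying over both, the two dehomogenizing linear forms differ by a unit.\<close>

lemma unit_lam:
  assumes x: "loc_pt x" "chart \<mu> \<subseteq> x" "\<mu> \<in> types" and j: "chart_ring j \<subseteq> x"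
  shows "unit_in x (lam j / \<mu>)"
proof -
  have s: "subring_of_field x" "range const_ff \<subseteq> x" using x by (auto simp: loc_pt_def local_subringD)
  have "lam j / \<mu> \<in> x" by (rule lam_chart[OF s x(2)])
  moreover have "\<mu> / lam j \<in> x"
    using j chart_ring_subset[OF s] by (intro type_lam_mem[OF s _ x(3)]) auto
  ultimately show ?thesis using lam_nonzero types_nonzero[OF x(3)] by (auto simp: unit_in_def)
qed

text \<open>A row of \<open>A\<close> expresses 1 as a constant combination of the quotients
  \<open>lam k / \<mu>\<close>, so in a local ring one of these quotients is a unit.\<close>

lemma ex_unit_lam:
  assumes x: "loc_pt x" "chart \<mu> \<subseteq> x" "\<mu> \<in> types"
  obtains j where "chart_ring j \<subseteq> x"
proof -
  have s: "subring_of_field x" "range const_ff \<subseteq> x" and lx: "local_subring x" using x by (auto simp: loc_pt_def local_subringD)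
  obtain a where a: "\<mu> = l a / l 3" using types_l[OF x(3)] by blast
  have "(\<Sum>k\<in>UNIV. const_ff (A $ a $ k) * (lam k / \<mu>)) = (\<Sum>k\<in>UNIV. const_ff (A $ a $ k) * lam k) / \<mu>"
    by (simp add: sum_divide_distrib)
  also have "... = 1" using types_nonzero[OF x(3)] by (simp add: lam_sum a)
  finally have 1: "unit_in x (\<Sum>k\<in>UNIV. const_ff (A $ a $ k) * (lam k / \<mu>))" using unit_in_1[OF s(1)] by simp
  have m: "const_ff (A $ a $ k) * (lam k / \<mu>) \<in> x" for k
    using s lam_chart[OF s x(2)] by (intro subring_mult[OF s(1)]) auto
  obtain j where "unit_in x (const_ff (A $ a $ j) * (lam j / \<mu>))"
    using local_subring_sum[OF lx _ m 1] by auto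
  then have "unit_in x (lam j / \<mu>)"
    using unit_in_factor[OF s(1), of "lam j / \<mu>" "const_ff (A $ a $ j)"] s lam_chart[OF s x(2)]
    by (auto simp: mult.commute)
  then have "\<mu> / lam j \<in> x" using unit_in_inverse_mem by fastforce
  then have "(lam i / \<mu>) * (\<mu> / lam j) \<in> x" for i using subring_mult[OF s(1) lam_chart[OF s x(2)]] by blast
  then have "chart_ring j \<subseteq> x" using types_nonzero[OF x(3)] by (simp add: chart_ring_subset[OF s])
  then show thesis using that by blast
qed

subsection \<open>The ideal of the points\<close>

definition van :: "nat set \<Rightarrow> 'k poly poly \<Rightarrow> bool" where
  "van S h \<longleftrightarrow> (\<forall>i\<in>S. ev2 (\<lambda>x. x) (up i) (vp i) h = 0)"

lemma van_mult: "van S h \<Longrightarrow> van S (k * h)" "van S h \<Longrightarrow> van S (h * k)"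
  by (simp_all add: van_def rhom.mult[OF rhom.rhom_ev2[OF rhom_id]])

lemma id_eq: "(id :: 'a \<Rightarrow> 'a) = (\<lambda>x. x)" by auto

definition dehom :: "'k poly3 \<Rightarrow> 'k poly poly" where
  "dehom f = eval_poly3 (\<lambda>c. [:[:c:]:]) (\<chi> i. lamP i) f"

lemma eval_coord:
  assumes "is_form n f"
  shows "eval_poly3 const_ff coord f / coord $ j ^ n = EV (dehom f) / lam j ^ n"
proof -
  have "coord = (\<chi> i. l 3 * (\<chi> i. lam i) $ i)" by (simp add: vec_eq_iff coord_lam)
  then have "eval_poly3 const_ff coord f = l 3 ^ n * eval_poly3 const_ff (\<chi> i. lam i) f"
    using eval_poly3_scale[OF assms, of const_ff "l 3" "\<chi> i. lam i"] by simp
  also have "eval_poly3 const_ff (\<chi> i. lam i) f = EV (dehom f)"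
    by (simp add: dehom_def ev2_eval_poly3[OF rhom_const_ff] lam_def)
  finally show ?thesis using l_nonzero[of 3] by (simp add: coord_lam power_mult_distrib)
qed

lemma eval_coord_chart_ring:
  fixes f :: "'k poly3"
  assumes "is_form n f"
  shows "eval_poly3 const_ff coord f / coord $ j ^ n \<in> chart_ring j"
proof -
  have c: "(coord :: 'k ff ^ 3) = (\<chi> i. coord $ j * (\<chi> i. coord $ i / coord $ j) $ i)"
  proof -
    have "coord $ j \<noteq> (0 :: 'k ff)" unfolding coord_lam using lam_nonzero l_nonzero by simp
    then show ?thesis by (simp add: vec_eq_iff)
  qed
  have "eval_poly3 const_ff coord f = coord $ j ^ n * eval_poly3 const_ff (\<chi> i. coord $ i / coord $ j) f"
    using eval_poly3_scale[OF assms, of const_ff "coord $ j" "\<chi> i. coord $ i / coord $ j"] unfolding c[symmetric] .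
  then have "eval_poly3 const_ff coord f / coord $ j ^ n = eval_poly3 const_ff (\<chi> i. coord $ i / coord $ j) f"
    using lam_nonzero[of j] l_nonzero[of 3] by (simp add: coord_lam)
  also have "... \<in> chart_ring j" unfolding eval_poly3_def chart_ring_def
    by (intro subring_sum subring_mult subring_prod subring_power subring_subalgebra_gen const_subalgebra_gen
        subsetD[OF subalgebra_gen_super]) (simp only: vec_lambda_beta, rule rangeI)
  finally show ?thesis .
qed

lemma point_coord:
  assumes "i < e"
  shows "p i = (\<chi> k. (A *v p i) $ 3 * (\<chi> k. ev2 (\<lambda>x. x) (up i) (vp i) (lamP k)) $ k)"
proof -
  note r = rhom.rhom_evalp[OF rhom_id, of "up i"]
  have "p i $ k = (A *v p i) $ 3 * (N $ k $ 3 + N $ k $ 1 * up i + N $ k $ 2 * vp i)" for k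
  proof -
    have "p i = N *v (A *v p i)" by (simp add: matrix_vector_mul_assoc NA)
    then have "p i $ k = (N *v (A *v p i)) $ k" by simp
    also have "... = (\<Sum>a\<in>UNIV. N $ k $ a * (A *v p i) $ a)" by (simp only: matrix_vector_mult_def vec_lambda_beta)
    finally have "p i $ k = (\<Sum>a\<in>UNIV. N $ k $ a * (A *v p i) $ a)" .
    then show ?thesis using infinity[OF assms] by (simp add: sum_3 up_def vp_def field_simps)
  qed
  moreover have "ev2 (\<lambda>x. x) (up i) (vp i) (lamP k) = N $ k $ 3 + N $ k $ 1 * up i + N $ k $ 2 * vp i" for k
    by (simp add: lamP_def rhom.evalp_pCons[OF r] rhom.evalp_0[OF r] evalp_id algebra_simps)
  ultimately show ?thesis by (simp add: vec_eq_iff)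
qed

lemma chart_ideal_pointsE:
  assumes b: "b \<in> chart_ideal (points_ideal (p ` S)) j" and S: "S \<subseteq> {..<e}"
  obtains h n where "van S h" "b = EV h / lam j ^ n" "b \<in> chart_ring j"
proof -
  obtain f n where f: "b = eval_poly3 const_ff coord f / coord $ j ^ n" "f \<in> points_ideal (p ` S)" "is_form n f"
    using b by (auto simp: chart_ideal_def)
  have "ev2 (\<lambda>x. x) (up i) (vp i) (dehom f) = 0" if "i \<in> S" for i
  proof -
    have i: "i < e" using that S by auto
    have "ev2 (\<lambda>x. x) (up i) (vp i) (dehom f) = eval_poly3 (\<lambda>x. x) (\<chi> k. ev2 (\<lambda>x. x) (up i) (vp i) (lamP k)) f"
      by (simp add: dehom_def ev2_eval_poly3[OF rhom_id])
    moreover have "eval_poly3 id (p i) f = 0" using points_ideal_vanishes[OF f(2)] that by auto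
    then have "(A *v p i) $ 3 ^ n * eval_poly3 (\<lambda>x. x) (\<chi> k. ev2 (\<lambda>x. x) (up i) (vp i) (lamP k)) f = 0"
      unfolding eval_poly3_scale[OF f(3), symmetric] point_coord[OF i, symmetric] id_eq .
    ultimately show ?thesis using infinity[OF i] by simp
  qed
  then have "van S (dehom f)" by (simp add: van_def)
  then show thesis using that f eval_coord[OF f(3), of j] eval_coord_chart_ring[OF f(3), of j] by metis
qed

lemma eval_linear_coord: "eval_poly3 const_ff coord (linear_form (A $ a)) = l a"
  by (simp add: eval_linear_form[OF rhom_const_ff] l_def)

lemma chart_ideal_pointsI:
  assumes h: "van S h" "tdle (int n) h" and S: "S \<subseteq> {..<e}"
  shows "EV h / lam j ^ n \<in> chart_ideal (points_ideal (p ` S)) j"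
proof -
  define f where "f = homogenize (A $ 3) (A $ 1) (A $ 2) n h"
  have form: "is_form n f" unfolding f_def by (rule is_form_homogenize[OF h(2)])
  have "eval_poly3 const_ff coord f = l 3 ^ n * EV h"
    unfolding f_def u_def v_def
    by (rule eval_homogenize[OF rhom_const_ff h(2)]) (simp_all add: eval_linear_coord l_nonzero)
  then have "EV h / lam j ^ n = eval_poly3 const_ff coord f / coord $ j ^ n"
    using l_nonzero[of 3] by (simp add: coord_lam power_mult_distrib)
  moreover have "eval_poly3 id w f = 0" if "w \<in> p ` S" for w
  proof -
    from that S obtain i where i: "i \<in> S" "w = p i" "i < e" by auto
    have lin: "eval_poly3 (\<lambda>x. x) (p i) (linear_form (A $ a)) = (A *v p i) $ a" for a
      by (simp add: eval_linear_form[OF rhom_id] matrix_vector_mult_def)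
    have "eval_poly3 (\<lambda>x. x) (p i) f = (A *v p i) $ 3 ^ n * ev2 (\<lambda>x. x) (up i) (vp i) h"
      unfolding f_def up_def vp_def
      by (rule eval_homogenize[OF rhom_id h(2)]) (use infinity[OF i(3)] in \<open>simp_all add: lin\<close>)
    then show ?thesis using h(1) i by (simp add: van_def id_eq)
  qed
  ultimately show ?thesis
    unfolding chart_ideal_def using form points_idealI[OF form, of "p ` S"] by blast
qed

text \<open>Divide \<open>h\<close> by \<open>v - \<psi>(u)\<close>. The remainder
  \<open>h(u, \<psi>(u))\<close> is a polynomial in u alone that vanishes at the distinct values
  \<open>u\<^sub>i\<close>, hence is divisible by the product of the linear factors.\<close>

lemma van_complete_intersection:
  assumes S: "S \<subseteq> {..<e}" and \<psi>: "\<And>i. i \<in> S \<Longrightarrow> poly \<psi> (up i) = vp i" and h: "van S h"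
  obtains a b where "h = a * [:- \<psi>, 1:] + b * [:\<Prod>i\<in>S. [:- up i, 1:]:]"
proof -
  have inj: "inj_on up S" using distinct S unfolding up_def[abs_def] by (rule inj_on_subset)
  have "poly (poly h \<psi>) (up i) = 0" if "i \<in> S" for i
    using h that \<psi>[OF that] ev2_id_poly[of "up i" \<psi> h] by (simp add: van_def)
  then have "(\<Prod>i\<in>S. [:- up i, 1:]) dvd poly h \<psi>"
    using S inj by (intro prod_linear_dvd) (auto intro: finite_subset)
  then obtain q where q: "poly h \<psi> = (\<Prod>i\<in>S. [:- up i, 1:]) * q" by (elim dvdE)
  have "h = [:- \<psi>, 1:] * synthetic_div h \<psi> + [:poly h \<psi>:]" by (rule synthetic_div_correct'[symmetric])
  also have "[:poly h \<psi>:] = [:q:] * [:\<Prod>i\<in>S. [:- up i, 1:]:]" by (simp add: q mult.commute)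
  finally show thesis using that[of "synthetic_div h \<psi>" "[:q:]"] by (simp only: mult.commute)
qed

lemma van_fP: "(\<And>i. i \<in> S \<Longrightarrow> poly \<psi> (up i) = vp i) \<Longrightarrow> van S [:- \<psi>, 1:]"
  unfolding van_def
proof
  fix i assume "\<And>i. i \<in> S \<Longrightarrow> poly \<psi> (up i) = vp i" "i \<in> S"
  then show "ev2 (\<lambda>x. x) (up i) (vp i) [:- \<psi>, 1:] = 0"
    using ev2_id_poly[of "up i" \<psi> "[:- \<psi>, 1:]"] by simp
qed

lemma van_gP: "finite S \<Longrightarrow> van S [:\<Prod>i\<in>S. [:- up i, 1:]:]"
  by (auto simp: van_def rhom.evalp_pCons[OF rhom.rhom_evalp[OF rhom_id]] rhom.evalp_0[OF rhom.rhom_evalp[OF rhom_id]]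
      evalp_id poly_prod)

end

text \<open>Determinants of the tridiagonal matrices with v on the diagonal and off-diagonal
  products u. Up to sign they are the entries of the kernel vector of the banded matrix that starts
  with 0, 1.\<close>

fun continuant :: "nat \<Rightarrow> 'k::comm_ring_1 poly poly" where
  "continuant 0 = 1"
| "continuant (Suc 0) = mono2 1 0 1"
| "continuant (Suc (Suc k)) = mono2 1 0 1 * continuant (Suc k) - mono2 1 1 0 * continuant k"

lemma vtop_V: "vtop 1 (mono2 1 0 1)" and utop_U: "utop 1 (mono2 1 1 0)"
  by (simp_all add: vtop_def utop_def tdle_0)

text \<open>The subtracted term has degree only \<open>k + 1\<close>, so the leading form
  \<open>v^(k+2)\<close> survives the recursion.\<close>

lemma vtop_continuant: "vtop k (continuant k :: 'k::comm_ring_1 poly poly)"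
proof (induction k rule: continuant.induct)
  case (3 k)
  have 1: "vtop (1 + Suc k) (mono2 1 0 1 * continuant (Suc k) :: 'k poly poly)" using vtop_mult[OF vtop_V 3(1)] by simp
  have "tdle (1 + int k) (mono2 1 1 0 * continuant k :: 'k poly poly)" by (intro tdle_mult tdle_mono2 vtop_tdle 3) simp
  moreover have "tdle (1 + int k) (mono2 1 0 1 * continuant (Suc k) - mono2 1 0 (Suc (Suc k)) :: 'k poly poly)"
    using 1 by (simp add: vtop_def)
  ultimately have "tdle (1 + int k) (mono2 1 0 1 * continuant (Suc k) - mono2 1 0 (Suc (Suc k)) - mono2 1 1 0 * continuant k :: 'k poly poly)"
    by (rule tdle_diff[rotated])
  then show ?case by (simp add: vtop_def diff_diff_eq add.commute)
qed (simp_all add: vtop_1 vtop_V[simplified])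

lemma utop_linear: "utop 1 (mono2 1 1 0 - mono2 a 0 0)" and vtop_linear: "vtop 1 (mono2 1 0 1 - mono2 a 0 0)"
  by (simp_all add: utop_def vtop_def tdle_uminus tdle_mono2)

section \<open>The four affine charts of the blow-up\<close>

context plane_points
begin

definition I :: "'k poly3 set" where "I = points_ideal (p ` {..<e})"
definition X :: "'k ff set set" where "X = blowup_plane I"

definition gp :: "'k poly" where "gp = (\<Prod>i<e. [:- up i, 1:])"
definition gP :: "'k poly poly" where "gP = [:gp:]"
definition fP :: "'k poly poly" where "fP = [:- \<phi>, 1:]"
definition f :: "'k ff" where "f = EV fP"
definition g :: "'k ff" where "g = EV gP"
text \<open>\<open>gP\<close> makes the curve pass through all the points. The extra factor
  \<open>U\<close> makes \<open>1 / u\<close> a fraction with denominator \<open>g1P\<close>, and it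
  keeps the degree positive when there are no points.\<close>

definition g1P :: "'k poly poly" where "g1P = U * gP"
definition m1 :: nat where "m1 = Suc e"
text \<open>\<open>V\<close> plays the role of \<open>U\<close> in \<open>g1P\<close>. The linear
  factors vanish at the points, even if several points share a v-coordinate, and the continuants are
  included in order to become invertible on the chart \<open>Y2\<close>.\<close>

definition g2P :: "'k poly poly" where
  "g2P = V * (\<Prod>i<e. V - mono2 (vp i) 0 0) * (\<Prod>k<d. continuant k)"
definition m2 :: nat where "m2 = Suc e + (\<Sum>k<d. k)"
definition \<gamma>1 :: "'k ff" where "\<gamma>1 = EV g1P / u ^ m1"
definition \<gamma>2 :: "'k ff" where "\<gamma>2 = EV g2P / v ^ m2"

lemma gP_prod: "gP = (\<Prod>i<e. U - mono2 (up i) 0 0)"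
proof -
  have "[:prod h S:] = (\<Prod>i\<in>S. [:h i:])" for h :: "nat \<Rightarrow> 'k poly" and S
  proof (induction S rule: infinite_finite_induct)
    case (insert i S)
    have "[:h i * prod h S:] = [:h i:] * [:prod h S:]" by simp
    then show ?case using insert by (simp only: prod.insert[OF insert.hyps(1,2)])
  qed (simp_all add: one_pCons)
  moreover have "[:[:- a, 1:]:] = U - mono2 a 0 0" for a :: 'k
    by (simp add: mono2_def monom_altdef one_pCons)
  ultimately show ?thesis by (simp add: gP_def gp_def)
qed

lemma utop_g1P: "utop m1 g1P"
proof -
  have "utop (1 + (\<Sum>i<e. 1)) g1P"
    unfolding g1P_def gP_prod by (intro utop_mult utop_U utop_prod utop_linear)
  then show ?thesis by (simp add: m1_def)
qed

lemma vtop_g2P: "vtop m2 g2P"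
proof -
  have "vtop (1 + (\<Sum>i<e. 1) + (\<Sum>k<d. k)) g2P"
    unfolding g2P_def by (intro vtop_mult vtop_V vtop_prod vtop_linear vtop_continuant)
  then show ?thesis by (simp add: m2_def)
qed

lemma interp': "i \<in> {..<e} \<Longrightarrow> poly \<phi> (up i) = vp i"
  using interp by (simp add: up_def vp_def)

lemma van_f: "van {..<e} fP" and van_g: "van {..<e} gP"
  unfolding fP_def gP_def gp_def by (rule van_fP[OF interp'] van_gP; simp)+

lemma van_g1P: "van {..<e} g1P"
  unfolding g1P_def by (rule van_mult(1)[OF van_g])

lemma van_g2P: "van {..<e} g2P"
  unfolding van_def
proof
  fix i assume i: "i \<in> {..<e}"
  note r = rhom.rhom_ev2[OF rhom_id, of "up i" "vp i"]
  have "(\<Prod>j<e. ev2 (\<lambda>x. x) (up i) (vp i) (V - mono2 (vp j) 0 0)) = 0"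
    using i by (intro prod_zero) (auto simp: rhom.minus[OF r] rhom.ev2_mono2[OF rhom_id] intro!: bexI[of _ i])
  then show "ev2 (\<lambda>x. x) (up i) (vp i) g2P = 0"
    by (simp add: g2P_def rhom.mult[OF r] rhom.prod[OF r])
qed

lemma van_fg: assumes "van {..<e} h" obtains a b where "h = a * fP + b * gP"
  using van_complete_intersection[OF order_refl interp' assms] unfolding fP_def gP_def gp_def by blast

lemma fP_nonzero: "fP \<noteq> 0" and gP_nonzero: "gP \<noteq> 0"
  by (simp add: fP_def) (simp add: gP_def gp_def)

lemma f_nonzero: "f \<noteq> 0" and g_nonzero: "g \<noteq> 0"
  using fP_nonzero gP_nonzero by (auto simp: f_def g_def EV_eq_0)

lemma types_memb [simp]: "1 \<in> types" "u \<in> types" "v \<in> types"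
  by (simp_all add: types_def)

lemma Spec_gen_subset: "x \<in> Spec_rings (subalgebra_gen G) \<Longrightarrow> G \<subseteq> x"
  by (rule subset_trans[OF subalgebra_gen_super Spec_rings_super[OF subring_subalgebra_gen]])

lemma blowup_chartE:
  assumes "x \<in> X"
  obtains j a where "x \<in> Spec_rings (subalgebra_gen (chart_ring j \<union> {b / a | b. b \<in> chart_ideal I j}))"
    "a \<in> chart_ideal I j" "a \<noteq> 0" "chart_ring j \<subseteq> x" "loc_pt x" "\<And>b. b \<in> chart_ideal I j \<Longrightarrow> b / a \<in> x"
proof -
  obtain j a where *: "x \<in> Spec_rings (subalgebra_gen (chart_ring j \<union> {b / a | b. b \<in> chart_ideal I j}))"
    "a \<in> chart_ideal I j" "a \<noteq> 0"
    using assms unfolding X_def blowup_plane_def by (elim UN_E DiffE) (rule that, auto)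
  have "chart_ring j \<union> {b / a | b. b \<in> chart_ideal I j} \<subseteq> x"
    by (rule Spec_gen_subset[OF *(1)])
  then have 1: "chart_ring j \<subseteq> x" and 2: "{b / a | b. b \<in> chart_ideal I j} \<subseteq> x" unfolding Un_subset_iff by simp_all
  show thesis by (rule that[OF * 1 loc_pt_Spec_rings[OF *(1)]]) (rule subsetD[OF 2], blast)
qed

lemma loc_ptD: "loc_pt x \<Longrightarrow> subring_of_field x" "loc_pt x \<Longrightarrow> range const_ff \<subseteq> x" "loc_pt x \<Longrightarrow> local_subring x"
  by (auto simp: loc_pt_def local_subringD)

lemma X_loc_pt: "x \<in> X \<Longrightarrow> loc_pt x"
  by (elim blowup_chartE)

lemma const_subring: "range const_ff \<subseteq> subalgebra_gen G"
  using const_subalgebra_gen by auto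

text \<open>Expanding \<open>lam j / lam j = 1\<close> in terms of 1, u, v over \<open>lam j\<close>
  shows that one of these three quotients is a unit; it selects the chart.\<close>

lemma X_type:
  assumes "x \<in> X"
  obtains \<mu> where "\<mu> \<in> types" "chart \<mu> \<subseteq> x"
proof -
  obtain j where j: "chart_ring j \<subseteq> x" and x: "loc_pt x" by (rule blowup_chartE[OF assms])
  note s = loc_ptD[OF x]
  have lam: "lam k / lam j \<in> x" for k using j chart_ring_subset[OF s(1,2)] by blast
  have m: "\<mu> / lam j \<in> x" if "\<mu> \<in> types" for \<mu> by (rule type_lam_mem[OF s(1,2) lam that])
  have "lam j / lam j = const_ff (N $ j $ 3) * (1 / lam j) + (const_ff (N $ j $ 1) * (u / lam j) + const_ff (N $ j $ 2) * (v / lam j))"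
    by (subst (1) lam_eq) (simp add: add_divide_distrib)
  then have "unit_in x (const_ff (N $ j $ 3) * (1 / lam j) + (const_ff (N $ j $ 1) * (u / lam j) + const_ff (N $ j $ 2) * (v / lam j)))"
    using lam_nonzero[of j] unit_in_1[OF s(1)] by simp
  moreover have c: "const_ff c * (\<mu> / lam j) \<in> x" if "\<mu> \<in> types" for c \<mu>
    using s m[OF that] by (intro subring_mult[OF s(1)]) auto
  ultimately have "\<exists>c \<mu>. \<mu> \<in> types \<and> unit_in x (const_ff c * (\<mu> / lam j))"
    using local_subring_add[OF s(3)] subring_add[OF s(1) c c] c types_memb by metis
  then obtain c \<mu> where \<mu>: "\<mu> \<in> types" "unit_in x (const_ff c * (\<mu> / lam j))" by blast
  have "unit_in x (\<mu> / lam j)"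
    using unit_in_factor[OF s(1), of "\<mu> / lam j" "const_ff c"] \<mu> m s(2) by (auto simp: mult.commute)
  then have "lam j / \<mu> \<in> x" using unit_in_inverse_mem by fastforce
  then have "(\<mu>' / lam j) * (lam j / \<mu>) \<in> x" if "\<mu>' \<in> types" for \<mu>'
    using subring_mult[OF s(1) m[OF that]] by blast
  then have "\<mu>' / \<mu> \<in> x" if "\<mu>' \<in> types" for \<mu>' using that lam_nonzero[of j] by simp
  then have "chart \<mu> \<subseteq> x" by (auto simp: chart_def)
  then show thesis using that \<mu> by blast
qed

lemma chart_ring_over:
  assumes S: "subring_of_field S" "range const_ff \<subseteq> S" "chart \<mu> \<subseteq> S" "S \<subseteq> x"
    and inv: "\<And>y. y \<in> S \<Longrightarrow> unit_in x y \<Longrightarrow> inverse y \<in> S"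
    and x: "loc_pt x" "\<mu> \<in> types" "chart_ring j \<subseteq> x"
  shows "chart_ring j \<subseteq> S" "\<mu> / lam j \<in> S"
proof -
  have u: "unit_in x (lam j / \<mu>)" using S by (intro unit_lam x) auto
  have lS: "lam i / \<mu> \<in> S" for i by (rule lam_chart[OF S(1-3)])
  show 1: "\<mu> / lam j \<in> S" using inv[OF lS u] by simp
  have "lam i / lam j \<in> S" for i
    using subring_mult[OF S(1) lS[of i] 1] types_nonzero[OF x(2)] by simp
  then show "chart_ring j \<subseteq> S" by (simp add: chart_ring_subset[OF S(1,2)])
qed

text \<open>\<open>\<rho>\<close> is to replace the generator \<open>a\<close> of the ideal of the
  points: every ideal element is divisible by it, and some element is a unit multiple of it. Hence
  \<open>a / \<rho>\<close> is a unit, and quotients by \<open>a\<close> become quotients by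
  \<open>\<rho>\<close>.\<close>

lemma X_to_chart:
  assumes x: "x \<in> X" "chart \<mu> \<subseteq> x" "\<mu> \<in> types" and E: "E \<subseteq> x"
    and \<rho>: "\<And>j S b. subring_of_field S \<Longrightarrow> range const_ff \<subseteq> S \<Longrightarrow> chart \<mu> \<union> E \<subseteq> S \<Longrightarrow> chart_ring j \<subseteq> S \<Longrightarrow>
        \<mu> / lam j \<in> S \<Longrightarrow> b \<in> chart_ideal I j \<Longrightarrow> b / \<rho> \<in> S"
    and b0: "\<And>j. chart_ring j \<subseteq> x \<Longrightarrow> \<exists>b\<in>chart_ideal I j. unit_in x (b / \<rho>)" and "\<rho> \<noteq> 0"
  shows "x \<in> Spec_rings (subalgebra_gen (chart \<mu> \<union> E))"
proof -
  obtain j a where j: "x \<in> Spec_rings (subalgebra_gen (chart_ring j \<union> {b / a | b. b \<in> chart_ideal I j}))"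
    "a \<in> chart_ideal I j" "a \<noteq> 0" "chart_ring j \<subseteq> x" "loc_pt x" "\<And>b. b \<in> chart_ideal I j \<Longrightarrow> b / a \<in> x"
    by (rule blowup_chartE[OF x(1)]) (rule that)
  note s = loc_ptD[OF j(5)]
  have cE: "chart \<mu> \<union> E \<subseteq> x" using x E by auto
  show ?thesis
  proof (rule Spec_rings_transfer[OF subring_subalgebra_gen j(1) subring_subalgebra_gen])
    show "subalgebra_gen (chart \<mu> \<union> E) \<subseteq> x" using cE by (simp add: subalgebra_gen_subset[OF s(1,2)])
    fix S assume S: "subring_of_field S" "subalgebra_gen (chart \<mu> \<union> E) \<subseteq> S" "S \<subseteq> x"
      and inv: "\<And>y. y \<in> S \<Longrightarrow> unit_in x y \<Longrightarrow> inverse y \<in> S"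
    have cS: "range const_ff \<subseteq> S" using S(2) const_subring by blast
    have ES: "chart \<mu> \<union> E \<subseteq> S" by (rule subset_trans[OF subalgebra_gen_super S(2)])
    note over = chart_ring_over[OF S(1) cS _ S(3) inv j(5) x(3) j(4)]
    have jS: "chart_ring j \<subseteq> S" "\<mu> / lam j \<in> S" using over ES by auto
    have \<rho>S: "b / \<rho> \<in> S" if "b \<in> chart_ideal I j" for b
      using \<rho>[OF S(1) cS ES jS that] .
    obtain b0 where b0: "b0 \<in> chart_ideal I j" "unit_in x (b0 / \<rho>)" using b0[OF j(4)] by blast
    have "(a / \<rho>) * (b0 / a) = b0 / \<rho>" using j(3) by simp
    then have au: "unit_in x (a / \<rho>)"
      using unit_in_factor[OF s(1), of "a / \<rho>" "b0 / a"] b0 j(6)[OF b0(1)] \<rho>S[OF j(2)] S(3) by auto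
    have "b / a \<in> S" if "b \<in> chart_ideal I j" for b
    proof -
      have "(b / \<rho>) * inverse (a / \<rho>) \<in> S" using inv[OF \<rho>S[OF j(2)] au] \<rho>S[OF that] by (intro subring_mult[OF S(1)])
      then show ?thesis using \<open>\<rho> \<noteq> 0\<close> by (simp add: field_simps)
    qed
    then show "subalgebra_gen (chart_ring j \<union> {b / a | b. b \<in> chart_ideal I j}) \<subseteq> S"
      using jS by (subst subalgebra_gen_subset[OF S(1) cS]) auto
  qed
qed

text \<open>Converse direction: a local ring of a candidate chart is a point of \<open>X\<close>
  once some \<open>a\<close> generates the ideal of the points there and the extra generators
  \<open>E\<close> are quotients by \<open>a\<close>.\<close>

lemma X_from_chart:
  assumes x: "x \<in> Spec_rings (subalgebra_gen (chart \<mu> \<union> E))" "\<mu> \<in> types" "chart_ring j \<subseteq> x"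
    and a: "a \<in> chart_ideal I j" "a \<noteq> 0" "\<And>b. b \<in> chart_ideal I j \<Longrightarrow> b / a \<in> x"
    and E: "\<And>\<epsilon>. \<epsilon> \<in> E \<Longrightarrow> \<exists>b\<in>chart_ideal I j. \<epsilon> = b / a"
  shows "x \<in> X"
proof -
  note lx = loc_pt_Spec_rings[OF x(1)]
  note s = loc_ptD[OF lx]
  let ?G = "chart_ring j \<union> {b / a | b. b \<in> chart_ideal I j}"
  have cx: "chart \<mu> \<union> E \<subseteq> x"
    by (rule Spec_gen_subset[OF x(1)])
  have "x \<in> Spec_rings (subalgebra_gen ?G)"
  proof (rule Spec_rings_transfer[OF subring_subalgebra_gen x(1) subring_subalgebra_gen])
    show "subalgebra_gen ?G \<subseteq> x" using x(3) a(3) by (subst subalgebra_gen_subset[OF s(1,2)]) auto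
    fix S assume S: "subring_of_field S" "subalgebra_gen ?G \<subseteq> S" "S \<subseteq> x"
      and inv: "\<And>y. y \<in> S \<Longrightarrow> unit_in x y \<Longrightarrow> inverse y \<in> S"
    have cS: "range const_ff \<subseteq> S" using S(2) const_subring by blast
    have GS: "?G \<subseteq> S" by (rule subset_trans[OF subalgebra_gen_super S(2)])
    have lam: "lam k / lam j \<in> S" for k using GS chart_ring_subset[OF S(1) cS, of j] by auto
    have m: "\<mu>' / lam j \<in> S" if "\<mu>' \<in> types" for \<mu>' by (rule type_lam_mem[OF S(1) cS lam that])
    have "unit_in x (lam j / \<mu>)" using cx by (intro unit_lam lx x) auto
    then have "unit_in x (\<mu> / lam j)" using unit_in_inverse by fastforce
    then have "lam j / \<mu> \<in> S" using inv[OF m[OF x(2)]] by simp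
    then have "(\<mu>' / lam j) * (lam j / \<mu>) \<in> S" if "\<mu>' \<in> types" for \<mu>' using subring_mult[OF S(1) m[OF that]] by blast
    then have "\<mu>' / \<mu> \<in> S" if "\<mu>' \<in> types" for \<mu>' using that lam_nonzero[of j] by simp
    then have "chart \<mu> \<subseteq> S" by (auto simp: chart_def)
    moreover have "E \<subseteq> S" using E GS by blast
    ultimately show "subalgebra_gen (chart \<mu> \<union> E) \<subseteq> S" by (simp add: subalgebra_gen_subset[OF S(1) cS])
  qed
  then show ?thesis using a by (auto simp: X_def blowup_plane_def)
qed

lemma chart_idealE:
  assumes "b \<in> chart_ideal I j"
  obtains h n where "van {..<e} h" "b = EV h / lam j ^ n" "b \<in> chart_ring j"
  using chart_ideal_pointsE[OF assms[unfolded I_def] order_refl] by metis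

lemma chart_idealI: "van {..<e} h \<Longrightarrow> tdle (int n) h \<Longrightarrow> EV h / lam j ^ n \<in> chart_ideal I j"
  unfolding I_def by (rule chart_ideal_pointsI) auto

lemma chart_unit_form:
  assumes "chart_ring j \<subseteq> x" "loc_pt x" "chart \<mu> \<subseteq> x" "\<mu> \<in> types" "unit_in x (EV G / \<mu> ^ m)"
  shows "unit_in x (EV G / lam j ^ m)"
proof -
  note s = loc_ptD[OF assms(2)]
  have "unit_in x ((EV G / \<mu> ^ m) / (lam j / \<mu>) ^ m)"
    by (rule unit_in_divide[OF s(1) assms(5) unit_in_power[OF s(1) unit_lam[OF assms(2-4,1)]]])
  moreover have "(EV G / \<mu> ^ m) / (lam j / \<mu>) ^ m = EV G / lam j ^ m"
    using types_nonzero[OF assms(4)] by (simp add: power_divide)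
  ultimately show ?thesis by (simp only:)
qed

text \<open>Where a form vanishing at all the points is invertible, their ideal is the unit ideal.
  There the blow-up is just the plane, and \<open>\<rho> = 1\<close> works.\<close>

lemma X_chart:
  assumes x: "x \<in> X" "chart \<mu> \<subseteq> x" "\<mu> \<in> types" and G: "van {..<e} G" "tdle (int m) G" "unit_in x (EV G / \<mu> ^ m)"
  shows "x \<in> Spec_rings (subalgebra_gen (chart \<mu>))"
proof -
  have "x \<in> Spec_rings (subalgebra_gen (chart \<mu> \<union> {}))"
  proof (rule X_to_chart[OF x, of _ 1])
    fix j and S :: "'k ff set" and b assume "chart_ring j \<subseteq> S" "b \<in> chart_ideal I j"
    then show "b / 1 \<in> S" using chart_idealE[of b j] by (metis div_by_1 subsetD)
  next
    fix j assume "chart_ring j \<subseteq> x"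
    then show "\<exists>b\<in>chart_ideal I j. unit_in x (b / 1)"
      using chart_idealI[OF G(1,2), of j] chart_unit_form[OF _ X_loc_pt[OF x(1)] x(2,3) G(3)] by auto
  qed auto
  then show ?thesis by simp
qed

lemma chart_X:
  assumes x: "x \<in> Spec_rings (subalgebra_gen (chart \<mu>))" "\<mu> \<in> types"
    and G: "van {..<e} G" "tdle (int m) G" "unit_in x (EV G / \<mu> ^ m)"
  shows "x \<in> X"
proof -
  note lx = loc_pt_Spec_rings[OF x(1)]
  note s = loc_ptD[OF lx]
  have cx: "chart \<mu> \<subseteq> x"
    by (rule Spec_gen_subset[OF x(1)])
  obtain j where j: "chart_ring j \<subseteq> x" using ex_unit_lam[OF lx cx x(2)] .
  note ua = chart_unit_form[OF j lx cx x(2) G(3)]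
  show ?thesis
  proof (rule X_from_chart[of x \<mu> "{}" j])
    show "x \<in> Spec_rings (subalgebra_gen (chart \<mu> \<union> {}))" using x by simp
    show "EV G / lam j ^ m \<in> chart_ideal I j" by (rule chart_idealI[OF G(1,2)])
    show "EV G / lam j ^ m \<noteq> 0" using ua by (rule unit_in_nonzero)
    fix b assume "b \<in> chart_ideal I j"
    then have "b \<in> x" using chart_idealE[of b j] j by blast
    then show "b / (EV G / lam j ^ m) \<in> x" using ua by (rule unit_in_divide_mem[OF s(1)])
  qed (use x j in auto)
qed

text \<open>Lets the chart where \<open>f / g\<close> is regular and the chart where
  \<open>g / f\<close> is regular share one argument.\<close>

definition fgpair :: "'k poly poly \<Rightarrow> 'k poly poly \<Rightarrow> bool" where
  "fgpair P Q \<longleftrightarrow> (P = fP \<and> Q = gP) \<or> (P = gP \<and> Q = fP)"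

lemma fgpair_van: "fgpair P Q \<Longrightarrow> van {..<e} P" "fgpair P Q \<Longrightarrow> van {..<e} Q" "fgpair P Q \<Longrightarrow> EV P \<noteq> 0" "fgpair P Q \<Longrightarrow> EV Q \<noteq> 0"
  using van_f van_g f_nonzero g_nonzero by (auto simp: fgpair_def f_def g_def)

lemma van_pair: assumes "fgpair P Q" "van {..<e} h" obtains a b where "h = a * P + b * Q"
  using van_fg[OF assms(2)] assms(1) unfolding fgpair_def by (metis add.commute)

lemma pair_ideal_mem:
  assumes PQ: "fgpair P Q" and S: "subring_of_field S" "range const_ff \<subseteq> S" "chart 1 \<subseteq> S" "EV P / EV Q \<in> S" and h: "van {..<e} h"
  shows "EV h / EV Q \<in> S"
proof -
  obtain a b where "h = a * P + b * Q" using van_pair[OF PQ h] .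
  then have "EV h / EV Q = EV a * (EV P / EV Q) + EV b"
    using fgpair_van[OF PQ] by (simp add: EV_hom add_divide_distrib)
  also have "... \<in> S" using S EV_mem[OF S(1-3)] by (intro subring_add[OF S(1)] subring_mult[OF S(1)])
  finally show ?thesis .
qed

lemma lam_unit1: "loc_pt x \<Longrightarrow> chart 1 \<subseteq> x \<Longrightarrow> chart_ring j \<subseteq> x \<Longrightarrow> unit_in x (lam j)"
  using unit_lam[of x 1 j] by simp

lemma X_B_pair:
  assumes x: "x \<in> X" "chart 1 \<subseteq> x" and PQ: "fgpair P Q" "EV P / EV Q \<in> x"
  shows "x \<in> Spec_rings (subalgebra_gen (chart 1 \<union> {EV P / EV Q}))"
proof -
  note lx = X_loc_pt[OF x(1)] note s = loc_ptD[OF lx]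
  show ?thesis
  proof (rule X_to_chart[OF x _ _, of _ "EV Q"])
    fix j S b assume S: "subring_of_field S" "range const_ff \<subseteq> S" "chart 1 \<union> {EV P / EV Q} \<subseteq> S" "chart_ring j \<subseteq> S"
      "1 / lam j \<in> S" and b: "b \<in> chart_ideal I j"
    obtain h n where h: "van {..<e} h" "b = EV h / lam j ^ n" using chart_idealE[OF b] by metis
    have "b / EV Q = (EV h / EV Q) * (1 / lam j) ^ n" using h by (simp add: power_divide)
    also have "... \<in> S" using S pair_ideal_mem[OF PQ(1) S(1,2) _ _ h(1)]
      by (intro subring_mult[OF S(1)] subring_power[OF S(1)]) auto
    finally show "b / EV Q \<in> S" .
  next
    fix j assume j: "chart_ring j \<subseteq> x"
    obtain n where n: "tdle (int n) Q" using tdle_exists by blast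
    have "EV Q / lam j ^ n \<in> chart_ideal I j" using fgpair_van[OF PQ(1)] n by (intro chart_idealI)
    moreover have "unit_in x (inverse (lam j ^ n))"
      using lam_unit1[OF lx x(2) j] by (intro unit_in_inverse unit_in_power s)
    ultimately show "\<exists>b\<in>chart_ideal I j. unit_in x (b / EV Q)"
      using fgpair_van[OF PQ(1)] by (intro bexI[of _ "EV Q / lam j ^ n"]) (simp_all add: inverse_eq_divide)
  qed (use PQ fgpair_van[OF PQ(1)] in auto)
qed

lemma B_pair_X:
  assumes PQ: "fgpair P Q" and x: "x \<in> Spec_rings (subalgebra_gen (chart 1 \<union> {EV P / EV Q}))"
  shows "x \<in> X"
proof -
  note lx = loc_pt_Spec_rings[OF x]
  note s = loc_ptD[OF lx]
  have cx: "chart 1 \<subseteq> x" "EV P / EV Q \<in> x"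
    using Spec_gen_subset[OF x] by auto
  obtain j where j: "chart_ring j \<subseteq> x" using ex_unit_lam[OF lx cx(1)] types_memb by metis
  obtain n where n: "tdle (int n) P" "tdle (int n) Q"
    using tdle_exists[of P] tdle_exists[of Q] tdle_mono by (metis linorder_le_cases of_nat_mono)
  note lu = lam_unit1[OF lx cx(1) j]
  have nz: "EV Q \<noteq> 0" "lam j \<noteq> 0" using fgpair_van[OF PQ] lam_nonzero by auto
  show ?thesis
  proof (rule X_from_chart[OF x _ j])
    show "EV Q / lam j ^ n \<in> chart_ideal I j" using fgpair_van[OF PQ] n by (intro chart_idealI)
    show "EV Q / lam j ^ n \<noteq> 0" using nz by simp
    show "\<exists>b\<in>chart_ideal I j. \<epsilon> = b / (EV Q / lam j ^ n)" if "\<epsilon> \<in> {EV P / EV Q}" for \<epsilon>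
      using that fgpair_van[OF PQ] n nz by (intro bexI[of _ "EV P / lam j ^ n"] chart_idealI) auto
    fix b assume "b \<in> chart_ideal I j"
    then obtain h k where h: "van {..<e} h" "b = EV h / lam j ^ k" using chart_idealE by metis
    have "b / (EV Q / lam j ^ n) = (EV h / EV Q) * lam j ^ n / lam j ^ k" using nz h by (simp add: field_simps)
    also have "... \<in> x"
      by (rule unit_in_divide_mem[OF s(1) subring_mult[OF s(1) pair_ideal_mem[OF PQ s(1,2) cx h(1)]
            unit_in_mem[OF unit_in_power[OF s(1) lu]]] unit_in_power[OF s(1) lu]])
    finally show "b / (EV Q / lam j ^ n) \<in> x" .
  qed simp
qed

text \<open>A local generator \<open>a\<close> of the ideal is, up to a unit, a combination of
  \<open>f\<close> and \<open>g\<close>. Dividing by \<open>a\<close> exhibits a unit as such a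
  combination of \<open>f / a\<close> and \<open>g / a\<close>, so one of these is a unit.\<close>

lemma X_fg:
  assumes x: "x \<in> X" "chart 1 \<subseteq> x"
  shows "f / g \<in> x \<or> g / f \<in> x"
proof -
  obtain j a where j: "a \<in> chart_ideal I j" "a \<noteq> 0" "chart_ring j \<subseteq> x" "loc_pt x" "\<And>b. b \<in> chart_ideal I j \<Longrightarrow> b / a \<in> x"
    by (rule blowup_chartE[OF x(1)]) (rule that)
  note s = loc_ptD[OF j(4)]
  note lu = lam_unit1[OF j(4) x(2) j(3)]
  have mem: "EV h / a \<in> x" if h: "van {..<e} h" for h
  proof -
    obtain n where n: "tdle (int n) h" using tdle_exists by blast
    have "(EV h / lam j ^ n) / a \<in> x" by (intro j chart_idealI h n)
    then have "(EV h / lam j ^ n) / a * lam j ^ n \<in> x"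
      using unit_in_power[OF s(1) lu] by (intro subring_mult[OF s(1)]) (auto simp: unit_in_mem)
    then show ?thesis using lam_nonzero[of j] by simp
  qed
  obtain h n where h: "van {..<e} h" "a = EV h / lam j ^ n" using chart_idealE[OF j(1)] by metis
  obtain b c where "h = b * fP + c * gP" using van_fg[OF h(1)] .
  then have "EV h = EV b * f + EV c * g" by (simp add: EV_hom f_def g_def)
  then have "EV b * (f / a) + EV c * (g / a) = lam j ^ n"
    using h(2) j(2) lam_nonzero[of j] by (simp add: field_simps)
  then have "unit_in x (EV b * (f / a) + EV c * (g / a))" using unit_in_power[OF s(1) lu] by simp
  moreover have m: "EV b \<in> x" "EV c \<in> x" "f / a \<in> x" "g / a \<in> x"
    using EV_mem[OF s(1,2) x(2)] mem van_f van_g by (auto simp: f_def g_def)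
  ultimately have "unit_in x (EV b * (f / a)) \<or> unit_in x (EV c * (g / a))"
    by (intro local_subring_add[OF s(3)] subring_mult[OF s(1)])
  then have "unit_in x (f / a) \<or> unit_in x (g / a)"
    using unit_in_factor[OF s(1)] m by (metis mult.commute)
  then have "(g / a) / (f / a) \<in> x \<or> (f / a) / (g / a) \<in> x"
    using unit_in_divide_mem[OF s(1)] m by blast
  then show ?thesis using j(2) by auto
qed

text \<open>At a point of the line at infinity \<open>1 / \<mu>\<close> is not a unit. With
  \<open>T\<close> the leading monomial, \<open>G / \<mu>^m\<close> is 1 plus a multiple of
  \<open>1 / \<mu>\<close>, hence a unit.\<close>

lemma near_one:
  assumes x: "loc_pt x" "chart \<mu> \<subseteq> x" "\<mu> \<noteq> 0" "\<not> unit_in x (1 / \<mu>)"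
    and G: "tdle (int m - 1) (G - T)" "EV T = \<mu> ^ m" "m > 0"
  shows "unit_in x (EV G / \<mu> ^ m)"
proof -
  note s = loc_ptD[OF x(1)]
  have "tdle (int (m - 1)) (G - T)" using G by (simp add: of_nat_diff)
  then have q: "EV (G - T) / \<mu> ^ (m - 1) \<in> x" by (rule tdle_chart_mem[OF s(1,2) x(2,3)])
  let ?r = "(1 / \<mu>) * (EV (G - T) / \<mu> ^ (m - 1))"
  have "\<mu> ^ m = \<mu> * \<mu> ^ (m - 1)" using G(3) by (simp add: power_eq_if)
  then have "EV G / \<mu> ^ m = 1 + ?r" using x(3) G(2) by (simp add: EV_hom field_simps)
  moreover have inv: "1 / \<mu> \<in> x" using x(2) by (auto simp: chart_def)
  then have "?r \<in> x" using q by (intro subring_mult[OF s(1)])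
  moreover have "\<not> unit_in x ?r" using unit_in_factor[OF s(1) _ inv q] x(4) by blast
  ultimately show ?thesis using unit_in_add_nonunit[OF s(3) unit_in_1[OF s(1)]] by simp
qed

lemma X_cases:
  assumes "x \<in> X"
  obtains "chart 1 \<subseteq> x" | "chart u \<subseteq> x" "unit_in x \<gamma>1" | "chart v \<subseteq> x" "unit_in x \<gamma>2"
proof -
  note lx = X_loc_pt[OF assms] note s = loc_ptD[OF lx]
  have switch: "chart \<mu>' \<subseteq> x" if c: "chart \<mu> \<subseteq> x" "\<mu> \<in> types" "\<mu>' \<in> types" "unit_in x (\<mu>' / \<mu>)" for \<mu> \<mu>'
  proof -
    have "\<nu> / \<mu>' \<in> x" if "\<nu> \<in> types" for \<nu>
    proof -
      have "(\<nu> / \<mu>) / (\<mu>' / \<mu>) \<in> x" by (rule unit_in_divide_mem[OF s(1) subsetD[OF c(1) types_in_chart[OF c(2) that]] c(4)])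
      then show ?thesis using types_nonzero[OF c(2)] by simp
    qed
    then show ?thesis by (auto simp: chart_def)
  qed
  obtain \<mu> where \<mu>: "\<mu> \<in> types" "chart \<mu> \<subseteq> x" using X_type[OF assms] .
  show thesis
  proof (cases "unit_in x (1 / \<mu>)")
    case True
    then show thesis using that(1) switch[OF \<mu>(2,1)] types_memb(1) by blast
  next
    case False
    then have "\<mu> \<noteq> 1" using unit_in_1[OF s(1)] by auto
    then consider "\<mu> = u" | "\<mu> = v" using \<mu>(1) by (auto simp: types_def)
    then show thesis
    proof cases
      case 1
      have "unit_in x \<gamma>1" unfolding \<gamma>1_def
        by (rule near_one[of x u m1 g1P "mono2 1 m1 0"]) (use lx \<mu> False 1 u_nonzero utop_g1P in \<open>auto simp: utop_def m1_def EV_mono2 const_ff_hom\<close>)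
      then show thesis using that(2) \<mu> 1 by blast
    next
      case 2
      have "unit_in x \<gamma>2" unfolding \<gamma>2_def
        by (rule near_one[of x v m2 g2P "mono2 1 0 m2"]) (use lx \<mu> False 2 v_nonzero vtop_g2P in \<open>auto simp: vtop_def m2_def EV_mono2 const_ff_hom\<close>)
      then show thesis using that(3) \<mu> 2 by blast
    qed
  qed
qed

lemma X_Spec_u: "x \<in> X \<Longrightarrow> chart u \<subseteq> x \<Longrightarrow> unit_in x \<gamma>1 \<Longrightarrow> x \<in> Spec_rings (subalgebra_gen (chart u))"
  and X_Spec_v: "x \<in> X \<Longrightarrow> chart v \<subseteq> x \<Longrightarrow> unit_in x \<gamma>2 \<Longrightarrow> x \<in> Spec_rings (subalgebra_gen (chart v))"
  unfolding \<gamma>1_def \<gamma>2_def using utop_tdle[OF utop_g1P] vtop_tdle[OF vtop_g2P] van_g1P van_g2P by (auto intro: X_chart)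

lemma Spec_u_X: "x \<in> Spec_rings (subalgebra_gen (chart u)) \<Longrightarrow> unit_in x \<gamma>1 \<Longrightarrow> x \<in> X"
  and Spec_v_X: "x \<in> Spec_rings (subalgebra_gen (chart v)) \<Longrightarrow> unit_in x \<gamma>2 \<Longrightarrow> x \<in> X"
  unfolding \<gamma>1_def \<gamma>2_def using utop_tdle[OF utop_g1P] vtop_tdle[OF vtop_g2P] van_g1P van_g2P by (auto intro: chart_X)

lemma fgpairs: "fgpair fP gP" "fgpair gP fP"
  by (simp_all add: fgpair_def)

lemma X_Spec_B: "x \<in> X \<Longrightarrow> chart 1 \<subseteq> x \<Longrightarrow> f / g \<in> x \<Longrightarrow> x \<in> Spec_rings (subalgebra_gen (chart 1 \<union> {f / g}))"
  "x \<in> X \<Longrightarrow> chart 1 \<subseteq> x \<Longrightarrow> g / f \<in> x \<Longrightarrow> x \<in> Spec_rings (subalgebra_gen (chart 1 \<union> {g / f}))"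
  using X_B_pair fgpairs unfolding f_def g_def by blast+

lemma Spec_B_X: "x \<in> Spec_rings (subalgebra_gen (chart 1 \<union> {f / g})) \<Longrightarrow> x \<in> X"
  "x \<in> Spec_rings (subalgebra_gen (chart 1 \<union> {g / f})) \<Longrightarrow> x \<in> X"
  using B_pair_X fgpairs unfolding f_def g_def by blast+

lemma finite_chart: "finite (chart \<mu>)"
  by (simp add: chart_def)

lemma noetherian_X: "noetherian_points X"
proof (rule noetherian_points_cover)
  let ?R = "{subalgebra_gen (chart 1 \<union> {f / g}), subalgebra_gen (chart 1 \<union> {g / f}), subalgebra_gen (chart u), subalgebra_gen (chart v)}"
  show "finite ?R" by simp
  show "subring_of_field R \<and> noetherian_subring R" if "R \<in> ?R" for R
    using that by (auto intro: subring_subalgebra_gen noetherian_subalgebra_gen simp: finite_chart)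
  show "X \<subseteq> (\<Union>R\<in>?R. Spec_rings R)"
  proof
    fix x assume x: "x \<in> X"
    then show "x \<in> (\<Union>R\<in>?R. Spec_rings R)"
      by (cases rule: X_cases) (use X_fg[OF x] X_Spec_B[OF x] X_Spec_u[OF x] X_Spec_v[OF x] in blast)+
  qed
qed

lemma subring_X: "x \<in> X \<Longrightarrow> subring_of_field x"
  using X_loc_pt loc_ptD(1) by blast

lemma generization_closed_X: "generization_closed X"
  unfolding generization_closed_def
proof (intro ballI conjI allI impI)
  fix x assume x: "x \<in> X"
  show s: "subring_of_field x" by (rule subring_X[OF x])
  fix Q assume Q: "prime_ideal_in x Q"
  let ?y = "localize x Q"
  have sup: "x \<subseteq> ?y" by (rule localize_super[OF s Q])
  have un: "unit_in x a \<Longrightarrow> unit_in ?y a" for a using sup by (auto simp: unit_in_def)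
  have gen: "x \<in> Spec_rings (subalgebra_gen G) \<Longrightarrow> ?y \<in> Spec_rings (subalgebra_gen G)" for G
    using Spec_rings_generization[OF subring_subalgebra_gen _ Q] .
  show "?y \<in> X" using x
  proof (cases rule: X_cases)
    case 1
    then show ?thesis using X_fg[OF x] X_Spec_B[OF x] gen Spec_B_X by blast
  next
    case 2
    then show ?thesis using X_Spec_u[OF x] gen Spec_u_X un by blast
  next
    case 3
    then show ?thesis using X_Spec_v[OF x] gen Spec_v_X un by blast
  qed
qed

end

section \<open>Acyclicity on the blow-up\<close>

context plane_points
begin

definition aff :: "'k ff set \<Rightarrow> 'k ff set set" where "aff G = {x \<in> X. G \<subseteq> x}"

definition GB1 :: "'k ff set" where "GB1 = chart 1 \<union> {g / f}"
definition GB2 :: "'k ff set" where "GB2 = chart 1 \<union> {f / g}"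
definition G1 :: "'k ff set" where "G1 = chart u \<union> {inverse \<gamma>1}"
definition G2 :: "'k ff set" where "G2 = chart v \<union> {inverse \<gamma>2}"
abbreviation "B1 \<equiv> aff GB1"
abbreviation "B2 \<equiv> aff GB2"
abbreviation "Y0 \<equiv> aff (chart 1)"
abbreviation "Y1 \<equiv> aff G1"
abbreviation "Y2 \<equiv> aff G2"

lemma aff_Int: "aff G \<inter> aff H = aff (G \<union> H)"
  by (auto simp: aff_def)

lemma openin_aff: "finite G \<Longrightarrow> openin (zariski X) (aff G)"
  unfolding aff_def using subring_1[OF subring_X] by (intro openin_zariski_finite)

lemma finite_G: "finite GB1" "finite GB2" "finite G1" "finite G2"
  by (auto simp: GB1_def GB2_def G1_def G2_def finite_chart)

lemma aff_subset: "aff G \<subseteq> X"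
  by (auto simp: aff_def)

lemma aff_subalgebra: "aff G = {x \<in> X. subalgebra_gen G \<subseteq> x}"
  unfolding aff_def using subalgebra_gen_subset loc_ptD X_loc_pt by blast

lemma \<gamma>_nonzero: "\<gamma>1 \<noteq> 0" "\<gamma>2 \<noteq> 0"
  using u_nonzero v_nonzero utop_nonzero[OF utop_g1P] vtop_nonzero[OF vtop_g2P] by (auto simp: \<gamma>1_def \<gamma>2_def EV_eq_0)

lemma \<gamma>1_mem: "subring_of_field x \<Longrightarrow> range const_ff \<subseteq> x \<Longrightarrow> chart u \<subseteq> x \<Longrightarrow> \<gamma>1 \<in> x"
  unfolding \<gamma>1_def by (rule tdle_chart_mem[OF _ _ _ u_nonzero utop_tdle[OF utop_g1P]])

lemma \<gamma>2_mem: "subring_of_field x \<Longrightarrow> range const_ff \<subseteq> x \<Longrightarrow> chart v \<subseteq> x \<Longrightarrow> \<gamma>2 \<in> x"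
  unfolding \<gamma>2_def by (rule tdle_chart_mem[OF _ _ _ v_nonzero vtop_tdle[OF vtop_g2P]])

lemma G1_unit: "loc_pt x \<Longrightarrow> G1 \<subseteq> x \<Longrightarrow> unit_in x \<gamma>1"
  using \<gamma>1_mem[of x] loc_ptD \<gamma>_nonzero by (auto simp: G1_def unit_in_def)

lemma G2_unit: "loc_pt x \<Longrightarrow> G2 \<subseteq> x \<Longrightarrow> unit_in x \<gamma>2"
  using \<gamma>2_mem[of x] loc_ptD \<gamma>_nonzero by (auto simp: G2_def unit_in_def)

lemma Y0_eq: "Y0 = B1 \<union> B2"
  using X_fg by (auto simp: aff_def GB1_def GB2_def)

lemma X_eq: "X = Y0 \<union> Y1 \<union> Y2"
proof -
  have "x \<in> Y0 \<union> Y1 \<union> Y2" if "x \<in> X" for x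
    using that
    by (cases rule: X_cases) (use that in \<open>auto simp: aff_def G1_def G2_def unit_in_inverse_mem\<close>)
  then show ?thesis using aff_subset by blast
qed

lemma chart_switch:
  assumes S: "subring_of_field S" "chart \<mu> \<subseteq> S" "S \<subseteq> x" and inv: "\<And>y. y \<in> S \<Longrightarrow> unit_in x y \<Longrightarrow> inverse y \<in> S"
    and t: "\<mu> \<in> types" "\<mu>' \<in> types" "chart \<mu>' \<subseteq> x"
  shows "chart \<mu>' \<subseteq> S"
proof -
  have mS: "\<nu> / \<mu> \<in> S" if "\<nu> \<in> types" for \<nu> using types_in_chart[OF t(1) that] S(2) by blast
  have "unit_in x (\<mu>' / \<mu>)"
    using mS[OF t(2)] S(3) types_in_chart[OF t(2,1)] t(3) types_nonzero[OF t(1)] types_nonzero[OF t(2)]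
    by (auto simp: unit_in_def)
  from inv[OF mS[OF t(2)] this] have "\<mu> / \<mu>' \<in> S" by simp
  then have "(\<nu> / \<mu>) * (\<mu> / \<mu>') \<in> S" if "\<nu> \<in> types" for \<nu> using subring_mult[OF S(1) mS[OF that]] by blast
  then have "\<nu> / \<mu>' \<in> S" if "\<nu> \<in> types" for \<nu> using that types_nonzero[OF t(1)] by simp
  then show ?thesis by (auto simp: chart_def)
qed

text \<open>The local rings of the algebra on \<open>H\<close> are already understood. The other
  elements of \<open>G\<close> must appear in every intermediate ring that inverts the units of
  \<open>x\<close>, which is what the transfer lemma asks for.\<close>

lemma Spec_aff_X:
  assumes R: "\<And>x. x \<in> Spec_rings (subalgebra_gen H) \<Longrightarrow> G \<subseteq> x \<Longrightarrow> x \<in> X"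
    and H: "H \<subseteq> G" and G: "\<And>x S. loc_pt x \<Longrightarrow> G \<subseteq> x \<Longrightarrow> subring_of_field S \<Longrightarrow> range const_ff \<subseteq> S \<Longrightarrow> H \<subseteq> S \<Longrightarrow> S \<subseteq> x \<Longrightarrow>
      (\<And>y. y \<in> S \<Longrightarrow> unit_in x y \<Longrightarrow> inverse y \<in> S) \<Longrightarrow> G \<subseteq> S"
  shows "Spec_rings (subalgebra_gen G) \<subseteq> X"
proof
  fix x assume x: "x \<in> Spec_rings (subalgebra_gen G)"
  note lx = loc_pt_Spec_rings[OF x] note s = loc_ptD[OF lx]
  have Gx: "G \<subseteq> x" by (rule Spec_gen_subset[OF x])
  have "x \<in> Spec_rings (subalgebra_gen H)"
  proof (rule Spec_rings_transfer[OF subring_subalgebra_gen x subring_subalgebra_gen])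
    show "subalgebra_gen H \<subseteq> x" using Gx H by (subst subalgebra_gen_subset[OF s(1,2)]) auto
    fix S assume S: "subring_of_field S" "subalgebra_gen H \<subseteq> S" "S \<subseteq> x"
      and inv: "\<And>y. y \<in> S \<Longrightarrow> unit_in x y \<Longrightarrow> inverse y \<in> S"
    have cS: "range const_ff \<subseteq> S" using S(2) const_subring by blast
    have "G \<subseteq> S"
      by (rule G[OF lx Gx S(1) cS subset_trans[OF subalgebra_gen_super S(2)] S(3) inv])
    then show "subalgebra_gen G \<subseteq> S" by (simp add: subalgebra_gen_subset[OF S(1) cS])
  qed
  then show "x \<in> X" using R Gx by blast
qed

lemma Spec_aff_u:
  assumes "G1 \<subseteq> G" "\<And>x S. loc_pt x \<Longrightarrow> G \<subseteq> x \<Longrightarrow> subring_of_field S \<Longrightarrow> range const_ff \<subseteq> S \<Longrightarrow> G1 \<subseteq> S \<Longrightarrow> S \<subseteq> x \<Longrightarrow>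
      (\<And>y. y \<in> S \<Longrightarrow> unit_in x y \<Longrightarrow> inverse y \<in> S) \<Longrightarrow> G \<subseteq> S"
  shows "Spec_rings (subalgebra_gen G) \<subseteq> X"
proof (rule Spec_aff_X[of "chart u"])
  show "x \<in> X" if "x \<in> Spec_rings (subalgebra_gen (chart u))" "G \<subseteq> x" for x
    using Spec_u_X[OF that(1)] G1_unit[OF loc_pt_Spec_rings[OF that(1)]] that(2) assms(1) by blast
  show "chart u \<subseteq> G" using assms(1) by (auto simp: G1_def)
  fix x S assume *: "loc_pt x" "G \<subseteq> x" "subring_of_field S" "range const_ff \<subseteq> S" "chart u \<subseteq> S" "S \<subseteq> x"
    "\<And>y. y \<in> S \<Longrightarrow> unit_in x y \<Longrightarrow> inverse y \<in> S"
  have "inverse \<gamma>1 \<in> S" using *(7)[OF \<gamma>1_mem[OF *(3-5)] G1_unit[OF *(1)]] *(2) assms(1) by blast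
  then have "G1 \<subseteq> S" using *(5) by (simp add: G1_def)
  then show "G \<subseteq> S" using assms(2) * by blast
qed

lemma Spec_aff_v:
  assumes "G2 \<subseteq> G" "\<And>x S. loc_pt x \<Longrightarrow> G \<subseteq> x \<Longrightarrow> subring_of_field S \<Longrightarrow> range const_ff \<subseteq> S \<Longrightarrow> G2 \<subseteq> S \<Longrightarrow> S \<subseteq> x \<Longrightarrow>
      (\<And>y. y \<in> S \<Longrightarrow> unit_in x y \<Longrightarrow> inverse y \<in> S) \<Longrightarrow> G \<subseteq> S"
  shows "Spec_rings (subalgebra_gen G) \<subseteq> X"
proof (rule Spec_aff_X[of "chart v"])
  show "x \<in> X" if "x \<in> Spec_rings (subalgebra_gen (chart v))" "G \<subseteq> x" for x
    using Spec_v_X[OF that(1)] G2_unit[OF loc_pt_Spec_rings[OF that(1)]] that(2) assms(1) by blast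
  show "chart v \<subseteq> G" using assms(1) by (auto simp: G2_def)
  fix x S assume *: "loc_pt x" "G \<subseteq> x" "subring_of_field S" "range const_ff \<subseteq> S" "chart v \<subseteq> S" "S \<subseteq> x"
    "\<And>y. y \<in> S \<Longrightarrow> unit_in x y \<Longrightarrow> inverse y \<in> S"
  have "inverse \<gamma>2 \<in> S" using *(7)[OF \<gamma>2_mem[OF *(3-5)] G2_unit[OF *(1)]] *(2) assms(1) by blast
  then have "G2 \<subseteq> S" using *(5) by (simp add: G2_def)
  then show "G \<subseteq> S" using assms(2) * by blast
qed

lemma switch_G:
  assumes "loc_pt x" "subring_of_field S" "range const_ff \<subseteq> S" "chart \<mu> \<subseteq> S" "S \<subseteq> x"
    and inv: "\<And>y. y \<in> S \<Longrightarrow> unit_in x y \<Longrightarrow> inverse y \<in> S" and "\<mu> \<in> types"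
  shows "chart 1 \<subseteq> x \<Longrightarrow> chart 1 \<subseteq> S" "G2 \<subseteq> x \<Longrightarrow> G2 \<subseteq> S"
proof -
  show "chart 1 \<subseteq> S" if "chart 1 \<subseteq> x" by (rule chart_switch[OF assms(2,4,5) inv assms(7) _ that]) auto
  assume G2: "G2 \<subseteq> x"
  have c: "chart v \<subseteq> S" by (rule chart_switch[OF assms(2,4,5) inv assms(7)]) (use G2 in \<open>auto simp: G2_def\<close>)
  have "inverse \<gamma>2 \<in> S" using inv[OF \<gamma>2_mem[OF assms(2,3) c] G2_unit[OF assms(1) G2]] .
  then show "G2 \<subseteq> S" using c by (simp add: G2_def)
qed

text \<open>The generator sets of the charts and of those intersections to which affine vanishing is
  applied in the two Mayer-Vietoris arguments. \<open>Y0\<close> itself is absent: it contains the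
  exceptional curves.\<close>

definition affines :: "'k ff set set" where
  "affines = {GB1, GB2, GB1 \<union> GB2, G1, G2, chart 1 \<union> G1, chart 1 \<union> G2, G1 \<union> G2, chart 1 \<union> G1 \<union> G2}"

lemma Spec_affines:
  assumes "G \<in> affines"
  shows "Spec_rings (subalgebra_gen G) \<subseteq> X"
proof -
  have u: "Spec_rings (subalgebra_gen G) \<subseteq> X" if "G \<in> {G1, chart 1 \<union> G1, G1 \<union> G2, chart 1 \<union> G1 \<union> G2}" for G
  proof (rule Spec_aff_u)
    show "G1 \<subseteq> G" using that by auto
    fix x S assume *: "loc_pt x" "G \<subseteq> x" "subring_of_field S" "range const_ff \<subseteq> S" "G1 \<subseteq> S" "S \<subseteq> x"
      "\<And>y. y \<in> S \<Longrightarrow> unit_in x y \<Longrightarrow> inverse y \<in> S"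
    have "chart u \<subseteq> S" using *(5) by (simp add: G1_def)
    note sw = switch_G[OF *(1,3,4) this *(6,7) types_memb(2)]
    have "chart 1 \<subseteq> G \<Longrightarrow> chart 1 \<subseteq> S" "G2 \<subseteq> G \<Longrightarrow> G2 \<subseteq> S"
      using sw subset_trans[OF _ *(2)] by blast+
    then show "G \<subseteq> S" using that *(5) by (elim insertE) (simp_all only: Un_subset_iff Un_upper1 Un_upper2 simp_thms le_supI1 empty_iff)
  qed
  have v: "Spec_rings (subalgebra_gen G) \<subseteq> X" if "G \<in> {G2, chart 1 \<union> G2}" for G
  proof (rule Spec_aff_v)
    show "G2 \<subseteq> G" using that by auto
    fix x S assume *: "loc_pt x" "G \<subseteq> x" "subring_of_field S" "range const_ff \<subseteq> S" "G2 \<subseteq> S" "S \<subseteq> x"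
      "\<And>y. y \<in> S \<Longrightarrow> unit_in x y \<Longrightarrow> inverse y \<in> S"
    have "chart v \<subseteq> S" using *(5) by (simp add: G2_def)
    note sw = switch_G[OF *(1,3,4) this *(6,7) types_memb(3)]
    have "chart 1 \<subseteq> G \<Longrightarrow> chart 1 \<subseteq> S" using sw(1) subset_trans[OF _ *(2)] by blast
    then show "G \<subseteq> S" using that *(5) by (elim insertE) (simp_all only: Un_subset_iff Un_upper1 Un_upper2 simp_thms le_supI1 empty_iff)
  qed
  have b: "Spec_rings (subalgebra_gen GB1) \<subseteq> X" "Spec_rings (subalgebra_gen GB2) \<subseteq> X"
    unfolding GB1_def GB2_def using Spec_B_X by blast+
  have bb: "Spec_rings (subalgebra_gen (GB1 \<union> GB2)) \<subseteq> X"
  proof (rule Spec_aff_X[of GB2])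
    show "x \<in> X" if "x \<in> Spec_rings (subalgebra_gen GB2)" for x using that b by blast
    fix x S assume *: "loc_pt x" "GB1 \<union> GB2 \<subseteq> x" "subring_of_field S" "range const_ff \<subseteq> S" "GB2 \<subseteq> S" "S \<subseteq> x"
      "\<And>y. y \<in> S \<Longrightarrow> unit_in x y \<Longrightarrow> inverse y \<in> S"
    have "f / g \<in> S" "unit_in x (f / g)"
      using *(2,5) f_nonzero g_nonzero by (auto simp: GB1_def GB2_def unit_in_def)
    then have "g / f \<in> S" using *(7) by fastforce
    then show "GB1 \<union> GB2 \<subseteq> S" using *(5) by (auto simp: GB1_def GB2_def)
  qed auto
  show ?thesis using assms unfolding affines_def by (elim insertE emptyE; simp add: u v b bb)
qed

text \<open>Both \<open>\<gamma>1\<close> and \<open>u\<close> are units here, and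
  \<open>u * g\<close> is \<open>\<gamma>1\<close> times a power of \<open>u\<close>. So the overlap
  misses the exceptional curves and lies inside \<open>B2\<close>.\<close>

lemma Y01_unit_g:
  assumes "x \<in> Y0 \<inter> Y1"
  shows "unit_in x g" "f / g \<in> x"
proof -
  have x: "x \<in> X" "chart 1 \<subseteq> x" "G1 \<subseteq> x" using assms by (auto simp: aff_def)
  note lx = X_loc_pt[OF x(1)] note s = loc_ptD[OF lx]
  have ux: "u \<in> x" "chart u \<subseteq> x" "inverse u \<in> x" using x by (auto simp: chart_def G1_def inverse_eq_divide)
  have uu: "unit_in x u" using ux u_nonzero by (simp add: unit_in_def)
  have "u * g = \<gamma>1 * u ^ m1" using u_nonzero unfolding \<gamma>1_def g1P_def g_def EV_hom EV_U by simp
  then have "unit_in x (g * u)"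
    using unit_in_mult[OF s(1) G1_unit[OF lx x(3)] unit_in_power[OF s(1) uu, of m1]] by (metis mult.commute)
  then show "unit_in x g" using unit_in_factor[OF s(1)] EV_mem[OF s(1,2) x(2)] ux by (auto simp: g_def)
  then show "f / g \<in> x" using unit_in_divide_mem[OF s(1)] EV_mem[OF s(1,2) x(2)] by (auto simp: f_def)
qed

lemma Y02_unit:
  assumes "x \<in> Y0 \<inter> Y2"
  shows "unit_in x (EV g2P)"
proof -
  have x: "x \<in> X" "chart 1 \<subseteq> x" "G2 \<subseteq> x" using assms by (auto simp: aff_def)
  note lx = X_loc_pt[OF x(1)] note s = loc_ptD[OF lx]
  have "v \<in> x" "inverse v \<in> x" using x by (auto simp: chart_def G2_def inverse_eq_divide)
  then have vv: "unit_in x v" using v_nonzero by (simp add: unit_in_def)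
  have "EV g2P = \<gamma>2 * v ^ m2" using v_nonzero by (simp add: \<gamma>2_def)
  then show ?thesis
    using unit_in_mult[OF s(1) G2_unit[OF lx x(3)] unit_in_power[OF s(1) vv]] by simp
qed

lemma fg_neq: "f \<noteq> g"
proof
  assume "f = g"
  then have "fP = gP" by (simp add: f_def g_def EV_inject)
  then show False by (simp add: fP_def gP_def)
qed

text \<open>Subordinate to the four affine charts, so that every intersection of at least one member
  lies in one of them.\<close>

definition fine_cover :: "'k ff set set set \<Rightarrow> bool" where
  "fine_cover C \<longleftrightarrow> finite C \<and> C \<noteq> {} \<and> (\<forall>W\<in>C. openin (zariski X) W) \<and> \<Union>C = X \<and>
     (\<forall>W\<in>C. W \<subseteq> B1 \<or> W \<subseteq> B2 \<or> W \<subseteq> Y1 \<or> W \<subseteq> Y2)"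

end

text \<open>The scalar multiplication is left abstract so that the same argument covers line bundles
  inside the function field and the bundle of rank two inside its square.\<close>

locale plane_sheaf = plane_points p e d A N \<phi> + vector_space scale
  for p :: "nat \<Rightarrow> 'k::field_char_0 ^ 3" and e d and A N :: "'k ^ 3 ^ 3" and \<phi> :: "'k poly"
    and scale :: "'k ff \<Rightarrow> 'm::ab_group_add \<Rightarrow> 'm" +
  fixes F :: "'k ff set \<Rightarrow> 'm set" and C :: "'k ff set set set"
  assumes F: "qc_sheaf X F" and C: "fine_cover C"
begin

sublocale group_sheaf X F
  by (rule qc_sheaf_group[OF F subring_X])

lemma C': "finite C" "C \<noteq> {}" "\<And>W. W \<in> C \<Longrightarrow> openin (zariski X) W" "\<Union>C = X"
  using C by (auto simp: fine_cover_def)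

lemma acyclic_affine: "G \<in> affines \<Longrightarrow> acyclic_at F C (aff G) (Suc n)"
proof -
  assume G: "G \<in> affines"
  then have "finite G" using finite_G finite_chart by (auto simp: affines_def)
  show ?thesis
    by (rule acyclic_at_affine[OF F noetherian_X subring_X subring_subalgebra_gen Spec_affines[OF G] aff_subalgebra
          openin_aff[OF \<open>finite G\<close>] C'(1,3)]) (use C' in auto)
qed

lemma openin_Inter: "set us \<subseteq> C \<Longrightarrow> openin (zariski X) W \<Longrightarrow> openin (zariski X) (\<Inter>(set us) \<inter> W)"
  by (induction us) (auto simp: Int_assoc C')

text \<open>On \<open>Y0\<close> intersected with \<open>Y2\<close> the function \<open>g2P\<close>
  is a unit and a combination of \<open>f\<close> and \<open>g\<close>, so powers of
  \<open>f\<close> and \<open>g\<close> still generate the unit ideal. A partition of unity with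
  these two functions splits the section.\<close>

lemma split_Y02:
  assumes us: "set us \<subseteq> C" "\<Inter>(set us) \<subseteq> Y2" and s: "s \<in> sections F (\<Inter>(set us) \<inter> (B1 \<inter> B2))"
  shows "\<exists>s1 s2. s1 \<in> sections F (\<Inter>(set us) \<inter> B1) \<and> s2 \<in> sections F (\<Inter>(set us) \<inter> B2) \<and> s = s1 - s2"
proof -
  have loc: "loc_pt y" "chart 1 \<subseteq> y" "f \<in> y" "g \<in> y" "y \<in> Y0 \<inter> Y2" "y \<in> X" if "y \<in> \<Inter>(set us) \<inter> B1 \<or> y \<in> \<Inter>(set us) \<inter> B2" for y
  proof -
    show "y \<in> X" "y \<in> Y0 \<inter> Y2" "chart 1 \<subseteq> y" "loc_pt y" using that us(2) X_loc_pt by (auto simp: aff_def GB1_def GB2_def)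
    then show "f \<in> y" "g \<in> y" using EV_mem loc_ptD by (auto simp: f_def g_def)
  qed
  \<comment> \<open>Inside \<open>B2\<close>, the locus where \<open>f\<close> is invertible lies in
    \<open>B1\<close>, where \<open>s\<close> is defined. Hence a power of \<open>f\<close> extends
    \<open>s\<close> to all of \<open>B2\<close>; the roles are exchanged below.\<close>
  obtain m where m: "\<And>k y. y \<in> \<Inter>(set us) \<inter> B2 \<Longrightarrow> k \<ge> m \<Longrightarrow> scale (f ^ k) s \<in> F y"
  proof (rule qc_sheaf_extend[OF F noetherian_X subring_X openin_Inter[OF us(1) openin_aff[OF finite_G(2)]] f_nonzero])
    fix y assume y: "y \<in> \<Inter>(set us) \<inter> B2"
    then show "f \<in> y" using loc by blast
    assume "inverse f \<in> y"
    then have "g / f \<in> y" using loc[of y] y subring_mult[OF loc_ptD(1)] by (auto simp: divide_inverse)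
    then have "y \<in> B1" using y by (auto simp: aff_def GB1_def GB2_def)
    then show "s \<in> F y" using s y by (auto simp: sections_mem)
  qed (auto)
  obtain m' where m': "\<And>k y. y \<in> \<Inter>(set us) \<inter> B1 \<Longrightarrow> k \<ge> m' \<Longrightarrow> scale (g ^ k) s \<in> F y"
  proof (rule qc_sheaf_extend[OF F noetherian_X subring_X openin_Inter[OF us(1) openin_aff[OF finite_G(1)]] g_nonzero])
    fix y assume y: "y \<in> \<Inter>(set us) \<inter> B1"
    then show "g \<in> y" using loc by blast
    assume "inverse g \<in> y"
    then have "f / g \<in> y" using loc[of y] y subring_mult[OF loc_ptD(1)] by (auto simp: divide_inverse)
    then have "y \<in> B2" using y by (auto simp: aff_def GB1_def GB2_def)
    then show "s \<in> F y" using s y by (auto simp: sections_mem)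
  qed (auto)
  define R where "R = subalgebra_gen (chart 1 \<union> {inverse (EV g2P)})"
  have sR: "subring_of_field R" and cR: "range const_ff \<subseteq> R" and GR: "chart 1 \<union> {inverse (EV g2P)} \<subseteq> R"
    unfolding R_def by (rule subring_subalgebra_gen const_subring subalgebra_gen_super)+
  have evR: "EV h \<in> R" for h using GR by (intro EV_mem[OF sR cR]) auto
  obtain a b where "g2P = a * fP + b * gP" using van_fg[OF van_g2P] .
  then have g2: "EV g2P = EV a * f + EV b * g" by (simp add: EV_hom f_def g_def)
  have "EV g2P \<noteq> 0" using vtop_nonzero[OF vtop_g2P] by (simp add: EV_eq_0)
  then have "1 = (EV a * f + EV b * g) * inverse (EV g2P)"
    unfolding g2[symmetric] by simp
  also have "... = (EV a * inverse (EV g2P)) * f + (EV b * inverse (EV g2P)) * g"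
    by (simp only: distrib_right distrib_left mult_ac)
  also have "... = (\<Sum>h\<in>{f, g}. (if h = f then EV a * inverse (EV g2P) else EV b * inverse (EV g2P)) * h)"
    using fg_neq by simp
  also have "... \<in> submod_gen (*) R {f, g}"
    unfolding submod_gen_def using evR GR subring_mult[OF sR]
    by (intro CollectI exI[of _ "{f, g}"] exI[of _ "\<lambda>h. if h = f then EV a * inverse (EV g2P) else EV b * inverse (EV g2P)"]) auto
  finally have one: "1 \<in> submod_gen (*) R {f, g}" .
  obtain c where c: "\<And>h. h \<in> {f, g} \<Longrightarrow> c h \<in> R" "(\<Sum>h\<in>{f, g}. c h * h ^ max m m') = 1"
    by (rule unit_ideal_powers[OF sR _ _ one]) (use evR in \<open>auto simp: f_def g_def\<close>)
  have one': "c f * f ^ max m m' + c g * g ^ max m m' = 1" using c(2) fg_neq by simp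
  have Ry: "R \<subseteq> y" if "y \<in> \<Inter>(set us) \<inter> B1 \<or> y \<in> \<Inter>(set us) \<inter> B2" for y
    unfolding R_def using loc[OF that] Y02_unit[of y] subalgebra_gen_subset[OF loc_ptD(1,2)[OF loc(1)[OF that]]]
    by (auto simp: unit_in_inverse_mem)
  have "scale (c g) (scale (g ^ max m m') s) \<in> sections F (\<Inter>(set us) \<inter> B1)"
    unfolding sections_mem
  proof
    fix y assume y: "y \<in> \<Inter>(set us) \<inter> B1"
    show "scale (c g) (scale (g ^ max m m') s) \<in> F y"
      using c(1)[of g] Ry[of y] y by (intro qc_sheafD(3)[OF F] m' loc(6)) auto
  qed
  moreover have "scale (- c f) (scale (f ^ max m m') s) \<in> sections F (\<Inter>(set us) \<inter> B2)"
    unfolding sections_mem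
  proof
    fix y assume y: "y \<in> \<Inter>(set us) \<inter> B2"
    have "- c f \<in> y" using c(1)[of f] Ry[of y] y loc[of y] by (intro subring_uminus loc_ptD) auto
    then show "scale (- c f) (scale (f ^ max m m') s) \<in> F y"
      using y by (intro qc_sheafD(3)[OF F] m loc(6)) auto
  qed
  moreover have "s = scale (c g) (scale (g ^ max m m') s) - scale (- c f) (scale (f ^ max m m') s)"
    using one' by (simp add: add.commute flip: scale_left_distrib)
  ultimately show ?thesis by blast
qed

text \<open>The decomposition over \<open>B1\<close> and \<open>B2\<close> is a real condition only
  for the empty list, that is for \<open>n = 0\<close>. For a nonempty list the open set lies in one
  chart: on \<open>B1\<close>, \<open>B2\<close> or \<open>Y1\<close> one of the two pieces is
  contained in the other, and \<open>Y2\<close> is handled by \<open>split_Y02\<close>.\<close>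

lemma acyclic_Y0:
  assumes "n = 0 \<Longrightarrow> (\<And>s. s \<in> sections F (B1 \<inter> B2) \<Longrightarrow> \<exists>s1 s2. s1 \<in> sections F B1 \<and> s2 \<in> sections F B2 \<and> s = s1 - s2)"
  shows "acyclic_at F C Y0 (Suc (Suc n))"
  unfolding Y0_eq
proof (rule acyclic_at_Un)
  show "B1 \<union> B2 \<subseteq> X" using aff_subset by blast
  show "acyclic_at F C B1 (Suc (Suc n))" "acyclic_at F C B2 (Suc (Suc n))" "acyclic_at F C (B1 \<inter> B2) (Suc n)"
    unfolding aff_Int by (rule acyclic_affine; simp add: affines_def)+
  fix us s assume us: "length us = n" "set us \<subseteq> C" and s: "s \<in> sections F (\<Inter>(set us) \<inter> (B1 \<inter> B2))"
  show "\<exists>s1 s2. s1 \<in> sections F (\<Inter>(set us) \<inter> B1) \<and> s2 \<in> sections F (\<Inter>(set us) \<inter> B2) \<and> s = s1 - s2"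
  proof (cases us)
    case Nil
    then show ?thesis using assms us s by auto
  next
    case (Cons w ws)
    then have w: "w \<in> C" "\<Inter>(set us) \<subseteq> w" using us by auto
    have X1: "\<Inter>(set us) \<inter> B1 \<subseteq> X" "\<Inter>(set us) \<inter> B2 \<subseteq> X" using aff_subset by auto
    have c1: ?thesis if "\<Inter>(set us) \<inter> B1 \<subseteq> B2"
    proof -
      have "\<Inter>(set us) \<inter> (B1 \<inter> B2) = \<Inter>(set us) \<inter> B1" using that by auto
      then show ?thesis using s sections_0[OF X1(2)] by (intro exI[of _ s] exI[of _ 0]) simp
    qed
    have c2: ?thesis if "\<Inter>(set us) \<inter> B2 \<subseteq> B1"
    proof -
      have "\<Inter>(set us) \<inter> (B1 \<inter> B2) = \<Inter>(set us) \<inter> B2" using that by auto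
      then show ?thesis using s sections_0[OF X1(1)] sections_uminus[OF X1(2)] by (intro exI[of _ 0] exI[of _ "- s"]) simp
    qed
    consider "w \<subseteq> B1" | "w \<subseteq> B2" | "w \<subseteq> Y1" | "w \<subseteq> Y2" using C w(1) by (auto simp: fine_cover_def)
    then show ?thesis
    proof cases
      case 1
      then show ?thesis using c2 w by blast
    next
      case 2
      then show ?thesis using c1 w by blast
    next
      case 3
      have "\<Inter>(set us) \<inter> B1 \<subseteq> B2"
      proof
        fix x assume x: "x \<in> \<Inter>(set us) \<inter> B1"
        then have "x \<in> Y0 \<inter> Y1" using 3 w by (auto simp: aff_def GB1_def)
        then show "x \<in> B2" using Y01_unit_g(2) by (auto simp: aff_def GB2_def)
      qed
      then show ?thesis by (rule c1)
    next
      case 4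
      then show ?thesis using split_Y02[OF us(2) _ s] w by blast
    qed
  qed
qed

text \<open>Only the empty list needs hypotheses, since any other intersection lies in one of
  \<open>Y0\<close>, \<open>Y1\<close>, \<open>Y2\<close>, where the small Cech complex splits
  trivially. The empty list occurs for \<open>n = 0\<close> in the cocycle condition and for
  \<open>n = 1\<close> in the triple overlap.\<close>

lemma acyclic_X:
  assumes n0: "n = 0 \<Longrightarrow> (\<And>s. s \<in> sections F (B1 \<inter> B2) \<Longrightarrow> \<exists>s1 s2. s1 \<in> sections F B1 \<and> s2 \<in> sections F B2 \<and> s = s1 - s2)"
    and D1: "n = 0 \<Longrightarrow> (\<And>s01 s02 s12. s01 \<in> sections F (Y0 \<inter> Y1) \<Longrightarrow> s02 \<in> sections F (Y0 \<inter> Y2) \<Longrightarrow> s12 \<in> sections F (Y1 \<inter> Y2) \<Longrightarrow>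
      s01 - s02 + s12 = 0 \<Longrightarrow> \<exists>r0 r1 r2. r0 \<in> sections F Y0 \<and> r1 \<in> sections F Y1 \<and> r2 \<in> sections F Y2 \<and>
         s01 = r0 - r1 \<and> s02 = r0 - r2 \<and> s12 = r1 - r2)"
    and D2: "n = 1 \<Longrightarrow> (\<And>s. s \<in> sections F (Y0 \<inter> Y1 \<inter> Y2) \<Longrightarrow> \<exists>s01 s02 s12. s01 \<in> sections F (Y0 \<inter> Y1) \<and>
      s02 \<in> sections F (Y0 \<inter> Y2) \<and> s12 \<in> sections F (Y1 \<inter> Y2) \<and> s = s01 - s02 + s12)"
  shows "acyclic_at F C X (Suc (Suc n))"
proof -
  have fine: "\<Inter>(set us) \<subseteq> Y0 \<or> \<Inter>(set us) \<subseteq> Y1 \<or> \<Inter>(set us) \<subseteq> Y2" if "us = w # ws" "set us \<subseteq> C" for us w ws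
  proof -
    have "w \<in> C" "\<Inter>(set us) \<subseteq> w" using that by auto
    moreover have "w \<subseteq> B1 \<or> w \<subseteq> B2 \<or> w \<subseteq> Y1 \<or> w \<subseteq> Y2" using C \<open>w \<in> C\<close> by (simp add: fine_cover_def)
    moreover have "B1 \<subseteq> Y0" "B2 \<subseteq> Y0" by (auto simp: aff_def GB1_def GB2_def)
    ultimately show ?thesis by (meson subset_trans)
  qed
  have "acyclic_at F C (Y0 \<union> Y1 \<union> Y2) (Suc (Suc n))"
  proof (rule acyclic_at_Un3)
    show "Y0 \<union> Y1 \<union> Y2 \<subseteq> X" using aff_subset by blast
    show "acyclic_at F C Y0 (Suc (Suc n))" by (rule acyclic_Y0[OF n0])
    show "acyclic_at F C Y1 (Suc (Suc n))" "acyclic_at F C Y2 (Suc (Suc n))" "acyclic_at F C (Y0 \<inter> Y1) (Suc n)"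
      "acyclic_at F C (Y0 \<inter> Y2) (Suc n)" "acyclic_at F C (Y1 \<inter> Y2) (Suc n)"
      unfolding aff_Int by (rule acyclic_affine; simp add: affines_def)+
    show "acyclic_at F C (Y0 \<inter> Y1 \<inter> Y2) n" if "n > 0"
      using acyclic_affine[of "chart 1 \<union> G1 \<union> G2" "n - 1"] that unfolding aff_Int by (simp add: affines_def)
    show "C \<noteq> {}" by (rule C')
  next
    fix us s01 s02 s12
    assume us: "length us = n" "set us \<subseteq> C" and s: "s01 \<in> sections F (\<Inter>(set us) \<inter> (Y0 \<inter> Y1))"
      "s02 \<in> sections F (\<Inter>(set us) \<inter> (Y0 \<inter> Y2))" "s12 \<in> sections F (\<Inter>(set us) \<inter> (Y1 \<inter> Y2))" "s01 - s02 + s12 = 0"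
    have sub: "\<Inter>(set us) \<inter> aff G \<subseteq> X" for G using aff_subset by blast
    show "\<exists>r0 r1 r2. r0 \<in> sections F (\<Inter>(set us) \<inter> Y0) \<and> r1 \<in> sections F (\<Inter>(set us) \<inter> Y1) \<and>
        r2 \<in> sections F (\<Inter>(set us) \<inter> Y2) \<and> s01 = r0 - r1 \<and> s02 = r0 - r2 \<and> s12 = r1 - r2"
    proof (cases us)
      case Nil
      then show ?thesis using D1[of s01 s02 s12] s us by auto
    next
      case (Cons w ws)
      consider "\<Inter>(set us) \<subseteq> Y0" | "\<Inter>(set us) \<subseteq> Y1" | "\<Inter>(set us) \<subseteq> Y2" using fine[OF Cons us(2)] by blast
      then show ?thesis
      proof cases
        case 1
        then have "\<Inter>(set us) \<inter> (Y0 \<inter> Y1) = \<Inter>(set us) \<inter> Y1" "\<Inter>(set us) \<inter> (Y0 \<inter> Y2) = \<Inter>(set us) \<inter> Y2" by auto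
        then have "- s01 \<in> sections F (\<Inter>(set us) \<inter> Y1)" "- s02 \<in> sections F (\<Inter>(set us) \<inter> Y2)" "0 \<in> sections F (\<Inter>(set us) \<inter> Y0)"
          using s sections_uminus[OF sub] sections_0[OF sub] by simp_all
        moreover have "s12 = - s01 - (- s02)" using s(4) by (simp add: algebra_simps eq_neg_iff_add_eq_0)
        ultimately show ?thesis by (intro exI[of _ 0] exI[of _ "- s01"] exI[of _ "- s02"]) simp
      next
        case 2
        then have "\<Inter>(set us) \<inter> (Y0 \<inter> Y1) = \<Inter>(set us) \<inter> Y0" "\<Inter>(set us) \<inter> (Y1 \<inter> Y2) = \<Inter>(set us) \<inter> Y2" by auto
        then have "s01 \<in> sections F (\<Inter>(set us) \<inter> Y0)" "- s12 \<in> sections F (\<Inter>(set us) \<inter> Y2)" "0 \<in> sections F (\<Inter>(set us) \<inter> Y1)"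
          using s sections_uminus[OF sub] sections_0[OF sub] by simp_all
        moreover have "s02 = s01 - (- s12)" using s(4) by (simp add: algebra_simps)
        ultimately show ?thesis by (intro exI[of _ s01] exI[of _ 0] exI[of _ "- s12"]) simp
      next
        case 3
        then have "\<Inter>(set us) \<inter> (Y0 \<inter> Y2) = \<Inter>(set us) \<inter> Y0" "\<Inter>(set us) \<inter> (Y1 \<inter> Y2) = \<Inter>(set us) \<inter> Y1" by auto
        then have "s02 \<in> sections F (\<Inter>(set us) \<inter> Y0)" "s12 \<in> sections F (\<Inter>(set us) \<inter> Y1)" "0 \<in> sections F (\<Inter>(set us) \<inter> Y2)"
          using s sections_0[OF sub] by simp_all
        moreover have "s01 = s02 - s12" using s(4) by (simp add: algebra_simps)
        ultimately show ?thesis by (intro exI[of _ s02] exI[of _ s12] exI[of _ 0]) simp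
      qed
    qed
  next
    fix us s assume us: "Suc (length us) = n" "set us \<subseteq> C" and s: "s \<in> sections F (\<Inter>(set us) \<inter> (Y0 \<inter> Y1 \<inter> Y2))"
    have sub: "\<Inter>(set us) \<inter> (aff G \<inter> aff G') \<subseteq> X" for G G' using aff_subset by blast
    show "\<exists>s01 s02 s12. s01 \<in> sections F (\<Inter>(set us) \<inter> (Y0 \<inter> Y1)) \<and> s02 \<in> sections F (\<Inter>(set us) \<inter> (Y0 \<inter> Y2)) \<and>
        s12 \<in> sections F (\<Inter>(set us) \<inter> (Y1 \<inter> Y2)) \<and> s = s01 - s02 + s12"
    proof (cases us)
      case Nil
      then show ?thesis using D2[of s] s us by auto
    next
      case (Cons w ws)
      note z = sections_0[OF sub]
      consider "\<Inter>(set us) \<subseteq> Y0" | "\<Inter>(set us) \<subseteq> Y1" | "\<Inter>(set us) \<subseteq> Y2" using fine[OF Cons us(2)] by blast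
      then show ?thesis
      proof cases
        case 1
        then have "\<Inter>(set us) \<inter> (Y0 \<inter> Y1 \<inter> Y2) = \<Inter>(set us) \<inter> (Y1 \<inter> Y2)" by auto
        then show ?thesis using s z by (intro exI[of _ 0] exI[of _ s]) simp
      next
        case 2
        then have "\<Inter>(set us) \<inter> (Y0 \<inter> Y1 \<inter> Y2) = \<Inter>(set us) \<inter> (Y0 \<inter> Y2)" by auto
        then show ?thesis using s z sections_uminus[OF sub] by (intro exI[of _ 0] exI[of _ "- s"] exI[of _ 0]) simp
      next
        case 3
        then have "\<Inter>(set us) \<inter> (Y0 \<inter> Y1 \<inter> Y2) = \<Inter>(set us) \<inter> (Y0 \<inter> Y1)" by auto
        then show ?thesis using s z by (intro exI[of _ s] exI[of _ 0]) simp
      qed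
    qed
  qed
  then show ?thesis using X_eq by simp
qed

end

section \<open>Line bundles\<close>

lemma unit_in_powi: "subring_of_field x \<Longrightarrow> unit_in x a \<Longrightarrow> unit_in x (a powi n)"
  by (auto simp: power_int_def intro: unit_in_power unit_in_inverse)

lemma unit_in_divide_iff:
  assumes "subring_of_field x" "unit_in x (\<rho> / \<rho>')"
  shows "a / \<rho> \<in> x \<longleftrightarrow> a / \<rho>' \<in> x"
proof -
  have "\<rho> \<noteq> 0" "\<rho>' \<noteq> 0" using unit_in_nonzero[OF assms(2)] by auto
  then have "a / \<rho>' = (\<rho> / \<rho>') * (a / \<rho>)" by simp
  then show ?thesis using unit_in_mult_iff[OF assms] by metis
qed

context plane_points
begin

text \<open>Local generators of the pullbacks of \<open>O(1)\<close> (divided by \<open>l 3\<close>) and of the ideal of the points.\<close>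

definition mu :: "'k ff set \<Rightarrow> 'k ff" where
  "mu x = (if chart 1 \<subseteq> x then 1 else if G1 \<subseteq> x then u else v)"

definition eps :: "'k ff set \<Rightarrow> 'k ff" where
  "eps x = (if chart 1 \<subseteq> x then (if f / g \<in> x then g else f) else 1)"

text \<open>\<open>O(nL - kE)\<close> as a subsheaf of the function field. It is normalized by
  dividing by \<open>l 3\<close> to the power \<open>n\<close>, which is why affine polynomials
  appear as its sections.\<close>

definition LB :: "int \<Rightarrow> int \<Rightarrow> 'k ff set \<Rightarrow> 'k ff set" where
  "LB n k x = {a. a / (mu x powi n * eps x powi k) \<in> x}"

lemma mu_nonzero: "mu x \<noteq> 0" and eps_nonzero: "eps x \<noteq> 0"
  using u_nonzero v_nonzero f_nonzero g_nonzero by (auto simp: mu_def eps_def)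

lemma LB_eqI:
  assumes "x \<in> X" "unit_in x (mu x powi n * eps x powi k / \<rho>)"
  shows "LB n k x = {a. a / \<rho> \<in> x}"
  using unit_in_divide_iff[OF subring_X[OF assms(1)] assms(2)] by (simp add: LB_def)

lemma chart1_unit:
  assumes "x \<in> X" "chart 1 \<subseteq> x"
  shows "G1 \<subseteq> x \<Longrightarrow> unit_in x u" "G2 \<subseteq> x \<Longrightarrow> unit_in x v"
  using assms u_nonzero v_nonzero by (auto simp: chart_def G1_def G2_def unit_in_def inverse_eq_divide)

lemma eps_unit_Y01: "x \<in> Y0 \<inter> Y1 \<Longrightarrow> unit_in x (eps x)"
  using Y01_unit_g by (auto simp: eps_def aff_def)

lemma eps_divides:
  assumes x: "x \<in> X" "chart 1 \<subseteq> x"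
  shows "f / eps x \<in> x" "g / eps x \<in> x" "eps x \<in> x" "unit_in x (f / eps x) \<or> unit_in x (g / eps x)"
proof -
  note s = loc_ptD[OF X_loc_pt[OF x(1)]]
  show "f / eps x \<in> x" "g / eps x \<in> x"
    using X_fg[OF x] x f_nonzero g_nonzero subring_1[OF s(1)] by (auto simp: eps_def)
  show "eps x \<in> x" using EV_mem[OF s(1,2) x(2)] subring_1[OF s(1)] by (simp add: eps_def f_def g_def)
  show "unit_in x (f / eps x) \<or> unit_in x (g / eps x)"
    using x(2) f_nonzero g_nonzero unit_in_1[OF s(1)] by (simp add: eps_def)
qed

text \<open>\<open>g2P\<close> lies in the ideal of the points, so the local generator
  \<open>eps x\<close> divides it, and on this overlap \<open>g2P\<close> is a unit.\<close>

lemma eps_unit_Y02: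
  assumes "x \<in> Y0 \<inter> Y2" shows "unit_in x (eps x)"
proof -
  have x: "x \<in> X" "chart 1 \<subseteq> x" using assms by (auto simp: aff_def)
  note s = loc_ptD[OF X_loc_pt[OF x(1)]] note ev = EV_mem[OF s(1,2) x(2)]
  obtain a b where "g2P = a * fP + b * gP" using van_fg[OF van_g2P] .
  then have "EV g2P = eps x * (EV a * (f / eps x) + EV b * (g / eps x))"
    using eps_nonzero[of x] by (simp add: EV_hom f_def g_def field_simps)
  moreover have "EV a * (f / eps x) + EV b * (g / eps x) \<in> x"
    by (intro subring_add[OF s(1)] subring_mult[OF s(1)] eps_divides[OF x] ev)
  ultimately show ?thesis
    using unit_in_factor[OF s(1) _ eps_divides(3)[OF x]] Y02_unit[OF assms] by simp
qed

lemma LB_B2: "x \<in> B2 \<Longrightarrow> LB n k x = {a. a / g powi k \<in> x}"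
  by (simp add: LB_def mu_def eps_def aff_def GB2_def)

lemma LB_B1:
  assumes "x \<in> B1" shows "LB n k x = {a. a / f powi k \<in> x}"
proof -
  have x: "x \<in> X" "chart 1 \<subseteq> x" "g / f \<in> x" using assms by (auto simp: aff_def GB1_def)
  note s = subring_X[OF x(1)]
  have "unit_in x (eps x / f)"
    using x f_nonzero g_nonzero unit_in_1[OF s] by (auto simp: eps_def unit_in_def)
  then have "unit_in x ((eps x / f) powi k)" by (rule unit_in_powi[OF s])
  then have "unit_in x (mu x powi n * eps x powi k / f powi k)"
    using x(2) by (simp add: mu_def power_int_divide_distrib)
  then show ?thesis by (rule LB_eqI[OF x(1)])
qed

lemma LB_Y1:
  assumes "x \<in> Y1" shows "LB n k x = {a. a / u powi n \<in> x}"
proof -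
  have x: "x \<in> X" "G1 \<subseteq> x" using assms by (auto simp: aff_def)
  note s = subring_X[OF x(1)]
  show ?thesis
  proof (cases "chart 1 \<subseteq> x")
    case True
    then have "unit_in x (eps x powi k)" "unit_in x (u powi n)"
      using eps_unit_Y01[of x] chart1_unit[OF x(1)] x assms by (auto intro!: unit_in_powi s simp: aff_def)
    then have "unit_in x (mu x powi n * eps x powi k / u powi n)"
      using True by (simp add: mu_def unit_in_divide[OF s])
    then show ?thesis by (rule LB_eqI[OF x(1)])
  next
    case False
    then show ?thesis using x by (simp add: LB_def mu_def eps_def)
  qed
qed

lemma unit_vu: "x \<in> X \<Longrightarrow> chart u \<subseteq> x \<Longrightarrow> chart v \<subseteq> x \<Longrightarrow> unit_in x (u / v)"
  using u_nonzero v_nonzero by (auto simp: unit_in_def chart_def)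

lemma LB_Y2:
  assumes "x \<in> Y2" shows "LB n k x = {a. a / v powi n \<in> x}"
proof -
  have x: "x \<in> X" "G2 \<subseteq> x" using assms by (auto simp: aff_def)
  note s = subring_X[OF x(1)]
  consider "chart 1 \<subseteq> x" | "\<not> chart 1 \<subseteq> x" "G1 \<subseteq> x" | "\<not> chart 1 \<subseteq> x" "\<not> G1 \<subseteq> x" by blast
  then show ?thesis
  proof cases
    case 1
    then have "unit_in x (eps x powi k)" "unit_in x (v powi n)"
      using eps_unit_Y02[of x] chart1_unit[OF x(1)] x assms by (auto intro!: unit_in_powi s simp: aff_def)
    then have "unit_in x (mu x powi n * eps x powi k / v powi n)"
      using 1 by (simp add: mu_def unit_in_divide[OF s])
    then show ?thesis by (rule LB_eqI[OF x(1)])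
  next
    case 2
    then have "unit_in x ((u / v) powi n)"
      using x by (intro unit_in_powi[OF s] unit_vu) (auto simp: G1_def G2_def)
    then have "unit_in x (mu x powi n * eps x powi k / v powi n)"
      using 2 by (simp add: mu_def eps_def power_int_divide_distrib)
    then show ?thesis by (rule LB_eqI[OF x(1)])
  next
    case 3
    then show ?thesis by (simp add: LB_def mu_def eps_def)
  qed
qed

lemma LB_frames:
  assumes "x \<in> X"
  obtains W \<rho> where "W \<in> {B1, B2, Y1, Y2}" "x \<in> W" "\<And>y. y \<in> W \<Longrightarrow> LB n k y = {a. a / \<rho> \<in> y}" "\<rho> \<noteq> 0"
proof -
  have nz: "f powi k \<noteq> 0" "g powi k \<noteq> 0" "u powi n \<noteq> 0" "v powi n \<noteq> 0"
    using f_nonzero g_nonzero u_nonzero v_nonzero by auto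
  have "x \<in> B1 \<or> x \<in> B2 \<or> x \<in> Y1 \<or> x \<in> Y2" using assms X_eq Y0_eq by blast
  then show thesis
    using that[of B1, OF _ _ LB_B1 nz(1)] that[of B2, OF _ _ LB_B2 nz(2)] that[of Y1, OF _ _ LB_Y1 nz(3)] that[of Y2, OF _ _ LB_Y2 nz(4)]
    by blast
qed

lemma openin_basic: "W \<in> {B1, B2, Y1, Y2} \<Longrightarrow> openin (zariski X) W"
  using openin_aff finite_G by auto

lemma qc_LB: "vector_space.qc_sheaf (*) X (LB n k)"
proof -
  show ?thesis
  proof (rule vector_space_over_itself.qc_sheaf_frames[where 'i = unit, OF generization_closed_X subring_1[OF subring_X]])
    fix x assume "x \<in> X"
    then obtain W \<rho> where W: "W \<in> {B1, B2, Y1, Y2}" "x \<in> W" "\<And>y. y \<in> W \<Longrightarrow> LB n k y = {a. a / \<rho> \<in> y}"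
      by (rule LB_frames[of x n k]) (rule that)
    show "\<exists>W I \<psi>. openin (zariski X) W \<and> x \<in> W \<and> finite (I :: unit set) \<and>
       (\<forall>i\<in>I. \<forall>a b r. \<psi> i (a + b) = \<psi> i a + \<psi> i b \<and> \<psi> i (r * a) = r * \<psi> i a) \<and>
       (\<forall>y\<in>W. LB n k y = {v. \<forall>i\<in>I. \<psi> i v \<in> y})"
      by (rule exI[of _ W], rule exI[of _ UNIV], rule exI[of _ "\<lambda>_ a. a / \<rho>"])
        (use W openin_basic in \<open>auto simp: add_divide_distrib\<close>)
  qed
qed

subsection \<open>Sections as fractions with bounded degree\<close>

definition frac :: "'k poly poly \<Rightarrow> 'k ff set" where
  "frac P = {EV h / EV P ^ M | h M. True}"

text \<open>With \<open>m\<close> the degree of \<open>P\<close>, these are the sections of the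
  plane sheaf \<open>O(a)\<close> off the homogenized curve \<open>P = 0\<close>. In
  \<open>frac P\<close> the condition along the line at infinity is dropped.\<close>

definition frac_deg :: "'k poly poly \<Rightarrow> nat \<Rightarrow> int \<Rightarrow> 'k ff set" where
  "frac_deg P m a = {EV h / EV P ^ M | h M. tdle (int (M * m) + a) h}"

context
  fixes P :: "'k poly poly"
  assumes P: "P \<noteq> 0"
begin

lemma EVP: "EV P \<noteq> 0"
  using P by (simp add: EV_eq_0)

lemma frac_raise: "EV h / EV P ^ M = EV (h * P ^ j) / EV P ^ (M + j)"
  using EVP by (simp add: EV_hom power_add)

lemma subring_frac: "subring_of_field (frac P)" "range const_ff \<subseteq> frac P" "EV h \<in> frac P"
proof -
  show ev: "EV h \<in> frac P" for h unfolding frac_def by (intro CollectI exI[of _ h] exI[of _ 0]) simp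
  have "const_ff c = EV (mono2 c 0 0)" for c by (simp add: EV_mono2)
  then show "range const_ff \<subseteq> frac P" using ev by auto
  show "subring_of_field (frac P)" unfolding subring_of_field_def
  proof (intro conjI ballI)
    show "0 \<in> frac P" "1 \<in> frac P" using ev[of 0] ev[of 1] by (simp_all add: EV_hom)
    fix a b assume "a \<in> frac P" "b \<in> frac P"
    then obtain h M h' M' where *: "a = EV h / EV P ^ M" "b = EV h' / EV P ^ M'" by (auto simp: frac_def)
    have "a = EV (h * P ^ M') / EV P ^ (M + M')" "b = EV (h' * P ^ M) / EV P ^ (M + M')"
      using frac_raise[of h M M'] frac_raise[of h' M' M] * by (simp_all add: add.commute)
    then have "a + b = EV (h * P ^ M' + h' * P ^ M) / EV P ^ (M + M')" "a - b = EV (h * P ^ M' - h' * P ^ M) / EV P ^ (M + M')"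
      by (simp_all add: EV_hom(1,5) add_divide_distrib diff_divide_distrib)
    moreover have "a * b = EV (h * h') / EV P ^ (M + M')" by (simp add: * EV_hom power_add)
    ultimately show "a + b \<in> frac P" "a - b \<in> frac P" "a * b \<in> frac P" unfolding frac_def by blast+
  qed
qed

lemma frac_deg_raise:
  assumes "tdle (int m) P" "y = EV h / EV P ^ M" "tdle (int (M * m) + a) h" "M \<le> M'"
  obtains h' where "y = EV h' / EV P ^ M'" "tdle (int (M' * m) + a) h'"
proof -
  have "tdle (int (M * m) + a + int (M' - M) * int m) (h * P ^ (M' - M))"
    by (intro tdle_mult tdle_power assms)
  moreover have "int (M * m) + a + int (M' - M) * int m = int (M' * m) + a"
    using assms(4) by (simp add: of_nat_diff algebra_simps)
  ultimately have "tdle (int (M' * m) + a) (h * P ^ (M' - M))" by (simp only:)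
  moreover have "y = EV (h * P ^ (M' - M)) / EV P ^ M'"
    using frac_raise[of h M "M' - M"] assms(2,4) by simp
  ultimately show thesis using that by blast
qed

lemma frac_deg_mult: "y \<in> frac_deg P m a \<Longrightarrow> z \<in> frac_deg P m b \<Longrightarrow> y * z \<in> frac_deg P m (a + b)"
proof -
  assume "y \<in> frac_deg P m a" "z \<in> frac_deg P m b"
  then obtain h M h' M' where *: "y = EV h / EV P ^ M" "tdle (int (M * m) + a) h" "z = EV h' / EV P ^ M'" "tdle (int (M' * m) + b) h'"
    by (auto simp: frac_deg_def)
  have "y * z = EV (h * h') / EV P ^ (M + M')" by (simp add: * EV_hom power_add)
  moreover have "int (M * m) + a + (int (M' * m) + b) = int ((M + M') * m) + (a + b)" by (simp add: algebra_simps)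
  then have "tdle (int ((M + M') * m) + (a + b)) (h * h')" using tdle_mult[OF *(2,4)] by (simp only:)
  ultimately show ?thesis unfolding frac_deg_def by blast
qed

lemma subring_frac_deg:
  assumes m: "tdle (int m) P"
  shows "subring_of_field (frac_deg P m 0)" "range const_ff \<subseteq> frac_deg P m 0"
proof -
  have ev: "EV h \<in> frac_deg P m a" if "tdle a h" for h a
    unfolding frac_deg_def using that by (intro CollectI exI[of _ h] exI[of _ 0]) simp
  have "const_ff c = EV (mono2 c 0 0)" for c by (simp add: EV_mono2)
  then show "range const_ff \<subseteq> frac_deg P m 0" using ev tdle_mono2[of 0 0 0] by auto
  show "subring_of_field (frac_deg P m 0)" unfolding subring_of_field_def
  proof (intro conjI ballI)
    show "0 \<in> frac_deg P m 0" "1 \<in> frac_deg P m 0" using ev[OF tdle_0, of 0] ev[OF tdle_1, of 0] by (simp_all add: EV_hom)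
    fix a b assume ab: "a \<in> frac_deg P m 0" "b \<in> frac_deg P m 0"
    then show "a * b \<in> frac_deg P m 0" using frac_deg_mult[of a m 0 b 0] by simp
    obtain h M h' M' where *: "a = EV h / EV P ^ M" "tdle (int (M * m) + 0) h" "b = EV h' / EV P ^ M'" "tdle (int (M' * m) + 0) h'"
      using ab by (auto simp: frac_deg_def)
    obtain k where k: "a = EV k / EV P ^ (M + M')" "tdle (int ((M + M') * m) + 0) k"
      using frac_deg_raise[OF m *(1,2), of "M + M'"] by auto
    obtain k' where k': "b = EV k' / EV P ^ (M + M')" "tdle (int ((M + M') * m) + 0) k'"
      using frac_deg_raise[OF m *(3,4), of "M + M'"] by auto
    have "a + b = EV (k + k') / EV P ^ (M + M')" "a - b = EV (k - k') / EV P ^ (M + M')"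
      by (simp_all add: k(1) k'(1) EV_hom(1,5) add_divide_distrib diff_divide_distrib)
    then show "a + b \<in> frac_deg P m 0" "a - b \<in> frac_deg P m 0"
      unfolding frac_deg_def using tdle_add[OF k(2) k'(2)] tdle_diff[OF k(2) k'(2)] by blast+
  qed
qed

end

lemma frac_deg_product:
  assumes "Q \<noteq> 0" "tdle (int m') Q"
  shows "frac_deg P m a \<subseteq> frac_deg (P * Q) (m + m') a" "frac P \<subseteq> frac (P * Q)" "frac_deg P m a \<subseteq> frac P"
proof -
  have EVQ: "EV Q \<noteq> 0" using assms(1) by (simp add: EV_eq_0)
  have eq: "EV h / EV P ^ M = EV (h * Q ^ M) / EV (P * Q) ^ M" for h M
    using EVQ by (simp add: EV_hom power_mult_distrib)
  show "frac P \<subseteq> frac (P * Q)" "frac_deg P m a \<subseteq> frac P" unfolding frac_def frac_deg_def using eq by blast+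
  show "frac_deg P m a \<subseteq> frac_deg (P * Q) (m + m') a"
  proof
    fix y assume "y \<in> frac_deg P m a"
    then obtain h M where *: "y = EV h / EV P ^ M" "tdle (int (M * m) + a) h" by (auto simp: frac_deg_def)
    have "tdle (int (M * m) + a + int M * int m') (h * Q ^ M)" by (intro tdle_mult tdle_power assms *)
    then have "tdle (int (M * (m + m')) + a) (h * Q ^ M)" by (simp add: algebra_simps)
    then show "y \<in> frac_deg (P * Q) (m + m') a" unfolding frac_deg_def using eq *(1) by blast
  qed
qed

definition q2P :: "'k poly poly" where "q2P = (\<Prod>i<e. V - mono2 (vp i) 0 0) * (\<Prod>k<d. continuant k)"

lemma g2P_V: "g2P = V * q2P"
  by (simp add: g2P_def q2P_def mult.assoc)

lemma tdle_gP: "tdle (int m1 - 1) gP"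
proof -
  have "utop (\<Sum>i<e. 1) gP" unfolding gP_prod by (intro utop_prod utop_linear)
  then show ?thesis using utop_tdle by (simp add: m1_def)
qed

lemma tdle_q2P: "tdle (int m2 - 1) q2P"
proof -
  have "vtop ((\<Sum>i<e. 1) + (\<Sum>k<d. k)) q2P"
    unfolding q2P_def by (intro vtop_mult vtop_prod vtop_linear vtop_continuant)
  then have "tdle (int ((\<Sum>i<e. 1) + (\<Sum>k<d. k))) q2P" by (rule vtop_tdle)
  then show ?thesis by (simp add: m2_def)
qed

lemma g1P_nonzero: "g1P \<noteq> 0" and g2P_nonzero: "g2P \<noteq> 0"
  using utop_nonzero[OF utop_g1P] vtop_nonzero[OF vtop_g2P] by auto

lemma frac_degI: "y * EV P = EV h \<Longrightarrow> P \<noteq> 0 \<Longrightarrow> tdle (int m + a) h \<Longrightarrow> y \<in> frac_deg P m a"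
  unfolding frac_deg_def by (intro CollectI exI[of _ h] exI[of _ 1]) (auto simp: EV_eq_0 eq_divide_eq)

lemma G1_frac: "G1 \<subseteq> frac_deg g1P m1 0"
proof -
  have "1 / u \<in> frac_deg g1P m1 0"
    by (rule frac_degI[OF _ g1P_nonzero, of _ gP])
      (use u_nonzero tdle_mono[OF tdle_gP] in \<open>simp_all add: g1P_def rhom.mult[OF rhom_EV] EV_mono2 const_ff_hom\<close>)
  moreover have "u / u \<in> frac_deg g1P m1 0"
    by (rule frac_degI[OF _ g1P_nonzero, of _ g1P])
      (use u_nonzero utop_tdle[OF utop_g1P] in \<open>simp_all\<close>)
  moreover have "tdle (int m1 + 0) (V * gP)" using tdle_mult[OF tdle_mono2[of 0 1 1 1] tdle_gP] by simp
  then have "v / u \<in> frac_deg g1P m1 0"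
    by (rule frac_degI[OF _ g1P_nonzero, rotated])
      (use u_nonzero in \<open>simp_all add: g1P_def rhom.mult[OF rhom_EV] EV_mono2 const_ff_hom\<close>)
  moreover have "inverse \<gamma>1 \<in> frac_deg g1P m1 0"
    by (rule frac_degI[OF _ g1P_nonzero, of _ "mono2 1 m1 0"])
      (use g1P_nonzero in \<open>simp_all add: \<gamma>1_def EV_mono2 const_ff_hom EV_eq_0 tdle_mono2\<close>)
  ultimately show ?thesis by (simp add: G1_def chart_def)
qed

lemma G2_frac: "G2 \<subseteq> frac_deg g2P m2 0"
proof -
  have "1 / v \<in> frac_deg g2P m2 0"
    by (rule frac_degI[OF _ g2P_nonzero, of _ q2P])
      (use v_nonzero tdle_mono[OF tdle_q2P] in \<open>simp_all add: g2P_V rhom.mult[OF rhom_EV] EV_mono2 const_ff_hom\<close>)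
  moreover have "v / v \<in> frac_deg g2P m2 0"
    by (rule frac_degI[OF _ g2P_nonzero, of _ g2P])
      (use v_nonzero vtop_tdle[OF vtop_g2P] in \<open>simp_all\<close>)
  moreover have "tdle (int m2 + 0) (U * q2P)" using tdle_mult[OF tdle_mono2[of 1 0 1 1] tdle_q2P] by simp
  then have "u / v \<in> frac_deg g2P m2 0"
    by (rule frac_degI[OF _ g2P_nonzero, rotated])
      (use v_nonzero in \<open>simp_all add: g2P_V rhom.mult[OF rhom_EV] EV_mono2 const_ff_hom\<close>)
  moreover have "inverse \<gamma>2 \<in> frac_deg g2P m2 0"
    by (rule frac_degI[OF _ g2P_nonzero, of _ "mono2 1 0 m2"])
      (use g2P_nonzero in \<open>simp_all add: \<gamma>2_def EV_mono2 const_ff_hom EV_eq_0 tdle_mono2\<close>)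
  ultimately show ?thesis by (simp add: G2_def chart_def)
qed

lemma chart1_frac: "P \<noteq> 0 \<Longrightarrow> chart 1 \<subseteq> frac P"
  using subring_frac(3)[of P 1] subring_frac(3)[of P U] subring_frac(3)[of P V] by (simp add: chart_def EV_hom EV_mono2 const_ff_hom)

text \<open>Covers the case \<open>n = - 1\<close> of \<open>LB_D1\<close>, where
  \<open>v powi n\<close> is not a polynomial. The factor \<open>V\<close> of \<open>g2P\<close>
  supplies the denominator.\<close>

lemma vinv_frac: "inverse v \<in> frac_deg (g1P * g2P) (m1 + m2) (- 1)"
proof (rule frac_degI[of _ _ "g1P * q2P"])
  show "tdle (int (m1 + m2) + - 1) (g1P * q2P)"
    using tdle_mult[OF utop_tdle[OF utop_g1P] tdle_q2P] by (simp add: add_diff_eq)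
qed (use v_nonzero g1P_nonzero g2P_nonzero in \<open>simp_all add: g2P_V rhom.mult[OF rhom_EV] EV_mono2 const_ff_hom\<close>)

lemma aff_sections:
  assumes "G \<in> affines" "\<And>x. x \<in> aff G \<Longrightarrow> a \<in> x"
  shows "a \<in> subalgebra_gen G"
proof (rule Inter_Spec_rings[OF subring_subalgebra_gen])
  fix x assume "x \<in> Spec_rings (subalgebra_gen G)"
  then show "a \<in> x" using Spec_affines[OF assms(1)] Spec_gen_subset by (intro assms(2)) (auto simp: aff_def)
qed

lemma alg_frac:
  "subalgebra_gen (chart 1 \<union> G1) \<subseteq> frac g1P"
  "subalgebra_gen (chart 1 \<union> G2) \<subseteq> frac g2P"
  "subalgebra_gen (chart 1 \<union> G1 \<union> G2) \<subseteq> frac (g1P * g2P)"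
  "subalgebra_gen (G1 \<union> G2) \<subseteq> frac_deg (g1P * g2P) (m1 + m2) 0"
  "subalgebra_gen G1 \<subseteq> frac_deg g1P m1 0"
proof -
  note nz = g1P_nonzero g2P_nonzero
  note t = utop_tdle[OF utop_g1P] vtop_tdle[OF vtop_g2P]
  have nz12: "g1P * g2P \<noteq> 0" using nz by simp
  have t12: "tdle (int (m1 + m2)) (g1P * g2P)" using tdle_mult[OF t] by simp
  have G1f: "G1 \<subseteq> frac g1P" "G2 \<subseteq> frac g2P" using G1_frac G2_frac frac_deg_product(3)[OF nz(1) t(1)] by blast+
  have G12: "G1 \<subseteq> frac_deg (g1P * g2P) (m1 + m2) 0" "G2 \<subseteq> frac_deg (g1P * g2P) (m1 + m2) 0"
    using G1_frac G2_frac frac_deg_product(1)[OF nz(2) t(2), of g1P m1 0] frac_deg_product(1)[OF nz(1) t(1), of g2P m2 0]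
    by (auto simp: mult.commute add.commute)
  show "subalgebra_gen (chart 1 \<union> G1) \<subseteq> frac g1P"
    using subring_frac(1,2)[OF nz(1)] chart1_frac[OF nz(1)] G1f by (subst subalgebra_gen_subset) auto
  show "subalgebra_gen (chart 1 \<union> G2) \<subseteq> frac g2P"
    using subring_frac(1,2)[OF nz(2)] chart1_frac[OF nz(2)] G1f by (subst subalgebra_gen_subset) auto
  have "G1 \<union> G2 \<subseteq> frac (g1P * g2P)" using G12 frac_deg_product(3)[OF nz(1) t(1)] by blast
  then show "subalgebra_gen (chart 1 \<union> G1 \<union> G2) \<subseteq> frac (g1P * g2P)"
    using subring_frac(1,2)[OF nz12] chart1_frac[OF nz12] by (subst subalgebra_gen_subset) auto
  show "subalgebra_gen (G1 \<union> G2) \<subseteq> frac_deg (g1P * g2P) (m1 + m2) 0"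
    using subring_frac_deg[OF nz12 t12] G12 by (subst subalgebra_gen_subset) auto
  show "subalgebra_gen G1 \<subseteq> frac_deg g1P m1 0"
    using subring_frac_deg[OF nz(1) t(1)] G1_frac by (subst subalgebra_gen_subset) auto
qed

lemma tdle_neg: "tdle n h \<Longrightarrow> n < 0 \<Longrightarrow> h = 0"
  by (rule cf_ext) (auto dest: tdleD)

lemma tdle_chart_powi:
  assumes x: "loc_pt x" "chart \<mu> \<subseteq> x" "\<mu> \<noteq> 0" and h: "tdle n h"
  shows "EV h / \<mu> powi n \<in> x"
proof (cases "n < 0")
  case True
  then show ?thesis using tdle_neg[OF h] subring_0[OF loc_ptD(1)[OF x(1)]] by (simp add: EV_hom)
next
  case False
  then show ?thesis using tdle_chart_mem[OF loc_ptD(1,2)[OF x(1)] x(2,3), of "nat n" h] h by (simp add: power_int_def)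
qed

lemma Y1_frac_mem:
  assumes x: "x \<in> Y1" and h: "tdle (int (M * m1) + n) h"
  shows "EV h / EV g1P ^ M / u powi n \<in> x"
proof -
  have X: "x \<in> X" "chart u \<subseteq> x" "G1 \<subseteq> x" using x by (auto simp: aff_def G1_def)
  note lx = X_loc_pt[OF X(1)] note s = loc_ptD(1)[OF lx]
  have "EV g1P ^ M = \<gamma>1 ^ M * u powi (int (M * m1))"
    using u_nonzero by (simp add: \<gamma>1_def power_divide power_mult[symmetric] mult.commute power_int_def flip: of_nat_mult)
  then have "EV h / EV g1P ^ M / u powi n = EV h / u powi (int (M * m1) + n) / \<gamma>1 ^ M"
    using u_nonzero by (simp add: power_int_add mult_ac)
  also have "... \<in> x"
    by (rule unit_in_divide_mem[OF s tdle_chart_powi[OF lx X(2) u_nonzero h] unit_in_power[OF s G1_unit[OF lx X(3)]]])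
  finally show ?thesis .
qed

lemma Y2_frac_mem:
  assumes x: "x \<in> Y2" and h: "tdle (int (M * m2) + n) h"
  shows "EV h / EV g2P ^ M / v powi n \<in> x"
proof -
  have X: "x \<in> X" "chart v \<subseteq> x" "G2 \<subseteq> x" using x by (auto simp: aff_def G2_def)
  note lx = X_loc_pt[OF X(1)] note s = loc_ptD(1)[OF lx]
  have "EV g2P ^ M = \<gamma>2 ^ M * v powi (int (M * m2))"
    using v_nonzero by (simp add: \<gamma>2_def power_divide power_mult[symmetric] mult.commute power_int_def flip: of_nat_mult)
  then have "EV h / EV g2P ^ M / v powi n = EV h / v powi (int (M * m2) + n) / \<gamma>2 ^ M"
    using v_nonzero by (simp add: power_int_add mult_ac)
  also have "... \<in> x"
    by (rule unit_in_divide_mem[OF s tdle_chart_powi[OF lx X(2) v_nonzero h] unit_in_power[OF s G2_unit[OF lx X(3)]]])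
  finally show ?thesis .
qed

lemma Y12_frac_mem:
  assumes x: "x \<in> Y1 \<inter> Y2" and h: "tdle (int (M * m1) + int (M * m2) + n) h"
  shows "EV h / (EV g1P ^ M * EV g2P ^ M) / v powi n \<in> x"
proof -
  have X: "x \<in> X" "chart v \<subseteq> x" "chart u \<subseteq> x" "G2 \<subseteq> x" "G1 \<subseteq> x" using x by (auto simp: aff_def G2_def G1_def)
  note lx = X_loc_pt[OF X(1)] note s = loc_ptD(1)[OF lx]
  let ?k = "M * m1" and ?l = "M * m2"
  have 1: "EV g1P ^ M = \<gamma>1 ^ M * (u / v) ^ ?k * v powi (int ?k)"
    using u_nonzero v_nonzero by (simp add: \<gamma>1_def power_divide power_mult[symmetric] mult.commute power_int_def flip: of_nat_mult)
  have 2: "EV g2P ^ M = \<gamma>2 ^ M * v powi (int ?l)"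
    using v_nonzero by (simp add: \<gamma>2_def power_divide power_mult[symmetric] mult.commute power_int_def flip: of_nat_mult)
  have "EV h / (EV g1P ^ M * EV g2P ^ M) / v powi n = EV h / v powi (int ?k + int ?l + n) / (\<gamma>1 ^ M * (u / v) ^ ?k * \<gamma>2 ^ M)"
    unfolding 1 2 using v_nonzero by (simp add: power_int_add mult_ac del: of_nat_mult)
  also have "... \<in> x"
    by (rule unit_in_divide_mem[OF s tdle_chart_powi[OF lx X(2) v_nonzero h]])
      (intro unit_in_mult unit_in_power s unit_vu X G1_unit G2_unit lx)
  finally show ?thesis .
qed

end

section \<open>Cohomology of the line bundles O(nL - kE)\<close>

context plane_points
begin

text \<open>Elements of the overlap algebra are Laurent polynomials in \<open>g / f\<close> over the
  coordinate ring of the affine plane; they are split into nonnegative and negative powers. The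
  negative part keeps an explicit factor \<open>f / g\<close>, the spare factor needed for
  \<open>O(E)\<close>.\<close>

lemma B12_split:
  assumes \<sigma>: "\<sigma> \<in> subalgebra_gen (GB1 \<union> GB2)"
  obtains \<sigma>1 \<sigma>2 where "\<sigma>1 \<in> subalgebra_gen GB1" "\<sigma>2 \<in> subalgebra_gen GB2" "\<sigma> = \<sigma>1 + (f / g) * \<sigma>2"
proof -
  let ?A = "subalgebra_gen (chart 1)" and ?R1 = "subalgebra_gen GB1" and ?R2 = "subalgebra_gen GB2"
  let ?w = "g / f"
  note s1 = subring_subalgebra_gen[of GB1] and s2 = subring_subalgebra_gen[of GB2]
  have ww: "?w * (f / g) = 1" using f_nonzero g_nonzero by simp
  have wR: "?w \<in> ?R1" "f / g \<in> ?R2" using subalgebra_gen_super[of GB1] subalgebra_gen_super[of GB2] by (auto simp: GB1_def GB2_def)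
  have AR: "?A \<subseteq> ?R1" "?A \<subseteq> ?R2" by (rule subalgebra_gen_mono; auto simp: GB1_def GB2_def)+
  \<comment> \<open>Multiplying by a power of \<open>g / f\<close> brings every element into the
    algebra of \<open>B1\<close>.\<close>
  define Z where "Z = {a * (f / g) ^ n | a n. a \<in> ?R1}"
  have Z1: "a \<in> Z" if "a \<in> ?R1" for a unfolding Z_def using that by (intro CollectI exI[of _ a] exI[of _ 0]) simp
  have "subring_of_field Z" unfolding subring_of_field_def
  proof (intro conjI ballI)
    show "0 \<in> Z" "1 \<in> Z" using Z1 subring_0[OF s1] subring_1[OF s1] by auto
    fix a b assume "a \<in> Z" "b \<in> Z"
    then obtain a' n b' m where *: "a = a' * (f / g) ^ n" "a' \<in> ?R1" "b = b' * (f / g) ^ m" "b' \<in> ?R1" by (auto simp: Z_def)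
    have r: "c * (f / g) ^ i = (c * ?w ^ j) * (f / g) ^ (i + j)" for c i j
    proof -
      have "(c * ?w ^ j) * (f / g) ^ (i + j) = c * (?w * (f / g)) ^ j * (f / g) ^ i"
        by (simp only: power_add power_mult_distrib mult_ac)
      then show ?thesis by (simp only: ww power_one mult_1_right)
    qed
    have "a = (a' * ?w ^ m) * (f / g) ^ (n + m)" "b = (b' * ?w ^ n) * (f / g) ^ (n + m)"
      using r[of a' n m] r[of b' m n] * by (simp_all only: add.commute)
    then have "a + b = (a' * ?w ^ m + b' * ?w ^ n) * (f / g) ^ (n + m)" "a - b = (a' * ?w ^ m - b' * ?w ^ n) * (f / g) ^ (n + m)"
      by (simp_all only: distrib_right left_diff_distrib)
    moreover have "a' * ?w ^ m + b' * ?w ^ n \<in> ?R1" "a' * ?w ^ m - b' * ?w ^ n \<in> ?R1"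
      by (rule subring_add[OF s1] subring_diff[OF s1]; intro subring_mult[OF s1] subring_power[OF s1] * wR)+
    ultimately show "a + b \<in> Z" "a - b \<in> Z" unfolding Z_def by blast+
    have "a * b = (a' * b') * (f / g) ^ (n + m)" by (simp only: * power_add mult_ac)
    then show "a * b \<in> Z" unfolding Z_def using subring_mult[OF s1 *(2,4)] by blast
  qed
  moreover have "f / g \<in> Z" unfolding Z_def using subring_1[OF s1] by (intro CollectI exI[of _ 1] exI[of _ 1]) simp
  moreover have "range const_ff \<subseteq> Z" "GB1 \<subseteq> Z" using Z1 const_subring[of GB1] subalgebra_gen_super[of GB1] by blast+
  ultimately have "subalgebra_gen (GB1 \<union> GB2) \<subseteq> Z"
    by (intro subalgebra_gen_least) (auto simp: GB1_def GB2_def)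
  then obtain a n where a: "\<sigma> = a * (f / g) ^ n" "a \<in> ?R1" using \<sigma> by (auto simp: Z_def)
  have "?R1 = adjoin ?A ?w" by (simp add: GB1_def subalgebra_gen_insert)
  then obtain q where q: "a = poly q ?w" "\<forall>i. coeff q i \<in> ?A" using a(2) by (auto simp: adjoin_def)
  define W where "W = {\<sigma>1 + (f / g) * \<sigma>2 | \<sigma>1 \<sigma>2. \<sigma>1 \<in> ?R1 \<and> \<sigma>2 \<in> ?R2}"
  have W0: "0 \<in> W" unfolding W_def using subring_0[OF s1] subring_0[OF s2] by (intro CollectI exI[of _ 0]) simp
  have Wadd: "x + y \<in> W" if xy: "x \<in> W" "y \<in> W" for x y
  proof -
    obtain a b a' b' where *: "x = a + (f / g) * b" "a \<in> ?R1" "b \<in> ?R2" "y = a' + (f / g) * b'" "a' \<in> ?R1" "b' \<in> ?R2"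
      using xy unfolding W_def by blast
    have "x + y = (a + a') + (f / g) * (b + b')" by (simp only: * distrib_left add_ac)
    then show ?thesis unfolding W_def using subring_add[OF s1 *(2,5)] subring_add[OF s2 *(3,6)] by blast
  qed
  have Wsum: "sum h S \<in> W" if "\<And>i. i \<in> S \<Longrightarrow> h i \<in> W" for h and S :: "nat set"
    using that by (induction S rule: infinite_finite_induct) (auto intro: W0 Wadd)
  have summand: "coeff q i * ?w ^ i * (f / g) ^ n \<in> W" for i
  proof (cases "n \<le> i")
    case True
    then have "?w ^ i * (f / g) ^ n = ?w ^ (i - n) * (?w * (f / g)) ^ n"
      by (simp only: power_mult_distrib mult.assoc[symmetric] power_add[symmetric]) simp
    then have "coeff q i * ?w ^ i * (f / g) ^ n = coeff q i * ?w ^ (i - n) + (f / g) * 0" by (simp only: ww power_one mult.assoc mult_1_right mult_zero_right add_0_right)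
    moreover have "coeff q i * ?w ^ (i - n) \<in> ?R1" using q AR wR by (intro subring_mult[OF s1] subring_power[OF s1]) auto
    ultimately show ?thesis unfolding W_def using subring_0[OF s2] by blast
  next
    case False
    then have n: "n = i + (1 + (n - i - 1))" by simp
    have "?w ^ i * (f / g) ^ n = (?w * (f / g)) ^ i * ((f / g) * (f / g) ^ (n - i - 1))"
      by (subst n) (simp only: power_add power_mult_distrib power_one_right mult_ac)
    then have "?w ^ i * (f / g) ^ n = (f / g) * (f / g) ^ (n - i - 1)"
      by (simp only: ww power_one mult_1_left)
    then have "coeff q i * ?w ^ i * (f / g) ^ n = 0 + (f / g) * (coeff q i * (f / g) ^ (n - i - 1))"
      by (simp only: mult.assoc mult.left_commute[of "coeff q i" "f / g"] add_0_left)
    moreover have "coeff q i * (f / g) ^ (n - i - 1) \<in> ?R2" using q AR wR by (intro subring_mult[OF s2] subring_power[OF s2]) auto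
    ultimately show ?thesis unfolding W_def using subring_0[OF s1] by blast
  qed
  have "\<sigma> = (\<Sum>i\<le>degree q. coeff q i * ?w ^ i * (f / g) ^ n)"
    unfolding a(1) q(1) by (simp only: poly_altdef sum_distrib_right)
  then have "\<sigma> \<in> W" using Wsum[of "{..degree q}"] summand by simp
  then show thesis using that unfolding W_def by blast
qed

lemma affines_memb [simp]: "GB1 \<in> affines" "GB2 \<in> affines" "GB1 \<union> GB2 \<in> affines" "G1 \<in> affines" "G2 \<in> affines"
  "chart 1 \<union> G1 \<in> affines" "chart 1 \<union> G2 \<in> affines" "G1 \<union> G2 \<in> affines" "chart 1 \<union> G1 \<union> G2 \<in> affines"
  by (simp_all add: affines_def)

lemma alg_mem_aff: "a \<in> subalgebra_gen G \<Longrightarrow> x \<in> aff G \<Longrightarrow> a \<in> x"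
  unfolding aff_subalgebra by auto

text \<open>\<open>R\<^sup>1\<close> of the blow-down vanishes for \<open>O\<close> and \<open>O(E)\<close>.\<close>

lemma LB_B12:
  assumes k: "k = 0 \<or> k = - 1" and s: "s \<in> sections (LB n k) (B1 \<inter> B2)"
  shows "\<exists>s1 s2. s1 \<in> sections (LB n k) B1 \<and> s2 \<in> sections (LB n k) B2 \<and> s = s1 - s2"
proof -
  have "s / f powi k \<in> x" if "x \<in> aff (GB1 \<union> GB2)" for x
    using s that LB_B1[of x n k] unfolding sections_mem aff_Int[symmetric] by blast
  then have "s / f powi k \<in> subalgebra_gen (GB1 \<union> GB2)" by (intro aff_sections) simp
  then obtain \<sigma>1 \<sigma>2 where \<sigma>: "\<sigma>1 \<in> subalgebra_gen GB1" "\<sigma>2 \<in> subalgebra_gen GB2" "s / f powi k = \<sigma>1 + (f / g) * \<sigma>2"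
    by (rule B12_split)
  have fk: "f powi k \<noteq> 0" "g powi k \<noteq> 0" using f_nonzero g_nonzero by auto
  define s1 where "s1 = f powi k * \<sigma>1"
  define s2 where "s2 = - (f powi k * (f / g) * \<sigma>2)"
  have "s = s1 - s2"
  proof -
    have "s = f powi k * (\<sigma>1 + (f / g) * \<sigma>2)" using \<sigma>(3) fk by (simp add: field_simps)
    then show ?thesis by (simp add: s1_def s2_def algebra_simps)
  qed
  moreover have "s1 \<in> sections (LB n k) B1"
    unfolding sections_mem using alg_mem_aff[OF \<sigma>(1)] fk by (simp add: LB_B1 s1_def)
  moreover have "s2 / g powi k \<in> x" if x: "x \<in> B2" for x
  proof -
    have sx: "subring_of_field x" using x subring_X by (auto simp: aff_def)
    have m: "\<sigma>2 \<in> x" by (rule alg_mem_aff[OF \<sigma>(2) x])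
    have "f / g \<in> x" using x by (auto simp: aff_def GB2_def)
    then have "- \<sigma>2 \<in> x" "- ((f / g) * \<sigma>2) \<in> x"
      using subring_uminus[OF sx m] subring_uminus[OF sx subring_mult[OF sx _ m]] by blast+
    \<comment> \<open>Passing from the generator \<open>f\<close> to \<open>g\<close> costs a factor
      \<open>g / f\<close> when \<open>k = - 1\<close>; the factor \<open>f / g\<close> split off
      before absorbs it.\<close>
    moreover have "s2 / g powi k = (if k = 0 then - ((f / g) * \<sigma>2) else - \<sigma>2)"
      using k f_nonzero g_nonzero by (auto simp: s2_def power_int_minus)
    ultimately show ?thesis by simp
  qed
  then have "s2 \<in> sections (LB n k) B2" by (simp add: sections_mem LB_B2)
  ultimately show ?thesis by blast
qed

lemma LB_Y01: assumes "x \<in> Y0 \<inter> Y1" shows "a \<in> LB n k x \<longleftrightarrow> a \<in> x"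
proof -
  have x: "x \<in> Y1" "x \<in> X" "chart 1 \<subseteq> x" "G1 \<subseteq> x" using assms by (auto simp: aff_def)
  have "unit_in x (inverse (u powi n))" using chart1_unit[OF x(2,3)] x(4) by (intro unit_in_inverse unit_in_powi subring_X x) auto
  then show ?thesis using unit_in_mult_iff[OF subring_X[OF x(2)], of "inverse (u powi n)" a]
    by (simp add: LB_Y1[OF x(1)] divide_inverse mult.commute)
qed

lemma LB_Y02: assumes "x \<in> Y0 \<inter> Y2" shows "a \<in> LB n k x \<longleftrightarrow> a \<in> x"
proof -
  have x: "x \<in> Y2" "x \<in> X" "chart 1 \<subseteq> x" "G2 \<subseteq> x" using assms by (auto simp: aff_def)
  have "unit_in x (inverse (v powi n))" using chart1_unit[OF x(2,3)] x(4) by (intro unit_in_inverse unit_in_powi subring_X x) auto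
  then show ?thesis using unit_in_mult_iff[OF subring_X[OF x(2)], of "inverse (v powi n)" a]
    by (simp add: LB_Y2[OF x(1)] divide_inverse mult.commute)
qed

lemma EV_LB:
  assumes "k \<le> 0"
  shows "EV h \<in> sections (LB n k) Y0"
proof -
  have "EV h \<in> LB n k x" if x: "x \<in> Y0" for x
  proof -
    have X: "x \<in> X" "chart 1 \<subseteq> x" using x by (auto simp: aff_def)
    note s = loc_ptD[OF X_loc_pt[OF X(1)]]
    have "EV h / (eps x powi k) = EV h * eps x ^ nat (- k)"
      using assms by (simp add: power_int_def divide_inverse power_inverse)
    also have "... \<in> x" by (intro subring_mult[OF s(1)] subring_power[OF s(1)] EV_mem[OF s(1,2)] eps_divides(3) X)
    finally show ?thesis using X(2) by (simp add: LB_def mu_def)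
  qed
  then show ?thesis by (simp add: sections_mem)
qed

text \<open>After clearing denominators the cocycle condition bounds the degree of
  \<open>h1' * g2P ^ M - h2' * g1P ^ M\<close>, and \<open>tdle_split\<close> extracts a polynomial
  \<open>\<kappa>\<close>. It becomes the component on \<open>Y0\<close>, and the two differences of
  controlled degree give those on \<open>Y1\<close> and \<open>Y2\<close>. A polynomial is a section
  over \<open>Y0\<close> because \<open>k \<le> 0\<close> permits poles along E.\<close>

lemma LB_D1:
  assumes n: "n \<ge> - 1" and k: "k \<le> 0"
    and s01: "s01 \<in> sections (LB n k) (Y0 \<inter> Y1)" and s02: "s02 \<in> sections (LB n k) (Y0 \<inter> Y2)"
    and s12: "s12 \<in> sections (LB n k) (Y1 \<inter> Y2)" and cyc: "s01 - s02 + s12 = 0"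
  shows "\<exists>r0 r1 r2. r0 \<in> sections (LB n k) Y0 \<and> r1 \<in> sections (LB n k) Y1 \<and> r2 \<in> sections (LB n k) Y2 \<and>
         s01 = r0 - r1 \<and> s02 = r0 - r2 \<and> s12 = r1 - r2"
proof -
  note nz = g1P_nonzero g2P_nonzero
  note t = utop_tdle[OF utop_g1P] vtop_tdle[OF vtop_g2P]
  have nz12: "g1P * g2P \<noteq> 0" using nz by simp
  have t12: "tdle (int (m1 + m2)) (g1P * g2P)" using tdle_mult[OF t] by simp
  have "s01 \<in> subalgebra_gen (chart 1 \<union> G1)"
  proof (rule aff_sections)
    fix x assume "x \<in> aff (chart 1 \<union> G1)"
    then have "x \<in> Y0 \<inter> Y1" by (simp add: aff_Int)
    then show "s01 \<in> x" using s01 LB_Y01[of x s01] unfolding sections_mem by blast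
  qed simp
  then have "s01 \<in> frac g1P" using alg_frac(1) by blast
  then obtain h1 M1 where h1: "s01 = EV h1 / EV g1P ^ M1" by (auto simp: frac_def)
  have "s02 \<in> subalgebra_gen (chart 1 \<union> G2)"
  proof (rule aff_sections)
    fix x assume "x \<in> aff (chart 1 \<union> G2)"
    then have "x \<in> Y0 \<inter> Y2" by (simp add: aff_Int)
    then show "s02 \<in> x" using s02 LB_Y02[of x s02] unfolding sections_mem by blast
  qed simp
  then have "s02 \<in> frac g2P" using alg_frac(2) by blast
  then obtain h2 M2 where h2: "s02 = EV h2 / EV g2P ^ M2" by (auto simp: frac_def)
  have "s12 / v powi n \<in> subalgebra_gen (G1 \<union> G2)"
  proof (rule aff_sections)
    fix x assume "x \<in> aff (G1 \<union> G2)"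
    then have x: "x \<in> Y1 \<inter> Y2" by (simp add: aff_Int)
    then show "s12 / v powi n \<in> x" using s12 LB_Y2[of x n k] by (auto simp: sections_mem)
  qed simp
  then have q: "s12 / v powi n \<in> frac_deg (g1P * g2P) (m1 + m2) 0" using alg_frac(4) by blast
  \<comment> \<open>On this overlap \<open>s12 / v powi n\<close> is a fraction of degree 0;
    multiplying back by \<open>v powi n\<close> gives \<open>s12\<close> as a fraction of degree
    \<open>n\<close>.\<close>
  have "v powi n \<in> frac_deg (g1P * g2P) (m1 + m2) n"
  proof (cases "n = - 1")
    case True
    then show ?thesis using vinv_frac by (simp add: power_int_minus)
  next
    case False
    then have "n = int (nat n)" using n by simp
    then have "v powi n = v ^ nat n" by (metis power_int_of_nat)
    then have "v powi n = EV (mono2 1 0 (nat n)) / EV (g1P * g2P) ^ 0" by (simp add: EV_mono2 const_ff_hom)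
    moreover have "tdle n (mono2 (1::'k) 0 (nat n))" using n False by (intro tdle_mono2) simp
    ultimately show ?thesis unfolding frac_deg_def by (intro CollectI exI[of _ "mono2 1 0 (nat n)"] exI[of _ 0]) simp
  qed
  from frac_deg_mult[OF nz12 q this] have "s12 \<in> frac_deg (g1P * g2P) (m1 + m2) n" using v_nonzero by simp
  then obtain h M3 where h: "s12 = EV h / EV (g1P * g2P) ^ M3" "tdle (int (M3 * (m1 + m2)) + n) h" by (auto simp: frac_deg_def)
  define M where "M = M1 + M2 + M3"
  obtain h' where h': "s12 = EV h' / EV (g1P * g2P) ^ M" "tdle (int (M * (m1 + m2)) + n) h'"
    using frac_deg_raise[OF nz12 t12 h, of M] by (auto simp: M_def)
  define h1' where "h1' = h1 * g1P ^ (M2 + M3)"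
  define h2' where "h2' = h2 * g2P ^ (M1 + M3)"
  have h1': "s01 = EV h1' / EV g1P ^ M" unfolding h1 h1'_def M_def using frac_raise[OF nz(1), of h1 M1 "M2 + M3"] by (simp only: add_ac)
  have h2': "s02 = EV h2' / EV g2P ^ M" unfolding h2 h2'_def M_def using frac_raise[OF nz(2), of h2 M2 "M1 + M3"] by (simp only: add_ac)
  have Gnz: "EV g1P ^ M \<noteq> 0" "EV g2P ^ M \<noteq> 0" using nz by (simp_all add: EV_eq_0)
  have "EV (h1' * g2P ^ M - h2' * g1P ^ M) = EV (- h')"
  proof -
    have "EV h1' / EV g1P ^ M - EV h2' / EV g2P ^ M + EV h' / (EV g1P ^ M * EV g2P ^ M) = 0"
      using cyc h'(1) by (simp add: h1' h2' EV_hom power_mult_distrib)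
    moreover have "a / P - b / Q + c / (P * Q) = 0 \<Longrightarrow> P \<noteq> 0 \<Longrightarrow> Q \<noteq> 0 \<Longrightarrow> a * Q - b * P + c = 0" for a b c P Q :: "'k ff"
      by (simp add: field_simps)
    ultimately have "EV h1' * EV g2P ^ M - EV h2' * EV g1P ^ M + EV h' = 0" using Gnz by blast
    then show ?thesis by (simp add: EV_hom eq_neg_iff_add_eq_0)
  qed
  then have eq: "h1' * g2P ^ M - h2' * g1P ^ M = - h'" by (simp only: EV_inject)
  have "tdle (int (M * m1) + int (M * m2) + n) (h1' * g2P ^ M - h2' * g1P ^ M)"
    unfolding eq using tdle_uminus[OF h'(2)] by (simp add: algebra_simps)
  then obtain \<kappa> where \<kappa>: "tdle (int (M * m1) + n) (h1' - \<kappa> * g1P ^ M)" "tdle (int (M * m2) + n) (h2' - \<kappa> * g2P ^ M)"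
    using tdle_split[OF utop_power[OF utop_g1P, of M] vtop_power[OF vtop_g2P, of M] n] by blast
  define r1 where "r1 = EV (- (h1' - \<kappa> * g1P ^ M)) / EV g1P ^ M"
  define r2 where "r2 = EV (- (h2' - \<kappa> * g2P ^ M)) / EV g2P ^ M"
  have e1: "s01 = EV \<kappa> - r1" using Gnz by (simp add: h1' r1_def EV_hom diff_divide_distrib)
  have e2: "s02 = EV \<kappa> - r2" using Gnz by (simp add: h2' r2_def EV_hom diff_divide_distrib)
  have "s12 = s02 - s01" using cyc by (simp add: algebra_simps add_eq_0_iff)
  then have "s12 = r1 - r2" by (simp add: e1 e2)
  moreover have "r1 \<in> sections (LB n k) Y1"
    unfolding sections_mem r1_def using Y1_frac_mem[OF _ tdle_uminus[OF \<kappa>(1)]] by (simp add: LB_Y1)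
  moreover have "r2 \<in> sections (LB n k) Y2"
    unfolding sections_mem r2_def using Y2_frac_mem[OF _ tdle_uminus[OF \<kappa>(2)]] by (simp add: LB_Y2)
  ultimately show ?thesis using EV_LB[OF k, of \<kappa> n] e1 e2 by blast
qed

text \<open>By \<open>tdle_remainder\<close> the numerator is a multiple of \<open>g1P ^ M\<close>,
  plus a multiple of \<open>g2P ^ M\<close>, plus a remainder whose degree fits the twist by -2
  exactly. The multiplicity \<open>k\<close> is arbitrary because the overlaps avoid E.\<close>

lemma LB_D2:
  assumes s: "s \<in> sections (LB (- 2) k) (Y0 \<inter> Y1 \<inter> Y2)"
  shows "\<exists>s01 s02 s12. s01 \<in> sections (LB (- 2) k) (Y0 \<inter> Y1) \<and> s02 \<in> sections (LB (- 2) k) (Y0 \<inter> Y2) \<and>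
    s12 \<in> sections (LB (- 2) k) (Y1 \<inter> Y2) \<and> s = s01 - s02 + s12"
proof -
  note nz = g1P_nonzero g2P_nonzero
  have "s \<in> subalgebra_gen (chart 1 \<union> G1 \<union> G2)"
  proof (rule aff_sections)
    fix x assume "x \<in> aff (chart 1 \<union> G1 \<union> G2)"
    then have "x \<in> Y0 \<inter> Y1 \<inter> Y2" by (simp add: aff_Int)
    then show "s \<in> x" using s LB_Y01[of x s] unfolding sections_mem by blast
  qed simp
  then have "s \<in> frac (g1P * g2P)" using alg_frac(3) by blast
  then obtain h M where h: "s = EV h / EV (g1P * g2P) ^ M" by (auto simp: frac_def)
  obtain a b r where abr: "h = a * g1P ^ M + b * g2P ^ M + r" "tdle (int (M * m1) + int (M * m2) - 2) r"
    using tdle_remainder[OF utop_power[OF utop_g1P, of M] vtop_power[OF vtop_g2P, of M]] by blast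
  have Gnz: "EV g1P ^ M \<noteq> 0" "EV g2P ^ M \<noteq> 0" using nz by (simp_all add: EV_eq_0)
  define s01 where "s01 = EV b / EV g1P ^ M"
  define s02 where "s02 = - (EV a / EV g2P ^ M)"
  define s12 where "s12 = EV r / (EV g1P ^ M * EV g2P ^ M)"
  have "s = s01 - s02 + s12"
    using Gnz unfolding h abr(1) s01_def s02_def s12_def by (simp add: EV_hom power_mult_distrib field_simps)
  moreover have "s01 \<in> sections (LB (- 2) k) (Y0 \<inter> Y1)"
    unfolding sections_mem
  proof
    fix x assume x: "x \<in> Y0 \<inter> Y1"
    then have X: "x \<in> X" "chart 1 \<subseteq> x" "chart u \<subseteq> x" "G1 \<subseteq> x" by (auto simp: aff_def G1_def)
    note lx = X_loc_pt[OF X(1)] note sx = loc_ptD[OF lx]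
    have "EV g1P = \<gamma>1 * u ^ m1" using u_nonzero by (simp add: \<gamma>1_def)
    then have "unit_in x (EV g1P)" using G1_unit[OF lx X(4)] chart1_unit[OF X(1,2)] X(4)
      by (auto intro!: unit_in_mult[OF sx(1)] unit_in_power[OF sx(1)])
    then have "s01 \<in> x" unfolding s01_def
      by (intro unit_in_divide_mem[OF sx(1)] EV_mem[OF sx(1,2)] X unit_in_power[OF sx(1)])
    then show "s01 \<in> LB (- 2) k x" by (simp add: LB_Y01[OF x])
  qed
  moreover have "s02 \<in> sections (LB (- 2) k) (Y0 \<inter> Y2)"
    unfolding sections_mem
  proof
    fix x assume x: "x \<in> Y0 \<inter> Y2"
    then have X: "x \<in> X" "chart 1 \<subseteq> x" by (auto simp: aff_def)
    note sx = loc_ptD[OF X_loc_pt[OF X(1)]]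
    have "s02 \<in> x" unfolding s02_def
      by (intro subring_uminus[OF sx(1)] unit_in_divide_mem[OF sx(1)] EV_mem[OF sx(1,2)] X unit_in_power[OF sx(1)] Y02_unit[OF x])
    then show "s02 \<in> LB (- 2) k x" by (simp add: LB_Y02[OF x])
  qed
  moreover have "s12 \<in> sections (LB (- 2) k) (Y1 \<inter> Y2)"
    unfolding sections_mem s12_def using Y12_frac_mem[of _ M "- 2" r] abr(2) by (auto simp: LB_Y2)
  ultimately show ?thesis by blast
qed

lemma plane_sheaf_LB: "fine_cover C \<Longrightarrow> plane_sheaf p e d A N \<phi> (*) (LB n k) C"
  by (intro plane_sheaf.intro plane_sheaf_axioms.intro plane_points_axioms vector_space_over_itself.vector_space_axioms qc_LB)

lemma LB_H1:
  assumes "fine_cover C" "n \<ge> - 1" "k = 0 \<or> k = - 1"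
  shows "acyclic_at (LB n k) C X 2"
proof -
  interpret plane_sheaf p e d A N \<phi> "(*)" "LB n k" C by (rule plane_sheaf_LB[OF assms(1)])
  have "acyclic_at (LB n k) C X (Suc (Suc 0))"
  proof (rule acyclic_X)
    show "\<exists>s1 s2. s1 \<in> sections (LB n k) B1 \<and> s2 \<in> sections (LB n k) B2 \<and> s = s1 - s2" if "s \<in> sections (LB n k) (B1 \<inter> B2)" for s
      by (rule LB_B12[OF assms(3) that])
    have "k \<le> 0" using assms(3) by auto
    then show "\<exists>r0 r1 r2. r0 \<in> sections (LB n k) Y0 \<and> r1 \<in> sections (LB n k) Y1 \<and> r2 \<in> sections (LB n k) Y2 \<and>
        s01 = r0 - r1 \<and> s02 = r0 - r2 \<and> s12 = r1 - r2"
      if "s01 \<in> sections (LB n k) (Y0 \<inter> Y1)" "s02 \<in> sections (LB n k) (Y0 \<inter> Y2)" "s12 \<in> sections (LB n k) (Y1 \<inter> Y2)"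
        "s01 - s02 + s12 = 0" for s01 s02 s12
      using that by (rule LB_D1[OF assms(2)])
  qed simp
  then show ?thesis by (simp add: numeral_2_eq_2)
qed

lemma LB_H2:
  assumes "fine_cover C"
  shows "acyclic_at (LB (- 2) k) C X 3"
proof -
  interpret plane_sheaf p e d A N \<phi> "(*)" "LB (- 2) k" C by (rule plane_sheaf_LB[OF assms(1)])
  have "acyclic_at (LB (- 2) k) C X (Suc (Suc 1))"
    by (rule acyclic_X) (simp, simp, rule LB_D2)
  then show ?thesis by (simp add: numeral_3_eq_3)
qed

text \<open>\<open>fP\<close> is linear in v, so divisibility by it means vanishing at
  \<open>v = \<phi>(u)\<close>. There \<open>gP\<close>, which does not involve v, stays nonzero and
  can be cancelled.\<close>

lemma fP_power_dvd:
  assumes "fP ^ M dvd h * gP ^ K"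
  shows "fP ^ M dvd h"
  using assms
proof (induction M arbitrary: h)
  case (Suc M)
  have root: "fP dvd q \<longleftrightarrow> poly q \<phi> = 0" for q by (simp add: fP_def poly_eq_0_iff_dvd)
  have "fP dvd h * gP ^ K" using Suc.prems by (rule dvd_trans[rotated]) simp
  then have "poly h \<phi> * gp ^ K = 0" by (simp add: root gP_def)
  moreover have "gp \<noteq> 0" by (simp add: gp_def)
  ultimately have "fP dvd h" by (simp add: root)
  then obtain q where q: "h = fP * q" by (elim dvdE)
  have "fP * fP ^ M dvd fP * (q * gP ^ K)" using Suc.prems unfolding q power_Suc by (simp only: mult.assoc)
  then have "fP ^ M dvd q * gP ^ K" using fP_nonzero by (simp only: dvd_mult_cancel_left simp_thms)
  then have "fP ^ M dvd q" by (rule Suc.IH)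
  then show ?case unfolding q power_Suc by (rule mult_dvd_mono[OF dvd_refl])
qed simp

text \<open>Regularity on \<open>B1\<close> and on \<open>B2\<close> gives two representations, with
  denominators powers of \<open>fP\<close> and of \<open>gP\<close>. These are coprime, so the
  section is a polynomial. It remains to bound its degree.\<close>

lemma LB_H0:
  assumes y: "y \<in> sections (LB (int m) 0) X"
  obtains h where "y = EV h" "tdle (int m) h"
proof -
  have mem: "y \<in> x" if "x \<in> Y0" for x
    using y that aff_subset[of "chart 1"] by (auto simp: sections_mem LB_def mu_def aff_def)
  have "chart 1 \<subseteq> GB1" "chart 1 \<subseteq> GB2" by (auto simp: GB1_def GB2_def)
  then have "y \<in> x" if "x \<in> B1 \<or> x \<in> B2" for x using that mem by (auto simp: aff_def)
  then have alg: "y \<in> subalgebra_gen GB1" "y \<in> subalgebra_gen GB2" by (auto intro: aff_sections)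
  have "g / f = EV gP / EV fP ^ 1" "f / g = EV fP / EV gP ^ 1" by (simp_all add: f_def g_def)
  then have "GB1 \<subseteq> frac fP" "GB2 \<subseteq> frac gP"
    using chart1_frac[OF fP_nonzero] chart1_frac[OF gP_nonzero] unfolding GB1_def GB2_def frac_def by blast+
  then have "subalgebra_gen GB1 \<subseteq> frac fP" "subalgebra_gen GB2 \<subseteq> frac gP"
    using subalgebra_gen_subset[OF subring_frac(1,2)[OF fP_nonzero]] subalgebra_gen_subset[OF subring_frac(1,2)[OF gP_nonzero]] by blast+
  then obtain h1 M h2 K where h12: "y = EV h1 / EV fP ^ M" "y = EV h2 / EV gP ^ K" using alg unfolding frac_def by blast
  have Pnz: "EV fP ^ M \<noteq> 0" "EV gP ^ K \<noteq> 0" using fP_nonzero gP_nonzero by (simp_all add: EV_eq_0)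
  have "EV h1 * EV gP ^ K = EV h2 * EV fP ^ M" using h12 Pnz by (simp add: field_simps)
  then have "EV (h1 * gP ^ K) = EV (fP ^ M * h2)" by (simp add: EV_hom mult.commute)
  then have "h1 * gP ^ K = fP ^ M * h2" by (simp only: EV_inject)
  then have "fP ^ M dvd h1" by (intro fP_power_dvd[of M h1 K]) simp
  then obtain h where "h1 = fP ^ M * h" by (elim dvdE)
  then have "y = EV fP ^ M * EV h / EV fP ^ M" using h12(1) by (simp only: EV_hom)
  then have yh: "y = EV h" using nonzero_mult_div_cancel_left[OF Pnz(1)] by (rule trans)
  \<comment> \<open>The chart \<open>Y1\<close> alone bounds the degree: \<open>g1P\<close> has
    leading form a power of u, so \<open>tdle_cancel_utop\<close> can cancel it.\<close>
  have "y / u powi (int m) \<in> subalgebra_gen G1"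
  proof (rule aff_sections)
    fix x assume "x \<in> Y1"
    then show "y / u powi (int m) \<in> x" using y LB_Y1[of x "int m" 0] aff_subset by (auto simp: sections_mem)
  qed simp
  then have "y / u ^ m \<in> frac_deg g1P m1 0" using alg_frac(5) by (auto simp: power_int_of_nat)
  moreover have "u ^ m = EV (mono2 1 m 0) / EV g1P ^ 0" by (simp add: EV_mono2 const_ff_hom)
  moreover have "tdle (int m) (mono2 (1::'k) m 0)" by (rule tdle_mono2) simp
  then have "tdle (int (0 * m1) + int m) (mono2 (1::'k) m 0)" by simp
  ultimately have "u ^ m \<in> frac_deg g1P m1 (int m)" unfolding frac_deg_def by blast
  with \<open>y / u ^ m \<in> _\<close> have "(y / u ^ m) * u ^ m \<in> frac_deg g1P m1 (0 + int m)"
    by (rule frac_deg_mult[OF g1P_nonzero])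
  then have "y \<in> frac_deg g1P m1 (int m)" using u_nonzero by simp
  then obtain h' K' where h': "y = EV h' / EV g1P ^ K'" "tdle (int (K' * m1) + int m) h'" by (auto simp: frac_deg_def)
  have "EV (h * g1P ^ K') = EV h'" using h'(1) g1P_nonzero by (simp add: yh EV_hom EV_eq_0)
  then have "h * g1P ^ K' = h'" by (simp only: EV_inject)
  then have "tdle (int m + int (K' * m1)) (h * g1P ^ K')" using h'(2) by (simp add: add.commute)
  then have "tdle (int m) h" by (rule tdle_cancel_utop[OF utop_power[OF utop_g1P]])
  then show thesis using that yh by blast
qed

end

section \<open>The rank two bundle\<close>

text \<open>The vectors with entries \<open>band s t j a\<close> form the kernel of the banded matrix with rows \<open>(s, t, 1)\<close>.\<close>

fun band :: "'f::field \<Rightarrow> 'f \<Rightarrow> nat \<Rightarrow> 'f ^ 2 \<Rightarrow> 'f" where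
  "band s t 0 a = a $ 1"
| "band s t (Suc 0) a = a $ 2"
| "band s t (Suc (Suc j)) a = - (s * band s t j a + t * band s t (Suc j) a)"

lemma band_linear: "band s t j (a + b) = band s t j a + band s t j b"
  "band s t j (r *s a) = r * band s t j a"
  by (induction j rule: induct_nat_012) (simp_all add: algebra_simps)

lemma band_eqI:
  assumes "\<And>j. Suc j < n \<Longrightarrow> s * \<beta> j + t * \<beta> (Suc j) + \<beta> (Suc (Suc j)) = 0" "j \<le> n"
  shows "band s t j (vector [\<beta> 0, \<beta> 1]) = \<beta> j"
  using assms(2)
proof (induction j rule: induct_nat_012)
  case (ge2 j)
  have "s * \<beta> j + t * \<beta> (Suc j) + \<beta> (Suc (Suc j)) = 0" using ge2 by (intro assms) auto
  then have "\<beta> (Suc (Suc j)) = - (s * \<beta> j + t * \<beta> (Suc j))" by (simp only: add_eq_0_iff)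
  then show ?case using ge2 by simp
qed simp_all

context plane_points
begin

abbreviation "w \<equiv> band u v"

text \<open>The bundle \<open>F(n, k)\<close>. A kernel vector is determined by its first two
  entries, so the kernel embeds into the square of the function field; what remains is that all
  \<open>d + 1\<close> entries are sections of \<open>LB n k\<close>.\<close>

definition VB :: "int \<Rightarrow> int \<Rightarrow> 'k ff set \<Rightarrow> ('k ff ^ 2) set" where
  "VB n k x = {a. \<forall>j\<le>d. w j a \<in> LB n k x}"

lemma chart_mu:
  assumes "x \<in> X" shows "chart (mu x) \<subseteq> x"
proof -
  have "x \<in> Y0 \<or> x \<in> Y1 \<or> x \<in> Y2" using assms X_eq by blast
  then show ?thesis by (auto simp: mu_def aff_def G1_def G2_def)
qed

lemma LB_group: "group_sheaf X (LB n k)"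
  by (rule vector_space_over_itself.qc_sheaf_group[OF qc_LB subring_X])

lemma LB_add: "x \<in> X \<Longrightarrow> a \<in> LB n k x \<Longrightarrow> b \<in> LB n k x \<Longrightarrow> a + b \<in> LB n k x"
  and LB_diff: "x \<in> X \<Longrightarrow> a \<in> LB n k x \<Longrightarrow> b \<in> LB n k x \<Longrightarrow> a - b \<in> LB n k x"
  and LB_0: "x \<in> X \<Longrightarrow> 0 \<in> LB n k x"
  using vector_space_over_itself.qc_sheafD[OF qc_LB, of x] group_sheaf.diff[OF LB_group, of x] group_sheaf.diff[OF LB_group, of x 0]
  by fastforce+

lemma LB_mult: "x \<in> X \<Longrightarrow> c \<in> LB m 0 x \<Longrightarrow> a \<in> LB n k x \<Longrightarrow> c * a \<in> LB (m + n) k x"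
  using subring_mult[OF subring_X, of x "c / mu x powi m" "a / (mu x powi n * eps x powi k)"] mu_nonzero[of x]
  by (simp add: LB_def power_int_add mult_ac)

lemma EV_mem_LB: "x \<in> X \<Longrightarrow> tdle n h \<Longrightarrow> EV h \<in> LB n 0 x"
  using tdle_chart_powi[OF X_loc_pt chart_mu mu_nonzero] by (simp add: LB_def)

lemma uv_LB: assumes "x \<in> X" shows "u \<in> LB 1 0 x" "v \<in> LB 1 0 x" "1 \<in> LB 1 0 x"
  using EV_mem_LB[OF assms tdle_mono2[of 1 0 1 1]] EV_mem_LB[OF assms tdle_mono2[of 0 1 1 1]] EV_mem_LB[OF assms tdle_1[of 1]]
  by (simp_all add: EV_mono2 const_ff_hom EV_hom(3))

lemma u_mult_LB: "x \<in> X \<Longrightarrow> a \<in> LB n k x \<Longrightarrow> u * a \<in> LB (n + 1) k x"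
  and v_mult_LB: "x \<in> X \<Longrightarrow> a \<in> LB n k x \<Longrightarrow> v * a \<in> LB (n + 1) k x"
  and LB_mono: "x \<in> X \<Longrightarrow> a \<in> LB n k x \<Longrightarrow> a \<in> LB (n + 1) k x"
  using LB_mult[of x u 1 a n k] LB_mult[of x v 1 a n k] LB_mult[of x 1 1 a n k] uv_LB[of x]
  by (simp_all add: add.commute)

lemma band_row_LB:
  "x \<in> X \<Longrightarrow> a \<in> LB n k x \<Longrightarrow> b \<in> LB n k x \<Longrightarrow> c \<in> LB n k x \<Longrightarrow> u * a + v * b + c \<in> LB (n + 1) k x"
  by (intro LB_add u_mult_LB v_mult_LB LB_mono)

definition cont :: "nat \<Rightarrow> 'k ff" where "cont j = EV (continuant j)"

lemma cont_simps: "cont 0 = 1" "cont (Suc 0) = v" "cont (Suc (Suc j)) = v * cont (Suc j) - u * cont j"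
  by (simp_all add: cont_def EV_hom EV_mono2 const_ff_hom del: One_nat_def)

lemma cont_nonzero: "cont j \<noteq> 0"
  using vtop_nonzero[OF vtop_continuant] by (simp add: cont_def EV_eq_0)

text \<open>The continuant is a factor of \<open>g2P\<close>, and the degrees add up:
  \<open>\<gamma>2\<close> is the product of \<open>cont j / v^j\<close> and the normalized
  cofactor. As \<open>\<gamma>2\<close> is a unit on \<open>Y2\<close>, so is
  \<open>cont j / v^j\<close>.\<close>

lemma cont_inverse_LB:
  assumes x: "x \<in> Y2" and j: "j < d"
  shows "inverse (cont j) \<in> LB (- int j) 0 x"
proof -
  have X: "x \<in> X" "chart v \<subseteq> x" "G2 \<subseteq> x" using x by (auto simp: aff_def G2_def)
  note lx = X_loc_pt[OF X(1)] note s = loc_ptD[OF lx]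
  define r where "r = V * (\<Prod>i<e. V - mono2 (vp i) 0 0) * (\<Prod>k\<in>{..<d} - {j}. continuant k)"
  define m where "m = 1 + (\<Sum>i<e. 1) + (\<Sum>k\<in>{..<d} - {j}. k)"
  have "(\<Prod>k<d. continuant k) = continuant j * (\<Prod>k\<in>{..<d} - {j}. continuant k :: 'k poly poly)"
    using j by (intro prod.remove) auto
  then have g2: "g2P = continuant j * r" by (simp add: g2P_def r_def mult_ac)
  have "(\<Sum>k<d. k) = j + (\<Sum>k\<in>{..<d} - {j}. k)" using j by (intro sum.remove) auto
  then have m2: "m2 = j + m" by (simp add: m2_def m_def)
  have "vtop m r" unfolding r_def m_def by (intro vtop_mult vtop_V vtop_prod vtop_linear vtop_continuant)
  then have r: "EV r / v ^ m \<in> x" by (intro tdle_chart_mem s X v_nonzero vtop_tdle)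
  have c: "EV (continuant j) / v ^ j \<in> x" by (intro tdle_chart_mem s X v_nonzero vtop_tdle vtop_continuant)
  have "\<gamma>2 = (EV (continuant j) / v ^ j) * (EV r / v ^ m)" unfolding \<gamma>2_def g2 m2 by (simp add: EV_hom power_add)
  then have "unit_in x (EV (continuant j) / v ^ j)" using unit_in_factor[OF s(1) _ c r] G2_unit[OF lx X(3)] by simp
  then have "v ^ j / cont j \<in> x" using unit_in_inverse_mem by (fastforce simp: cont_def)
  then show ?thesis by (simp add: LB_Y2[OF x] power_int_minus divide_inverse mult.commute)
qed

lemma cont_LB: "x \<in> X \<Longrightarrow> cont j \<in> LB (int j) 0 x"
  unfolding cont_def by (intro EV_mem_LB vtop_tdle vtop_continuant)

text \<open>On each chart, two of the entries determine the others.\<close>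

lemma band_mem_Y0:
  assumes x: "x \<in> Y0" and eq: "\<And>j. Suc j < d \<Longrightarrow> u * r j + v * r (Suc j) + r (Suc (Suc j)) \<in> LB (n + 1) k x"
    and r: "r 0 \<in> LB n k x" "r 1 \<in> LB n k x" and "j \<le> d"
  shows "r j \<in> LB n k x"
  using \<open>j \<le> d\<close>
proof (induction j rule: induct_nat_012)
  case (ge2 j)
  have X: "x \<in> X" "chart 1 \<subseteq> x" using x by (auto simp: aff_def)
  have deg: "LB n' k x = LB n k x" for n' using X by (simp add: LB_def mu_def)
  have "u * r j \<in> LB (n + 1) k x" "v * r (Suc j) \<in> LB (n + 1) k x"
    using ge2 by (auto intro: u_mult_LB v_mult_LB X)
  then have "(u * r j + v * r (Suc j) + r (Suc (Suc j))) - (u * r j + v * r (Suc j)) \<in> LB (n + 1) k x"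
    using ge2 by (intro LB_diff LB_add eq X) auto
  then show ?case using deg[of "n + 1"] by simp
qed (use r in auto)

lemma band_mem_Y1:
  assumes x: "x \<in> Y1" and eq: "\<And>j. Suc j < d \<Longrightarrow> u * r j + v * r (Suc j) + r (Suc (Suc j)) \<in> LB (n + 1) k x"
    and r: "r (d - 1) \<in> LB n k x" "r d \<in> LB n k x" and "j \<le> d"
  shows "r j \<in> LB n k x"
proof -
  have X: "x \<in> X" using x by (auto simp: aff_def)
  have iu: "inverse u \<in> LB (- 1) 0 x" using subring_1[OF subring_X[OF X]] u_nonzero by (simp add: LB_Y1[OF x] power_int_minus)
  have "i < d \<Longrightarrow> r (d - i) \<in> LB n k x \<and> r (d - Suc i) \<in> LB n k x" for i
  proof (induction i)
    case (Suc i)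
    define j where "j = d - Suc (Suc i)"
    have j: "d - i = Suc (Suc j)" "d - Suc i = Suc j" "Suc j < d" using Suc.prems by (auto simp: j_def)
    have IH: "r (Suc (Suc j)) \<in> LB n k x" "r (Suc j) \<in> LB n k x" using Suc j by auto
    have "(u * r j + v * r (Suc j) + r (Suc (Suc j))) - (v * r (Suc j) + r (Suc (Suc j))) \<in> LB (n + 1) k x"
      by (intro LB_diff LB_add X eq j v_mult_LB LB_mono IH)
    then have "u * r j \<in> LB (n + 1) k x" by simp
    from LB_mult[OF X iu this] have "r j \<in> LB n k x" using u_nonzero by (simp flip: mult.assoc)
    then show ?case using Suc j by (simp add: j_def)
  qed (use r in simp)
  from this[of "d - j"] this[of "d - Suc j"] show ?thesis using \<open>j \<le> d\<close> d_pos r by (cases "j = 0") (auto simp: Suc_diff_Suc)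
qed

lemma band_mem_Y2:
  assumes x: "x \<in> Y2" and eq: "\<And>j. Suc j < d \<Longrightarrow> u * r j + v * r (Suc j) + r (Suc (Suc j)) \<in> LB (n + 1) k x"
    and r: "r 0 \<in> LB n k x" "r d \<in> LB n k x" and "j \<le> d"
  shows "r j \<in> LB n k x"
proof -
  have X: "x \<in> X" using x by (auto simp: aff_def)
  \<comment> \<open>Eliminating the entry 0 from the rows leaves a two-term relation whose
    coefficients are continuants, of degree raised by \<open>j\<close>. Starting from the known
    entry \<open>d\<close>, it is solved downwards, dividing by one continuant at a time.\<close>
  define R where "R j = cont (Suc j) * r (Suc j) + cont j * r (Suc (Suc j))" for j
  have R: "Suc j < d \<Longrightarrow> R j \<in> LB (n + 1 + int j) k x" for j
  proof (induction j)
    case 0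
    have "(u * r 0 + v * r (Suc 0) + r (Suc (Suc 0))) - u * r 0 \<in> LB (n + 1) k x"
      by (intro LB_diff X eq 0 u_mult_LB r)
    then show ?case by (simp add: R_def cont_simps)
  next
    case (Suc j)
    have "cont (Suc j) * (u * r (Suc j) + v * r (Suc (Suc j)) + r (Suc (Suc (Suc j)))) \<in> LB (int (Suc j) + (n + 1)) k x"
      using Suc.prems by (intro LB_mult X cont_LB eq)
    moreover have "int (Suc j) + (n + 1) = n + 1 + int (Suc j)" by simp
    ultimately have "cont (Suc j) * (u * r (Suc j) + v * r (Suc (Suc j)) + r (Suc (Suc (Suc j)))) \<in> LB (n + 1 + int (Suc j)) k x"
      by (simp only:)
    moreover have "u * R j \<in> LB (n + 1 + int j + 1) k x"
      using Suc by (intro u_mult_LB X) auto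
    moreover have "n + 1 + int j + 1 = n + 1 + int (Suc j)" by simp
    moreover have "R (Suc j) = cont (Suc j) * (u * r (Suc j) + v * r (Suc (Suc j)) + r (Suc (Suc (Suc j)))) - u * R j"
      by (simp add: R_def cont_simps algebra_simps)
    ultimately show ?case using LB_diff[OF X] by (simp only:)
  qed
  have "i < d \<Longrightarrow> r (d - i) \<in> LB n k x" for i
  proof (induction i)
    case (Suc i)
    define j where "j = d - Suc (Suc i)"
    have j: "d - i = Suc (Suc j)" "d - Suc i = Suc j" "Suc j < d" using Suc.prems by (auto simp: j_def)
    have IH: "r (Suc (Suc j)) \<in> LB n k x" using Suc j by auto
    have "cont j * r (Suc (Suc j)) \<in> LB (int j + n) k x" by (rule LB_mult[OF X cont_LB[OF X] IH])
    then have "1 * (cont j * r (Suc (Suc j))) \<in> LB (1 + (int j + n)) k x" by (rule LB_mult[OF X uv_LB(3)[OF X]])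
    then have "R j - cont j * r (Suc (Suc j)) \<in> LB (n + 1 + int j) k x"
      using R[OF j(3)] by (intro LB_diff X) (simp_all add: algebra_simps)
    then have "cont (Suc j) * r (Suc j) \<in> LB (n + 1 + int j) k x" by (simp add: R_def)
    from LB_mult[OF X cont_inverse_LB[OF x j(3)] this] have "r (Suc j) \<in> LB n k x"
      using cont_nonzero[of "Suc j"] by (simp add: algebra_simps)
    then show ?case using j by simp
  qed (use r in simp)
  from this[of "d - j"] show ?thesis using \<open>j \<le> d\<close> r by (cases "j = 0") auto
qed

lemma band_relation: "u * w j a + v * w (Suc j) a + w (Suc (Suc j)) a = 0"
  by simp

lemma VB_Y0: "x \<in> Y0 \<Longrightarrow> VB n k x = {a. w 0 a \<in> LB n k x \<and> w 1 a \<in> LB n k x}"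
  and VB_Y1: "x \<in> Y1 \<Longrightarrow> VB n k x = {a. w (d - 1) a \<in> LB n k x \<and> w d a \<in> LB n k x}"
  and VB_Y2: "x \<in> Y2 \<Longrightarrow> VB n k x = {a. w 0 a \<in> LB n k x \<and> w d a \<in> LB n k x}"
proof -
  have z: "u * w j a + v * w (Suc j) a + w (Suc (Suc j)) a \<in> LB (n + 1) k x" if "x \<in> X" for j a x
    unfolding band_relation by (rule LB_0[OF that])
  show "VB n k x = {a. w 0 a \<in> LB n k x \<and> w 1 a \<in> LB n k x}" if x: "x \<in> Y0"
  proof -
    have X: "x \<in> X" using x by (auto simp: aff_def)
    have "w j a \<in> LB n k x" if "w 0 a \<in> LB n k x" "w 1 a \<in> LB n k x" "j \<le> d" for a j
      by (rule band_mem_Y0[OF x _ that]) (rule z[OF X])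
    moreover have "0 \<le> d" "1 \<le> d" "d - 1 \<le> d" "d \<le> d" using d_pos by auto
    ultimately show ?thesis unfolding VB_def by blast
  qed
  show "VB n k x = {a. w (d - 1) a \<in> LB n k x \<and> w d a \<in> LB n k x}" if x: "x \<in> Y1"
  proof -
    have X: "x \<in> X" using x by (auto simp: aff_def)
    have "w j a \<in> LB n k x" if "w (d - 1) a \<in> LB n k x" "w d a \<in> LB n k x" "j \<le> d" for a j
      by (rule band_mem_Y1[OF x _ that]) (rule z[OF X])
    moreover have "0 \<le> d" "1 \<le> d" "d - 1 \<le> d" "d \<le> d" using d_pos by auto
    ultimately show ?thesis unfolding VB_def by blast
  qed
  show "VB n k x = {a. w 0 a \<in> LB n k x \<and> w d a \<in> LB n k x}" if x: "x \<in> Y2"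
  proof -
    have X: "x \<in> X" using x by (auto simp: aff_def)
    have "w j a \<in> LB n k x" if "w 0 a \<in> LB n k x" "w d a \<in> LB n k x" "j \<le> d" for a j
      by (rule band_mem_Y2[OF x _ that]) (rule z[OF X])
    moreover have "0 \<le> d" "1 \<le> d" "d - 1 \<le> d" "d \<le> d" using d_pos by auto
    ultimately show ?thesis unfolding VB_def by blast
  qed
qed

text \<open>The coefficients of the linear functional \<open>w j\<close>. Frames and determinants of
  the bundle are computed from these rows.\<close>

definition wrow :: "nat \<Rightarrow> 'k ff ^ 2" where "wrow j = vector [w j (axis 1 1), w j (axis 2 1)]"

lemma wrow: "w j a = wrow j $ 1 * a $ 1 + wrow j $ 2 * a $ 2"
proof -
  have "a = a $ 1 *s axis 1 1 + a $ 2 *s axis 2 1" by (simp add: vec_eq_iff forall_2 axis_def)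
  then have "w j a = w j (a $ 1 *s axis 1 1 + a $ 2 *s axis 2 1)" by simp
  then show ?thesis by (simp add: band_linear wrow_def mult.commute)
qed

text \<open>The Casoratian of the three-term recursion: each step multiplies it by the coefficient
  u.\<close>

lemma wrow_det: "wrow j $ 1 * wrow (Suc j) $ 2 - wrow (Suc j) $ 1 * wrow j $ 2 = u ^ j"
  by (induction j) (simp_all add: wrow_def axis_def algebra_simps)

lemma wrow_0: "wrow 0 $ 1 = 1" "wrow 0 $ 2 = 0" "wrow 1 $ 1 = 0" "wrow 1 $ 2 = 1"
  by (simp_all add: wrow_def axis_def)

lemma wrow_cont: "wrow (Suc j) $ 2 = (- 1) ^ j * cont j"
  by (induction j rule: induct_nat_012) (simp_all add: wrow_def axis_def cont_simps algebra_simps)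

text \<open>The frame is dual to the entries 0, 1 on the affine plane, to \<open>d - 1\<close>,
  \<open>d\<close> on \<open>Y1\<close>, and to \<open>0\<close>, \<open>d\<close> on
  \<open>Y2\<close>, according to which of the coefficients 1, u, v of the rows can serve as pivot.
  The determinants are 1, a power of u, and a continuant up to sign.\<close>

lemma VB_frames:
  assumes "x \<in> X"
  obtains W \<rho> i j where "openin (zariski X) W" "x \<in> W" "\<rho> \<noteq> 0"
    "\<And>y. y \<in> W \<Longrightarrow> VB n k y = {a. w i a / \<rho> \<in> y \<and> w j a / \<rho> \<in> y}"
    "wrow i $ 1 * wrow j $ 2 - wrow j $ 1 * wrow i $ 2 \<noteq> 0"
proof -
  have nz: "f powi k \<noteq> 0" "g powi k \<noteq> 0" "u powi n \<noteq> 0" "v powi n \<noteq> 0"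
    using f_nonzero g_nonzero u_nonzero v_nonzero by auto
  have B0: "B1 \<subseteq> Y0" "B2 \<subseteq> Y0" by (auto simp: aff_def GB1_def GB2_def)
  have d1: "wrow 0 $ 1 * wrow 1 $ 2 - wrow 1 $ 1 * wrow 0 $ 2 \<noteq> 0" unfolding wrow_0 by simp
  have dt: "wrow 0 $ 1 * wrow d $ 2 - wrow d $ 1 * wrow 0 $ 2 \<noteq> 0"
    using wrow_cont[of "d - 1"] cont_nonzero[of "d - 1"] d_pos by (simp add: wrow_0)
  have du: "wrow (d - 1) $ 1 * wrow d $ 2 - wrow d $ 1 * wrow (d - 1) $ 2 \<noteq> 0"
    using wrow_det[of "d - 1"] u_nonzero d_pos by simp
  have "x \<in> B2 \<or> (x \<in> B1 \<and> x \<notin> B2) \<or> x \<in> Y1 \<or> x \<in> Y2" using assms X_eq Y0_eq by blast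
  then show thesis
  proof (elim disjE)
    assume x: "x \<in> B2"
    show thesis
    proof (rule that[of B2 "g powi k" 0 1])
      show "VB n k y = {a. w 0 a / g powi k \<in> y \<and> w 1 a / g powi k \<in> y}" if "y \<in> B2" for y
        using VB_Y0[of y n k] LB_B2[of y n k] that B0 by auto
      show "wrow 0 $ 1 * wrow 1 $ 2 - wrow 1 $ 1 * wrow 0 $ 2 \<noteq> 0" by (rule d1)
    qed (use x nz openin_basic in auto)
  next
    assume x: "x \<in> B1 \<and> x \<notin> B2"
    show thesis
    proof (rule that[of B1 "f powi k" 0 1])
      show "VB n k y = {a. w 0 a / f powi k \<in> y \<and> w 1 a / f powi k \<in> y}" if "y \<in> B1" for y
        using VB_Y0[of y n k] LB_B1[of y n k] that B0 by auto
      show "wrow 0 $ 1 * wrow 1 $ 2 - wrow 1 $ 1 * wrow 0 $ 2 \<noteq> 0" by (rule d1)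
    qed (use x nz openin_basic in auto)
  next
    assume x: "x \<in> Y1"
    show thesis
    proof (rule that[of Y1 "u powi n" "d - 1" d])
      show "VB n k y = {a. w (d - 1) a / u powi n \<in> y \<and> w d a / u powi n \<in> y}" if "y \<in> Y1" for y
        using VB_Y1[of y n k] LB_Y1[of y n k] that  by auto
      show "wrow (d - 1) $ 1 * wrow d $ 2 - wrow d $ 1 * wrow (d - 1) $ 2 \<noteq> 0" by (rule du)
    qed (use x nz openin_basic in auto)
  next
    assume x: "x \<in> Y2"
    show thesis
    proof (rule that[of Y2 "v powi n" 0 d])
      show "VB n k y = {a. w 0 a / v powi n \<in> y \<and> w d a / v powi n \<in> y}" if "y \<in> Y2" for y
        using VB_Y2[of y n k] LB_Y2[of y n k] that  by auto
      show "wrow 0 $ 1 * wrow d $ 2 - wrow d $ 1 * wrow 0 $ 2 \<noteq> 0" by (rule dt)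
    qed (use x nz openin_basic in auto)
  qed
qed

lemma qc_VB: "vec.qc_sheaf X (VB n k)"
proof (rule vec.qc_sheaf_frames[where 'i = bool, OF generization_closed_X subring_1[OF subring_X]])
  fix x assume "x \<in> X"
  then obtain W \<rho> i j where W: "openin (zariski X) W" "x \<in> W" "\<rho> \<noteq> 0"
    "\<And>y. y \<in> W \<Longrightarrow> VB n k y = {a. w i a / \<rho> \<in> y \<and> w j a / \<rho> \<in> y}" by (rule VB_frames[of x n k]) (rule that)
  show "\<exists>U I \<psi>. openin (zariski X) U \<and> x \<in> U \<and> finite (I :: bool set) \<and>
       (\<forall>i\<in>I. \<forall>a b r. \<psi> i (a + b) = \<psi> i a + \<psi> i b \<and> \<psi> i (r *s a) = r * \<psi> i a) \<and>
       (\<forall>y\<in>U. VB n k y = {v. \<forall>i\<in>I. \<psi> i v \<in> y})"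
    by (rule exI[of _ W], rule exI[of _ UNIV], rule exI[of _ "\<lambda>b a. (if b then w i a else w j a) / \<rho>"])
      (use W in \<open>auto simp: band_linear add_divide_distrib split: if_splits\<close>)
qed

section \<open>Cohomology of the bundle of rank two\<close>

lemma plane_sheaf_VB: "fine_cover C \<Longrightarrow> plane_sheaf p e d A N \<phi> (*s) (VB n k) C"
  by (intro plane_sheaf.intro plane_sheaf_axioms.intro plane_points_axioms vec.vector_space_axioms qc_VB)

text \<open>In cohomological degree at least 3 the decomposition hypotheses of
  \<open>acyclic_X\<close> are vacuous: three pieces have no overlaps beyond the triple one.\<close>

lemma VB_high:
  assumes "fine_cover C" "m \<ge> 3"
  shows "acyclic_at (VB n k) C X (Suc m)"
proof -
  interpret plane_sheaf p e d A N \<phi> "(*s)" "VB n k" C by (rule plane_sheaf_VB[OF assms(1)])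
  have "acyclic_at (VB n k) C X (Suc (Suc (m - 1)))"
    using assms(2) by (intro acyclic_X) auto
  then show ?thesis using assms(2) by simp
qed

text \<open>The long exact sequence of \<open>0 \<rightarrow> VB n k \<rightarrow> (LB n k)\<^sup>d\<^sup>+\<^sup>1 \<rightarrow> (LB (n+1) k)\<^sup>d\<^sup>-\<^sup>1 \<rightarrow> 0\<close>.\<close>

lemma VB_acyclic:
  assumes acyc: "acyclic_at (LB n k) C X (Suc (Suc m))" "acyclic_at (LB (n + 1) k) C X (Suc m)"
    and surj: "\<And>us z. length us = m \<Longrightarrow> set us \<subseteq> C \<Longrightarrow> (\<And>j. Suc j < d \<Longrightarrow> z j \<in> sections (LB (n + 1) k) (\<Inter>(set us) \<inter> X)) \<Longrightarrow>
      \<exists>r. (\<forall>j\<le>d. r j \<in> sections (LB n k) (\<Inter>(set us) \<inter> X)) \<and> (\<forall>j. Suc j < d \<longrightarrow> u * r j + v * r (Suc j) + r (Suc (Suc j)) = z j)"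
  shows "acyclic_at (VB n k) C X (Suc (Suc m))"
  unfolding acyclic_at_def
proof (intro allI impI, elim conjE)
  fix c assume c: "cochain (VB n k) C X (Suc (Suc m)) c"
    and cc: "\<forall>us. length us = Suc (Suc (Suc m)) \<and> set us \<subseteq> C \<longrightarrow> cech_diff c us = 0"
  note grp = group_sheaf.acyclic_atD[OF LB_group]
  have wlin: "cech_diff (\<lambda>us. w j (e us)) us = w j (cech_diff e us)" for j us and e :: "'k ff set set list \<Rightarrow> 'k ff ^ 2"
    by (rule cech_diff_additive) (rule band_linear)
  have w0: "w j 0 = 0" for j using band_linear(2)[of u v j 0 0] by simp
  have "\<exists>b. j \<le> d \<longrightarrow> cochain (LB n k) C X (Suc m) b \<and> (\<forall>us. length us = Suc (Suc m) \<and> set us \<subseteq> C \<longrightarrow> cech_diff b us = w j (c us))" for j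
  proof (cases "j \<le> d")
    case True
    have "cochain (LB n k) C X (Suc (Suc m)) (\<lambda>us. w j (c us))"
      using c True unfolding cochain_def sections_mem VB_def by blast
    moreover have "cech_diff (\<lambda>us. w j (c us)) us = 0" if "length us = Suc (Suc (Suc m))" "set us \<subseteq> C" for us
      using cc that by (simp add: wlin w0)
    ultimately show ?thesis using grp[OF acyc(1)] by blast
  qed blast
  then obtain b where b: "\<And>j. j \<le> d \<Longrightarrow> cochain (LB n k) C X (Suc m) (b j)"
    "\<And>j us. j \<le> d \<Longrightarrow> length us = Suc (Suc m) \<Longrightarrow> set us \<subseteq> C \<Longrightarrow> cech_diff (b j) us = w j (c us)" by metis
  have row: "cech_diff (\<lambda>us. u * r1 us + v * r2 us + r3 us) us = u * cech_diff r1 us + v * cech_diff r2 us + cech_diff r3 us" for r1 r2 r3 us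
    by (simp add: cech_diff_add cech_diff_additive[of "\<lambda>a. u * a"] cech_diff_additive[of "\<lambda>a. v * a"] distrib_left)
  \<comment> \<open>The connecting homomorphism: lift the entries of \<open>c\<close> to the
    primitives \<open>b\<close> and apply the rows. The result is a cocycle because \<open>c\<close>
    takes values in the kernel.\<close>
  define y where "y j us = u * b j us + v * b (Suc j) us + b (Suc (Suc j)) us" for j us
  have "\<exists>z. Suc j < d \<longrightarrow> cochain (LB (n + 1) k) C X m z \<and> (\<forall>us. length us = Suc m \<and> set us \<subseteq> C \<longrightarrow> cech_diff z us = y j us)" for j
  proof (cases "Suc j < d")
    case True
    have "cochain (LB (n + 1) k) C X (Suc m) (y j)"
      using b(1)[of j] b(1)[of "Suc j"] b(1)[of "Suc (Suc j)"] True
      unfolding cochain_def sections_mem y_def by (auto intro!: band_row_LB)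
    moreover have "cech_diff (y j) us = 0" if us: "length us = Suc (Suc m)" "set us \<subseteq> C" for us
    proof -
      have "cech_diff (y j) us = u * w j (c us) + v * w (Suc j) (c us) + w (Suc (Suc j)) (c us)"
        using True us by (simp only: y_def[abs_def] row b(2))
      then show ?thesis by (simp only: band_relation)
    qed
    ultimately show ?thesis using grp[OF acyc(2)] by blast
  qed blast
  then obtain z where z: "\<And>j. Suc j < d \<Longrightarrow> cochain (LB (n + 1) k) C X m (z j)"
    "\<And>j us. Suc j < d \<Longrightarrow> length us = Suc m \<Longrightarrow> set us \<subseteq> C \<Longrightarrow> cech_diff (z j) us = y j us" by metis
  have "\<exists>r. length us = m \<longrightarrow> set us \<subseteq> C \<longrightarrow> (\<forall>j\<le>d. r j \<in> sections (LB n k) (\<Inter>(set us) \<inter> X)) \<and>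
     (\<forall>j. Suc j < d \<longrightarrow> u * r j + v * r (Suc j) + r (Suc (Suc j)) = z j us)" for us
    using surj[of us "\<lambda>j. z j us"] z(1) unfolding cochain_def by blast
  then obtain r where r: "\<And>us. length us = m \<Longrightarrow> set us \<subseteq> C \<Longrightarrow> (\<forall>j\<le>d. r us j \<in> sections (LB n k) (\<Inter>(set us) \<inter> X)) \<and>
     (\<forall>j. Suc j < d \<longrightarrow> u * r us j + v * r us (Suc j) + r us (Suc (Suc j)) = z j us)" by metis
  \<comment> \<open>The rows send \<open>b\<close> to the coboundary of \<open>z\<close>, and
    \<open>r\<close> lifts \<open>z\<close>. Subtracting the coboundary of \<open>r\<close>
    therefore moves the primitives into the kernel without changing their coboundary.\<close>
  define \<beta> where "\<beta> j us = b j us - cech_diff (\<lambda>us. r us j) us" for j us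
  have \<beta>c: "cochain (LB n k) C X (Suc m) (\<beta> j)" if "j \<le> d" for j
    unfolding \<beta>_def using r that
    by (intro group_sheaf.cochain_diff[OF LB_group] group_sheaf.cochain_cech_diff[OF LB_group] b order_refl) (auto simp: cochain_def)
  have rel: "u * \<beta> j us + v * \<beta> (Suc j) us + \<beta> (Suc (Suc j)) us = 0" if us: "length us = Suc m" "set us \<subseteq> C" and j: "Suc j < d" for j us
  proof -
    have "cech_diff (\<lambda>us. u * r us j + v * r us (Suc j) + r us (Suc (Suc j))) us = cech_diff (z j) us"
      using r us j by (intro cech_diff_cong) auto
    then have "u * cech_diff (\<lambda>us. r us j) us + v * cech_diff (\<lambda>us. r us (Suc j)) us + cech_diff (\<lambda>us. r us (Suc (Suc j))) us
       = u * b j us + v * b (Suc j) us + b (Suc (Suc j)) us"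
      unfolding row z(2)[OF j us] y_def .
    then show ?thesis by (simp add: \<beta>_def algebra_simps)
  qed
  define B where "B us = (vector [\<beta> 0 us, \<beta> 1 us] :: 'k ff ^ 2)" for us
  have wB: "w j (B us) = \<beta> j us" if "length us = Suc m" "set us \<subseteq> C" "j \<le> d" for j us
    unfolding B_def by (rule band_eqI[of d u "\<lambda>j. \<beta> j us" v]) (use rel[OF that(1,2)] that(3) in auto)
  have "cochain (VB n k) C X (Suc m) B"
    using \<beta>c wB unfolding cochain_def sections_mem VB_def by simp
  moreover have "cech_diff B us = c us" if us: "length us = Suc (Suc m)" "set us \<subseteq> C" for us
  proof -
    have comp: "cech_diff B us $ i = cech_diff (\<lambda>us. B us $ i) us" for i
      by (rule cech_diff_additive[symmetric, of "\<lambda>a. a $ i"]) simp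
    have d\<beta>: "cech_diff (\<beta> j) us = w j (c us)" if "j \<le> d" for j
      using b(2)[OF that us] by (simp add: \<beta>_def[abs_def] cech_diff_diff cech_diff_cech_diff)
    have "cech_diff B us $ 1 = c us $ 1" "cech_diff B us $ 2 = c us $ 2"
      unfolding comp using d\<beta>[of 0] d\<beta>[of 1] d_pos by (simp_all add: B_def[abs_def])
    then show ?thesis by (simp add: vec_eq_iff forall_2)
  qed
  ultimately show "\<exists>b. cochain (VB n k) C X (Suc (Suc m) - 1) b \<and> (\<forall>us. length us = Suc (Suc m) \<and> set us \<subseteq> C \<longrightarrow> cech_diff b us = c us)"
    by auto
qed

text \<open>This and the next two lemmas solve the inhomogeneous system with zeros at the pair of
  entries that controls the rest on \<open>Y0\<close>, \<open>Y1\<close> and \<open>Y2\<close>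
  respectively. Regularity of the solution then follows from the corresponding
  \<open>band_mem\<close> lemma.\<close>

lemma band_solve_up:
  obtains r where "r 0 = 0" "r 1 = 0" "\<And>j. u * r j + v * r (Suc j) + r (Suc (Suc j)) = (z j :: 'k ff)"
proof -
  define s where "s = rec_nat (0, 0) (\<lambda>j (a, b). (b, z j - u * a - v * b))"
  have s: "s 0 = (0, 0)" "s (Suc j) = (snd (s j), z j - u * fst (s j) - v * snd (s j))" for j
    by (simp_all add: s_def split: prod.split)
  show thesis by (rule that[of "\<lambda>j. fst (s j)"]) (simp_all add: s)
qed

lemma band_solve_down:
  obtains r where "r (d - 1) = 0" "r d = 0" "\<And>j. Suc j < d \<Longrightarrow> u * r j + v * r (Suc j) + r (Suc (Suc j)) = (z j :: 'k ff)"
proof -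
  define s where "s = rec_nat (0, 0) (\<lambda>i (a, b). (b, (z (d - i - 2) - v * b - a) / u))"
  have s: "s 0 = (0, 0)" "s (Suc i) = (snd (s i), (z (d - i - 2) - v * snd (s i) - fst (s i)) / u)" for i
    by (simp_all add: s_def split: prod.split)
  have eq: "u * fst (s (Suc (Suc i))) + v * fst (s (Suc i)) + fst (s i) = z (d - i - 2)" for i
    using u_nonzero by (simp add: s field_simps)
  show thesis
  proof (rule that[of "\<lambda>j. fst (s (d - j))"])
    fix j assume "Suc j < d"
    then obtain i where i: "d - j = Suc (Suc i)" "d - Suc j = Suc i" "d - Suc (Suc j) = i" "d - i - 2 = j"
      by (intro that[of "d - Suc (Suc j)"]) auto
    show "u * fst (s (d - j)) + v * fst (s (d - Suc j)) + fst (s (d - Suc (Suc j))) = z j"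
      using eq[of i] by (simp only: i)
  qed (use d_pos in \<open>simp_all add: s\<close>)
qed

lemma band_solve_ends:
  obtains r where "r 0 = 0" "r d = 0" "\<And>j. Suc j < d \<Longrightarrow> u * r j + v * r (Suc j) + r (Suc (Suc j)) = (z j :: 'k ff)"
proof -
  obtain q where q: "q 0 = 0" "q 1 = 0" "\<And>j. u * q j + v * q (Suc j) + q (Suc (Suc j)) = z j" using band_solve_up by metis
  define t where "t = q d / wrow d $ 2"
  have nz: "wrow d $ 2 \<noteq> 0" using wrow_cont[of "d - 1"] cont_nonzero[of "d - 1"] d_pos by simp
  show thesis
  proof (rule that[of "\<lambda>j. q j - t * wrow j $ 2"])
    fix j
    have "u * wrow j $ 2 + v * wrow (Suc j) $ 2 + wrow (Suc (Suc j)) $ 2 = 0" by (simp add: wrow_def)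
    moreover have "u * (q j - t * wrow j $ 2) + v * (q (Suc j) - t * wrow (Suc j) $ 2) + (q (Suc (Suc j)) - t * wrow (Suc (Suc j)) $ 2)
      = (u * q j + v * q (Suc j) + q (Suc (Suc j))) - t * (u * wrow j $ 2 + v * wrow (Suc j) $ 2 + wrow (Suc (Suc j)) $ 2)"
      by (simp add: algebra_simps)
    ultimately show "u * (q j - t * wrow j $ 2) + v * (q (Suc j) - t * wrow (Suc j) $ 2) + (q (Suc (Suc j)) - t * wrow (Suc (Suc j)) $ 2) = z j"
      using q(3) by simp
  qed (use q nz in \<open>simp_all add: wrow_0 t_def\<close>)
qed

lemma local_surj:
  assumes O: "O' \<subseteq> Y0 \<or> O' \<subseteq> Y1 \<or> O' \<subseteq> Y2" and z: "\<And>j. Suc j < d \<Longrightarrow> z j \<in> sections (LB (n + 1) k) O'"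
  shows "\<exists>r. (\<forall>j\<le>d. r j \<in> sections (LB n k) O') \<and> (\<forall>j. Suc j < d \<longrightarrow> u * r j + v * r (Suc j) + r (Suc (Suc j)) = z j)"
proof -
  have zero: "0 \<in> LB n k x" if "x \<in> Y0 \<or> x \<in> Y1 \<or> x \<in> Y2" for x using that LB_0 by (auto simp: aff_def)
  show ?thesis using O
  proof (elim disjE)
    assume O: "O' \<subseteq> Y0"
    obtain r where r: "r 0 = 0" "r 1 = 0" "\<And>j. u * r j + v * r (Suc j) + r (Suc (Suc j)) = z j" using band_solve_up by metis
    have "r j \<in> LB n k x" if "x \<in> O'" "j \<le> d" for j x
      by (rule band_mem_Y0[of x r]) (use that O r z zero[of x] in \<open>auto simp: sections_mem\<close>)
    then show ?thesis using r by (auto simp: sections_mem)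
  next
    assume O: "O' \<subseteq> Y1"
    obtain r where r: "r (d - 1) = 0" "r d = 0" "\<And>j. Suc j < d \<Longrightarrow> u * r j + v * r (Suc j) + r (Suc (Suc j)) = z j" using band_solve_down by metis
    have "r j \<in> LB n k x" if "x \<in> O'" "j \<le> d" for j x
      by (rule band_mem_Y1[of x r]) (use that O r z zero[of x] in \<open>auto simp: sections_mem\<close>)
    then show ?thesis using r by (auto simp: sections_mem)
  next
    assume O: "O' \<subseteq> Y2"
    obtain r where r: "r 0 = 0" "r d = 0" "\<And>j. Suc j < d \<Longrightarrow> u * r j + v * r (Suc j) + r (Suc (Suc j)) = z j" using band_solve_ends by metis
    have "r j \<in> LB n k x" if "x \<in> O'" "j \<le> d" for j x
      by (rule band_mem_Y2[of x r]) (use that O r z zero[of x] in \<open>auto simp: sections_mem\<close>)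
    then show ?thesis using r by (auto simp: sections_mem)
  qed
qed

text \<open>On the empty list surjectivity is needed for global sections. By \<open>LB_H0\<close>
  these are polynomials of degree at most \<open>d - 1\<close>, which is also the number of rows,
  precisely the case of \<open>band_surj\<close>.\<close>

lemma VB_H1:
  assumes "fine_cover C"
  shows "acyclic_at (VB (int d - 2) 0) C X 2"
proof -
  have "acyclic_at (VB (int d - 2) 0) C X (Suc (Suc 0))"
  proof (rule VB_acyclic)
    show "acyclic_at (LB (int d - 2) 0) C X (Suc (Suc 0))"
      using LB_H1[OF assms, of "int d - 2" 0] d_pos by (simp add: numeral_2_eq_2)
    show "acyclic_at (LB (int d - 2 + 1) 0) C X (Suc 0)"
      using assms by (intro group_sheaf.acyclic_at_1[OF LB_group]) (auto simp: fine_cover_def)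
    fix us :: "'k ff set set list" and z
    assume us: "length us = 0" and z: "\<And>j. Suc j < d \<Longrightarrow> z j \<in> sections (LB (int d - 2 + 1) 0) (\<Inter>(set us) \<inter> X)"
    define K where "K = d - 1"
    have K: "int d - 2 + 1 = int K" "int d - 2 = int K - 1" using d_pos by (simp_all add: K_def of_nat_diff)
    have "\<exists>h. Suc j < d \<longrightarrow> z j = EV h \<and> tdle (int K) h" for j
    proof (cases "Suc j < d")
      case True
      then have "z j \<in> sections (LB (int K) 0) X" using z[OF True] us unfolding K by simp
      then show ?thesis using LB_H0 by metis
    qed auto
    then obtain h where h: "\<And>j. Suc j < d \<Longrightarrow> z j = EV (h j)" "\<And>j. Suc j < d \<Longrightarrow> tdle (int K) (h j)" by metis
    obtain r where r: "\<And>j. tdle (int K - 1) (r j)" "\<And>j. j < K \<Longrightarrow> h j = U * r j + V * r (Suc j) + r (Suc (Suc j))"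
      using band_surj[of K h] h(2) by (metis K_def less_diff_conv Suc_eq_plus1)
    have "EV (r j) \<in> sections (LB (int d - 2) 0) X" for j
      unfolding sections_mem using EV_mem_LB[OF _ r(1)] unfolding K by simp
    moreover have "u * EV (r j) + v * EV (r (Suc j)) + EV (r (Suc (Suc j))) = z j" if "Suc j < d" for j
    proof -
      have "j < K" using that by (simp add: K_def)
      from arg_cong[OF r(2)[OF this], of EV] h(1)[OF that] show ?thesis by (simp only: EV_hom EV_U EV_V)
    qed
    ultimately show "\<exists>r. (\<forall>j\<le>d. r j \<in> sections (LB (int d - 2) 0) (\<Inter>(set us) \<inter> X)) \<and>
        (\<forall>j. Suc j < d \<longrightarrow> u * r j + v * r (Suc j) + r (Suc (Suc j)) = z j)"
      using us by (intro exI[of _ "\<lambda>j. EV (r j)"]) simp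
  qed
  then show ?thesis by (simp add: numeral_2_eq_2)
qed

text \<open>Here surjectivity is needed only on lists of length 1, whose open set lies inside a
  chart; local surjectivity is enough.\<close>

lemma VB_H2:
  assumes "fine_cover C"
  shows "acyclic_at (VB (- 2) (- 1)) C X 3"
proof -
  have "acyclic_at (VB (- 2) (- 1)) C X (Suc (Suc 1))"
  proof (rule VB_acyclic)
    show "acyclic_at (LB (- 2) (- 1)) C X (Suc (Suc 1))"
      using LB_H2[OF assms] by (simp add: numeral_3_eq_3)
    show "acyclic_at (LB (- 2 + 1) (- 1)) C X (Suc 1)"
      using LB_H1[OF assms, of "- 1" "- 1"] by (simp add: numeral_2_eq_2)
    fix us :: "'k ff set set list" and z
    assume us: "length us = 1" "set us \<subseteq> C" and z: "\<And>j. Suc j < d \<Longrightarrow> z j \<in> sections (LB (- 2 + 1) (- 1)) (\<Inter>(set us) \<inter> X)"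
    obtain W where W: "us = [W]" "W \<in> C" using us by (cases us) auto
    have "W \<subseteq> B1 \<or> W \<subseteq> B2 \<or> W \<subseteq> Y1 \<or> W \<subseteq> Y2" using assms W by (simp add: fine_cover_def)
    moreover have "B1 \<subseteq> Y0" "B2 \<subseteq> Y0" by (auto simp: aff_def GB1_def GB2_def)
    ultimately have "\<Inter>(set us) \<inter> X \<subseteq> Y0 \<or> \<Inter>(set us) \<inter> X \<subseteq> Y1 \<or> \<Inter>(set us) \<inter> X \<subseteq> Y2" using W(1) by auto
    then show "\<exists>r. (\<forall>j\<le>d. r j \<in> sections (LB (- 2) (- 1)) (\<Inter>(set us) \<inter> X)) \<and>
        (\<forall>j. Suc j < d \<longrightarrow> u * r j + v * r (Suc j) + r (Suc (Suc j)) = z j)"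
      using z by (rule local_surj)
  qed
  then show ?thesis by (simp add: numeral_3_eq_3)
qed

end

section \<open>Invertible sheaves\<close>

text \<open>Reduces the defined sheaves to one normal form: if \<open>\<rho>\<close> divides all
  generators and is associated to one of them, the stalk is the principal module generated by
  \<open>\<rho>\<close>.\<close>

lemma submod_gen_principal:
  fixes x :: "'f::field set"
  assumes x: "subring_of_field x" and \<rho>: "\<rho> \<noteq> 0" "\<And>a. a \<in> G \<Longrightarrow> a / \<rho> \<in> x" and G: "\<exists>a\<in>G. unit_in x (a / \<rho>)"
  shows "submod_gen (*) x G = {b. b / \<rho> \<in> x}"
proof
  show "submod_gen (*) x G \<subseteq> {b. b / \<rho> \<in> x}"
  proof (rule submod_gen_least)
    fix r a assume "r \<in> x" "a \<in> G"
    then have "r * (a / \<rho>) \<in> x" using \<rho>(2) by (intro subring_mult[OF x])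
    then show "r * a \<in> {b. b / \<rho> \<in> x}" by simp
  qed (auto simp: add_divide_distrib subring_0[OF x] intro: subring_add[OF x])
  obtain a where a: "a \<in> G" "unit_in x (a / \<rho>)" using G by blast
  show "{b. b / \<rho> \<in> x} \<subseteq> submod_gen (*) x G"
  proof safe
    fix b assume "b / \<rho> \<in> x"
    then have "(b / \<rho>) / (a / \<rho>) \<in> x" using a(2) by (rule unit_in_divide_mem[OF x])
    then have "(b / \<rho>) / (a / \<rho>) * a \<in> submod_gen (*) x G" using a(1) by (rule submod_gen_single)
    moreover have "a \<noteq> 0" using unit_in_nonzero[OF a(2)] by simp
    ultimately show "b \<in> submod_gen (*) x G" using \<rho> by simp
  qed
qed

context
  fixes x :: "'f::field set"
  assumes x: "subring_of_field x"
begin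

lemma principal_unit: "unit_in x (\<rho> / \<sigma>) \<Longrightarrow> {b. b / \<rho> \<in> x} = {b. b / \<sigma> \<in> x}"
  using unit_in_divide_iff[OF x] by blast

lemma tensor_principal:
  assumes "M x = {b. b / \<rho> \<in> x}" "N x = {b. b / \<sigma> \<in> x}" "\<rho> \<noteq> 0" "\<sigma> \<noteq> 0"
  shows "tensor M N x = {b. b / (\<rho> * \<sigma>) \<in> x}"
  unfolding tensor_def
proof (rule submod_gen_principal[OF x])
  show "\<exists>a\<in>{m * n |m n. m \<in> M x \<and> n \<in> N x}. unit_in x (a / (\<rho> * \<sigma>))"
  proof
    show "\<rho> * \<sigma> \<in> {m * n |m n. m \<in> M x \<and> n \<in> N x}"
      unfolding assms mem_Collect_eq using subring_1[OF x] assms(3,4) by (intro exI[of _ \<rho>] exI[of _ \<sigma>]) simp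
  qed (use assms unit_in_1[OF x] in simp)
  show "a / (\<rho> * \<sigma>) \<in> x" if a: "a \<in> {m * n |m n. m \<in> M x \<and> n \<in> N x}" for a
  proof -
    obtain m n where "a = m * n" "m / \<rho> \<in> x" "n / \<sigma> \<in> x" using a assms by auto
    then show ?thesis using subring_mult[OF x, of "m / \<rho>" "n / \<sigma>"] by simp
  qed
qed (use assms in simp)

lemma tensor_power_principal:
  assumes "M x = {b. b / \<rho> \<in> x}" "\<rho> \<noteq> 0"
  shows "tensor_power M n x = {b. b / \<rho> ^ n \<in> x}"
proof (induction n)
  case (Suc n)
  show ?case using tensor_principal[of "tensor_power M n" "\<rho> ^ n" M \<rho>] Suc assms by (simp add: mult.commute)
qed simp

lemma tensor_prod_principal:
  assumes "\<And>i. i < n \<Longrightarrow> M i x = {b. b / \<rho> i \<in> x}" "\<And>i. i < n \<Longrightarrow> \<rho> i \<noteq> 0"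
  shows "tensor_prod M n x = {b. b / (\<Prod>i<n. \<rho> i) \<in> x}"
  using assms
proof (induction n)
  case (Suc n)
  have "tensor_prod M n x = {b. b / (\<Prod>i<n. \<rho> i) \<in> x}" using Suc by simp
  then show ?case using tensor_principal[of "tensor_prod M n" "\<Prod>i<n. \<rho> i" "M n" "\<rho> n"] Suc.prems by simp
qed simp

lemma dual_principal:
  assumes "M x = {b. b / \<rho> \<in> x}" "\<rho> \<noteq> 0"
  shows "dual M x = {b. b / (1 / \<rho>) \<in> x}"
proof -
  have "(\<forall>m. m / \<rho> \<in> x \<longrightarrow> a * m \<in> x) \<longleftrightarrow> a * \<rho> \<in> x" for a
  proof
    assume "\<forall>m. m / \<rho> \<in> x \<longrightarrow> a * m \<in> x"
    then show "a * \<rho> \<in> x" using subring_1[OF x] assms(2) by auto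
  next
    assume "a * \<rho> \<in> x"
    then show "\<forall>m. m / \<rho> \<in> x \<longrightarrow> a * m \<in> x" using subring_mult[OF x, of "a * \<rho>"] assms(2) by fastforce
  qed
  then show ?thesis unfolding dual_def assms(1) by simp
qed

end

section \<open>Frames of rank two\<close>

lemma matrix_2_vector: "(vector [\<alpha>, \<beta>] :: 'f::field ^ 2 ^ 2) *v a = vector [\<alpha> $ 1 * a $ 1 + \<alpha> $ 2 * a $ 2, \<beta> $ 1 * a $ 1 + \<beta> $ 2 * a $ 2]"
  by (simp add: vec_eq_iff forall_2 matrix_vector_mult_def sum_2)

lemma rank_two_frame:
  fixes \<alpha> \<beta> :: "'f::field ^ 2"
  assumes "\<alpha> $ 1 * \<beta> $ 2 - \<beta> $ 1 * \<alpha> $ 2 \<noteq> 0"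
  obtains B :: "'f ^ 2 ^ 2" where "invertible B"
    "\<And>y. {a. \<alpha> $ 1 * a $ 1 + \<alpha> $ 2 * a $ 2 \<in> y \<and> \<beta> $ 1 * a $ 1 + \<beta> $ 2 * a $ 2 \<in> y} = (\<lambda>v. B *v v) ` {v. \<forall>i. v $ i \<in> y}"
proof -
  define \<Phi> :: "'f ^ 2 ^ 2" where "\<Phi> = vector [\<alpha>, \<beta>]"
  have "det \<Phi> \<noteq> 0" using assms by (simp add: \<Phi>_def det_2 mult.commute)
  then have inv: "invertible \<Phi>" by (simp add: invertible_det_nz)
  then obtain B where B: "\<Phi> ** B = mat 1" "B ** \<Phi> = mat 1" unfolding invertible_def by blast
  show thesis
  proof (rule that)
    show "invertible B" using B unfolding invertible_def by blast
    fix y :: "'f set"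
    have mem: "\<alpha> $ 1 * a $ 1 + \<alpha> $ 2 * a $ 2 \<in> y \<and> \<beta> $ 1 * a $ 1 + \<beta> $ 2 * a $ 2 \<in> y \<longleftrightarrow> (\<forall>i. (\<Phi> *v a) $ i \<in> y)" for a
      by (simp add: \<Phi>_def matrix_2_vector forall_2)
    have "a = B *v (\<Phi> *v a)" "\<Phi> *v (B *v a) = a" for a
      by (simp_all only: matrix_vector_mul_assoc B matrix_vector_mul_lid)
    then show "{a. \<alpha> $ 1 * a $ 1 + \<alpha> $ 2 * a $ 2 \<in> y \<and> \<beta> $ 1 * a $ 1 + \<beta> $ 2 * a $ 2 \<in> y} = (\<lambda>v. B *v v) ` {v. \<forall>i. v $ i \<in> y}"
      unfolding mem by (auto simp: image_iff)
  qed
qed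

lemma det_bundle_frame:
  fixes \<alpha> \<beta> :: "'f::field ^ 2"
  and F :: "'f set \<Rightarrow> ('f ^ 2) set"
  assumes x: "subring_of_field x" and \<delta>: "\<delta> = \<alpha> $ 1 * \<beta> $ 2 - \<beta> $ 1 * \<alpha> $ 2" "\<delta> \<noteq> 0"
    and F: "F x = {a. \<alpha> $ 1 * a $ 1 + \<alpha> $ 2 * a $ 2 \<in> x \<and> \<beta> $ 1 * a $ 1 + \<beta> $ 2 * a $ 2 \<in> x}"
  shows "det_bundle F x = {b. b / (1 / \<delta>) \<in> x}"
  unfolding det_bundle_def
proof (rule submod_gen_principal[OF x])
  \<comment> \<open>The rows are the basis dual to the functionals \<open>\<alpha>\<close>,
    \<open>\<beta>\<close>, so they lie in the stalk and their determinant is the inverse of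
    \<open>\<delta>\<close>.\<close>
  define A :: "'f ^ 2 ^ 2" where "A = vector [vector [\<beta> $ 2 / \<delta>, - \<beta> $ 1 / \<delta>], vector [- \<alpha> $ 2 / \<delta>, \<alpha> $ 1 / \<delta>]]"
  have *: "\<alpha> $ 1 * (\<beta> $ 2 / \<delta>) - \<alpha> $ 2 * (\<beta> $ 1 / \<delta>) = 1" "\<beta> $ 2 * (\<alpha> $ 1 / \<delta>) - \<beta> $ 1 * (\<alpha> $ 2 / \<delta>) = 1"
    using \<delta> by (simp_all add: field_simps)
  have "\<forall>i. A $ i \<in> F x"
    using * subring_0[OF x] subring_1[OF x] unfolding F A_def forall_2 by (simp add: mult.commute)
  moreover have "unit_in x (det A / (1 / \<delta>))"
  proof -
    have "det A * \<delta> = \<alpha> $ 1 * (\<beta> $ 2 / \<delta>) - \<alpha> $ 2 * (\<beta> $ 1 / \<delta>)"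
      using \<delta>(2) by (simp add: A_def det_2 field_simps)
    then show ?thesis using * unit_in_1[OF x] by simp
  qed
  ultimately show "\<exists>a\<in>{det A |A. \<forall>i. A $ i \<in> F x}. unit_in x (a / (1 / \<delta>))" by blast
  fix a assume "a \<in> {det A |A :: 'f ^ 2 ^ 2. \<forall>i. A $ i \<in> F x}"
  then obtain A :: "'f ^ 2 ^ 2" where A: "a = det A" "\<And>i. A $ i \<in> F x" by blast
  have "det A * \<delta> = (\<alpha> $ 1 * A $ 1 $ 1 + \<alpha> $ 2 * A $ 1 $ 2) * (\<beta> $ 1 * A $ 2 $ 1 + \<beta> $ 2 * A $ 2 $ 2)
    - (\<beta> $ 1 * A $ 1 $ 1 + \<beta> $ 2 * A $ 1 $ 2) * (\<alpha> $ 1 * A $ 2 $ 1 + \<alpha> $ 2 * A $ 2 $ 2)"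
    by (simp add: \<delta>(1) det_2 algebra_simps)
  also have "\<dots> \<in> x" using A(2) F by (auto intro!: subring_diff[OF x] subring_mult[OF x])
  finally show "a / (1 / \<delta>) \<in> x" using A by simp
qed (use \<delta> in simp)

lemma twist_principal:
  fixes F :: "'f::field set \<Rightarrow> ('f ^ 'n) set"
  assumes x: "subring_of_field x" and M: "M x = {b. b / \<theta> \<in> x}" "\<theta> \<noteq> 0"
    and F: "0 \<in> F x" "\<And>a b. a \<in> F x \<Longrightarrow> b \<in> F x \<Longrightarrow> a + b \<in> F x" "\<And>r a. r \<in> x \<Longrightarrow> a \<in> F x \<Longrightarrow> r *s a \<in> F x"
  shows "twist F M x = (\<lambda>a. \<theta> *s a) ` F x"
proof
  note img = mem_scale_image[OF M(2)]
  show "twist F M x \<subseteq> (\<lambda>a. \<theta> *s a) ` F x"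
    unfolding twist_def
  proof (rule submod_gen_least)
    fix r a assume r: "r \<in> x" and "a \<in> {m *s v |m v. m \<in> M x \<and> v \<in> F x}"
    then obtain m v where a: "a = m *s v" "m / \<theta> \<in> x" "v \<in> F x" using M by auto
    have "inverse \<theta> *s (r *s a) = r *s ((m / \<theta>) *s v)" by (simp add: a vector_smult_assoc divide_inverse mult_ac)
    also have "\<dots> \<in> F x" by (intro F r a)
    finally show "r *s a \<in> (\<lambda>a. \<theta> *s a) ` F x" unfolding img .
  qed (simp_all add: img vector_add_ldistrib F)
  show "(\<lambda>a. \<theta> *s a) ` F x \<subseteq> twist F M x"
  proof safe
    fix a assume "a \<in> F x"
    then have "\<theta> *s a \<in> {m *s v |m v. m \<in> M x \<and> v \<in> F x}"
      unfolding mem_Collect_eq using M subring_1[OF x] by (intro exI[of _ \<theta>] exI[of _ a]) simp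
    with subring_1[OF x] have "1 *s (\<theta> *s a) \<in> twist F M x"
      unfolding twist_def by (rule submod_gen_single)
    then show "\<theta> *s a \<in> twist F M x" by simp
  qed
qed

lemma acyclic_at_cong:
  assumes "acyclic_at F C Y n" "\<And>x. x \<in> Y \<Longrightarrow> F x = F' x"
  shows "acyclic_at F' C Y n"
proof -
  have "sections F' (W \<inter> Y) = sections F (W \<inter> Y)" for W using assms(2) by (auto simp: sections_mem)
  then show ?thesis using assms(1) by (simp add: acyclic_at_def cochain_def)
qed

text \<open>The rows of \<open>A\<close> are taken on the curve \<open>(1, c, c^2)\<close>. Each
  condition on a row then says that some nonzero polynomial does not vanish at \<open>c\<close>,
  which excludes finitely many values; distinct parameters make \<open>A\<close> an invertible
  Vandermonde matrix.\<close>

lemma coordinate_change: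
  fixes p :: "nat \<Rightarrow> 'k::field_char_0 ^ 3"
  assumes "distinct_points e p"
  obtains A N :: "'k ^ 3 ^ 3" where "N ** A = mat 1" "\<And>i. i < e \<Longrightarrow> (A *v p i) $ 3 \<noteq> 0"
    "inj_on (\<lambda>i. (A *v p i) $ 1 / (A *v p i) $ 3) {..<e}"
proof -
  have avoid: "\<exists>c. \<forall>q\<in>S. poly q c \<noteq> 0" if "finite S" "\<forall>q\<in>S. q \<noteq> 0" for S :: "'k poly set"
  proof -
    have "finite (\<Union>q\<in>S. {c. poly q c = 0})" using that by (auto intro: poly_roots_finite)
    then show ?thesis using ex_new_if_finite[OF infinite_UNIV_char_0] by blast
  qed
  define P where "P i = [:p i $ 1, p i $ 2, p i $ 3:]" for i
  have P: "poly (P i) c = p i $ 1 + p i $ 2 * c + p i $ 3 * c ^ 2" for i c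
    by (simp add: P_def power2_eq_square algebra_simps)
  have P0: "P i \<noteq> 0" if "i < e" for i
  proof
    assume "P i = 0"
    then have "p i = 0" by (simp add: P_def vec_eq_iff forall_3)
    then show False using assms that by (simp add: distinct_points_def)
  qed
  obtain c3 where c3: "\<And>i. i < e \<Longrightarrow> poly (P i) c3 \<noteq> 0" using avoid[of "P ` {..<e}"] P0 by auto
  \<comment> \<open>\<open>Q i j\<close> vanishes at \<open>c\<close> exactly when the points i and
    j get equal ratios with respect to the rows \<open>c\<close> and \<open>c3\<close>. It is not
    the zero polynomial because the two points are not proportional.\<close>
  define Q where "Q i j = smult (poly (P j) c3) (P i) - smult (poly (P i) c3) (P j)" for i j
  have Q: "Q i j \<noteq> 0" if ij: "i < e" "j < e" "i \<noteq> j" for i j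
  proof
    assume "Q i j = 0"
    then have "poly (P j) c3 * p i $ k = poly (P i) c3 * p j $ k" for k
      unfolding Q_def P_def using exhaust_3[of k] by auto
    then have "p i = (poly (P i) c3 / poly (P j) c3) *s p j" using c3[OF ij(2)] by (simp add: vec_eq_iff field_simps)
    then show False using assms ij unfolding distinct_points_def by blast
  qed
  obtain c1 where c1: "\<And>i j. i < e \<Longrightarrow> j < e \<Longrightarrow> i \<noteq> j \<Longrightarrow> poly (Q i j) c1 \<noteq> 0" "c1 \<noteq> c3"
  proof -
    define S where "S = insert [:- c3, 1:] ((\<lambda>(i, j). Q i j) ` {(i, j). i < e \<and> j < e \<and> i \<noteq> j})"
    have "finite {(i, j). i < e \<and> j < e \<and> i \<noteq> j}" by (rule finite_subset[of _ "{..<e} \<times> {..<e}"]) auto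
    then have "finite S" "\<forall>q\<in>S. q \<noteq> 0" using Q by (auto simp: S_def)
    from avoid[OF this] obtain c where c: "\<forall>q\<in>S. poly q c \<noteq> 0" ..
    show thesis by (rule that[of c]) (use c in \<open>auto simp: S_def\<close>)
  qed
  obtain c2 where c2: "c2 \<noteq> c1" "c2 \<noteq> c3" using ex_new_if_finite[OF infinite_UNIV_char_0, of "{c1, c3}"] by auto
  define A :: "'k ^ 3 ^ 3" where "A = vector [vector [1, c1, c1 ^ 2], vector [1, c2, c2 ^ 2], vector [1, c3, c3 ^ 2]]"
  have "det A = (c2 - c1) * (c3 - c1) * (c3 - c2)"
    by (simp add: A_def det_3 algebra_simps power2_eq_square)
  then have "invertible A" using c1 c2 by (simp add: invertible_det_nz)
  then obtain N where "N ** A = mat 1" unfolding invertible_def by blast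
  moreover have A: "(A *v p i) $ 1 = poly (P i) c1" "(A *v p i) $ 3 = poly (P i) c3" for i
    by (simp_all add: A_def P matrix_vector_mult_def sum_3 mult.commute)
  moreover have "inj_on (\<lambda>i. poly (P i) c1 / poly (P i) c3) {..<e}"
  proof (rule inj_onI, rule ccontr)
    fix i j assume ij: "i \<in> {..<e}" "j \<in> {..<e}" "i \<noteq> j" "poly (P i) c1 / poly (P i) c3 = poly (P j) c1 / poly (P j) c3"
    then have "poly (P j) c3 * poly (P i) c1 = poly (P i) c3 * poly (P j) c1" using c3 by (simp add: field_simps)
    then show False using c1(1)[of i j] ij by (simp add: Q_def)
  qed
  ultimately show thesis using c3 by (intro that[of N A]) simp_all
qed

context plane_points
begin

lemma mu_types: "mu x \<in> types"
  by (simp add: mu_def)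

lemma X_trichotomy:
  assumes "x \<in> X"
  obtains "chart 1 \<subseteq> x" "mu x = 1" "x \<in> Y0"
  | "\<not> chart 1 \<subseteq> x" "mu x = u" "eps x = 1" "x \<in> Y1"
  | "\<not> chart 1 \<subseteq> x" "mu x = v" "eps x = 1" "x \<in> Y2"
proof (cases "chart 1 \<subseteq> x")
  case True
  then show thesis using assms that(1) by (simp add: mu_def aff_def)
next
  case False
  note nc = this
  show thesis
  proof (cases "G1 \<subseteq> x")
    case True
    then show thesis using nc assms that(2) by (simp add: mu_def eps_def aff_def)
  next
    case False
    then have "x \<in> Y2" using nc assms X_eq unfolding aff_def by blast
    then show thesis using nc False that(3) by (simp add: mu_def eps_def)
  qed
qed

section \<open>The hyperplane class\<close>

text \<open>The pulled back line has local equation \<open>lam 3 / lam j\<close>, which is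
  associated to \<open>lam 3 / mu x\<close>. Dualizing inverts it, and \<open>coord $ 3 = 1\<close>
  turns \<open>1 / lam 3\<close> into \<open>l 3\<close>.\<close>

lemma O_L_stalk:
  assumes x: "x \<in> X"
  shows "O_L x = {b. b / (l 3 * mu x) \<in> x}"
proof -
  note s = subring_X[OF x] and lx = X_loc_pt[OF x]
  define J :: "'k poly3 set" where "J = ideal_gen {var3 3}"
  have l3: "l 3 \<noteq> 0" "lam 3 = 1 / l 3"
    using l_nonzero coord_lam[of 3] by (simp_all add: coord_def field_simps)
  have ideal: "inverse_image_ideal J x = {b. b / (lam 3 / mu x) \<in> x}"
    unfolding inverse_image_ideal_def
  proof (rule submod_gen_principal[OF s])
    have unit: "unit_in x (lam j / mu x)" if "chart_ring j \<subseteq> x" for j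
      by (rule unit_lam[OF lx chart_mu[OF x] mu_types that])
    show "lam 3 / mu x \<noteq> 0" using lam_nonzero mu_nonzero by simp
    fix a assume "a \<in> (\<Union>j\<in>{j. chart_ring j \<subseteq> x}. chart_ideal J j)"
    then obtain j h n where j: "chart_ring j \<subseteq> x" and h: "h \<in> J" "is_form n h" "a = eval_poly3 const_ff coord h / coord $ j ^ n"
      by (auto simp: chart_ideal_def)
    show "a / (lam 3 / mu x) \<in> x"
    proof (cases "h = 0")
      case True
      have "a = 0" unfolding h(3) True by (simp add: eval_poly3_def)
      then show ?thesis using subring_0[OF s] by simp
    next
      case False
      obtain m q where q: "n = Suc m" "is_form m q" "h = q * var3 3"
        using form_in_var_ideal[OF h(1)[unfolded J_def] h(2) False] by metis
      have "a = (eval_poly3 const_ff coord q / coord $ j ^ m) * (coord $ 3 / coord $ j)"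
        unfolding h(3) q(1,3) by (simp add: eval_poly3_mult[OF rhom_const_ff] eval_var3[OF rhom_const_ff])
      then have "a / (lam 3 / mu x) = (eval_poly3 const_ff coord q / coord $ j ^ m) * inverse (lam j / mu x)"
        unfolding coord_ratio using lam_nonzero by (simp add: field_simps)
      moreover have "eval_poly3 const_ff coord q / coord $ j ^ m \<in> x" using eval_coord_chart_ring[OF q(2)] j by blast
      ultimately show ?thesis using subring_mult[OF s _ unit_in_inverse_mem[OF unit[OF j]]] by (simp only:)
    qed
  next
    obtain j where j: "chart_ring j \<subseteq> x" using ex_unit_lam[OF lx chart_mu[OF x] mu_types] by blast
    have "is_form 1 (var3 3 :: 'k poly3)" unfolding var3_def by (rule is_form_single) (simp add: lookup_single when_def)
    moreover have "var3 3 \<in> J" unfolding J_def ideal_gen_def by (rule module.span_base[OF module_poly3 singletonI])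
    moreover have "lam 3 / lam j = eval_poly3 const_ff coord (var3 3) / coord $ j ^ 1"
      unfolding coord_ratio[symmetric] by (simp add: eval_var3[OF rhom_const_ff])
    ultimately have "lam 3 / lam j \<in> chart_ideal J j" unfolding chart_ideal_def by blast
    moreover have "unit_in x (lam 3 / lam j / (lam 3 / mu x))"
      using unit_in_inverse[OF unit_lam[OF lx chart_mu[OF x] mu_types j]] lam_nonzero by simp
    ultimately show "\<exists>a\<in>\<Union>j\<in>{j. chart_ring j \<subseteq> x}. chart_ideal J j. unit_in x (a / (lam 3 / mu x))"
      using j by blast
  qed
  have "O_L x = dual (inverse_image_ideal J) x" by (simp add: O_L_def J_def var3_def)
  also have "\<dots> = {b. b / (1 / (lam 3 / mu x)) \<in> x}"
    using lam_nonzero mu_nonzero by (intro dual_principal[where M = "inverse_image_ideal J" and \<rho> = "lam 3 / mu x", OF s ideal]) simp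
  also have "1 / (lam 3 / mu x) = l 3 * mu x" using l3 by simp
  finally show ?thesis .
qed

lemma fP_eq: "fP = V - [:\<phi>:]"
  by (simp add: fP_def mono2_def monom_altdef)

lemma uP: "EV (U - mono2 (up i) 0 0) = u - const_ff (up i)"
  by (simp only: rhom.minus[OF rhom_EV] EV_mono2) (simp add: const_ff_hom)

lemma O_minus_E_stalk:
  assumes x: "x \<in> X" and i: "i < e" and \<eta>: "\<eta> \<noteq> 0"
    and mem: "\<And>h j n. van {i} h \<Longrightarrow> EV h / lam j ^ n \<in> x \<Longrightarrow> chart_ring j \<subseteq> x \<Longrightarrow> EV h / lam j ^ n / \<eta> \<in> x"
    and unit: "\<And>j. chart_ring j \<subseteq> x \<Longrightarrow> \<exists>h n. van {i} h \<and> tdle (int n) h \<and> unit_in x (EV h / lam j ^ n / \<eta>)"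
  shows "O_minus_E (p i) x = {b. b / \<eta> \<in> x}"
  unfolding O_minus_E_def inverse_image_ideal_def
proof (rule submod_gen_principal[OF subring_X[OF x] \<eta>])
  have J: "{p i} = p ` {i}" "{i} \<subseteq> {..<e}" using i by auto
  show "a / \<eta> \<in> x" if a: "a \<in> (\<Union>j\<in>{j. chart_ring j \<subseteq> x}. chart_ideal (points_ideal {p i}) j)" for a
  proof -
    obtain j where j: "chart_ring j \<subseteq> x" "a \<in> chart_ideal (points_ideal (p ` {i})) j" using a by auto
    obtain h n where "van {i} h" "a = EV h / lam j ^ n" "a \<in> chart_ring j" by (rule chart_ideal_pointsE[OF j(2) J(2)])
    then show ?thesis using mem[of h j n] j by blast
  qed
  obtain j where j: "chart_ring j \<subseteq> x" using ex_unit_lam[OF X_loc_pt[OF x] chart_mu[OF x] mu_types] by blast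
  then obtain h n where h: "van {i} h" "tdle (int n) h" "unit_in x (EV h / lam j ^ n / \<eta>)" using unit by blast
  have "EV h / lam j ^ n \<in> chart_ideal (points_ideal {p i}) j" unfolding J(1) by (rule chart_ideal_pointsI[OF h(1,2) J(2)])
  then show "\<exists>a\<in>\<Union>j\<in>{j. chart_ring j \<subseteq> x}. chart_ideal (points_ideal {p i}) j. unit_in x (a / \<eta>)"
    using h j by blast
qed

text \<open>Over the affine plane the ideal of a single point is generated by \<open>f\<close> and
  \<open>u - u\<^sub>i\<close>, since \<open>\<phi>\<close> also interpolates that point. Thus only
  these two elements have to be compared with \<open>\<eta>\<close>.\<close>

lemma O_minus_E_Y0:
  assumes x: "x \<in> X" "chart 1 \<subseteq> x" and i: "i < e" and \<eta>: "\<eta> \<noteq> 0" "f / \<eta> \<in> x" "(u - const_ff (up i)) / \<eta> \<in> x"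
    and unit: "unit_in x (f / \<eta>) \<or> unit_in x ((u - const_ff (up i)) / \<eta>)"
  shows "O_minus_E (p i) x = {b. b / \<eta> \<in> x}"
proof (rule O_minus_E_stalk[OF x(1) i \<eta>(1)])
  note lx = X_loc_pt[OF x(1)] note s = loc_ptD[OF lx]
  have U1: "[:\<Prod>k\<in>{i}. [:- up k, 1:]:] = U - mono2 (up i) 0 0"
    by (simp add: mono2_def monom_altdef)
  have vf: "van {i} fP" unfolding fP_def using interp' i by (intro van_fP) auto
  fix j assume j: "chart_ring j \<subseteq> x"
  have lj: "unit_in x (lam j ^ n)" for n by (intro unit_in_power[OF s(1)] lam_unit1[OF lx x(2) j])
  show "EV h / lam j ^ n / \<eta> \<in> x" if h: "van {i} h" for h n
  proof -
    have "\<And>k. k \<in> {i} \<Longrightarrow> poly \<phi> (up k) = vp k" using interp' i by auto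
    then obtain a b where "h = a * [:- \<phi>, 1:] + b * [:\<Prod>k\<in>{i}. [:- up k, 1:]:]"
      using van_complete_intersection[of "{i}" \<phi> h] i h by auto
    then have "EV h / \<eta> = EV a * (f / \<eta>) + EV b * ((u - const_ff (up i)) / \<eta>)"
      unfolding U1 f_def fP_def by (simp only: rhom.add[OF rhom_EV] rhom.mult[OF rhom_EV] uP times_divide_eq_right add_divide_distrib)
    also have "\<dots> \<in> x" by (intro subring_add subring_mult s EV_mem x \<eta>)
    finally have "EV h / \<eta> / lam j ^ n \<in> x" using lj by (rule unit_in_divide_mem[OF s(1)])
    then show ?thesis by (simp add: mult.commute)
  qed
  show "\<exists>h n. van {i} h \<and> tdle (int n) h \<and> unit_in x (EV h / lam j ^ n / \<eta>)"
  proof -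
    obtain h where h: "van {i} h" "unit_in x (EV h / \<eta>)"
      using unit
    proof
      assume "unit_in x (f / \<eta>)"
      then show thesis using vf by (intro that[of fP]) (simp_all add: f_def)
    next
      assume "unit_in x ((u - const_ff (up i)) / \<eta>)"
      then show thesis using van_gP[of "{i}", unfolded U1] by (intro that[of "U - mono2 (up i) 0 0"]) (simp_all only: uP finite.intros)
    qed
    obtain n where n: "tdle (int n) h" using tdle_exists by blast
    have "unit_in x (EV h / \<eta> / lam j ^ n)" by (rule unit_in_divide[OF s(1) h(2) lj])
    then have "unit_in x (EV h / lam j ^ n / \<eta>)" by (simp add: mult.commute)
    then show ?thesis using h n by blast
  qed
qed

lemma g_prod: "g = (\<Prod>i<e. u - const_ff (up i))"
  unfolding g_def gP_prod rhom.prod[OF rhom_EV] uP ..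

lemma u_minus_nonzero: "i < e \<Longrightarrow> u - const_ff (up i) \<noteq> 0"
  using g_nonzero unfolding g_prod by (simp add: prod_zero_iff)

lemma up_distinct: "i < e \<Longrightarrow> k < e \<Longrightarrow> up i = up k \<Longrightarrow> i = k"
  using distinct unfolding up_def by (auto dest: inj_onD)

lemma u_minus_mem: "x \<in> X \<Longrightarrow> chart 1 \<subseteq> x \<Longrightarrow> u - const_ff (up i) \<in> x"
  unfolding uP[symmetric] by (intro EV_mem loc_ptD X_loc_pt)

text \<open>Two of the functions \<open>u - u\<^sub>i\<close> differ by a nonzero constant, so at
  most one of them is a nonunit.\<close>

lemma u_minus_unit:
  assumes x: "x \<in> X" "chart 1 \<subseteq> x" and ik: "i < e" "k < e" "i \<noteq> k" and nk: "\<not> unit_in x (u - const_ff (up k))"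
  shows "unit_in x (u - const_ff (up i))"
proof -
  note s = loc_ptD[OF X_loc_pt[OF x(1)]]
  define c where "c = up k - up i"
  have "c \<noteq> 0" using up_distinct[OF ik(1,2)] ik(3) by (auto simp: c_def)
  then have "const_ff c \<noteq> 0" using const_ff_inject[of c 0] by (simp add: const_ff_hom(1))
  moreover have "const_ff c \<in> x" "const_ff (inverse c) \<in> x" using s(2) by auto
  ultimately have "unit_in x (const_ff (up k - up i))" by (simp add: unit_in_def const_ff_inverse flip: c_def)
  then have "unit_in x (const_ff (up k - up i) + (u - const_ff (up k)))"
    by (rule unit_in_add_nonunit[OF s(3) _ u_minus_mem[OF x] nk])
  then show ?thesis by (simp add: const_ff_hom)
qed

lemma ex_nonunit:
  assumes x: "x \<in> X" "chart 1 \<subseteq> x" "f / g \<notin> x"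
  obtains k where "k < e" "\<not> unit_in x (u - const_ff (up k))"
proof (rule ccontr)
  note s = loc_ptD[OF X_loc_pt[OF x(1)]]
  assume "\<not> thesis"
  then have "unit_in x g" unfolding g_prod using that by (intro unit_in_prod[OF s(1)]) auto
  moreover have "f \<in> x" unfolding f_def by (intro EV_mem s x)
  ultimately show False using x(3) unit_in_divide_mem[OF s(1)] by blast
qed

text \<open>Where \<open>f / g\<close> is regular, each factor \<open>u - u\<^sub>i\<close>
  generates the ideal of its own point and the product is \<open>g\<close>. Elsewhere over the
  affine plane exactly one factor is a nonunit and contributes \<open>f\<close>. Near infinity a
  form vanishing at all points is a unit, so every ideal is trivial.\<close>

lemma O_E_stalk:
  assumes x: "x \<in> X"
  shows "tensor_prod (\<lambda>i. O_minus_E (p i)) e x = {b. b / eps x \<in> x}"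
proof -
  note lx = X_loc_pt[OF x] note s = loc_ptD[OF lx]
  have u1: "unit_in x 1" by (rule unit_in_1[OF s(1)])
  show ?thesis
  proof (rule X_trichotomy[OF x])
    assume c: "chart 1 \<subseteq> x"
    have fx: "f \<in> x" unfolding f_def by (intro EV_mem s c)
    show ?thesis
    proof (cases "f / g \<in> x")
      case True
      have "O_minus_E (p i) x = {b. b / (u - const_ff (up i)) \<in> x}" if i: "i < e" for i
      proof (rule O_minus_E_Y0[OF x c i])
        have q: "f / a = (f / g) * b" if "g = a * b" for a b using g_nonzero that by auto
        have "g = (u - const_ff (up i)) * (\<Prod>k\<in>{..<e} - {i}. u - const_ff (up k))"
          unfolding g_prod using i by (intro prod.remove) auto
        from q[OF this] have "f / (u - const_ff (up i)) = (f / g) * (\<Prod>k\<in>{..<e} - {i}. u - const_ff (up k))" .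
        also have "\<dots> \<in> x" by (intro subring_mult subring_prod s True u_minus_mem x c)
        finally show "f / (u - const_ff (up i)) \<in> x" .
      qed (use u_minus_nonzero[OF i] u1 subring_1[OF s(1)] in simp_all)
      then have "tensor_prod (\<lambda>i. O_minus_E (p i)) e x = {b. b / (\<Prod>i<e. u - const_ff (up i)) \<in> x}"
        using u_minus_nonzero by (intro tensor_prod_principal[OF s(1)]) auto
      then show ?thesis using c True by (simp add: eps_def flip: g_prod)
    next
      case False
      then have gf: "g / f \<in> x" using X_fg[OF x c] by blast
      obtain k where k: "k < e" "\<not> unit_in x (u - const_ff (up k))" by (rule ex_nonunit[OF x c False])
      have un: "unit_in x (u - const_ff (up i))" if "i < e" "i \<noteq> k" for i
        by (rule u_minus_unit[OF x c that(1) k(1) that(2) k(2)])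
      \<comment> \<open>Only the point \<open>k\<close> lies below \<open>x\<close>; there
        \<open>g / f\<close> is regular, so \<open>f\<close> generates, and the ideals of the other
        points are trivial.\<close>
      define \<eta> where "\<eta> i = (if i = k then f else 1)" for i
      have "O_minus_E (p i) x = {b. b / \<eta> i \<in> x}" if i: "i < e" for i
      proof (rule O_minus_E_Y0[OF x c i])
        have "g = (u - const_ff (up k)) * (\<Prod>i\<in>{..<e} - {k}. u - const_ff (up i))"
          unfolding g_prod using k by (intro prod.remove) auto
        moreover have "unit_in x (\<Prod>i\<in>{..<e} - {k}. u - const_ff (up i))"
          using un by (intro unit_in_prod[OF s(1)]) auto
        ultimately have "unit_in x (g / (u - const_ff (up k)))" using u_minus_nonzero[OF k(1)] by simp
        from unit_in_divide_mem[OF s(1) gf this] have "(u - const_ff (up k)) / f \<in> x" using g_nonzero by simp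
        then show "(u - const_ff (up i)) / \<eta> i \<in> x" using u_minus_mem[OF x c] by (simp add: \<eta>_def)
        show "unit_in x (f / \<eta> i) \<or> unit_in x ((u - const_ff (up i)) / \<eta> i)"
          using u1 f_nonzero un[OF i] by (simp add: \<eta>_def)
      qed (use f_nonzero fx subring_1[OF s(1)] in \<open>simp_all add: \<eta>_def\<close>)
      then have "tensor_prod (\<lambda>i. O_minus_E (p i)) e x = {b. b / (\<Prod>i<e. \<eta> i) \<in> x}"
        using f_nonzero by (intro tensor_prod_principal[OF s(1)]) (auto simp: \<eta>_def)
      moreover have "(\<Prod>i<e. \<eta> i) = f" unfolding \<eta>_def using k(1) by simp
      ultimately show ?thesis using c False by (simp add: eps_def)
    qed
  next
    have *: ?thesis if \<mu>: "chart \<mu> \<subseteq> x" "\<mu> \<in> types" and G: "van {..<e} G" "tdle (int m) G" "unit_in x (EV G / \<mu> ^ m)" and "eps x = 1" for \<mu> G m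
    proof -
      have "O_minus_E (p i) x = {b. b / 1 \<in> x}" if i: "i < e" for i
      proof (rule O_minus_E_stalk[OF x i])
        fix j assume "chart_ring j \<subseteq> x"
        then have "unit_in x (EV G / lam j ^ m / 1)" using chart_unit_form[OF _ lx \<mu> G(3)] by simp
        moreover have "van {i} G" using G(1) i by (simp add: van_def)
        ultimately show "\<exists>h n. van {i} h \<and> tdle (int n) h \<and> unit_in x (EV h / lam j ^ n / 1)" using G(2) by blast
      qed simp_all
      then have "tensor_prod (\<lambda>i. O_minus_E (p i)) e x = {b. b / (\<Prod>i<e. 1) \<in> x}"
        by (intro tensor_prod_principal[OF s(1)]) auto
      then show ?thesis using that by simp
    qed
    {
      assume "eps x = 1" "x \<in> Y1"
      moreover from this have "chart u \<subseteq> x" "unit_in x \<gamma>1" using G1_unit[OF lx] by (auto simp: aff_def G1_def)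
      ultimately show ?thesis using utop_g1P by (intro *[of u g1P m1] van_g1P utop_tdle) (simp_all add: \<gamma>1_def)
    next
      assume "eps x = 1" "x \<in> Y2"
      moreover from this have "chart v \<subseteq> x" "unit_in x \<gamma>2" using G2_unit[OF lx] by (auto simp: aff_def G2_def)
      ultimately show ?thesis using vtop_g2P by (intro *[of v g2P m2] van_g2P vtop_tdle) (simp_all add: \<gamma>2_def)
    }
  qed
qed

lemma O_H_stalk:
  assumes x: "x \<in> X"
  shows "O_H d e p x = {b. b / ((l 3 * mu x) ^ d * eps x) \<in> x}"
  unfolding O_H_def using l_nonzero mu_nonzero eps_nonzero
  by (intro tensor_principal tensor_power_principal subring_X x O_L_stalk O_E_stalk) simp_all

section \<open>The canonical class\<close>

abbreviation "J0 \<equiv> jacobian u v"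

text \<open>Every chart of \<open>X\<close> is generated by 1 and at most three functions, so three
  Jacobians control all of the canonical stalk.\<close>

lemma jacobian_triple_bound:
  fixes a b c :: "'k ff"
  assumes x: "x \<in> Spec_rings (subalgebra_gen {1, a, b, c})" and \<rho>: "\<rho> \<noteq> 0"
    and mem: "jacobian a b / \<rho> \<in> x" "jacobian a c / \<rho> \<in> x" "jacobian b c / \<rho> \<in> x" and ab: "y \<in> x" "z \<in> x"
  shows "jacobian y z / \<rho> \<in> x"
proof (rule jacobian_Spec_rings_bound[OF x _ \<rho> ab])
  have s: "subring_of_field x" by (rule loc_ptD[OF loc_pt_Spec_rings[OF x]])
  have neg: "jacobian r q / \<rho> \<in> x" if "jacobian q r / \<rho> \<in> x" for q r
    using subring_uminus[OF s that] jacobian_commute[of r q] by simp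
  have one: "jacobian q 1 / \<rho> \<in> x" "jacobian 1 q / \<rho> \<in> x" "jacobian q q / \<rho> \<in> x" for q
    using derivation.one[OF derivation_jacobian_right, of q] derivation.one[OF derivation_jacobian_left, of q]
    by (simp_all add: jacobian_self subring_0[OF s])
  show "jacobian q r / \<rho> \<in> x" if "q \<in> {1, a, b, c}" "r \<in> {1, a, b, c}" for q r
    using that mem neg[OF mem(1)] neg[OF mem(2)] neg[OF mem(3)] one by blast
qed

lemma canonical_stalkI:
  fixes a b c :: "'k ff"
  assumes x: "x \<in> Spec_rings (subalgebra_gen {1, a, b, c})" and \<rho>: "\<rho> \<noteq> 0"
    and mem: "jacobian a b / \<rho> \<in> x" "jacobian a c / \<rho> \<in> x" "jacobian b c / \<rho> \<in> x"
    and unit: "\<exists>q\<in>x. \<exists>r\<in>x. unit_in x (jacobian q r / \<rho>)"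
  shows "canonical_sheaf x = {b. b / \<rho> \<in> x}"
  unfolding canonical_sheaf_def
  by (rule submod_gen_principal[OF loc_ptD(1)[OF loc_pt_Spec_rings[OF x]] \<rho>])
    (use jacobian_triple_bound[OF x \<rho> mem] unit in blast)+

lemma EV_pCons0: "EV [:q:] = evalp const_ff u q"
  by (simp add: rhom.evalp_pCons[OF rhom.rhom_evalp[OF rhom_const_ff]] rhom.evalp_0[OF rhom.rhom_evalp[OF rhom_const_ff]])

lemma f_eq: "f = v - EV [:\<phi>:]"
proof -
  show ?thesis by (simp only: f_def fP_eq rhom.minus[OF rhom_EV] EV_V)
qed

lemma jacobian_EV_u: "jacobian u (EV [:q:]) = 0" "jacobian v (EV [:q:]) = - (EV [:pderiv q:] * J0)"
  unfolding EV_pCons0 derivation.evalp_const[OF derivation_jacobian_right] jacobian_commute[of v u]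
  by (simp_all add: jacobian_self)

lemma jacobian_fg:
  "jacobian u f = J0" "jacobian v f = EV [:pderiv \<phi>:] * J0" "jacobian u g = 0" "jacobian v g = - (EV [:pderiv gp:] * J0)"
  unfolding f_eq g_def gP_def
  by (simp_all add: derivation.diff[OF derivation_jacobian_right] jacobian_EV_u jacobian_self)

lemma jacobian_quot:
  "jacobian u (f / g) = J0 / g" "jacobian v (f / g) = (EV [:pderiv \<phi>:] + f / g * EV [:pderiv gp:]) * (J0 / g)"
  "jacobian u (g / f) = - (g / f) * (J0 / f)" "jacobian v (g / f) = - (EV [:pderiv gp:] + g / f * EV [:pderiv \<phi>:]) * (J0 / f)"
  using f_nonzero g_nonzero
  by (simp_all add: derivation.divide[OF derivation_jacobian_right] jacobian_fg field_simps)

lemma jacobian_infinity: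
  "jacobian (1 / u) (v / u) = - (J0 / u ^ 3)" "jacobian (1 / v) (u / v) = J0 / v ^ 3"
proof -
  have one: "jacobian q 1 = 0" for q :: "'k ff" by (rule derivation.one[OF derivation_jacobian_right])
  have "jacobian (1 / u) u = 0" "jacobian (1 / u) v = - (J0 / u ^ 2)" "jacobian (1 / v) v = 0" "jacobian (1 / v) u = J0 / v ^ 2"
    using u_nonzero v_nonzero jacobian_commute[of "1 / u"] jacobian_commute[of "1 / v"] jacobian_commute[of v u]
    by (simp_all add: derivation.divide[OF derivation_jacobian_right] one jacobian_self power2_eq_square)
  then show "jacobian (1 / u) (v / u) = - (J0 / u ^ 3)" "jacobian (1 / v) (u / v) = J0 / v ^ 3"
    using u_nonzero v_nonzero
    by (simp_all add: derivation.divide[OF derivation_jacobian_right] power2_eq_square power3_eq_cube)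
qed

text \<open>The points with \<open>f / g \<notin> x\<close> lie on the strict transform of \<open>g = 0\<close>, and \<open>gp\<close> has simple roots.\<close>

lemma pderiv_gp_unit:
  assumes x: "x \<in> X" "chart 1 \<subseteq> x" "f / g \<notin> x"
  shows "unit_in x (EV [:pderiv gp:])"
proof -
  note s = loc_ptD[OF X_loc_pt[OF x(1)]]
  obtain k where k: "k < e" "\<not> unit_in x (u - const_ff (up k))" by (rule ex_nonunit[OF x])
  define r where "r = (\<Prod>i\<in>{..<e} - {k}. [:- up i, 1:])"
  have "gp = [:- up k, 1:] * r" unfolding gp_def r_def using k by (intro prod.remove) auto
  then have "pderiv gp = [:- up k, 1:] * pderiv r + r * pderiv [:- up k, 1:]" by (simp only: pderiv_mult)
  moreover have "pderiv [:- up k, 1:] = 1" by (simp add: pderiv_pCons)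
  ultimately have "pderiv gp = r + [:- up k, 1:] * pderiv r" by (simp only: mult_1_right add.commute)
  then have dg: "[:pderiv gp:] = [:r:] + [:[:- up k, 1:]:] * [:pderiv r:]" by simp
  have lin: "EV [:[:- up i, 1:]:] = u - const_ff (up i)" for i
    unfolding EV_pCons0 by (simp add: rhom.evalp_pCons[OF rhom_const_ff] rhom.evalp_0[OF rhom_const_ff] const_ff_hom)
  have "EV [:r:] = (\<Prod>i\<in>{..<e} - {k}. u - const_ff (up i))"
    unfolding r_def EV_pCons0 rhom.prod[OF rhom.rhom_evalp[OF rhom_const_ff]] lin[symmetric] ..
  then have ru: "unit_in x (EV [:r:])" using u_minus_unit[OF x(1,2) _ k(1) _ k(2)] by (auto intro!: unit_in_prod[OF s(1)])
  have m: "EV [:pderiv r:] \<in> x" by (intro EV_mem s x)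
  have "\<not> unit_in x ((u - const_ff (up k)) * EV [:pderiv r:])"
    using unit_in_factor[OF s(1) _ u_minus_mem[OF x(1,2)] m] k(2) by blast
  from unit_in_add_nonunit[OF s(3) ru subring_mult[OF s(1) u_minus_mem[OF x(1,2)] m] this]
  show ?thesis unfolding dg rhom.add[OF rhom_EV] rhom.mult[OF rhom_EV] lin .
qed

text \<open>Local form of \<open>K = -3L + E\<close>: the form \<open>du \<and> dv\<close> spans on
  the affine plane, the chart coordinates at infinity contribute \<open>mu x ^ 3\<close>, and on the
  blow-up charts the Jacobian with the quotient of \<open>f\<close> and \<open>g\<close> contributes
  one factor \<open>eps x\<close>.\<close>

lemma canonical_stalk:
  assumes x: "x \<in> X"
  shows "canonical_sheaf x = {b. b / (J0 / (mu x ^ 3 * eps x)) \<in> x}"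
proof -
  note lx = X_loc_pt[OF x] note s = loc_ptD[OF lx]
  have u1: "unit_in x 1" and z: "0 \<in> x" by (rule unit_in_1[OF s(1)], rule subring_0[OF s(1)])
  have EVx: "chart 1 \<subseteq> x \<Longrightarrow> EV q \<in> x" for q by (intro EV_mem s)
  show ?thesis
  proof (rule X_trichotomy[OF x])
    assume c: "chart 1 \<subseteq> x" and mu: "mu x = 1"
    have uv: "u \<in> x" "v \<in> x" using c by (auto simp: chart_def)
    show ?thesis
    proof (cases "f / g \<in> x")
      case True
      have eps: "eps x = g" using c True by (simp add: eps_def)
      have "chart 1 \<union> {f / g} = {1, u, v, f / g}" by (auto simp: chart_def)
      then have "x \<in> Spec_rings (subalgebra_gen {1, u, v, f / g})" using X_Spec_B(1)[OF x c True] by simp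
      then show ?thesis unfolding mu eps
      proof (rule canonical_stalkI)
        have "jacobian u (f / g) / (J0 / (1 ^ 3 * g)) = 1" using jacobian_uv g_nonzero by (simp add: jacobian_quot)
        then show "\<exists>q\<in>x. \<exists>r\<in>x. unit_in x (jacobian q r / (J0 / (1 ^ 3 * g)))"
            "jacobian u (f / g) / (J0 / (1 ^ 3 * g)) \<in> x"
          using u1 uv True unit_in_mem[OF u1] by (metis, simp)
        have "jacobian v (f / g) / (J0 / (1 ^ 3 * g)) = EV [:pderiv \<phi>:] + f / g * EV [:pderiv gp:]"
          using jacobian_uv g_nonzero by (simp add: jacobian_quot)
        also have "\<dots> \<in> x" by (intro subring_add subring_mult s EVx c True)
        finally show "jacobian v (f / g) / (J0 / (1 ^ 3 * g)) \<in> x" .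
        have "g \<in> x" unfolding g_def by (rule EVx[OF c])
        then show "J0 / (J0 / (1 ^ 3 * g)) \<in> x" using jacobian_uv by simp
      qed (use jacobian_uv g_nonzero in simp)
    next
      case False
      then have gf: "g / f \<in> x" using X_fg[OF x c] by blast
      have eps: "eps x = f" using c False by (simp add: eps_def)
      have "chart 1 \<union> {g / f} = {1, u, v, g / f}" by (auto simp: chart_def)
      then have "x \<in> Spec_rings (subalgebra_gen {1, u, v, g / f})" using X_Spec_B(2)[OF x c gf] by simp
      then show ?thesis unfolding mu eps
      proof (rule canonical_stalkI)
        have "jacobian u (g / f) / (J0 / (1 ^ 3 * f)) = - (g / f)" using jacobian_uv f_nonzero by (simp add: jacobian_quot)
        then show "jacobian u (g / f) / (J0 / (1 ^ 3 * f)) \<in> x" using subring_uminus[OF s(1) gf] by simp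
        \<comment> \<open>\<open>f / g\<close> is not regular, so \<open>g / f\<close> is a nonunit
          and its multiple cannot spoil the unit given by the derivative of
          \<open>gp\<close>.\<close>
        have "\<not> unit_in x (g / f * EV [:pderiv \<phi>:])"
        proof
          assume "unit_in x (g / f * EV [:pderiv \<phi>:])"
          then have "unit_in x (g / f)" by (rule unit_in_factor[OF s(1) _ gf EVx[OF c]])
          then show False using unit_in_inverse_mem False by fastforce
        qed
        then have "unit_in x (EV [:pderiv gp:] + g / f * EV [:pderiv \<phi>:])"
          by (intro unit_in_add_nonunit[OF s(3) pderiv_gp_unit[OF x c False]] subring_mult s gf EVx c)
        then have "unit_in x (- (EV [:pderiv gp:] + g / f * EV [:pderiv \<phi>:]))" by (rule unit_in_uminus[OF s(1)])
        moreover have "jacobian v (g / f) / (J0 / (1 ^ 3 * f)) = - (EV [:pderiv gp:] + g / f * EV [:pderiv \<phi>:])"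
          using jacobian_uv f_nonzero by (simp add: jacobian_quot)
        ultimately have unit: "unit_in x (jacobian v (g / f) / (J0 / (1 ^ 3 * f)))" by simp
        then show "\<exists>q\<in>x. \<exists>r\<in>x. unit_in x (jacobian q r / (J0 / (1 ^ 3 * f)))" using uv gf by blast
        show "jacobian v (g / f) / (J0 / (1 ^ 3 * f)) \<in> x" by (rule unit_in_mem[OF unit])
        have "f \<in> x" unfolding f_def by (rule EVx[OF c])
        then show "J0 / (J0 / (1 ^ 3 * f)) \<in> x" using jacobian_uv by simp
      qed (use jacobian_uv f_nonzero in simp)
    qed
  next
    assume mu: "mu x = u" "eps x = 1" and Y: "x \<in> Y1"
    have c: "chart u \<subseteq> x" "unit_in x \<gamma>1" using Y G1_unit[OF lx] by (auto simp: aff_def G1_def)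
    \<comment> \<open>Two functions suffice on this chart; one is repeated to fit the pattern of
      three.\<close>
    have "chart u = {1, 1 / u, v / u, v / u}" using u_nonzero by (auto simp: chart_def)
    then have X: "x \<in> Spec_rings (subalgebra_gen {1, 1 / u, v / u, v / u})" and m: "1 / u \<in> x" "v / u \<in> x"
      using X_Spec_u[OF x c] c by auto
    have eq: "jacobian (1 / u) (v / u) / (J0 / (u ^ 3 * 1)) = - 1"
      using jacobian_uv u_nonzero by (simp add: jacobian_infinity)
    have n1: "unit_in x (- 1)" by (rule unit_in_uminus[OF s(1) u1])
    have ex: "\<exists>q\<in>x. \<exists>r\<in>x. unit_in x (jacobian q r / (J0 / (u ^ 3 * 1)))"
      by (rule bexI[OF _ m(1)], rule bexI[OF _ m(2)], unfold eq, rule n1)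
    show ?thesis unfolding mu
      by (rule canonical_stalkI[OF X])
        (use ex m(1) z eq unit_in_mem[OF n1] jacobian_uv u_nonzero in \<open>simp_all add: jacobian_self\<close>)
  next
    assume mu: "mu x = v" "eps x = 1" and Y: "x \<in> Y2"
    have c: "chart v \<subseteq> x" "unit_in x \<gamma>2" using Y G2_unit[OF lx] by (auto simp: aff_def G2_def)
    have "chart v = {1, 1 / v, u / v, u / v}" using v_nonzero by (auto simp: chart_def)
    then have X: "x \<in> Spec_rings (subalgebra_gen {1, 1 / v, u / v, u / v})" and m: "1 / v \<in> x" "u / v \<in> x"
      using X_Spec_v[OF x c] c by auto
    have eq: "jacobian (1 / v) (u / v) / (J0 / (v ^ 3 * 1)) = 1"
      using jacobian_uv v_nonzero by (simp add: jacobian_infinity)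
    have ex: "\<exists>q\<in>x. \<exists>r\<in>x. unit_in x (jacobian q r / (J0 / (v ^ 3 * 1)))"
      by (rule bexI[OF _ m(1)], rule bexI[OF _ m(2)], unfold eq, rule u1)
    show ?thesis unfolding mu
      by (rule canonical_stalkI[OF X])
        (use ex m(1) z eq unit_in_mem[OF u1] jacobian_uv v_nonzero in \<open>simp_all add: jacobian_self\<close>)
  qed
qed

section \<open>The Ulrich bundle\<close>

lemma VB_vector_bundle: "vector_bundle X (VB n k)"
  unfolding vector_bundle_def
proof
  fix x assume "x \<in> X"
  then obtain W \<rho> i j where W: "openin (zariski X) W" "x \<in> W" "\<rho> \<noteq> 0"
    "\<And>y. y \<in> W \<Longrightarrow> VB n k y = {a. w i a / \<rho> \<in> y \<and> w j a / \<rho> \<in> y}"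
    "wrow i $ 1 * wrow j $ 2 - wrow j $ 1 * wrow i $ 2 \<noteq> 0" by (rule VB_frames[of x n k]) (rule that)
  define \<alpha> \<beta> where "\<alpha> = inverse \<rho> *s wrow i" and "\<beta> = inverse \<rho> *s wrow j"
  have w: "w i a / \<rho> = \<alpha> $ 1 * a $ 1 + \<alpha> $ 2 * a $ 2" "w j a / \<rho> = \<beta> $ 1 * a $ 1 + \<beta> $ 2 * a $ 2" for a
    by (simp_all add: wrow[of i a] wrow[of j a] \<alpha>_def \<beta>_def add_divide_distrib divide_inverse algebra_simps)
  have "\<alpha> $ 1 * \<beta> $ 2 - \<beta> $ 1 * \<alpha> $ 2 = inverse \<rho> ^ 2 * (wrow i $ 1 * wrow j $ 2 - wrow j $ 1 * wrow i $ 2)"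
    by (simp add: \<alpha>_def \<beta>_def algebra_simps power2_eq_square)
  then have "\<alpha> $ 1 * \<beta> $ 2 - \<beta> $ 1 * \<alpha> $ 2 \<noteq> 0" using W by simp
  then obtain B :: "'k ff ^ 2 ^ 2" where "invertible B"
    "\<And>y. {a. \<alpha> $ 1 * a $ 1 + \<alpha> $ 2 * a $ 2 \<in> y \<and> \<beta> $ 1 * a $ 1 + \<beta> $ 2 * a $ 2 \<in> y} = (\<lambda>v. B *v v) ` {v. \<forall>i. v $ i \<in> y}"
    by (rule rank_two_frame) (rule that)
  then show "\<exists>U. openin (zariski X) U \<and> x \<in> U \<and>
      (\<exists>B :: 'k ff ^ 2 ^ 2. invertible B \<and> (\<forall>y\<in>U. VB n k y = (\<lambda>v. B *v v) ` {v. \<forall>i. v $ i \<in> y}))"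
    using W(1,2,4) unfolding w by (intro exI[of _ W] conjI exI[of _ B]) auto
qed

text \<open>With \<open>c\<close> the local generator of the entries and \<open>\<delta>\<close> the
  determinant of the frame, the stalk is generated by \<open>c ^ 2 / \<delta>\<close>. On every
  chart \<open>\<delta>\<close> is associated to \<open>mu x ^ (d - 1)\<close>: it is 1, a power of
  u, or a continuant, so \<open>4(d - 1)\<close> drops to \<open>3(d - 1)\<close>.\<close>

lemma det_VB_stalk:
  assumes x: "x \<in> X"
  shows "det_bundle (VB (2 * int d - 2) 1) x = {b. b / (mu x ^ (3 * (d - 1)) * eps x ^ 2) \<in> x}"
proof -
  note s = subring_X[OF x]
  define c where "c = mu x ^ (2 * (d - 1)) * eps x"
  have c0: "c \<noteq> 0" using mu_nonzero eps_nonzero by (simp add: c_def)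
  have "2 * int d - 2 = int (2 * (d - 1))" using d_pos by (simp add: of_nat_diff)
  then have "mu x powi (2 * int d - 2) = mu x ^ (2 * (d - 1))" by (simp only: power_int_of_nat)
  then have LB: "LB (2 * int d - 2) 1 x = {a. a / c \<in> x}" by (simp only: LB_def c_def power_int_1_right)
  have main: "det_bundle (VB (2 * int d - 2) 1) x = {b. b / (c ^ 2 / \<delta>) \<in> x}"
    if VB: "VB (2 * int d - 2) 1 x = {a. w i a \<in> LB (2 * int d - 2) 1 x \<and> w j a \<in> LB (2 * int d - 2) 1 x}"
      and \<delta>: "\<delta> = wrow i $ 1 * wrow j $ 2 - wrow j $ 1 * wrow i $ 2" "\<delta> \<noteq> 0" for i j \<delta>
  proof -
    define \<alpha> \<beta> where "\<alpha> = inverse c *s wrow i" and "\<beta> = inverse c *s wrow j"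
    have w: "w i a / c = \<alpha> $ 1 * a $ 1 + \<alpha> $ 2 * a $ 2" "w j a / c = \<beta> $ 1 * a $ 1 + \<beta> $ 2 * a $ 2" for a
      by (simp_all add: wrow[of i a] wrow[of j a] \<alpha>_def \<beta>_def add_divide_distrib divide_inverse algebra_simps)
    have "\<delta> / c ^ 2 = \<alpha> $ 1 * \<beta> $ 2 - \<beta> $ 1 * \<alpha> $ 2"
      using c0 by (simp add: \<alpha>_def \<beta>_def \<delta>(1) field_simps power2_eq_square)
    moreover have "\<delta> / c ^ 2 \<noteq> 0" using c0 \<delta>(2) by simp
    moreover have "VB (2 * int d - 2) 1 x = {a. \<alpha> $ 1 * a $ 1 + \<alpha> $ 2 * a $ 2 \<in> x \<and> \<beta> $ 1 * a $ 1 + \<beta> $ 2 * a $ 2 \<in> x}"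
      unfolding VB LB by (simp only: mem_Collect_eq w)
    ultimately have "det_bundle (VB (2 * int d - 2) 1) x = {b. b / (1 / (\<delta> / c ^ 2)) \<in> x}"
      by (rule det_bundle_frame[OF s])
    then show ?thesis by simp
  qed
  show ?thesis
  proof (rule X_trichotomy[OF x])
    assume "mu x = 1" "x \<in> Y0"
    then show ?thesis using main[OF VB_Y0, of 1] by (simp add: c_def wrow_0 del: One_nat_def)
  next
    assume *: "mu x = u" "eps x = 1" "x \<in> Y1"
    have "u ^ (d - 1) = wrow (d - 1) $ 1 * wrow d $ 2 - wrow d $ 1 * wrow (d - 1) $ 2" using wrow_det[of "d - 1"] d_pos by simp
    from main[OF VB_Y1[OF *(3)] this] have "det_bundle (VB (2 * int d - 2) 1) x = {b. b / (c ^ 2 / u ^ (d - 1)) \<in> x}"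
      using u_nonzero by simp
    moreover have "c ^ 2 / u ^ (d - 1) = u ^ (3 * (d - 1))"
    proof -
      have "c ^ 2 = u ^ (3 * (d - 1)) * u ^ (d - 1)"
        by (simp only: c_def * power_mult[symmetric] power_add[symmetric] mult_1_right) simp
      then show ?thesis using u_nonzero by simp
    qed
    ultimately show ?thesis by (simp only: * power_one mult_1_right)
  next
    assume *: "mu x = v" "eps x = 1" "x \<in> Y2"
    have "(- 1) ^ (d - 1) * cont (d - 1) = wrow 0 $ 1 * wrow d $ 2 - wrow d $ 1 * wrow 0 $ 2"
      using wrow_cont[of "d - 1"] d_pos by (simp add: wrow_0)
    from main[OF VB_Y2[OF *(3)] this]
    have "det_bundle (VB (2 * int d - 2) 1) x = {b. b / (c ^ 2 / ((- 1) ^ (d - 1) * cont (d - 1))) \<in> x}"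
      using cont_nonzero by simp
    also have "\<dots> = {b. b / v ^ (3 * (d - 1)) \<in> x}"
    proof (rule principal_unit[OF s])
      have i: "v ^ (d - 1) / cont (d - 1) \<in> x"
        using cont_inverse_LB[OF *(3), of "d - 1"] d_pos
        by (simp only: LB_def mem_Collect_eq * power_int_minus power_int_of_nat power_int_0_right mult_1_right divide_inverse
          inverse_inverse_eq mult.commute[of "v ^ (d - 1)"])
      have "cont (d - 1) / v ^ (d - 1) \<in> x" using cont_LB[OF x, of "d - 1"] * by (simp add: LB_def)
      then have "unit_in x (v ^ (d - 1) / cont (d - 1))" using i cont_nonzero v_nonzero by (simp add: unit_in_def)
      then have "unit_in x (v ^ (d - 1) / cont (d - 1) / (- 1) ^ (d - 1))"
        by (rule unit_in_divide[OF s]) (intro unit_in_power unit_in_uminus unit_in_1 s)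
      moreover have "c ^ 2 = v ^ (3 * (d - 1)) * v ^ (d - 1)"
        by (simp only: c_def * power_mult[symmetric] power_add[symmetric] mult_1_right) simp
      ultimately show "unit_in x (c ^ 2 / ((- 1) ^ (d - 1) * cont (d - 1)) / v ^ (3 * (d - 1)))"
        using v_nonzero by (simp add: mult.commute)
    qed
    finally show ?thesis using * by simp
  qed
qed

lemma X_nonempty: "X \<noteq> {}"
proof -
  define B where "B = subalgebra_gen (chart 1 \<union> {f / g})"
  have B: "subring_of_field B" unfolding B_def by (rule subring_subalgebra_gen)
  \<comment> \<open>The zero ideal gives the generic point.\<close>
  have "prime_ideal_in B {0}" using subring_0[OF B] by (auto simp: prime_ideal_in_def)
  then have "localize B {0} \<in> X" unfolding Spec_rings_eq B_def by (intro Spec_B_X(1)) (auto simp: Spec_rings_eq)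
  then show ?thesis by blast
qed

text \<open>\<open>VB\<close> is normalized without \<open>l 3\<close> while the stalks of
  \<open>O_H\<close> contain it, so the twist agrees with the shifted bundle only up to the global
  constant \<open>l 3 ^ (d * i)\<close>. Rescaling does not affect cohomology.\<close>

lemma twist_VB:
  assumes x: "x \<in> X"
  shows "twist (VB (2 * int d - 2) 1) (tensor_power (dual (O_H d e p)) i) x
    = (\<lambda>a. inverse (l 3 ^ (d * i)) *s a) ` VB (2 * int d - 2 - int (d * i)) (1 - int i) x"
proof -
  note s = subring_X[OF x]
  define \<theta> where "\<theta> = (1 / ((l 3 * mu x) ^ d * eps x)) ^ i"
  have \<theta>0: "\<theta> \<noteq> 0" using l_nonzero mu_nonzero eps_nonzero by (simp add: \<theta>_def)
  have M: "tensor_power (dual (O_H d e p)) i x = {b. b / \<theta> \<in> x}"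
    unfolding \<theta>_def using l_nonzero mu_nonzero eps_nonzero
    by (intro tensor_power_principal dual_principal O_H_stalk s x) simp_all
  have w0: "w j 0 = 0" for j using band_linear(2)[of u v j 0 0] by simp
  have "twist (VB (2 * int d - 2) 1) (tensor_power (dual (O_H d e p)) i) x = (\<lambda>a. \<theta> *s a) ` VB (2 * int d - 2) 1 x"
  proof (rule twist_principal[where \<theta> = \<theta> and F = "VB (2 * int d - 2) 1" and M = "tensor_power (dual (O_H d e p)) i", OF s M \<theta>0])
    fix r a assume "r \<in> x" and a: "a \<in> VB (2 * int d - 2) 1 x"
    then have "r \<in> LB 0 0 x" by (simp add: LB_def)
    then show "r *s a \<in> VB (2 * int d - 2) 1 x"
      using a LB_mult[OF x, of r 0 _ "2 * int d - 2" 1] by (simp add: VB_def band_linear)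
  qed (simp_all add: VB_def w0 band_linear LB_0[OF x] LB_add[OF x])
  also have "\<dots> = (\<lambda>a. inverse (l 3 ^ (d * i)) *s a) ` (\<lambda>a. (l 3 ^ (d * i) * \<theta>) *s a) ` VB (2 * int d - 2) 1 x"
  proof -
    have "inverse (l 3 ^ (d * i)) * (l 3 ^ (d * i) * \<theta>) = \<theta>" using l_nonzero by simp
    then show ?thesis by (simp only: image_image vector_smult_assoc)
  qed
  also have "(\<lambda>a. (l 3 ^ (d * i) * \<theta>) *s a) ` VB (2 * int d - 2) 1 x = VB (2 * int d - 2 - int (d * i)) (1 - int i) x"
  proof -
    define \<kappa> where "\<kappa> = l 3 ^ (d * i) * \<theta>"
    have \<kappa>: "\<kappa> \<noteq> 0" using \<theta>0 l_nonzero by (simp add: \<kappa>_def)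
    have "\<kappa> = 1 / (mu x ^ (d * i) * eps x ^ i)"
      using l_nonzero by (simp add: \<kappa>_def \<theta>_def power_mult_distrib power_mult power_divide)
    moreover have "a powi (m - int n) = a powi m / a ^ n" if "a \<noteq> 0" for a :: "'k ff" and m n
      using power_int_diff[of a m "int n"] that by simp
    note this[OF mu_nonzero] this[OF eps_nonzero]
    ultimately have "mu x powi (2 * int d - 2 - int (d * i)) * eps x powi (1 - int i) = \<kappa> * (mu x powi (2 * int d - 2) * eps x powi 1)"
      by (simp only: times_divide_times_eq) (simp only: times_divide_eq_left mult_1_left)
    then have LB: "b \<in> LB (2 * int d - 2 - int (d * i)) (1 - int i) x \<longleftrightarrow> inverse \<kappa> * b \<in> LB (2 * int d - 2) 1 x" for b
      by (simp add: LB_def divide_inverse mult_ac)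
    have "b \<in> VB (2 * int d - 2 - int (d * i)) (1 - int i) x \<longleftrightarrow> inverse \<kappa> *s b \<in> VB (2 * int d - 2) 1 x" for b
      by (simp only: VB_def mem_Collect_eq LB band_linear)
    then show ?thesis unfolding \<kappa>_def[symmetric] by (intro set_eqI) (simp only: mem_scale_image[OF \<kappa>])
  qed
  finally show ?thesis .
qed

lemma VB_zero_regular: "zero_regular X (O_H d e p) (VB (2 * int d - 2) 1)"
  unfolding zero_regular_def
proof (intro allI impI)
  fix i :: nat assume i: "i > 0"
  show "cohomology_vanishes X (twist (VB (2 * int d - 2) 1) (tensor_power (dual (O_H d e p)) i)) i"
  proof (rule cohomology_vanishesI[OF noetherian_X X_nonempty _ _ i, of "{B1, B2, Y1, Y2}"])
    show "W \<in> {B1, B2, Y1, Y2} \<Longrightarrow> openin (zariski X) W" for W by (rule openin_basic)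
    show "X \<subseteq> \<Union> {B1, B2, Y1, Y2}" using X_eq Y0_eq by blast
    fix C assume C: "finite C" "C \<noteq> {}" "\<And>W. W \<in> C \<Longrightarrow> openin (zariski X) W" "\<Union>C = X"
      "\<And>W. W \<in> C \<Longrightarrow> \<exists>W'\<in>{B1, B2, Y1, Y2}. W \<subseteq> W'"
    then have fine: "fine_cover C" unfolding fine_cover_def by blast
    have "acyclic_at (VB (2 * int d - 2 - int (d * i)) (1 - int i)) C X (Suc i)"
    proof -
      consider "i = 1" | "i = 2" | "i \<ge> 3" using i by linarith
      then show ?thesis
      proof cases
        case 1
        then show ?thesis using VB_H1[OF fine] by (simp add: numeral_2_eq_2)
      next
        case 2
        then show ?thesis using VB_H2[OF fine] by (simp add: numeral_3_eq_3)
      next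
        case 3
        then show ?thesis by (rule VB_high[OF fine])
      qed
    qed
    then have "acyclic_at (\<lambda>x. (\<lambda>a. inverse (l 3 ^ (d * i)) *s a) ` VB (2 * int d - 2 - int (d * i)) (1 - int i) x) C X (Suc i)"
      using l_nonzero by (intro acyclic_at_scale) simp_all
    then show "acyclic_at (twist (VB (2 * int d - 2) 1) (tensor_power (dual (O_H d e p)) i)) C X (Suc i)"
      by (rule acyclic_at_cong) (rule twist_VB[symmetric])
  qed
qed

lemma VB_special: "special_rank2_ulrich X (O_H d e p) (VB (2 * int d - 2) 1)"
proof -
  \<comment> \<open>The rational function between the two determinant sheaves: \<open>l 3\<close>
    enters with power \<open>d\<close> in each of the three factors \<open>O(H)\<close>, and the
    canonical sheaf contributes the Jacobian of u and v.\<close>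
  define \<kappa> where "\<kappa> = l 3 ^ (3 * d) * J0"
  have \<kappa>: "\<kappa> \<noteq> 0" using l_nonzero jacobian_uv by (simp add: \<kappa>_def)
  have "det_bundle (VB (2 * int d - 2) 1) x = (\<lambda>m. (1 / \<kappa>) * m) ` tensor (tensor_power (O_H d e p) 3) canonical_sheaf x"
    if x: "x \<in> X" for x
  proof -
    define \<sigma> where "\<sigma> = mu x ^ (3 * (d - 1)) * eps x ^ 2"
    define \<tau> where "\<tau> = ((l 3 * mu x) ^ d * eps x) ^ 3 * (J0 / (mu x ^ 3 * eps x))"
    note nz = l_nonzero[of 3] mu_nonzero[of x] eps_nonzero[of x]
    have "tensor (tensor_power (O_H d e p) 3) canonical_sheaf x = {b. b / \<tau> \<in> x}"
      unfolding \<tau>_def using nz jacobian_uv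
      by (intro tensor_principal tensor_power_principal O_H_stalk canonical_stalk subring_X x) simp_all
    moreover have "\<tau> = \<kappa> * \<sigma>"
    proof -
      have "mu x ^ (3 * d) = mu x ^ (3 * (d - 1)) * mu x ^ 3"
        using d_pos by (simp only: power_add[symmetric]) (simp add: algebra_simps)
      moreover have "\<tau> = l 3 ^ (3 * d) * mu x ^ (3 * d) * eps x ^ 3 * (J0 / (mu x ^ 3 * eps x))"
        by (simp add: \<tau>_def power_mult_distrib mult.commute[of 3 d] power_mult)
      ultimately show ?thesis using nz by (simp add: \<kappa>_def \<sigma>_def field_simps power2_eq_square power3_eq_cube)
    qed
    ultimately have T: "b \<in> tensor (tensor_power (O_H d e p) 3) canonical_sheaf x \<longleftrightarrow> b / (\<kappa> * \<sigma>) \<in> x" for b by simp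
    show ?thesis unfolding det_VB_stalk[OF x] \<sigma>_def[symmetric]
    proof (intro set_eqI iffI)
      fix b assume "b \<in> {b. b / \<sigma> \<in> x}"
      then have "\<kappa> * b \<in> tensor (tensor_power (O_H d e p) 3) canonical_sheaf x" using \<kappa> by (simp add: T)
      moreover have "b = 1 / \<kappa> * (\<kappa> * b)" using \<kappa> by simp
      ultimately show "b \<in> (\<lambda>m. (1 / \<kappa>) * m) ` tensor (tensor_power (O_H d e p) 3) canonical_sheaf x" by (rule rev_image_eqI)
    next
      fix b assume "b \<in> (\<lambda>m. (1 / \<kappa>) * m) ` tensor (tensor_power (O_H d e p) 3) canonical_sheaf x"
      then show "b \<in> {b. b / \<sigma> \<in> x}" by (auto simp: T)
    qed
  qed
  then have "same_class X (det_bundle (VB (2 * int d - 2) 1)) (tensor (tensor_power (O_H d e p) 3) canonical_sheaf)"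
    unfolding same_class_def using \<kappa> by (intro exI[of _ "1 / \<kappa>"]) auto
  then show ?thesis unfolding special_rank2_ulrich_def using VB_vector_bundle VB_zero_regular by blast
qed

end

theorem theorem6p5:
  fixes p :: "nat \<Rightarrow> 'k::field_char_0 ^ 3" and d e :: nat
    and I :: "'k poly3 set" and X :: "'k ff set set"
  assumes d_pos: "d \<ge> 1"
    and points: "distinct_points e p"
    and I_def: "I = points_ideal (p ` {..<e})"
    and X_def: "X = blowup_plane I"
    and embedded: "embedded_by_complete_system X (O_H d e p)"
    and generated: "generated_in_degree_le I (d - 1)"
  shows "\<exists>F :: 'k ff set \<Rightarrow> ('k ff ^ 2) set. special_rank2_ulrich X (O_H d e p) F"
proof -
  obtain A N :: "'k ^ 3 ^ 3" where A: "N ** A = mat 1" "\<And>i. i < e \<Longrightarrow> (A *v p i) $ 3 \<noteq> 0"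
    "inj_on (\<lambda>i. (A *v p i) $ 1 / (A *v p i) $ 3) {..<e}" by (rule coordinate_change[OF points]) (rule that)
  obtain \<phi> where \<phi>: "\<And>i. i \<in> {..<e} \<Longrightarrow> poly \<phi> ((A *v p i) $ 1 / (A *v p i) $ 3) = (A *v p i) $ 2 / (A *v p i) $ 3"
    by (rule interpolation[OF finite_lessThan A(3), where s = "\<lambda>i. (A *v p i) $ 2 / (A *v p i) $ 3"]) (rule that)
  interpret plane_points p e d A N \<phi>
    by unfold_locales (use A \<phi> d_pos in auto)
  show ?thesis using VB_special unfolding plane_points.X_def[OF plane_points_axioms] plane_points.I_def[OF plane_points_axioms]
      assms(3)[symmetric] assms(4)[symmetric] by blast
qed

end
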